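(* Let $\beta\in(0,2)$, let $L=(L_t)_{t\in\mathbb{R}}$ be a two-sided $\beta$-stable Lévy process, let $\lambda>0$, and let $(X_t)_{t\in\mathbb{R}}$ be the stable Ornstein–Uhlenbeck process $$X_t=\int_{-\infty}^t e^{-\lambda(t-s)}\,dL_s .$$ Let $f\in C_b^2(\mathbb{R})$, $V_n=n^{-1/2}\sum_{t=1}^n(f(X_t)-\mathbb{E}[f(X_1)])$, $v_n=\sqrt{\mathrm{var}(V_n)}$, suppose that $v^2=\sum_{j\in\mathbb{Z}}\mathrm{cov}(f(X_0),f(X_j))$ satisfies $v^2>0$, and let $Z\sim\mathcal{N}(0,1)$. Then there is a constant $C>0$ not depending on $n$ such that, for all $n\in\mathbb{N}$ with $v_n>0$, $$d_W(v_n^{-1}V_n,Z)\le C\,n^{-1/2}\qquad\text{and}\qquad d_K(v_n^{-1}V_n,Z)\le C\,n^{-1/2}.$$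
   Context: $C_b^2(\mathbb{R})$ is the space of twice continuously differentiable $f:\mathbb{R}\to\mathbb{R}$ with $f,f',f''$ bounded. Stochastic integrals of deterministic functions with respect to $L$ are understood in the usual sense of Rajput and Rosiński; $L_0=0$ a.s. The Wasserstein distance is $d_W(F,G)=\sup_h|\mathbb{E}[h(F)]-\mathbb{E}[h(G)]|$, the supremum being over all functions $h:\mathbb{R}\to\mathbb{R}$ that are Lipschitz with constant at most $1$. The Kolmogorov distance is $d_K(F,G)=\sup_{x\in\mathbb{R}}|\mathbb{P}(F\le x)-\mathbb{P}(G\le x)|$. *)

theory Defs
  imports "HOL-Probability.Probability"
begin

definition C2_bounded :: "(real \<Rightarrow> real) \<Rightarrow> bool" where
  "C2_bounded f \<longleftrightarrow> (\<exists>f' f''.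
     (\<forall>x. (f has_real_derivative f' x) (at x)) \<and>
     (\<forall>x. (f' has_real_derivative f'' x) (at x)) \<and>
     continuous_on UNIV f'' \<and>
     bounded (range f) \<and> bounded (range f') \<and> bounded (range f''))"

definition tendsto_in_prob ::
    "'a measure \<Rightarrow> (nat \<Rightarrow> 'a \<Rightarrow> real) \<Rightarrow> ('a \<Rightarrow> real) \<Rightarrow> bool" where
  "tendsto_in_prob M Y Y' \<longleftrightarrow>
     (\<forall>\<epsilon>>0. (\<lambda>n. measure M {\<omega> \<in> space M. \<bar>Y n \<omega> - Y' \<omega>\<bar> > \<epsilon>}) \<longlonglongrightarrow> 0)"

definition covar :: "'a measure \<Rightarrow> ('a \<Rightarrow> real) \<Rightarrow> ('a \<Rightarrow> real) \<Rightarrow> real" where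
  "covar M Y Y' = (\<integral>\<omega>. (Y \<omega> - (\<integral>\<omega>'. Y \<omega>' \<partial>M)) * (Y' \<omega> - (\<integral>\<omega>'. Y' \<omega>' \<partial>M)) \<partial>M)"

section \<open>Two-sided stable Levy processes\<close>

definition two_sided_levy_process :: "'a measure \<Rightarrow> (real \<Rightarrow> 'a \<Rightarrow> real) \<Rightarrow> bool" where
  "two_sided_levy_process M L \<longleftrightarrow>
     (\<forall>t. L t \<in> borel_measurable M) \<and>
     (AE \<omega> in M. L 0 \<omega> = 0) \<and>
     (\<forall>t::nat \<Rightarrow> real. strict_mono t \<longrightarrow>
        prob_space.indep_vars M (\<lambda>_. borel) (\<lambda>i \<omega>. L (t (Suc i)) \<omega> - L (t i) \<omega>) UNIV) \<and>
     (\<forall>s t h. s \<le> t \<longrightarrow>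
        distr M borel (\<lambda>\<omega>. L (t + h) \<omega> - L (s + h) \<omega>) = distr M borel (\<lambda>\<omega>. L t \<omega> - L s \<omega>)) \<and>
     (\<forall>t. \<forall>\<epsilon>>0. ((\<lambda>s. measure M {\<omega> \<in> space M. \<bar>L s \<omega> - L t \<omega>\<bar> > \<epsilon>}) \<longlongrightarrow> 0) (at t)) \<and>
     (AE \<omega> in M. \<forall>t. continuous (at_right t) (\<lambda>s. L s \<omega>) \<and>
        (\<exists>l. ((\<lambda>s. L s \<omega>) \<longlongrightarrow> l) (at_left t)))"

text \<open>
  Stability in the wide sense: if \<open>Y\<close>, \<open>Y'\<close> are independent with law \<open>\<mu>\<close>, then \<open>a Y + b Y'\<close> has
  the law of \<open>c Y + d\<close> where \<open>c\<close> satisfies \<open>c powr \<beta> = a powr \<beta> + b powr \<beta>\<close>. Skewness and drift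
  are allowed. As usual, point masses (scale parameter zero) are not excluded.
\<close>

definition stable_law :: "real \<Rightarrow> real measure \<Rightarrow> bool" where
  "stable_law \<beta> \<mu> \<longleftrightarrow> real_distribution \<mu> \<and>
     (\<forall>a>0. \<forall>b>0. \<exists>d. distr (\<mu> \<Otimes>\<^sub>M \<mu>) borel (\<lambda>(x, y). a * x + b * y) =
        distr \<mu> borel (\<lambda>x. (a powr \<beta> + b powr \<beta>) powr (1 / \<beta>) * x + d))"

definition stable_levy_process :: "real \<Rightarrow> 'a measure \<Rightarrow> (real \<Rightarrow> 'a \<Rightarrow> real) \<Rightarrow> bool" where
  "stable_levy_process \<beta> M L \<longleftrightarrow>
     two_sided_levy_process M L \<and> stable_law \<beta> (distr M borel (L 1))"

section \<open>The Rajput--Rosinski integral of a deterministic function\<close>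

text \<open>
  The independently scattered random measure induced by \<open>L\<close> lives on the delta-ring of bounded
  Borel sets and is determined, up to null sets, by its values on half-open intervals.
\<close>

definition bounded_borel :: "real set set" where
  "bounded_borel = {A \<in> sets borel. bounded A}"

definition levy_random_measure ::
    "'a measure \<Rightarrow> (real \<Rightarrow> 'a \<Rightarrow> real) \<Rightarrow> (real set \<Rightarrow> 'a \<Rightarrow> real) \<Rightarrow> bool" where
  "levy_random_measure M L \<Lambda> \<longleftrightarrow>
     (\<forall>A\<in>bounded_borel. \<Lambda> A \<in> borel_measurable M) \<and>
     (\<forall>A::nat \<Rightarrow> real set. range A \<subseteq> bounded_borel \<and> disjoint_family A \<longrightarrow>
        prob_space.indep_vars M (\<lambda>_. borel) (\<lambda>i. \<Lambda> (A i)) UNIV \<and>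
        ((\<Union>i. A i) \<in> bounded_borel \<longrightarrow>
          (AE \<omega> in M. (\<lambda>i. \<Lambda> (A i) \<omega>) sums \<Lambda> (\<Union>i. A i) \<omega>))) \<and>
     (\<forall>s t. s < t \<longrightarrow> (AE \<omega> in M. \<Lambda> {s<..t} \<omega> = L t \<omega> - L s \<omega>))"

definition simple_integrand :: "(real \<Rightarrow> real) \<Rightarrow> bool" where
  "simple_integrand g \<longleftrightarrow> simple_function borel g \<and> bounded {s. g s \<noteq> 0}"

text \<open>The integral over \<open>A\<close>, written with the canonical representation of \<open>g\<close> by its level sets.\<close>

definition simple_integral ::
    "(real set \<Rightarrow> 'a \<Rightarrow> real) \<Rightarrow> real set \<Rightarrow> (real \<Rightarrow> real) \<Rightarrow> 'a \<Rightarrow> real" where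
  "simple_integral \<Lambda> A g \<omega> = (\<Sum>y\<in>range g - {0}. y * \<Lambda> (A \<inter> g -` {y}) \<omega>)"

text \<open>
  \<open>Y\<close> is a version of the integral of \<open>g\<close> over the real line. The almost everywhere convergence is
  with respect to Lebesgue measure, to which the control measure of \<open>L\<close> is proportional. As in the
  original definition, the simple integrals must converge in probability over every Borel set.
\<close>

definition has_levy_integral ::
    "'a measure \<Rightarrow> (real \<Rightarrow> 'a \<Rightarrow> real) \<Rightarrow> (real \<Rightarrow> real) \<Rightarrow> ('a \<Rightarrow> real) \<Rightarrow> bool" where
  "has_levy_integral M L g Y \<longleftrightarrow>
     g \<in> borel_measurable borel \<and> Y \<in> borel_measurable M \<and>
     (\<exists>\<Lambda> G. levy_random_measure M L \<Lambda> \<and>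
        (\<forall>n. simple_integrand (G n)) \<and>
        (AE s in lborel. (\<lambda>n. G n s) \<longlonglongrightarrow> g s) \<and>
        (\<forall>A\<in>sets borel. \<exists>W\<in>borel_measurable M.
           tendsto_in_prob M (\<lambda>n. simple_integral \<Lambda> A (G n)) W) \<and>
        tendsto_in_prob M (\<lambda>n. simple_integral \<Lambda> UNIV (G n)) Y)"

definition stable_OU_process ::
    "real \<Rightarrow> real \<Rightarrow> 'a measure \<Rightarrow> (real \<Rightarrow> 'a \<Rightarrow> real) \<Rightarrow> (real \<Rightarrow> 'a \<Rightarrow> real) \<Rightarrow> bool" where
  "stable_OU_process \<beta> \<kappa> M L X \<longleftrightarrow> stable_levy_process \<beta> M L \<and>
     (\<forall>t. has_levy_integral M L (\<lambda>s. if s \<le> t then exp (- \<kappa> * (t - s)) else 0) (X t))"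

section \<open>Partial sums and distances between laws\<close>

definition partial_sum ::
    "'a measure \<Rightarrow> (real \<Rightarrow> 'a \<Rightarrow> real) \<Rightarrow> (real \<Rightarrow> real) \<Rightarrow> nat \<Rightarrow> 'a \<Rightarrow> real" where
  "partial_sum M X f n \<omega> =
     (\<Sum>t=1..n. f (X (real t) \<omega>) - (\<integral>\<omega>'. f (X 1 \<omega>') \<partial>M)) / sqrt (real n)"

definition partial_sum_sd ::
    "'a measure \<Rightarrow> (real \<Rightarrow> 'a \<Rightarrow> real) \<Rightarrow> (real \<Rightarrow> real) \<Rightarrow> nat \<Rightarrow> real" where
  "partial_sum_sd M X f n = sqrt (prob_space.variance M (partial_sum M X f n))"

text \<open>
  The unconditional sum \<open>infsum\<close> is zero for a family that is not summable, so positivity of this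
  quantity includes convergence of the series.
\<close>

definition long_run_variance ::
    "'a measure \<Rightarrow> (real \<Rightarrow> 'a \<Rightarrow> real) \<Rightarrow> (real \<Rightarrow> real) \<Rightarrow> real" where
  "long_run_variance M X f =
     (\<Sum>\<^sub>\<infinity>j\<in>(UNIV::int set). covar M (\<lambda>\<omega>. f (X 0 \<omega>)) (\<lambda>\<omega>. f (X (of_int j) \<omega>)))"

text \<open>
  The random variables \<open>F\<close> and \<open>G\<close> may live on different probability spaces \<open>M\<close> and \<open>N\<close>. The
  Wasserstein distance is meaningful for integrable \<open>F\<close> and \<open>G\<close>; it takes values in \<open>ennreal\<close> so
  that the supremum is never an unspecified real.
\<close>

definition wasserstein_dist ::
    "'a measure \<Rightarrow> ('a \<Rightarrow> real) \<Rightarrow> 'b measure \<Rightarrow> ('b \<Rightarrow> real) \<Rightarrow> ennreal" where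
  "wasserstein_dist M F N G =
     (SUP h\<in>{h :: real \<Rightarrow> real. 1-lipschitz_on UNIV h}.
        ennreal \<bar>(\<integral>\<omega>. h (F \<omega>) \<partial>M) - (\<integral>\<omega>. h (G \<omega>) \<partial>N)\<bar>)"

definition kolmogorov_dist ::
    "'a measure \<Rightarrow> ('a \<Rightarrow> real) \<Rightarrow> 'b measure \<Rightarrow> ('b \<Rightarrow> real) \<Rightarrow> real" where
  "kolmogorov_dist M F N G =
     (SUP x::real. \<bar>measure M {\<omega> \<in> space M. F \<omega> \<le> x} - measure N {\<omega> \<in> space N. G \<omega> \<le> x}\<bar>)"

end

theory Submission
  imports Defs
begin

text \<open>
  The path of the process at integer times is a linear recursion \<open>X (t + 1) = exp (- \<kappa>) * X t + \<xi>\<close>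
  with independent innovations \<open>\<xi>\<close>, so the normalized sum is a function of independent inputs which
  forgets each input at a geometric rate. Stein's method for such functions gives both distances at
  once. The heavy tails are harmless because the sum depends on the inputs only through the bounded
  function \<open>f\<close>.

  The recursion comes from characteristic functions. The increments of \<open>L\<close> have a continuous
  exponent \<open>\<psi>\<close>, and stability in the form \<open>\<psi> (c * u) = 2 * \<psi> u - \<i> * d * u\<close> with \<open>c > 1\<close> yields
  \<open>norm (\<psi> u) \<le> C * \<bar>u\<bar> powr p\<close> near 0 for some \<open>p > 0\<close>. The characteristic function of the integral
  of \<open>h\<close> is the exponential of the integral of \<open>\<psi> (u * h)\<close>. This is \<open>cf_levy_integral\<close>; the
  approximating simple functions converge only almost everywhere, and the required convergence over
  all Borel sets is turned into convergence of the integrals by \<open>gliding_hump\<close>. The innovations are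
  integrals of functions with disjoint supports, so their joint characteristic function factorizes
  and they are independent, with laws that do not depend on the starting time. The bound on \<open>\<psi>\<close>
  bounds the moments of order less than \<open>p\<close> of the difference of two independent copies of an
  innovation. All this is collected in \<open>stable_OU_chain\<close> and \<open>symmetrized_moment_bound\<close>.

  For a functional \<open>W\<close> of independent inputs with mean 0 and variance 1, replacing the inputs one by
  one by independent copies expresses \<open>E (W * g W)\<close> by increments of \<open>W\<close> (\<open>covariance_identity\<close>).
  Inserting the solution \<open>g\<close> of Stein's equation bounds both distances, up to constants, by the
  standard deviation of a sum \<open>\<A>\<close> of products of increments, whose mean is 1, plus an error of the
  linearization. For Lipschitz test functions that error is a third moment (\<open>wasserstein_bound\<close>).
  For indicators the monotonicity of the solution and the antisymmetry under exchange of an input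
  with its copy bound it by the standard deviation of a similar sum \<open>\<B>\<close> (\<open>kolmogorov_bound\<close>).

  For \<open>W = (F - c) / \<sigma>\<close>, where \<open>F\<close> is the sum of the values \<open>f (X t)\<close>, all these quantities are
  small. A bounded Lipschitz function is Hoelder continuous of every small order, so the effect of
  one input on \<open>F\<close> is bounded by a small power of its distance to the copy, and that power has as
  many moments as are needed. The effect of one input on another input's increment decays
  geometrically in the distance of the two indices. So changing one input changes \<open>\<A>\<close> and \<open>\<B>\<close> by
  \<open>O(1 / \<sigma>\<^sup>2)\<close>, and the Efron-Stein inequality bounds their variances by \<open>O(n / \<sigma>\<^sup>4)\<close>. The sum of
  third moments is \<open>O(n / \<sigma>\<^sup>3)\<close>.

  Positivity of the long run variance includes summability of the covariances, which by stationarity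
  makes \<open>\<sigma>\<^sup>2\<close> at least a constant times \<open>n\<close> for large \<open>n\<close> (\<open>averaged_double_sum_lower_bound\<close>). Then
  both bounds are \<open>O(n powr (- 1 / 2))\<close>. The remaining finitely many \<open>n\<close> are absorbed in the
  constant.
\<close>

section \<open>Characteristic functions\<close>

abbreviation cf :: "'a measure \<Rightarrow> ('a \<Rightarrow> real) \<Rightarrow> real \<Rightarrow> complex" where
  "cf M Y \<equiv> char (distr M borel Y)"

lemma cf_eq: "Y \<in> borel_measurable M \<Longrightarrow> cf M Y u = (\<integral>\<omega>. iexp (u * Y \<omega>) \<partial>M)"
  by (simp add: char_def integral_distr)

lemma norm_iexp_diff_le: "norm (iexp a - iexp b) \<le> \<bar>a - b\<bar>"
proof -
  have "iexp a - iexp b = iexp b * (iexp (a - b) - 1)"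
    by (simp add: algebra_simps flip: exp_add)
  then have "norm (iexp a - iexp b) = norm (iexp (a - b) - 1)"
    by (simp add: norm_mult)
  also have "\<dots> \<le> \<bar>a - b\<bar>" using iexp_approx1[of "a-b" 0] by simp
  finally show ?thesis .
qed

lemma norm_iexp_diff_le_2: "norm (iexp a - iexp b) \<le> 2"
  using norm_triangle_ineq4[of "iexp a" "iexp b"] by simp

lemma (in prob_space) norm_cf_diff_le:
  assumes [measurable]: "Y \<in> borel_measurable M" "Y' \<in> borel_measurable M" and e: "e > 0"
  shows "norm (cf M Y u - cf M Y' u) \<le> \<bar>u\<bar> * e + 2 * prob {\<omega> \<in> space M. \<bar>Y \<omega> - Y' \<omega>\<bar> > e}"
proof -
  let ?S = "{\<omega> \<in> space M. \<bar>Y \<omega> - Y' \<omega>\<bar> > e}"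
  have i: "integrable M (\<lambda>\<omega>. iexp (u * Z \<omega>))" if "Z \<in> borel_measurable M" for Z
    using that by (intro integrable_iexp) auto
  have "cf M Y u - cf M Y' u = (\<integral>\<omega>. iexp (u * Y \<omega>) - iexp (u * Y' \<omega>) \<partial>M)"
    using i[of Y] i[of Y'] by (subst Bochner_Integration.integral_diff) (simp_all add: cf_eq)
  also have "norm \<dots> \<le> (\<integral>\<omega>. norm (iexp (u * Y \<omega>) - iexp (u * Y' \<omega>)) \<partial>M)"
    by (intro integral_norm_bound)
  also have "\<dots> \<le> (\<integral>\<omega>. \<bar>u\<bar> * e + 2 * indicator ?S \<omega> \<partial>M)"
  proof (rule integral_mono)
    fix \<omega> assume w: "\<omega> \<in> space M"
    have *: "norm (iexp (u * Y \<omega>) - iexp (u * Y' \<omega>)) \<le> \<bar>u\<bar> * \<bar>Y \<omega> - Y' \<omega>\<bar>"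
      using norm_iexp_diff_le[of "u * Y \<omega>" "u * Y' \<omega>"]
      by (simp add: abs_mult[symmetric] right_diff_distrib)
    show "norm (iexp (u * Y \<omega>) - iexp (u * Y' \<omega>)) \<le> \<bar>u\<bar> * e + 2 * indicator ?S \<omega>"
    proof (cases "\<bar>Y \<omega> - Y' \<omega>\<bar> > e")
      case True
      then show ?thesis using norm_iexp_diff_le_2[of "u * Y \<omega>" "u * Y' \<omega>"] w e
        by (auto intro: order_trans)
    next
      case False
      then have "\<bar>u\<bar> * \<bar>Y \<omega> - Y' \<omega>\<bar> \<le> \<bar>u\<bar> * e" by (intro mult_left_mono) auto
      then show ?thesis using * False by simp
    qed
  next
    show "integrable M (\<lambda>\<omega>. norm (iexp (u * Y \<omega>) - iexp (u * Y' \<omega>)))"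
      by (intro integrable_norm Bochner_Integration.integrable_diff i) auto
    show "integrable M (\<lambda>\<omega>. \<bar>u\<bar> * e + 2 * indicator ?S \<omega>)"
      by (intro Bochner_Integration.integrable_add integrable_const integrable_mult_right integrable_real_indicator)
         (auto simp: emeasure_eq_measure)
  qed
  also have "\<dots> = \<bar>u\<bar> * e + 2 * prob ?S"
    by (subst Bochner_Integration.integral_add) (auto simp: prob_space emeasure_eq_measure)
  finally show ?thesis .
qed

lemma (in prob_space) tendsto_cf:
  assumes Y[measurable]: "\<And>x. Y x \<in> borel_measurable M" "Y' \<in> borel_measurable M"
    and conv: "\<And>e. e > 0 \<Longrightarrow> ((\<lambda>x. prob {\<omega> \<in> space M. \<bar>Y x \<omega> - Y' \<omega>\<bar> > e}) \<longlongrightarrow> 0) F"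
  shows "((\<lambda>x. cf M (Y x) u) \<longlongrightarrow> cf M Y' u) F"
proof (rule tendstoI)
  fix d :: real assume d: "d > 0"
  define e where "e = d / (2 * (\<bar>u\<bar> + 1))"
  have e: "e > 0" using d by (simp add: e_def)
  have ue: "\<bar>u\<bar> * e < d / 2 \<or> \<bar>u\<bar> * e \<le> d/2" using d by (auto simp: e_def field_simps)
  have "\<forall>\<^sub>F x in F. prob {\<omega> \<in> space M. \<bar>Y x \<omega> - Y' \<omega>\<bar> > e} < d / 4"
    using conv[OF e] d by (intro order_tendstoD) auto
  then show "\<forall>\<^sub>F x in F. dist (cf M (Y x) u) (cf M Y' u) < d"
  proof eventually_elim
    case (elim x)
    then show ?case using norm_cf_diff_le[of "Y x" Y' e u] Y e ue by (auto simp: dist_norm)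
  qed
qed

section \<open>The exponent of a stable Levy process\<close>

text \<open>
  Integrating the functional equation over \<open>[0, a]\<close> gives \<open>q s * \<Phi> a = \<Phi> (s + a) - \<Phi> s\<close> for the
  primitive \<open>\<Phi>\<close>. So \<open>q\<close> is differentiable and solves a linear equation \<open>q' = z q\<close>. The exponent is
  stated as an explicit quotient and not as a logarithm, because a quotient depends continuously on
  parameters without any choice of branch.
\<close>

lemma multiplicative_continuous_eq_exp:
  fixes q :: "real \<Rightarrow> complex"
  assumes cont: "continuous_on {0..} q"
    and mult: "\<And>s t. s \<ge> 0 \<Longrightarrow> t \<ge> 0 \<Longrightarrow> q (s + t) = q s * q t"
    and a: "a > 0" "integral {0..a} q \<noteq> 0" and t: "t \<ge> 0"
  shows "q t = exp (of_real t * ((q a - 1) / integral {0..a} q))"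
proof -
  define \<Phi> where "\<Phi> x = integral {0..x} q" for x
  define z where "z = (q a - 1) / \<Phi> a"
  have int: "q integrable_on {x..y}" if "x \<ge> 0" for x y
    using that by (intro integrable_continuous_interval continuous_on_subset[OF cont]) auto
  have eq: "q s * \<Phi> a = \<Phi> (s + a) - \<Phi> s" if "s \<ge> 0" for s
  proof -
    have "integral {0..a} (\<lambda>x. q s * q x) = integral {0..a} (\<lambda>x. q (x + s))"
      using that by (intro integral_cong) (auto simp: mult[symmetric] add.commute)
    also have "\<dots> = integral {s..s+a} q"
      using integral_shift_real_ivl[of s s "s + a" q]
      by simp
    also have "\<dots> = \<Phi> (s + a) - \<Phi> s"
      unfolding \<Phi>_def using that a
      by (subst Henstock_Kurzweil_Integration.integral_combine[of 0 s "s+a" q, symmetric]) (auto intro: int)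
    finally show ?thesis by (simp add: \<Phi>_def)
  qed
  have \<Phi>': "(\<Phi> has_vector_derivative q s) (at s within {0..T})" if "s \<in> {0..T}" for s T
    unfolding \<Phi>_def using that
    by (intro integral_has_vector_derivative continuous_on_subset[OF cont]) auto
  have q': "(q has_vector_derivative z * q s) (at s within {0..t})" if s: "s \<in> {0..t}" for s
  proof -
    have 1: "(\<Phi> has_vector_derivative q s) (at s within {0..t})"
      using \<Phi>'[of s t] s by auto
    have "((\<Phi> \<circ> (\<lambda>s. s + a)) has_vector_derivative (1 *\<^sub>R q (s + a))) (at s within {0..t})"
      using s a
      by (intro vector_diff_chain_within has_vector_derivative_within_subset[OF \<Phi>'[of "s+a" "t+a"]])
         (auto intro!: derivative_eq_intros)
    then have 2: "((\<lambda>s. \<Phi> (s + a)) has_vector_derivative q (s + a)) (at s within {0..t})"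
      by (simp add: o_def)
    have "((\<lambda>s. (\<Phi> (s + a) - \<Phi> s) / \<Phi> a) has_vector_derivative (q (s + a) - q s) / \<Phi> a) (at s within {0..t})"
      by (intro has_vector_derivative_divide has_vector_derivative_diff 1 2)
    moreover have "(q (s + a) - q s) / \<Phi> a = z * q s"
      using mult[of s a] s a by (simp add: z_def algebra_simps divide_simps)
    ultimately have "((\<lambda>s. (\<Phi> (s + a) - \<Phi> s) / \<Phi> a) has_vector_derivative z * q s) (at s within {0..t})"
      by simp
    then show ?thesis
      by (rule has_vector_derivative_transform[OF s, rotated]) (use a eq in \<open>auto simp: \<Phi>_def eq_divide_eq\<close>)
  qed
  define h where "h s = q s * exp (- (of_real s * z))" for s
  have h': "(h has_vector_derivative 0) (at s within {0..t})" if s: "s \<in> {0..t}" for s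
  proof -
    have "((\<lambda>s. exp (- (of_real s * z))) has_vector_derivative (- z) * exp (- (of_real s * z))) (at s within {0..t})"
    proof -
      have "((\<lambda>w. exp (- (w * z))) has_field_derivative (- z) * exp (- (of_real s * z))) (at (of_real s))"
        by (auto intro!: derivative_eq_intros)
      then show ?thesis
        using has_vector_derivative_real_field has_vector_derivative_at_within by blast
    qed
    from has_vector_derivative_mult[OF q'[OF s] this] show ?thesis
      unfolding h_def by (simp add: algebra_simps)
  qed
  obtain c where c: "\<And>s. s \<in> {0..t} \<Longrightarrow> h s = c"
    using has_vector_derivative_zero_constant[of "{0..t}" h] h' by (auto)
  have q0: "q 0 = 1"
  proof -
    have "q 0 * \<Phi> a = \<Phi> a" using eq[of 0] by (simp add: \<Phi>_def)
    then show ?thesis using a by (simp add: \<Phi>_def)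
  qed
  have "h t = h 0" using c t by simp
  then have "q t * exp (- (of_real t * z)) = 1" by (simp add: h_def q0)
  then have "q t = exp (of_real t * z)" by (simp add: exp_minus field_simps)
  then show ?thesis by (simp add: z_def \<Phi>_def)
qed

lemma integral_initial_segment_nonzero:
  fixes q :: "real \<Rightarrow> complex"
  assumes cont: "continuous_on {0..} q" and q0: "q 0 = 1"
  shows "\<exists>a>0. integral {0..a} q \<noteq> 0"
proof -
  obtain d where d: "d > 0" "\<And>x. x \<in> {0..} \<Longrightarrow> dist x 0 < d \<Longrightarrow> dist (q x) (q 0) < 1/2"
    using cont[unfolded continuous_on_iff, rule_format, of 0 "1/2"] by auto
  define a where "a = d / 2"
  have a: "a > 0" using d by (simp add: a_def)
  have c: "continuous_on {0..a} q" by (rule continuous_on_subset[OF cont]) auto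
  have "norm (integral {0..a} (\<lambda>x. q x - 1)) \<le> 1/2 * (a - 0)"
  proof (rule integral_bound)
    show "\<And>t. t \<in> {0..a} \<Longrightarrow> norm (q t - 1) \<le> 1/2"
      using d(2) d(1) q0 by (auto simp: dist_norm a_def intro!: less_imp_le)
  qed (use a c in \<open>auto intro!: continuous_intros\<close>)
  moreover have "integral {0..a} (\<lambda>x. q x - 1) = integral {0..a} q - of_real a"
    using a c by (subst Henstock_Kurzweil_Integration.integral_diff) (auto intro!: integrable_continuous_interval simp: scaleR_conv_of_real)
  ultimately have "integral {0..a} q \<noteq> 0" using a by auto
  with a show ?thesis by blast
qed

text \<open>
  At time \<open>1 / norm (z - w)\<close> the two exponents differ by a number of modulus 1, which is too short
  to be a period of the exponential.
\<close>

lemma exp_linear_inj: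
  fixes z w :: complex
  assumes "\<And>t. t \<ge> 0 \<Longrightarrow> exp (of_real t * z) = exp (of_real t * w)"
  shows "z = w"
proof (rule ccontr)
  assume ne: "z \<noteq> w"
  define t where "t = 1 / norm (z - w)"
  have t: "t > 0" using ne by (simp add: t_def)
  have "exp (of_real t * (z - w)) = 1"
    using assms[of t] t by (simp add: right_diff_distrib exp_diff)
  then obtain n :: int where n: "Re (of_real t * (z - w)) = 0" "Im (of_real t * (z - w)) = of_int (2 * n) * pi"
    unfolding exp_eq_1 by auto
  have "norm (of_real t * (z - w)) = 1" using ne by (simp add: norm_mult norm_divide t_def)
  then have "\<bar>Im (of_real t * (z - w))\<bar> = 1"
    using n(1) by (metis abs_Im_le_cmod cmod_eq_Im)
  moreover have "\<bar>of_int (2 * n) * pi\<bar> = \<bar>of_int (2 * n)\<bar> * pi" by (subst abs_mult) simp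
  ultimately have *: "\<bar>of_int (2 * n)\<bar> * pi = 1" using n(2) by argo
  have "n \<noteq> 0" using * by auto
  then have "\<bar>of_int (2 * n)\<bar> \<ge> (1::real)" by auto
  then have "\<bar>of_int (2 * n)\<bar> * pi \<ge> 1 * pi" by (intro mult_right_mono) auto
  with * pi_gt3 show False by linarith
qed

lemma levy_process_measurable: "two_sided_levy_process M L \<Longrightarrow> L t \<in> borel_measurable M"
  by (simp add: two_sided_levy_process_def)

lemma (in prob_space) cf_zero_rv: "cf M (\<lambda>_. 0) u = 1"
  by (simp add: char_def integral_return)

text \<open>
  As a function of the length of the increment, the characteristic function at \<open>u\<close> is continuous and
  multiplicative, hence exponential. The segment \<open>[0, a]\<close> on which its integral does not vanish
  depends on \<open>u\<close>, but the exponent does not depend on the segment, and one segment serves a whole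
  neighbourhood of \<open>u\<close>; this gives continuity of the exponent.
\<close>

lemma (in prob_space) levy_exponent_exists:
  assumes L: "two_sided_levy_process M L"
  obtains \<psi> where "continuous_on UNIV \<psi>" "\<psi> 0 = (0::complex)"
    "\<And>s t u. s \<le> t \<Longrightarrow> cf M (\<lambda>\<omega>. L t \<omega> - L s \<omega>) u = exp (of_real (t - s) * \<psi> u)"
proof -
  note [measurable] = levy_process_measurable[OF L]
  define q where "q u t = cf M (\<lambda>\<omega>. L t \<omega> - L 0 \<omega>) u" for u t
  have stat: "cf M (\<lambda>\<omega>. L t \<omega> - L s \<omega>) u = q u (t - s)" if "s \<le> t" for s t u
  proof -
    have "distr M borel (\<lambda>\<omega>. L (t + - s) \<omega> - L (s + - s) \<omega>) = distr M borel (\<lambda>\<omega>. L t \<omega> - L s \<omega>)"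
      using L that unfolding two_sided_levy_process_def by blast
    then show ?thesis by (simp add: q_def)
  qed
  have cont: "continuous_on {0..} (q u)" for u
    unfolding continuous_on_def
  proof
    fix t :: real
    have "(q u \<longlongrightarrow> q u t) (at t)"
      unfolding q_def
    proof (rule tendsto_cf)
      show "((\<lambda>x. prob {\<omega> \<in> space M. e < \<bar>L x \<omega> - L 0 \<omega> - (L t \<omega> - L 0 \<omega>)\<bar>}) \<longlongrightarrow> 0) (at t)" if "e > 0" for e
        using L that unfolding two_sided_levy_process_def by simp
    qed auto
    then show "(q u \<longlongrightarrow> q u t) (at t within {0..})"
      by (rule tendsto_within_subset) auto
  qed
  have q0: "q u 0 = 1" for u unfolding q_def diff_self by (rule cf_zero_rv)
  have mult: "q u (s + t) = q u s * q u t" if st: "s \<ge> 0" "t \<ge> 0" for u s t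
  proof (cases "s = 0 \<or> t = 0")
    case False
    with st have st: "s > 0" "t > 0" by auto
    define T where "T i = (if i = 0 then 0 else s + (real i - 1) * t)" for i :: nat
    have "strict_mono T"
      unfolding strict_mono_Suc_iff T_def using st by (auto simp: algebra_simps)
    then have "indep_vars (\<lambda>_. borel) (\<lambda>i \<omega>. L (T (Suc i)) \<omega> - L (T i) \<omega>) UNIV"
      using L unfolding two_sided_levy_process_def by blast
    then have *: "indep_vars (\<lambda>_. borel) (\<lambda>i \<omega>. L (T (Suc i)) \<omega> - L (T i) \<omega>) {0, 1}"
      by (rule indep_vars_subset) auto
    have "q u (s + t) = cf M (\<lambda>\<omega>. \<Sum>i\<in>{0,1}. L (T (Suc i)) \<omega> - L (T i) \<omega>) u"
      by (simp add: q_def T_def)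
    also have "\<dots> = (\<Prod>i\<in>{0,1}. cf M (\<lambda>\<omega>. L (T (Suc i)) \<omega> - L (T i) \<omega>) u)"
      by (rule char_distr_sum[OF *])
    also have "\<dots> = q u s * q u t"
      using st by (simp add: T_def stat)
    finally show ?thesis .
  qed (auto simp: q0)
  have rd: "real_distribution (distr M borel (\<lambda>\<omega>. L t \<omega> - L s \<omega>))" for t s
    by (intro real_distribution_distr) auto
  have qnorm: "norm (q u t) \<le> 1" for u t
    unfolding q_def by (rule real_distribution.cmod_char_le_1[OF rd])
  have qcont: "isCont (\<lambda>u. q u t) u" for u t
    unfolding q_def by (rule real_distribution.isCont_char[OF rd])
  define \<Phi> where "\<Phi> u a = integral {0..a} (q u)" for u a
  have "\<exists>a. a > 0 \<and> \<Phi> u a \<noteq> 0" for u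
    unfolding \<Phi>_def by (rule integral_initial_segment_nonzero[OF cont q0])
  then obtain a where a: "\<And>u. a u > 0" "\<And>u. \<Phi> u (a u) \<noteq> 0" by metis
  define \<psi> where "\<psi> u = (q u (a u) - 1) / \<Phi> u (a u)" for u
  have q_exp: "q u t = exp (of_real t * ((q u b - 1) / \<Phi> u b))" if "b > 0" "\<Phi> u b \<noteq> 0" "t \<ge> 0" for u b t
    unfolding \<Phi>_def using that
    by (intro multiplicative_continuous_eq_exp) (auto intro: cont mult simp: \<Phi>_def)
  have \<psi>_eq: "\<psi> u = (q u b - 1) / \<Phi> u b" if "b > 0" "\<Phi> u b \<noteq> 0" for u b
    unfolding \<psi>_def
    by (rule exp_linear_inj) (rule trans[OF sym[OF q_exp[OF a]] q_exp[OF that]])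
  have "continuous_on UNIV \<psi>"
  proof (intro continuous_at_imp_continuous_on ballI)
    fix u
    define b where "b = a u"
    have \<Phi>cont: "isCont (\<lambda>v. \<Phi> v b) u"
      unfolding continuous_at_sequentially o_def
    proof (intro allI impI)
      fix x assume x: "x \<longlonglongrightarrow> u"
      show "(\<lambda>n. \<Phi> (x n) b) \<longlonglongrightarrow> \<Phi> u b" unfolding \<Phi>_def
      proof (rule dominated_convergence(2)[where h="\<lambda>_. 1"])
        show "q (x n) integrable_on {0..b}" for n
          by (intro integrable_continuous_interval continuous_on_subset[OF cont]) auto
        show "(\<lambda>n. q (x n) t) \<longlonglongrightarrow> q u t" if "t \<in> {0..b}" for t
          using isCont_tendsto_compose[OF qcont x] .
      qed (auto intro: qnorm)
    qed
    have ev: "\<forall>\<^sub>F v in nhds u. \<Phi> v b \<noteq> 0"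
    proof -
      have "((\<lambda>v. \<Phi> v b) \<longlongrightarrow> \<Phi> u b) (nhds u)"
        using \<Phi>cont tendsto_at_iff_tendsto_nhds[of "\<lambda>v. \<Phi> v b" u] unfolding isCont_def by simp
      then show ?thesis using a(2)[of u] unfolding b_def by (rule tendsto_imp_eventually_ne)
    qed
    have "isCont (\<lambda>v. (q v b - 1) / \<Phi> v b) u"
      using a(2)[of u] by (intro continuous_intros qcont \<Phi>cont) (simp add: b_def)
    moreover have "\<forall>\<^sub>F v in nhds u. (q v b - 1) / \<Phi> v b = \<psi> v"
      using ev a(1)[of u] by (auto elim!: eventually_mono simp: b_def intro!: \<psi>_eq[symmetric])
    ultimately show "isCont \<psi> u" by (rule isCont_cong[THEN iffD1, rotated])
  qed
  moreover have "\<psi> 0 = 0"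
    unfolding \<psi>_def q_def real_distribution.char_zero[OF rd] by simp
  moreover have "cf M (\<lambda>\<omega>. L t \<omega> - L s \<omega>) u = exp (of_real (t - s) * \<psi> u)" if "s \<le> t" for s t u
    unfolding stat[OF that] \<psi>_def using that by (intro q_exp a) auto
  ultimately show ?thesis by (rule that)
qed

text \<open>
  Dividing \<open>u\<close> by \<open>c\<close> halves \<open>\<psi> u\<close> up to a drift that is linear in \<open>u\<close>, hence itself geometrically
  small along \<open>u, u / c, u / c\<^sup>2, \<dots>\<close>. So \<open>\<psi>\<close> decays geometrically along this sequence, which is a
  power bound in \<open>u\<close>.
\<close>

lemma stable_exponent_growth:
  fixes \<psi> :: "real \<Rightarrow> complex"
  assumes cont: "continuous_on UNIV \<psi>" and c: "c > 1"
    and rec: "\<And>u. \<psi> (c * u) = 2 * \<psi> u - \<i> * of_real (d * u)"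
  obtains C p where "C > 0" "0 < p" "p \<le> 1" "\<And>u. \<bar>u\<bar> \<le> 1 \<Longrightarrow> norm (\<psi> u) \<le> C * \<bar>u\<bar> powr p"
proof -
  define r where "r = 1 / c"
  have r: "0 < r" "r < 1" using c by (auto simp: r_def)
  \<comment> \<open>A ratio of at least \<open>3/4\<close> leaves room, above the factor \<open>1/2\<close> from the recursion, for the
      drift, which is at most \<open>C / 4\<close> by the choice of \<open>C\<close> below. A ratio of at least \<open>r\<close> keeps the
      power \<open>p\<close> at most 1.\<close>
  define \<theta> where "\<theta> = max r (3/4)"
  have \<theta>: "\<theta> \<ge> r" "\<theta> \<ge> 3/4" "\<theta> < 1" "\<theta> > 0" using r by (auto simp: \<theta>_def)
  have "compact (\<psi> ` {-1..1})"
    by (intro compact_continuous_image continuous_on_subset[OF cont]) auto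
  then obtain K where "\<forall>z\<in>\<psi> ` {-1..1}. norm z \<le> K"
    using compact_imp_bounded[of "\<psi> ` {-1..1}"] unfolding bounded_iff by blast
  then have K: "norm (\<psi> u) \<le> K" if "\<bar>u\<bar> \<le> 1" for u
    using that by (auto simp: abs_le_iff)
  define D where "D = \<bar>d\<bar>"
  define C where "C = K + 4 * D + 1"
  have K0: "K \<ge> 0" using K[of 0] norm_ge_zero[of "\<psi> 0"] by linarith
  have step: "norm (\<psi> (r * u)) \<le> norm (\<psi> u) / 2 + D * \<bar>u\<bar>" for u
  proof -
    have "\<psi> u = 2 * \<psi> (r * u) - \<i> * of_real (d * (r * u))"
      using rec[of "r * u"] c by (simp add: r_def)
    then have "2 * \<psi> (r * u) = \<psi> u + \<i> * of_real (d * (r * u))" by (simp add: algebra_simps)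
    then have "(2 * \<psi> (r * u)) / 2 = \<psi> u / 2 + \<i> * of_real (d * r * u) / 2"
      by (simp only: add_divide_distrib mult.assoc)
    then have "\<psi> (r * u) = \<psi> u / 2 + \<i> * of_real (d * r * u) / 2" by simp
    then have "norm (\<psi> (r * u)) \<le> norm (\<psi> u / 2) + norm (\<i> * of_real (d * r * u) / 2)"
      by (simp only: norm_triangle_ineq)
    also have "norm (\<i> * of_real (d * r * u) / 2) = D * \<bar>u\<bar> * (r / 2)"
      using r by (simp add: norm_mult norm_divide abs_mult D_def)
    also have "\<dots> \<le> D * \<bar>u\<bar> * 1" using r by (intro mult_left_mono) (auto simp: D_def)
    finally show ?thesis by (simp add: norm_divide)
  qed
  have main: "norm (\<psi> u) \<le> C * \<theta> ^ k" if "\<bar>u\<bar> \<le> r ^ k" for k u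
    using that
  proof (induction k arbitrary: u)
    case 0
    then show ?case using K[of u] by (simp add: C_def D_def)
  next
    case (Suc k)
    define v where "v = u / r"
    have u: "u = r * v" using r by (simp add: v_def)
    have v: "\<bar>v\<bar> \<le> r ^ k" using Suc.prems r by (simp add: v_def abs_divide divide_simps mult.commute)
    have "r ^ k \<le> \<theta> ^ k" using r \<theta> by (intro power_mono) auto
    with v have v': "D * \<bar>v\<bar> \<le> D * \<theta> ^ k" by (intro mult_left_mono) (auto simp: D_def)
    have "norm (\<psi> u) \<le> (C * \<theta> ^ k) / 2 + D * \<theta> ^ k"
      using step[of v] Suc.IH[OF v] v' unfolding u by linarith
    also have "\<dots> = (C / 2 + D) * \<theta> ^ k" by (simp add: algebra_simps)
    also have "\<dots> \<le> (C * \<theta>) * \<theta> ^ k"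
    proof (intro mult_right_mono)
      have "C / 2 + D \<le> C * (3/4)" using K0 by (simp add: C_def D_def)
      also have "\<dots> \<le> C * \<theta>" using \<theta> K0 by (intro mult_left_mono) (auto simp: C_def D_def)
      finally show "C / 2 + D \<le> C * \<theta>" .
    qed (use \<theta> in auto)
    finally show ?case by (simp add: mult.assoc)
  qed
  \<comment> \<open>The power for which \<open>r powr p = \<theta>\<close>.\<close>
  define p where "p = ln \<theta> / ln r"
  have lnr: "ln r < 0" "ln \<theta> < 0" using r \<theta> by auto
  have p: "p > 0" "p \<le> 1" using lnr r \<theta> by (auto simp: p_def divide_neg_neg divide_le_eq)
  have rp: "r powr p = \<theta>" using r \<theta> lnr by (simp add: powr_def p_def)
  have C0: "C > 0" using K0 by (simp add: C_def D_def)
  have "norm (\<psi> u) \<le> C / \<theta> * \<bar>u\<bar> powr p" if u: "\<bar>u\<bar> \<le> 1" for u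
  proof (cases "u = 0")
    case True
    have "\<psi> 0 = 0" using rec[of 0] by simp
    with True show ?thesis by simp
  next
    case False
    then obtain n where n: "r ^ n < \<bar>u\<bar>" using real_arch_pow_inv[of "\<bar>u\<bar>" r] r by auto
    define m where "m = (LEAST n. r ^ n < \<bar>u\<bar>)"
    have m: "r ^ m < \<bar>u\<bar>" unfolding m_def by (rule LeastI[of _ n]) (rule n)
    then have "m \<noteq> 0" using u by (intro notI) auto
    then obtain k where k: "m = Suc k" by (cases m) auto
    have "\<not> r ^ k < \<bar>u\<bar>" using k not_less_Least[of k "\<lambda>n. r ^ n < \<bar>u\<bar>"] m_def by auto
    then have "norm (\<psi> u) \<le> C * \<theta> ^ k" by (intro main) auto
    also have "\<dots> = C / \<theta> * \<theta> ^ m" using \<theta> by (simp add: k)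
    also have "\<theta> ^ m = (r ^ m) powr p"
      using r by (simp add: rp[symmetric] powr_realpow[symmetric] powr_powr mult.commute)
    also have "C / \<theta> * (r ^ m) powr p \<le> C / \<theta> * \<bar>u\<bar> powr p"
      using m p \<theta> C0 r by (intro mult_left_mono powr_mono2) auto
    finally show ?thesis .
  qed
  moreover have "C / \<theta> > 0" using C0 \<theta> by auto
  ultimately show ?thesis using p that by blast
qed

text \<open>The values of \<open>g\<close> are multiples of \<open>2 \<pi> \<i>\<close>, a discrete set.\<close>

lemma exp_eq_1_continuous_zero:
  fixes g :: "real \<Rightarrow> complex"
  assumes cont: "continuous_on UNIV g" and exp: "\<And>u. exp (g u) = 1" and g0: "g 0 = 0"
  shows "g u = 0"
proof -
  have "g constant_on UNIV"
  proof (rule continuous_discrete_range_constant[OF _ cont])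
    fix x :: real
    show "\<exists>e>0. \<forall>y. y \<in> UNIV \<and> g y \<noteq> g x \<longrightarrow> e \<le> cmod (g y - g x)"
    proof (intro exI[of _ "2*pi"] conjI allI impI)
      fix y assume y: "y \<in> UNIV \<and> g y \<noteq> g x"
      have "exp (g y - g x) = 1" using exp by (simp add: exp_diff)
      then obtain n :: int where n: "Re (g y - g x) = 0" "Im (g y - g x) = of_int (2 * n) * pi"
        unfolding exp_eq_1 by auto
      have "n \<noteq> 0" using n y by (auto simp: complex_eq_iff)
      then have "2 * \<bar>real_of_int n\<bar> * pi \<ge> 2 * 1 * pi" by (intro mult_right_mono mult_left_mono) auto
      also have "2 * \<bar>real_of_int n\<bar> * pi = \<bar>Im (g y - g x)\<bar>" using n by (simp add: abs_mult)
      also have "\<dots> \<le> cmod (g y - g x)" by (rule abs_Im_le_cmod)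
      finally show "2 * pi \<le> cmod (g y - g x)" by simp
    qed simp
  qed simp
  then show ?thesis using g0 unfolding constant_on_def by (metis UNIV_I)
qed

text \<open>
  Stability with both weights equal to 1, written for characteristic functions, determines the
  exponents up to multiples of \<open>2 \<pi> \<i>\<close>, and continuity leaves only the multiple zero.
\<close>

lemma stable_law_exponent_rec:
  fixes \<psi> :: "real \<Rightarrow> complex"
  assumes st: "stable_law \<beta> \<mu>" and \<beta>: "\<beta> > 0"
    and \<psi>: "continuous_on UNIV \<psi>" "\<psi> 0 = 0" "\<And>u. char \<mu> u = exp (\<psi> u)"
  obtains c d where "c > 1" "\<And>u. \<psi> (c * u) = 2 * \<psi> u - \<i> * of_real (d * u)"
proof -
  interpret \<mu>: real_distribution \<mu> using st by (simp add: stable_law_def)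
  interpret P: pair_prob_space \<mu> \<mu> ..
  define c where "c = (2::real) powr (1 / \<beta>)"
  have c: "c > 1" using \<beta> by (simp add: c_def)
  obtain d where d: "distr (\<mu> \<Otimes>\<^sub>M \<mu>) borel (\<lambda>(x, y). 1 * x + 1 * y) = distr \<mu> borel (\<lambda>x. c * x + d)"
    using st unfolding stable_law_def c_def by (metis zero_less_one powr_one_eq_one one_add_one)
  have eq: "exp (2 * \<psi> u) = exp (\<i> * of_real (d * u) + \<psi> (c * u))" for u
  proof -
    have "char (distr (\<mu> \<Otimes>\<^sub>M \<mu>) borel (\<lambda>(x, y). 1 * x + 1 * y)) u
        = (\<integral>z. iexp (u * fst z) * iexp (u * snd z) \<partial>(\<mu> \<Otimes>\<^sub>M \<mu>))"
      by (simp add: char_def integral_distr split_beta' ring_distribs exp_add)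
    also have "\<dots> = char \<mu> u * char \<mu> u"
      unfolding char_def
      by (subst P.integral_fst'[symmetric])
         (auto intro!: P.integrable_const_bound[where B=1] simp: norm_mult)
    finally have 1: "char (distr (\<mu> \<Otimes>\<^sub>M \<mu>) borel (\<lambda>(x, y). 1 * x + 1 * y)) u = exp (2 * \<psi> u)"
      by (simp add: \<psi> flip: exp_add)
    have "char (distr \<mu> borel (\<lambda>x. c * x + d)) u = (\<integral>x. iexp (u * d) * iexp (c * u * x) \<partial>\<mu>)"
      by (simp add: char_def integral_distr ring_distribs exp_add mult_ac)
    also have "\<dots> = iexp (u * d) * char \<mu> (c * u)"
      unfolding char_def by (subst integral_mult_right_zero) simp
    also have "\<dots> = exp (\<i> * of_real (d * u) + \<psi> (c * u))"
      by (simp add: \<psi> exp_add mult_ac)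
    finally show ?thesis using 1 d by simp
  qed
  define g where "g u = 2 * \<psi> u - (\<i> * of_real (d * u) + \<psi> (c * u))" for u
  have "g u = 0" for u
  proof (rule exp_eq_1_continuous_zero)
    show "continuous_on UNIV g"
      unfolding g_def by (intro continuous_intros \<psi> continuous_on_compose2[OF \<psi>(1)]) auto
    show "exp (g u) = 1" for u
      using eq[of u] by (simp add: g_def exp_diff)
  qed (simp add: g_def \<psi>)
  then have "\<psi> (c * u) = 2 * \<psi> u - \<i> * of_real (d * u)" for u
    by (simp add: g_def algebra_simps)
  with c that show ?thesis by blast
qed

section \<open>A gliding hump argument\<close>

text \<open>
  The \<open>k n\<close> need not have a common integrable bound, so pointwise convergence alone does not control
  their integrals; convergence over every Borel set has to be exploited. Any mass that fails to
  vanish must move: along a subsequence \<open>N i\<close> it sits, up to errors \<open>2 * e i\<close>, on pairwise disjoint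
  blocks \<open>B i\<close>. Let \<open>A\<close> be the union of the blocks with even index. Along odd indices the integrals
  over \<open>A\<close> tend to 0, so the limit belonging to \<open>A\<close> is 1. Along even indices the integral over \<open>A\<close>
  is asymptotically the whole integral, so the limit belonging to the whole line is the same.
\<close>

lemma gliding_hump:
  fixes k :: "nat \<Rightarrow> real \<Rightarrow> complex"
  assumes int: "\<And>n. integrable lborel (k n)"
    and lim: "AE s in lborel. (\<lambda>n. k n s) \<longlonglongrightarrow> 0"
    and conv: "\<And>A. A \<in> sets borel \<Longrightarrow> convergent (\<lambda>n. exp (LINT s:A|lborel. k n s))"
  shows "(\<lambda>n. exp (LINT s|lborel. k n s)) \<longlonglongrightarrow> 1"
proof -
  have [measurable]: "k n \<in> borel_measurable borel" for n
    using borel_measurable_integrable[OF int[of n]] by simp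
  \<comment> \<open>On each \<open>F m\<close> dominated convergence applies, and the \<open>F m\<close> exhaust almost all of the line
      because a convergent sequence is bounded.\<close>
  define F where "F m = {s. \<bar>s\<bar> \<le> real m \<and> (\<forall>n. norm (k n s) \<le> real m)}" for m :: nat
  have [measurable]: "F m \<in> sets borel" for m unfolding F_def by measurable
  have Fmono: "F m \<subseteq> F m'" if "m \<le> m'" for m m'
    using that unfolding F_def by (auto intro: order_trans)
  define I where "I S n = (LINT s|lborel. indicator S s * norm (k n s))" for S n
  have Iint: "integrable lborel (\<lambda>s. indicator S s * norm (k n s))" if [measurable]: "S \<in> sets borel" for S n
    by (rule Bochner_Integration.integrable_bound[OF int[of n]]) (auto simp: indicator_def)
  have F1: "(\<lambda>n. I (F m) n) \<longlonglongrightarrow> 0" for m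
  proof -
    have "(\<lambda>n. I (F m) n) \<longlonglongrightarrow> integral\<^sup>L lborel (\<lambda>s::real. 0::real)"
      unfolding I_def
    proof (rule integral_dominated_convergence[where w="\<lambda>s. real m * indicator {-real m..real m} s" and s="\<lambda>n s. indicator (F m) s * norm (k n s)"])
      show "AE s in lborel. (\<lambda>n. indicator (F m) s * norm (k n s)) \<longlonglongrightarrow> (0::real)"
        using lim
      proof eventually_elim
        case (elim s)
        then show ?case by (intro tendsto_mult_right_zero tendsto_norm_zero)
      qed
      show "AE s in lborel. norm (indicator (F m) s * norm (k n s)) \<le> real m * indicator {-real m..real m} s" for n
        by (auto simp: indicator_def F_def abs_le_iff)
      show "integrable lborel (\<lambda>s. real m * indicator {-real m..real m} s)"
        by (intro integrable_mult_right integrable_real_indicator) auto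
    qed measurable
    then show ?thesis by simp
  qed
  have F2: "(\<lambda>m. I (- F m) n) \<longlonglongrightarrow> 0" for n
  proof -
    have "(\<lambda>m. I (- F m) n) \<longlonglongrightarrow> integral\<^sup>L lborel (\<lambda>s::real. 0::real)"
      unfolding I_def
    proof (rule integral_dominated_convergence[where w="\<lambda>s. norm (k n s)"])
      show "AE s in lborel. (\<lambda>m. indicator (- F m) s * norm (k n s)) \<longlonglongrightarrow> (0::real)"
        using lim
      proof eventually_elim
        case (elim s)
        then have "Bseq (\<lambda>n. k n s)" by (intro convergent_imp_Bseq convergentI)
        then obtain K where K: "\<And>n. norm (k n s) \<le> K" unfolding Bseq_def by auto
        define m0 where "m0 = nat \<lceil>max K \<bar>s\<bar>\<rceil>"
        have "s \<in> F m" if "m \<ge> m0" for m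
        proof -
          have "real m \<ge> max K \<bar>s\<bar>" using that unfolding m0_def by linarith
          then show ?thesis using K unfolding F_def by (auto intro: order_trans)
        qed
        then have "\<forall>\<^sub>F m in sequentially. indicator (- F m) s * norm (k n s) = (0::real)"
          unfolding eventually_sequentially by (intro exI[of _ m0]) auto
        then show ?case by (rule tendsto_eventually)
      qed
      show "AE s in lborel. norm (indicator (- F m) s * norm (k n s)) \<le> norm (k n s)" for m
        by (auto simp: indicator_def)
      show "integrable lborel (\<lambda>s. norm (k n s))" using int by simp
    qed measurable
    then show ?thesis by simp
  qed
  define e where "e i = 1 / real (Suc i)" for i
  \<comment> \<open>The index \<open>n\<close> is chosen after \<open>m\<close> and the level \<open>m'\<close> after \<open>n\<close>: then \<open>k n\<close> is nearly supported
      on the block between \<open>F m\<close> and \<open>F m'\<close>.\<close>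
  define P where "P i x = (case x of (n, m, m') \<Rightarrow> m \<le> m' \<and> I (F m) n < e i \<and> I (- F m') n < e i)"
    for i and x :: "nat \<times> nat \<times> nat"
  have ex: "\<exists>n m'. P i (n, m, m') \<and> n > n0" for i m n0
  proof -
    have e: "e i > 0" by (simp add: e_def)
    have "\<forall>\<^sub>F n in sequentially. I (F m) n < e i \<and> n > n0"
      by (intro eventually_conj order_tendstoD(2)[OF F1] e eventually_gt_at_top)
    then obtain n where n: "I (F m) n < e i" "n > n0"
      unfolding eventually_sequentially by auto
    have "\<forall>\<^sub>F m' in sequentially. I (- F m') n < e i \<and> m' \<ge> m"
      by (intro eventually_conj order_tendstoD(2)[OF F2] e eventually_ge_at_top)
    then obtain m' where "I (- F m') n < e i" "m' \<ge> m"
      unfolding eventually_sequentially by auto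
    with n show ?thesis by (auto simp: P_def)
  qed
  have "\<exists>x. \<forall>i. P i (x i) \<and> (fst (x i) < fst (x (Suc i)) \<and> snd (snd (x i)) = fst (snd (x (Suc i))))"
  proof (rule dependent_nat_choice)
    show "\<exists>x. P 0 x" using ex by blast
    fix x i assume "P i x"
    obtain n m' where "P (Suc i) (n, snd (snd x), m')" "n > fst x" using ex by blast
    then show "\<exists>y. P (Suc i) y \<and> fst x < fst y \<and> snd (snd x) = fst (snd y)"
      by (intro exI[of _ "(n, snd (snd x), m')"]) auto
  qed
  then obtain x where x: "\<And>i. P i (x i)" "\<And>i. fst (x i) < fst (x (Suc i))"
    "\<And>i. snd (snd (x i)) = fst (snd (x (Suc i)))" by blast
  define N where "N i = fst (x i)" for i
  define m where "m i = fst (snd (x i))" for i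
  have x': "snd (snd (x i)) = m (Suc i)" for i using x(3) by (simp add: m_def)
  have Ps: "m i \<le> m (Suc i)" "I (F (m i)) (N i) < e i" "I (- F (m (Suc i))) (N i) < e i" for i
    using x(1)[of i] x'[of i] by (auto simp: P_def N_def m_def split_beta)
  have Nmono: "strict_mono N" unfolding strict_mono_Suc_iff using x(2) by (simp add: N_def)
  define B where "B i = F (m (Suc i)) - F (m i)" for i
  have mm: "m i \<le> m j" if "i \<le> j" for i j
    by (rule lift_Suc_mono_le[of m, OF Ps(1) that])
  have Bdisj: "B i \<inter> B j = {}" if "i < j" for i j
  proof -
    have "F (m (Suc i)) \<subseteq> F (m j)" using that by (intro Fmono mm) auto
    then show ?thesis unfolding B_def by auto
  qed
  define A where "A = (\<Union>i. B (2 * i))"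
  have [measurable]: "A \<in> sets borel" unfolding A_def B_def by measurable
  have small: "norm (LINT s:S|lborel. k (N i) s) \<le> 2 * e i"
    if [measurable]: "S \<in> sets borel" and S: "S \<inter> B i = {}" for S i
  proof -
    have "norm (LINT s:S|lborel. k (N i) s) \<le> (LINT s|lborel. norm (indicator S s *\<^sub>R k (N i) s))"
      unfolding set_lebesgue_integral_def by (rule integral_norm_bound)
    also have "\<dots> \<le> (LINT s|lborel. indicator (F (m i)) s * norm (k (N i) s) + indicator (- F (m (Suc i))) s * norm (k (N i) s))"
    proof (rule integral_mono)
      show "integrable lborel (\<lambda>s. norm (indicator S s *\<^sub>R k (N i) s))"
        using Iint[of S "N i"] by simp
      show "integrable lborel (\<lambda>s. indicator (F (m i)) s * norm (k (N i) s) + indicator (- F (m (Suc i))) s * norm (k (N i) s))"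
        by (intro Bochner_Integration.integrable_add Iint) auto
      fix s
      show "norm (indicator S s *\<^sub>R k (N i) s) \<le> indicator (F (m i)) s * norm (k (N i) s) + indicator (- F (m (Suc i))) s * norm (k (N i) s)"
        using S by (auto simp: indicator_def B_def)
    qed
    also have "\<dots> = I (F (m i)) (N i) + I (- F (m (Suc i))) (N i)"
      unfolding I_def by (intro Bochner_Integration.integral_add Iint) auto
    also have "\<dots> \<le> 2 * e i" using Ps[of i] by simp
    finally show ?thesis .
  qed
  have e0: "e \<longlonglongrightarrow> 0" unfolding e_def by (rule LIMSEQ_Suc[OF lim_1_over_n])
  have sub: "strict_mono (\<lambda>i. 2 * i :: nat)" "strict_mono (\<lambda>i. 2 * i + 1 :: nat)"
    by (auto simp: strict_mono_def)
  have e_even: "(\<lambda>i. 2 * e (2 * i)) \<longlonglongrightarrow> 0" and e_odd: "(\<lambda>i. 2 * e (2 * i + 1)) \<longlonglongrightarrow> 0"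
    using LIMSEQ_subseq_LIMSEQ[OF e0 sub(1)] LIMSEQ_subseq_LIMSEQ[OF e0 sub(2)]
    by (auto intro!: tendsto_mult_right_zero simp: o_def)
  obtain l where l: "(\<lambda>n. exp (LINT s:A|lborel. k n s)) \<longlonglongrightarrow> l"
    using conv[of A] by (auto simp: convergent_def)
  have odd0: "(\<lambda>i. LINT s:A|lborel. k (N (2 * i + 1)) s) \<longlonglongrightarrow> 0"
  proof (rule Lim_null_comparison[OF _ e_odd], intro always_eventually allI small)
    show "A \<inter> B (2 * i + 1) = {}" for i
    proof -
      have "B (2 * j) \<inter> B (2 * i + 1) = {}" for j
      proof (cases "2*j < 2*i+1")
        case False
        then have "2*i+1 < 2*j" by presburger
        from Bdisj[OF this] show ?thesis by (simp add: Int_commute)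
      qed (rule Bdisj)
      then show ?thesis unfolding A_def by auto
    qed
  qed auto
  have even0: "(\<lambda>i. LINT s:(-A)|lborel. k (N (2 * i)) s) \<longlonglongrightarrow> 0"
  proof (rule Lim_null_comparison[OF _ e_even], intro always_eventually allI small)
    show "- A \<in> sets borel" by measurable
    show "- A \<inter> B (2 * i) = {}" for i by (auto simp: A_def)
  qed
  have "(\<lambda>i. exp (LINT s:A|lborel. k (N (2 * i + 1)) s)) \<longlonglongrightarrow> exp 0"
    by (intro tendsto_exp odd0)
  moreover have "(\<lambda>i. exp (LINT s:A|lborel. k (N (2 * i + 1)) s)) \<longlonglongrightarrow> l"
    using LIMSEQ_subseq_LIMSEQ[OF l strict_mono_o[OF Nmono sub(2)]] by (simp add: o_def)
  ultimately have l1: "l = 1" using LIMSEQ_unique by force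
  have split: "(LINT s|lborel. k n s) = (LINT s:A|lborel. k n s) + (LINT s:(-A)|lborel. k n s)" for n
  proof -
    have "(LINT s:A|lborel. k n s) + (LINT s:(-A)|lborel. k n s) = (LINT s:(A \<union> -A)|lborel. k n s)"
      by (rule set_integral_Un[symmetric]) (auto simp: set_integrable_def intro!: integrable_mult_indicator int)
    then show ?thesis by (simp add: set_lebesgue_integral_def)
  qed
  have "(\<lambda>i. exp (LINT s:A|lborel. k (N (2 * i)) s)) \<longlonglongrightarrow> 1"
    using LIMSEQ_subseq_LIMSEQ[OF l strict_mono_o[OF Nmono sub(1)]] l1 by (simp add: o_def)
  then have "(\<lambda>i. exp (LINT s:A|lborel. k (N (2 * i)) s) * exp (LINT s:(-A)|lborel. k (N (2 * i)) s)) \<longlonglongrightarrow> 1 * exp 0"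
    by (intro tendsto_mult tendsto_exp even0)
  then have *: "(\<lambda>i. exp (LINT s|lborel. k (N (2 * i)) s)) \<longlonglongrightarrow> 1"
    by (simp add: split exp_add)
  have "convergent (\<lambda>n. exp (LINT s|lborel. k n s))"
    using conv[of UNIV] by (simp add: set_lebesgue_integral_def)
  then obtain l' where l': "(\<lambda>n. exp (LINT s|lborel. k n s)) \<longlonglongrightarrow> l'" by (auto simp: convergent_def)
  have "(\<lambda>i. exp (LINT s|lborel. k (N (2 * i)) s)) \<longlonglongrightarrow> l'"
    using LIMSEQ_subseq_LIMSEQ[OF l' strict_mono_o[OF Nmono sub(1)]] by (simp add: o_def)
  with * have "l' = 1" by (rule LIMSEQ_unique[symmetric])
  with l' show ?thesis by simp
qed

section \<open>Integrals with respect to a Levy random measure\<close>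

lemma empty_bounded_borel [simp]: "{} \<in> bounded_borel"
  by (simp add: bounded_borel_def)

lemma bounded_borel_cover:
  assumes "B \<in> bounded_borel"
  shows "\<exists>K>0. B \<subseteq> {-K<..K}"
proof -
  obtain K where K: "K > 0" "\<forall>x\<in>B. norm x < K"
    using assms unfolding bounded_borel_def bounded_pos_less by auto
  have "x \<in> {-K<..K}" if "x \<in> B" for x
  proof -
    have "\<bar>x\<bar> < K" using K that by auto
    then show ?thesis by auto
  qed
  with K show ?thesis by blast
qed

text \<open>
  The half-open intervals are closed under intersection and generate the Borel sets. Dynkin's
  theorem is applied to traces on one large half-open interval \<open>J\<close>, which keeps every set of the
  induction bounded.
\<close>

lemma bounded_borel_induct [consumes 1, case_names Ioc diff union]:
  assumes B: "B \<in> bounded_borel"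
    and Ioc: "\<And>s t. P {s<..t}"
    and diff: "\<And>A B. A \<in> bounded_borel \<Longrightarrow> B \<in> bounded_borel \<Longrightarrow> A \<subseteq> B \<Longrightarrow> P A \<Longrightarrow> P B \<Longrightarrow> P (B - A)"
    and union: "\<And>A. range A \<subseteq> bounded_borel \<Longrightarrow> disjoint_family A \<Longrightarrow> (\<Union>i. A i) \<in> bounded_borel \<Longrightarrow>
      (\<And>i::nat. P (A i)) \<Longrightarrow> P (\<Union>i. A i)"
  shows "P B"
proof -
  obtain K where K: "K > 0" "B \<subseteq> {-K<..K}" using bounded_borel_cover[OF B] by blast
  define J where "J = {-K<..K}"
  have Jb: "A \<inter> J \<in> bounded_borel" if "A \<in> sets borel" for A
    using that by (auto simp: bounded_borel_def J_def intro: bounded_subset[of "{-K<..K}"])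
  let ?G = "range (\<lambda>(a, b). {a <.. b::real})"
  have G: "sets borel = sigma_sets UNIV ?G"
    by (subst borel_sigma_sets_Ioc) (rule sets_measure_of, auto)
  have st: "Int_stable ?G"
  proof (rule Int_stableI)
    fix a b assume "a \<in> ?G" "b \<in> ?G"
    then obtain x y x' y' where "a = {x<..y}" "b = {x'<..y'}" by auto
    then have "a \<inter> b = {max x x'<..min y y'}" by auto
    then show "a \<inter> b \<in> ?G" by auto
  qed
  have "B \<in> sigma_sets UNIV ?G" using B G by (simp add: bounded_borel_def)
  with st _ have "P (B \<inter> J)"
  proof (rule sigma_sets_induct_disjoint)
    fix A assume "A \<in> ?G"
    then obtain a b where "A = {a<..b}" by auto
    then have "A \<inter> J = {max a (-K)<..min b K}" by (auto simp: J_def)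
    then show "P (A \<inter> J)" using Ioc by simp
  next
    show "P ({} \<inter> J)" using Ioc[of 0 0] by simp
  next
    fix A assume "A \<in> sigma_sets UNIV ?G" and A: "P (A \<inter> J)"
    then have "A \<inter> J \<in> bounded_borel" using G by (intro Jb) simp
    moreover have "J \<in> bounded_borel" using Jb[of UNIV] by simp
    moreover have "P J" unfolding J_def by (rule Ioc)
    ultimately have "P (J - A \<inter> J)" using A by (intro diff) simp_all
    moreover have "(UNIV - A) \<inter> J = J - A \<inter> J" by auto
    ultimately show "P ((UNIV - A) \<inter> J)" by simp
  next
    fix A :: "nat \<Rightarrow> real set"
    assume dis: "disjoint_family A" and A: "range A \<subseteq> sigma_sets UNIV ?G" and P: "\<And>i. P (A i \<inter> J)"
    have Ab: "A i \<in> sets borel" for i using A G by auto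
    have "P (\<Union>i. A i \<inter> J)"
    proof (rule union)
      show "range (\<lambda>i. A i \<inter> J) \<subseteq> bounded_borel" using Jb Ab by auto
      show "disjoint_family (\<lambda>i. A i \<inter> J)" using dis by (auto simp: disjoint_family_on_def)
      have "(\<Union>i. A i) \<inter> J \<in> bounded_borel" using Ab by (intro Jb) auto
      then show "(\<Union>i. A i \<inter> J) \<in> bounded_borel" by simp
    qed (rule P)
    then show "P ((\<Union>i. A i) \<inter> J)" by simp
  qed auto
  moreover have "B \<inter> J = B" using K by (auto simp: J_def)
  ultimately show ?thesis by simp
qed

locale levy_basis = prob_space M for M :: "'a measure" +
  fixes L :: "real \<Rightarrow> 'a \<Rightarrow> real" and \<Lambda> :: "real set \<Rightarrow> 'a \<Rightarrow> real" and \<psi> :: "real \<Rightarrow> complex"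
  assumes basis: "levy_random_measure M L \<Lambda>"
    and L_measurable [measurable]: "\<And>t. L t \<in> borel_measurable M"
    and \<psi>_cont: "continuous_on UNIV \<psi>" and \<psi>_0 [simp]: "\<psi> 0 = 0"
    and cf_increment: "\<And>s t u. s \<le> t \<Longrightarrow> cf M (\<lambda>\<omega>. L t \<omega> - L s \<omega>) u = exp (of_real (t - s) * \<psi> u)"
begin

lemma \<psi>_measurable [measurable]: "\<psi> \<in> borel_measurable borel"
  by (rule borel_measurable_continuous_onI[OF \<psi>_cont])

lemma basis_measurable [measurable (raw)]: "B \<in> bounded_borel \<Longrightarrow> \<Lambda> B \<in> borel_measurable M"
  using basis by (simp add: levy_random_measure_def)

lemma basis_indep:
  assumes "range A \<subseteq> bounded_borel" "disjoint_family A"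
  shows "indep_vars (\<lambda>_. borel) (\<lambda>i::nat. \<Lambda> (A i)) UNIV"
  using basis assms unfolding levy_random_measure_def by blast

lemma basis_sums:
  assumes "range A \<subseteq> bounded_borel" "disjoint_family A" "(\<Union>i::nat. A i) \<in> bounded_borel"
  shows "AE \<omega> in M. (\<lambda>i. \<Lambda> (A i) \<omega>) sums \<Lambda> (\<Union>i. A i) \<omega>"
  using basis assms unfolding levy_random_measure_def by blast

lemma basis_empty: "AE \<omega> in M. \<Lambda> {} \<omega> = 0"
proof -
  have "AE \<omega> in M. (\<lambda>i::nat. \<Lambda> {} \<omega>) sums \<Lambda> {} \<omega>"
    using basis_sums[of "\<lambda>_. {}"] by (simp add: disjoint_family_on_def image_subset_iff)
  then show ?thesis
  proof eventually_elim
    case (elim \<omega>)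
    then have "(\<lambda>i::nat. \<Lambda> {} \<omega>) \<longlonglongrightarrow> 0" by (intro summable_LIMSEQ_zero sums_summable)
    then show ?case by (simp add: LIMSEQ_const_iff)
  qed
qed

text \<open>
  The random measure is specified on sequences of sets, so a finite family is padded with empty
  sets.
\<close>

lemma basis_finite_union:
  assumes I: "finite I" and E: "\<And>i. i \<in> I \<Longrightarrow> E i \<in> bounded_borel" and dis: "disjoint_family_on E I"
  shows "AE \<omega> in M. \<Lambda> (\<Union>i\<in>I. E i) \<omega> = (\<Sum>i\<in>I. \<Lambda> (E i) \<omega>)"
    and "cf M (\<lambda>\<omega>. \<Sum>i\<in>I. c i * \<Lambda> (E i) \<omega>) u = (\<Prod>i\<in>I. cf M (\<Lambda> (E i)) (u * c i))"
proof -
  obtain h where h: "bij_betw h {0..<card I} I" using ex_bij_betw_nat_finite[OF I] by blast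
  then have hI: "h n \<in> I" if "n < card I" for n using that by (auto simp: bij_betw_def)
  define A where "A n = (if n < card I then E (h n) else {})" for n
  have A: "range A \<subseteq> bounded_borel" using E hI by (auto simp: A_def)
  have inj: "h m = h n \<longleftrightarrow> m = n" if "m < card I" "n < card I" for m n
    using h that by (auto simp: bij_betw_def inj_on_def)
  have disA: "disjoint_family A"
    unfolding disjoint_family_on_def
  proof (intro ballI impI)
    fix m n :: nat assume mn: "m \<noteq> n"
    show "A m \<inter> A n = {}"
    proof (cases "m < card I \<and> n < card I")
      case True
      then show ?thesis
        using disjoint_family_onD[OF dis hI hI, of m n] inj[of m n] mn by (simp add: A_def)
    qed (auto simp: A_def)
  qed
  have UA: "(\<Union>n. A n) = (\<Union>i\<in>I. E i)"
  proof -
    have "(\<Union>n. A n) = (\<Union>n\<in>{0..<card I}. E (h n))" by (auto simp: A_def split: if_splits)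
    also have "\<dots> = (\<Union>i\<in>h ` {0..<card I}. E i)" by blast
    also have "h ` {0..<card I} = I" using h by (simp add: bij_betw_def)
    finally show ?thesis .
  qed
  have UB: "(\<Union>i\<in>I. E i) \<in> bounded_borel" using I E by (auto simp: bounded_borel_def)
  show "AE \<omega> in M. \<Lambda> (\<Union>i\<in>I. E i) \<omega> = (\<Sum>i\<in>I. \<Lambda> (E i) \<omega>)"
    using basis_sums[OF A disA, unfolded UA, OF UB] basis_empty
  proof (eventually_elim)
    case (elim \<omega>)
    have "(\<lambda>i. \<Lambda> (A i) \<omega>) sums (\<Sum>n\<in>{0..<card I}. \<Lambda> (A n) \<omega>)"
      by (rule sums_finite) (auto simp: A_def elim)
    then have "\<Lambda> (\<Union>i\<in>I. E i) \<omega> = (\<Sum>n\<in>{0..<card I}. \<Lambda> (A n) \<omega>)"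
      using elim UB sums_unique2 by blast
    also have "\<dots> = (\<Sum>n\<in>{0..<card I}. \<Lambda> (E (h n)) \<omega>)" by (simp add: A_def)
    also have "\<dots> = (\<Sum>i\<in>I. \<Lambda> (E i) \<omega>)" by (rule sum.reindex_bij_betw[OF h])
    finally show ?case .
  qed
  have "indep_vars (\<lambda>_. borel) (\<lambda>n. \<Lambda> (A n)) {0..<card I}"
    by (rule indep_vars_subset[OF basis_indep[OF A disA]]) auto
  then have "indep_vars (\<lambda>_. borel) (\<lambda>n \<omega>. c (h n) * \<Lambda> (A n) \<omega>) {0..<card I}"
    by (rule indep_vars_compose2[where Y="\<lambda>n x. c (h n) * x"]) auto
  then have "cf M (\<lambda>\<omega>. \<Sum>n\<in>{0..<card I}. c (h n) * \<Lambda> (A n) \<omega>) u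
      = (\<Prod>n\<in>{0..<card I}. cf M (\<lambda>\<omega>. c (h n) * \<Lambda> (A n) \<omega>) u)"
    by (rule char_distr_sum)
  also have "(\<lambda>\<omega>. \<Sum>n\<in>{0..<card I}. c (h n) * \<Lambda> (A n) \<omega>) = (\<lambda>\<omega>. \<Sum>i\<in>I. c i * \<Lambda> (E i) \<omega>)"
  proof
    fix \<omega>
    have "(\<Sum>n\<in>{0..<card I}. c (h n) * \<Lambda> (A n) \<omega>) = (\<Sum>n\<in>{0..<card I}. c (h n) * \<Lambda> (E (h n)) \<omega>)"
      by (simp add: A_def)
    also have "\<dots> = (\<Sum>i\<in>I. c i * \<Lambda> (E i) \<omega>)" by (rule sum.reindex_bij_betw[OF h])
    finally show "(\<Sum>n\<in>{0..<card I}. c (h n) * \<Lambda> (A n) \<omega>) = (\<Sum>i\<in>I. c i * \<Lambda> (E i) \<omega>)" .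
  qed
  also have "(\<Prod>n\<in>{0..<card I}. cf M (\<lambda>\<omega>. c (h n) * \<Lambda> (A n) \<omega>) u)
      = (\<Prod>n\<in>{0..<card I}. cf M (\<Lambda> (E (h n))) (u * c (h n)))"
    by (rule prod.cong[OF refl]) (simp add: A_def cf_eq E hI mult.assoc)
  also have "\<dots> = (\<Prod>i\<in>I. cf M (\<Lambda> (E i)) (u * c i))" by (rule prod.reindex_bij_betw[OF h])
  finally show "cf M (\<lambda>\<omega>. \<Sum>i\<in>I. c i * \<Lambda> (E i) \<omega>) u = (\<Prod>i\<in>I. cf M (\<Lambda> (E i)) (u * c i))" .
qed

end

lemma (in prob_space) cf_cong_AE:
  assumes "Y \<in> borel_measurable M" "Y' \<in> borel_measurable M" "AE \<omega> in M. Y \<omega> = Y' \<omega>"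
  shows "cf M Y = cf M Y'"
  using assms by (auto intro!: ext integral_cong_AE simp: cf_eq)

context levy_basis begin

lemma basis_diff:
  assumes A: "A \<in> bounded_borel" and B: "B \<in> bounded_borel" and AB: "A \<subseteq> B"
  shows "AE \<omega> in M. \<Lambda> B \<omega> = \<Lambda> A \<omega> + \<Lambda> (B - A) \<omega>"
    and "cf M (\<Lambda> B) u = cf M (\<Lambda> A) u * cf M (\<Lambda> (B - A)) u"
proof -
  let ?E = "\<lambda>b. if b then A else B - A"
  have E: "?E b \<in> bounded_borel" for b
    using A B by (auto simp: bounded_borel_def intro: bounded_subset[of B])
  have dis: "disjoint_family_on ?E UNIV" by (auto simp: disjoint_family_on_def)
  have U: "(\<Union>b. ?E b) = B" using AB by (auto simp: UNIV_bool)
  have ae: "AE \<omega> in M. \<Lambda> B \<omega> = (\<Sum>b\<in>UNIV. 1 * \<Lambda> (?E b) \<omega>)"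
    using basis_finite_union(1)[of UNIV ?E, OF _ E dis] unfolding U by simp
  then show "AE \<omega> in M. \<Lambda> B \<omega> = \<Lambda> A \<omega> + \<Lambda> (B - A) \<omega>" by (simp add: UNIV_bool add.commute)
  have "cf M (\<Lambda> B) = cf M (\<lambda>\<omega>. \<Sum>b\<in>UNIV. 1 * \<Lambda> (?E b) \<omega>)"
    by (rule cf_cong_AE[OF _ _ ae])
      (intro borel_measurable_sum borel_measurable_times borel_measurable_const basis_measurable E B)+
  then have "cf M (\<Lambda> B) u = (\<Prod>b\<in>UNIV. cf M (\<Lambda> (?E b)) (u * 1))"
    using basis_finite_union(2)[of UNIV ?E "\<lambda>_. 1" u, OF _ E dis] by simp
  then show "cf M (\<Lambda> B) u = cf M (\<Lambda> A) u * cf M (\<Lambda> (B - A)) u" by (simp add: UNIV_bool)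
qed

lemma bounded_borel_sets: "B \<in> bounded_borel \<Longrightarrow> B \<in> sets borel"
  by (simp add: bounded_borel_def)

lemma bounded_borel_emeasure: "B \<in> bounded_borel \<Longrightarrow> emeasure lborel B \<noteq> \<infinity>"
  using emeasure_bounded_finite[of B] by (auto simp: bounded_borel_def)

text \<open>
  The claim is known for intervals and both sides are compatible with disjoint unions. For
  differences one has to cancel a characteristic function, which is possible because exponentials do
  not vanish.
\<close>

lemma cf_basis:
  assumes B: "B \<in> bounded_borel"
  shows "cf M (\<Lambda> B) u = exp (of_real (measure lborel B) * \<psi> u)"
  using B
proof (induction rule: bounded_borel_induct)
  case (Ioc s t)
  show ?case
  proof (cases "s < t")
    case True
    have "AE \<omega> in M. \<Lambda> {s<..t} \<omega> = L t \<omega> - L s \<omega>"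
      using basis True unfolding levy_random_measure_def by blast
    moreover have "{s<..t} \<in> bounded_borel" by (auto simp: bounded_borel_def)
    ultimately have "cf M (\<Lambda> {s<..t}) = cf M (\<lambda>\<omega>. L t \<omega> - L s \<omega>)"
      by (intro cf_cong_AE) auto
    then show ?thesis using cf_increment[of s t u] True by simp
  next
    case False
    then have "{s<..t} = {}" by auto
    moreover have "cf M (\<Lambda> {}) = cf M (\<lambda>_. 0)" by (intro cf_cong_AE basis_empty) auto
    ultimately show ?thesis using cf_zero_rv[of u] by simp
  qed
next
  case (diff A B)
  have "measure lborel B = measure lborel A + measure lborel (B - A)"
    using measure_Diff[of lborel B A] bounded_borel_emeasure[OF diff(2)] bounded_borel_sets diff(1,2,3) by auto
  then have "exp (of_real (measure lborel A) * \<psi> u) * exp (of_real (measure lborel (B - A)) * \<psi> u)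
      = exp (of_real (measure lborel A) * \<psi> u) * cf M (\<Lambda> (B - A)) u"
    using basis_diff(2)[OF diff(1,2,3), of u] diff(4,5) by (simp add: ring_distribs exp_add)
  then show ?case by simp
next
  case (union A)
  have [measurable]: "\<Lambda> (A i) \<in> borel_measurable M" for i
    by (rule basis_measurable) (use union(1) in auto)
  note [measurable] = basis_measurable[OF union(3)]
  have "(\<lambda>n. cf M (\<lambda>\<omega>. \<Sum>i<n. \<Lambda> (A i) \<omega>) u) \<longlonglongrightarrow> cf M (\<Lambda> (\<Union>i. A i)) u"
  proof (subst (1 2) cf_eq)
    show "(\<lambda>n. \<integral>\<omega>. iexp (u * (\<Sum>i<n. \<Lambda> (A i) \<omega>)) \<partial>M) \<longlonglongrightarrow> (\<integral>\<omega>. iexp (u * \<Lambda> (\<Union>i. A i) \<omega>) \<partial>M)"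
    proof (rule integral_dominated_convergence[where w="\<lambda>_. 1"])
      show "AE \<omega> in M. (\<lambda>n. iexp (u * (\<Sum>i<n. \<Lambda> (A i) \<omega>))) \<longlonglongrightarrow> iexp (u * \<Lambda> (\<Union>i. A i) \<omega>)"
        using basis_sums[OF union(1-3)]
      proof eventually_elim
        case (elim \<omega>)
        then show ?case unfolding sums_def by (intro tendsto_intros)
      qed
    qed auto
  qed auto
  moreover have "cf M (\<lambda>\<omega>. \<Sum>i<n. \<Lambda> (A i) \<omega>) u = exp (of_real (\<Sum>i<n. measure lborel (A i)) * \<psi> u)" for n
  proof -
    have "cf M (\<lambda>\<omega>. \<Sum>i<n. 1 * \<Lambda> (A i) \<omega>) u = (\<Prod>i<n. cf M (\<Lambda> (A i)) (u * 1))"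
      using union(1,2) by (intro basis_finite_union(2)) (auto simp: disjoint_family_on_def)
    then show ?thesis using union(4) by (simp add: exp_sum sum_distrib_right)
  qed
  moreover have "(\<lambda>n. exp (of_real (\<Sum>i<n. measure lborel (A i)) * \<psi> u))
      \<longlonglongrightarrow> exp (of_real (measure lborel (\<Union>i. A i)) * \<psi> u)"
  proof -
    have "(\<lambda>i. measure lborel (A i)) sums measure lborel (\<Union>i. A i)"
      using union(1,2) bounded_borel_sets bounded_borel_emeasure[OF union(3)] by (intro measure_UNION) auto
    then show ?thesis unfolding sums_def by (intro tendsto_intros)
  qed
  ultimately show ?case using LIMSEQ_unique by auto
qed

lemma basis_unique:
  assumes \<Lambda>': "levy_random_measure M L \<Lambda>'" and B: "B \<in> bounded_borel"
  shows "AE \<omega> in M. \<Lambda>' B \<omega> = \<Lambda> B \<omega>"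
proof -
  interpret B': levy_basis M L \<Lambda>' \<psi>
    by unfold_locales (rule \<Lambda>' L_measurable \<psi>_cont \<psi>_0 cf_increment | assumption)+
  show ?thesis
    using B
  proof (induction rule: bounded_borel_induct)
    case (Ioc s t)
    show ?case
    proof (cases "s < t")
      case True
      have "AE \<omega> in M. \<Lambda> {s<..t} \<omega> = L t \<omega> - L s \<omega>" "AE \<omega> in M. \<Lambda>' {s<..t} \<omega> = L t \<omega> - L s \<omega>"
        using basis \<Lambda>' True unfolding levy_random_measure_def by blast+
      then show ?thesis by eventually_elim simp
    next
      case False
      then have "{s<..t} = {}" by auto
      then show ?thesis using basis_empty B'.basis_empty by auto
    qed
  next
    case (diff A B)
    show ?case
      using diff(4,5) basis_diff(1)[OF diff(1,2,3)] B'.basis_diff(1)[OF diff(1,2,3)]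
      by eventually_elim linarith
  next
    case (union A)
    have "AE \<omega> in M. \<forall>i. \<Lambda>' (A i) \<omega> = \<Lambda> (A i) \<omega>"
      using union(4) by (simp add: AE_all_countable)
    then show ?case
      using basis_sums[OF union(1-3)] B'.basis_sums[OF union(1-3)]
    proof eventually_elim
      case (elim \<omega>)
      then show ?case by (auto intro: sums_unique2)
    qed
  qed
qed

end

lemma (in prob_space) tendsto_in_prob_cong_AE:
  assumes [measurable]: "\<And>n. Y n \<in> borel_measurable M" "\<And>n. Z n \<in> borel_measurable M" "W \<in> borel_measurable M"
    and ae: "\<And>n. AE \<omega> in M. Y n \<omega> = Z n \<omega>"
    and lim: "tendsto_in_prob M Y W"
  shows "tendsto_in_prob M Z W"
proof -
  have "prob {\<omega> \<in> space M. \<bar>Y n \<omega> - W \<omega>\<bar> > e} = prob {\<omega> \<in> space M. \<bar>Z n \<omega> - W \<omega>\<bar> > e}" for n e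
    using ae[of n] by (intro finite_measure_eq_AE) (auto elim!: eventually_mono)
  then show ?thesis using lim by (simp add: tendsto_in_prob_def)
qed

lemma (in prob_space) tendsto_in_prob_linear:
  assumes [measurable]: "\<And>n. Y n \<in> borel_measurable M" "\<And>n. Z n \<in> borel_measurable M"
      "W \<in> borel_measurable M" "V \<in> borel_measurable M"
    and Y: "tendsto_in_prob M Y W" and Z: "tendsto_in_prob M Z V"
  shows "tendsto_in_prob M (\<lambda>n \<omega>. a * Y n \<omega> + b * Z n \<omega>) (\<lambda>\<omega>. a * W \<omega> + b * V \<omega>)"
  unfolding tendsto_in_prob_def
proof (intro allI impI)
  fix e :: real assume e: "e > 0"
  define c where "c = \<bar>a\<bar> + \<bar>b\<bar> + 1"
  have c: "c > 0" unfolding c_def by (intro add_nonneg_pos add_nonneg_nonneg) auto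
  define d where "d = e / c"
  have d: "d > 0" using e c by (simp add: d_def)
  have "(\<bar>a\<bar> + \<bar>b\<bar>) * d \<le> c * d" using d by (intro mult_right_mono) (auto simp: c_def)
  also have "c * d = e" using c by (simp add: d_def)
  finally have de: "(\<bar>a\<bar> + \<bar>b\<bar>) * d \<le> e" .
  let ?P = "\<lambda>n. prob {\<omega> \<in> space M. \<bar>Y n \<omega> - W \<omega>\<bar> > d} + prob {\<omega> \<in> space M. \<bar>Z n \<omega> - V \<omega>\<bar> > d}"
  have "?P \<longlonglongrightarrow> 0 + 0" using Y Z d unfolding tendsto_in_prob_def by (intro tendsto_add) auto
  then have lim: "?P \<longlonglongrightarrow> 0" by simp
  show "(\<lambda>n. prob {\<omega> \<in> space M. \<bar>a * Y n \<omega> + b * Z n \<omega> - (a * W \<omega> + b * V \<omega>)\<bar> > e}) \<longlonglongrightarrow> 0"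
  proof (rule tendsto_sandwich[OF _ _ tendsto_const lim])
    show "\<forall>\<^sub>F n in sequentially. prob {\<omega> \<in> space M. \<bar>a * Y n \<omega> + b * Z n \<omega> - (a * W \<omega> + b * V \<omega>)\<bar> > e} \<le> ?P n"
    proof (intro always_eventually allI)
      fix n
      have "prob {\<omega> \<in> space M. \<bar>a * Y n \<omega> + b * Z n \<omega> - (a * W \<omega> + b * V \<omega>)\<bar> > e}
         \<le> prob ({\<omega> \<in> space M. \<bar>Y n \<omega> - W \<omega>\<bar> > d} \<union> {\<omega> \<in> space M. \<bar>Z n \<omega> - V \<omega>\<bar> > d})"
      proof (rule finite_measure_mono, rule subsetI)
        fix \<omega> assume w: "\<omega> \<in> {\<omega> \<in> space M. \<bar>a * Y n \<omega> + b * Z n \<omega> - (a * W \<omega> + b * V \<omega>)\<bar> > e}"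
        show "\<omega> \<in> {\<omega> \<in> space M. \<bar>Y n \<omega> - W \<omega>\<bar> > d} \<union> {\<omega> \<in> space M. \<bar>Z n \<omega> - V \<omega>\<bar> > d}"
        proof (rule ccontr)
          assume "\<omega> \<notin> {\<omega> \<in> space M. \<bar>Y n \<omega> - W \<omega>\<bar> > d} \<union> {\<omega> \<in> space M. \<bar>Z n \<omega> - V \<omega>\<bar> > d}"
          then have 1: "\<bar>Y n \<omega> - W \<omega>\<bar> \<le> d" "\<bar>Z n \<omega> - V \<omega>\<bar> \<le> d" using w by auto
          have "\<bar>a * Y n \<omega> + b * Z n \<omega> - (a * W \<omega> + b * V \<omega>)\<bar> = \<bar>a * (Y n \<omega> - W \<omega>) + b * (Z n \<omega> - V \<omega>)\<bar>"
            by (simp add: algebra_simps)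
          also have "\<dots> \<le> \<bar>a\<bar> * \<bar>Y n \<omega> - W \<omega>\<bar> + \<bar>b\<bar> * \<bar>Z n \<omega> - V \<omega>\<bar>"
            by (metis abs_mult abs_triangle_ineq)
          also have "\<dots> \<le> \<bar>a\<bar> * d + \<bar>b\<bar> * d" using 1 by (intro add_mono mult_left_mono) auto
          also have "\<dots> \<le> e" using de by (simp add: algebra_simps)
          finally show False using w by auto
        qed
      qed measurable
      also have "\<dots> \<le> ?P n" by (intro measure_Un_le) measurable
      finally show "prob {\<omega> \<in> space M. \<bar>a * Y n \<omega> + b * Z n \<omega> - (a * W \<omega> + b * V \<omega>)\<bar> > e} \<le> ?P n" .
    qed
  qed (auto intro!: always_eventually)
qed

lemma simple_integrand_finite: "simple_integrand g \<Longrightarrow> finite (range g)"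
  by (auto simp: simple_integrand_def simple_function_def)

lemma level_set_bounded_borel:
  assumes "simple_function borel e" "bounded {s. e s \<noteq> z}" "A \<in> sets borel" "v \<noteq> z"
  shows "A \<inter> e -` {v} \<in> bounded_borel"
proof -
  have "e -` {v} \<inter> space borel \<in> sets borel" using assms(1) by (rule simple_functionD)
  moreover have "A \<inter> e -` {v} \<subseteq> {s. e s \<noteq> z}" using assms(4) by auto
  ultimately show ?thesis using assms(2,3) by (auto simp: bounded_borel_def intro: bounded_subset)
qed

lemma simple_integrand_linear:
  assumes "simple_integrand g" "simple_integrand h"
  shows "simple_integrand (\<lambda>s. a * g s + b * h s)"
proof -
  have "simple_function borel (\<lambda>s. a * g s + b * h s)"
    using assms by (intro simple_function_add simple_function_mult simple_function_const) (auto simp: simple_integrand_def)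
  moreover have "bounded {s. a * g s + b * h s \<noteq> 0}"
    by (rule bounded_subset[of "{s. g s \<noteq> 0} \<union> {s. h s \<noteq> 0}"]) (use assms in \<open>auto simp: simple_integrand_def\<close>)
  ultimately show ?thesis by (simp add: simple_integrand_def)
qed

context levy_basis begin

lemma simple_integral_measurable:
  assumes g: "simple_integrand g" and A: "A \<in> sets borel"
  shows "simple_integral \<Lambda> A g \<in> borel_measurable M"
  unfolding simple_integral_def
  by (intro borel_measurable_sum borel_measurable_times borel_measurable_const basis_measurable
        level_set_bounded_borel[where z=0] A)
     (use g in \<open>auto simp: simple_integrand_def\<close>)

text \<open>
  A simple integral is defined by the level sets of its integrand. Here it is computed from a finer
  partition, by the level sets of \<open>e\<close>; with \<open>e\<close> pair-valued this puts two integrands on a common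
  partition. The value \<open>z\<close> is excluded because its level set is unbounded and has no random measure.
\<close>

lemma simple_integral_partition:
  assumes e: "simple_function borel e" "bounded {s. e s \<noteq> z}" and A: "A \<in> sets borel" and z: "r z = 0"
  shows "AE \<omega> in M. simple_integral \<Lambda> A (\<lambda>s. r (e s)) \<omega> = (\<Sum>v\<in>range e - {z}. r v * \<Lambda> (A \<inter> e -` {v}) \<omega>)"
proof -
  have fin: "finite (range e)" using e by (auto simp: simple_function_def)
  define V where "V y = {v \<in> range e - {z}. r v = y}" for y
  have Vfin: "finite (V y)" for y using fin by (simp add: V_def)
  have Un: "A \<inter> (\<lambda>s. r (e s)) -` {y} = (\<Union>v\<in>V y. A \<inter> e -` {v})" if "y \<noteq> 0" for y
    using that z by (auto simp: V_def)
  have "AE \<omega> in M. \<forall>y\<in>range (\<lambda>s. r (e s)) - {0}. \<Lambda> (A \<inter> (\<lambda>s. r (e s)) -` {y}) \<omega> = (\<Sum>v\<in>V y. \<Lambda> (A \<inter> e -` {v}) \<omega>)"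
  proof (rule AE_finite_allI)
    have "range (\<lambda>s. r (e s)) = r ` range e" by auto
    then show "finite (range (\<lambda>s. r (e s)) - {0})" using fin by simp
    fix y assume "y \<in> range (\<lambda>s. r (e s)) - {0}"
    then have y: "y \<noteq> 0" by auto
    show "AE \<omega> in M. \<Lambda> (A \<inter> (\<lambda>s. r (e s)) -` {y}) \<omega> = (\<Sum>v\<in>V y. \<Lambda> (A \<inter> e -` {v}) \<omega>)"
      unfolding Un[OF y]
    proof (rule basis_finite_union(1)[OF Vfin])
      show "A \<inter> e -` {v} \<in> bounded_borel" if "v \<in> V y" for v
        using that by (intro level_set_bounded_borel[OF e A]) (auto simp: V_def)
    qed (auto simp: disjoint_family_on_def)
  qed
  then show ?thesis
  proof eventually_elim
    case (elim \<omega>)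
    let ?S = "range e - {z}"
    have "simple_integral \<Lambda> A (\<lambda>s. r (e s)) \<omega> = (\<Sum>y\<in>range (\<lambda>s. r (e s)) - {0}. y * (\<Sum>v\<in>V y. \<Lambda> (A \<inter> e -` {v}) \<omega>))"
      unfolding simple_integral_def by (intro sum.cong refl) (use elim in auto)
    also have "\<dots> = (\<Sum>y\<in>range (\<lambda>s. r (e s)). y * (\<Sum>v\<in>V y. \<Lambda> (A \<inter> e -` {v}) \<omega>))"
    proof (rule sum.mono_neutral_left)
      have "range (\<lambda>s. r (e s)) = r ` range e" by auto
      then show "finite (range (\<lambda>s. r (e s)))" using fin by simp
    qed auto
    also have "\<dots> = (\<Sum>y\<in>range (\<lambda>s. r (e s)). \<Sum>v\<in>{v \<in> ?S. r v = y}. r v * \<Lambda> (A \<inter> e -` {v}) \<omega>)"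
      by (intro sum.cong refl) (simp add: V_def sum_distrib_left)
    also have "\<dots> = (\<Sum>v\<in>?S. r v * \<Lambda> (A \<inter> e -` {v}) \<omega>)"
    proof (rule sum.group)
      have "range (\<lambda>s. r (e s)) = r ` range e" by auto
      then show "finite (range (\<lambda>s. r (e s)))" using fin by simp
    qed (use fin in auto)
    finally show ?case .
  qed
qed

lemma simple_integral_linear:
  assumes g: "simple_integrand g" and h: "simple_integrand h" and A: "A \<in> sets borel"
  shows "AE \<omega> in M. simple_integral \<Lambda> A (\<lambda>s. a * g s + b * h s) \<omega>
           = a * simple_integral \<Lambda> A g \<omega> + b * simple_integral \<Lambda> A h \<omega>"
proof -
  define e where "e s = (g s, h s)" for s
  have "simple_function borel e"
    unfolding e_def using g h by (intro simple_function_Pair) (auto simp: simple_integrand_def)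
  moreover have "bounded {s. e s \<noteq> (0, 0)}"
    by (rule bounded_subset[of "{s. g s \<noteq> 0} \<union> {s. h s \<noteq> 0}"])
       (use g h in \<open>auto simp: simple_integrand_def e_def\<close>)
  ultimately have *: "AE \<omega> in M. simple_integral \<Lambda> A (\<lambda>s. r (e s)) \<omega> = (\<Sum>v\<in>range e - {(0,0)}. r v * \<Lambda> (A \<inter> e -` {v}) \<omega>)"
    if "r (0, 0) = 0" for r
    using that A by (intro simple_integral_partition) auto
  have "AE \<omega> in M. simple_integral \<Lambda> A g \<omega> = (\<Sum>v\<in>range e - {(0,0)}. fst v * \<Lambda> (A \<inter> e -` {v}) \<omega>)"
    using *[of fst] by (simp add: e_def)
  moreover have "AE \<omega> in M. simple_integral \<Lambda> A h \<omega> = (\<Sum>v\<in>range e - {(0,0)}. snd v * \<Lambda> (A \<inter> e -` {v}) \<omega>)"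
    using *[of snd] by (simp add: e_def)
  moreover have "AE \<omega> in M. simple_integral \<Lambda> A (\<lambda>s. a * g s + b * h s) \<omega> = (\<Sum>v\<in>range e - {(0,0)}. (a * fst v + b * snd v) * \<Lambda> (A \<inter> e -` {v}) \<omega>)"
    using *[of "\<lambda>v. a * fst v + b * snd v"] by (simp add: e_def)
  ultimately show ?thesis
    by eventually_elim (simp add: sum_distrib_left sum.distrib[symmetric] algebra_simps)
qed

lemma simple_integral_basis_unique:
  assumes \<Lambda>': "levy_random_measure M L \<Lambda>'" and g: "simple_integrand g" and A: "A \<in> sets borel"
  shows "AE \<omega> in M. simple_integral \<Lambda>' A g \<omega> = simple_integral \<Lambda> A g \<omega>"
proof -
  have "AE \<omega> in M. \<forall>y\<in>range g - {0}. \<Lambda>' (A \<inter> g -` {y}) \<omega> = \<Lambda> (A \<inter> g -` {y}) \<omega>"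
    using g simple_integrand_finite[OF g]
    by (intro AE_finite_allI basis_unique \<Lambda>' level_set_bounded_borel[where z=0] A)
       (auto simp: simple_integrand_def)
  then show ?thesis
    by eventually_elim (auto simp: simple_integral_def)
qed

text \<open>
  As \<open>\<psi>\<close> vanishes at 0, the integrals on the right are finite sums over the bounded level sets of
  \<open>g\<close>.
\<close>

lemma cf_simple_integral:
  assumes g: "simple_integrand g" and A: "A \<in> sets borel"
  shows "integrable lborel (\<lambda>s. \<psi> (u * g s))"
    and "cf M (simple_integral \<Lambda> A g) u = exp (LINT s:A|lborel. \<psi> (u * g s))"
proof -
  define R where "R = range g - {0}"
  have fin: "finite R" using simple_integrand_finite[OF g] by (simp add: R_def)
  have bb: "S \<inter> g -` {y} \<in> bounded_borel" if "y \<in> R" "S \<in> sets borel" for y S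
    using g that by (intro level_set_bounded_borel[where z=0]) (auto simp: simple_integrand_def R_def)
  have ms: "S \<inter> g -` {y} \<in> sets borel" if "y \<in> R" "S \<in> sets borel" for y S
    using bb[OF that] by (simp add: bounded_borel_def)
  have lt: "emeasure lborel (S \<inter> g -` {y}) < \<infinity>" if "y \<in> R" "S \<in> sets borel" for y S
    using bb[OF that] emeasure_bounded_finite by (auto simp: bounded_borel_def)
  have rep: "indicator S s *\<^sub>R \<psi> (u * g s) = (\<Sum>y\<in>R. indicator (S \<inter> g -` {y}) s *\<^sub>R \<psi> (u * y))" for S s
  proof (cases "g s = 0")
    case True
    then show ?thesis by (auto simp: R_def intro!: sum.neutral[symmetric])
  next
    case False
    then have "g s \<in> R" by (simp add: R_def)
    then show ?thesis using fin
      by (subst sum.remove[of _ "g s"]) (auto simp: indicator_def intro!: sum.neutral)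
  qed
  have int: "integrable lborel (\<lambda>s. indicator S s *\<^sub>R \<psi> (u * g s))" if "S \<in> sets borel" for S
    unfolding rep using lt ms that
    by (intro Bochner_Integration.integrable_sum integrable_scaleR_left integrable_real_indicator) auto
  show "integrable lborel (\<lambda>s. \<psi> (u * g s))" using int[of UNIV] by simp
  have "cf M (simple_integral \<Lambda> A g) u = cf M (\<lambda>\<omega>. \<Sum>y\<in>R. y * \<Lambda> (A \<inter> g -` {y}) \<omega>) u"
    by (simp add: simple_integral_def[abs_def] R_def)
  also have "\<dots> = (\<Prod>y\<in>R. cf M (\<Lambda> (A \<inter> g -` {y})) (u * y))"
    using fin bb A by (intro basis_finite_union(2)) (auto simp: disjoint_family_on_def)
  also have "\<dots> = (\<Prod>y\<in>R. exp (of_real (measure lborel (A \<inter> g -` {y})) * \<psi> (u * y)))"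
    using bb A by (intro prod.cong refl cf_basis) auto
  also have "\<dots> = exp (\<Sum>y\<in>R. of_real (measure lborel (A \<inter> g -` {y})) * \<psi> (u * y))"
    using fin by (simp add: exp_sum)
  also have "(\<Sum>y\<in>R. of_real (measure lborel (A \<inter> g -` {y})) * \<psi> (u * y)) = (LINT s:A|lborel. \<psi> (u * g s))"
  proof -
    have "(LINT s:A|lborel. \<psi> (u * g s)) = (\<Sum>y\<in>R. LINT s|lborel. indicator (A \<inter> g -` {y}) s *\<^sub>R \<psi> (u * y))"
      unfolding set_lebesgue_integral_def rep using lt ms A
      by (intro Bochner_Integration.integral_sum integrable_scaleR_left integrable_real_indicator) auto
    also have "\<dots> = (\<Sum>y\<in>R. of_real (measure lborel (A \<inter> g -` {y})) * \<psi> (u * y))"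
      using lt ms A by (intro sum.cong refl, subst integral_scaleR_left) (auto simp: scaleR_conv_of_real)
    finally show ?thesis by simp
  qed
  finally show "cf M (simple_integral \<Lambda> A g) u = exp (LINT s:A|lborel. \<psi> (u * g s))" .
qed

text \<open>
  The definition allows each integral its own random measure. All of them agree almost surely on
  each bounded set, so one fixed random measure serves every integral, and integrals can be added.
\<close>

lemma has_levy_integral_basis:
  "has_levy_integral M L g Y \<longleftrightarrow>
     g \<in> borel_measurable borel \<and> Y \<in> borel_measurable M \<and>
     (\<exists>G. (\<forall>n. simple_integrand (G n)) \<and> (AE s in lborel. (\<lambda>n. G n s) \<longlonglongrightarrow> g s) \<and>
        (\<forall>A\<in>sets borel. \<exists>W\<in>borel_measurable M. tendsto_in_prob M (\<lambda>n. simple_integral \<Lambda> A (G n)) W) \<and>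
        tendsto_in_prob M (\<lambda>n. simple_integral \<Lambda> UNIV (G n)) Y)" (is "?L \<longleftrightarrow> ?R")
proof
  assume ?L
  then obtain \<Lambda>' G where g: "g \<in> borel_measurable borel" and Y: "Y \<in> borel_measurable M"
    and \<Lambda>': "levy_random_measure M L \<Lambda>'" and G: "\<And>n. simple_integrand (G n)"
    and ae: "AE s in lborel. (\<lambda>n. G n s) \<longlonglongrightarrow> g s"
    and W: "\<And>A. A \<in> sets borel \<Longrightarrow> \<exists>W\<in>borel_measurable M. tendsto_in_prob M (\<lambda>n. simple_integral \<Lambda>' A (G n)) W"
    and lim: "tendsto_in_prob M (\<lambda>n. simple_integral \<Lambda>' UNIV (G n)) Y"
    unfolding has_levy_integral_def by blast
  interpret B': levy_basis M L \<Lambda>' \<psi>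
    by unfold_locales (rule \<Lambda>' L_measurable \<psi>_cont \<psi>_0 cf_increment | assumption)+
  have conv: "tendsto_in_prob M (\<lambda>n. simple_integral \<Lambda> A (G n)) W"
    if "A \<in> sets borel" "W \<in> borel_measurable M" "tendsto_in_prob M (\<lambda>n. simple_integral \<Lambda>' A (G n)) W" for A W
    by (rule tendsto_in_prob_cong_AE[OF _ _ _ _ that(3)])
      (intro B'.simple_integral_measurable simple_integral_measurable simple_integral_basis_unique \<Lambda>' G that)+
  have "\<exists>W\<in>borel_measurable M. tendsto_in_prob M (\<lambda>n. simple_integral \<Lambda> A (G n)) W" if "A \<in> sets borel" for A
    using W[OF that] conv[OF that] by blast
  moreover have "tendsto_in_prob M (\<lambda>n. simple_integral \<Lambda> UNIV (G n)) Y"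
    by (rule conv[OF _ Y lim]) simp
  ultimately show ?R using g Y G ae by (intro conjI exI[of _ G]) auto
next
  assume ?R
  then show ?L unfolding has_levy_integral_def using basis by blast
qed

lemma has_levy_integral_linear:
  assumes g: "has_levy_integral M L g Y" and h: "has_levy_integral M L h Z"
  shows "has_levy_integral M L (\<lambda>s. a * g s + b * h s) (\<lambda>\<omega>. a * Y \<omega> + b * Z \<omega>)"
proof -
  obtain G where [measurable]: "g \<in> borel_measurable borel" "Y \<in> borel_measurable M"
    and G: "\<And>n. simple_integrand (G n)" "AE s in lborel. (\<lambda>n. G n s) \<longlonglongrightarrow> g s"
    and GW: "\<And>A. A \<in> sets borel \<Longrightarrow> \<exists>W\<in>borel_measurable M. tendsto_in_prob M (\<lambda>n. simple_integral \<Lambda> A (G n)) W"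
    and GY: "tendsto_in_prob M (\<lambda>n. simple_integral \<Lambda> UNIV (G n)) Y"
    using g unfolding has_levy_integral_basis by blast
  obtain H where [measurable]: "h \<in> borel_measurable borel" "Z \<in> borel_measurable M"
    and H: "\<And>n. simple_integrand (H n)" "AE s in lborel. (\<lambda>n. H n s) \<longlonglongrightarrow> h s"
    and HW: "\<And>A. A \<in> sets borel \<Longrightarrow> \<exists>W\<in>borel_measurable M. tendsto_in_prob M (\<lambda>n. simple_integral \<Lambda> A (H n)) W"
    and HZ: "tendsto_in_prob M (\<lambda>n. simple_integral \<Lambda> UNIV (H n)) Z"
    using h unfolding has_levy_integral_basis by blast
  let ?K = "\<lambda>n s. a * G n s + b * H n s"
  have K: "simple_integrand (?K n)" for n by (intro simple_integrand_linear G H)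
  have lin: "tendsto_in_prob M (\<lambda>n. simple_integral \<Lambda> A (?K n)) (\<lambda>\<omega>. a * W \<omega> + b * V \<omega>)"
    if A: "A \<in> sets borel" and [measurable]: "W \<in> borel_measurable M" "V \<in> borel_measurable M"
      and W: "tendsto_in_prob M (\<lambda>n. simple_integral \<Lambda> A (G n)) W"
      and V: "tendsto_in_prob M (\<lambda>n. simple_integral \<Lambda> A (H n)) V" for A W V
  proof -
    have [measurable]: "simple_integral \<Lambda> A (G n) \<in> borel_measurable M" "simple_integral \<Lambda> A (H n) \<in> borel_measurable M"
      "simple_integral \<Lambda> A (?K n) \<in> borel_measurable M" for n
      by (intro simple_integral_measurable G H K A)+
    have "tendsto_in_prob M (\<lambda>n \<omega>. a * simple_integral \<Lambda> A (G n) \<omega> + b * simple_integral \<Lambda> A (H n) \<omega>) (\<lambda>\<omega>. a * W \<omega> + b * V \<omega>)"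
      by (rule tendsto_in_prob_linear[OF _ _ _ _ W V]) measurable
    then show ?thesis
    proof (rule tendsto_in_prob_cong_AE[rotated -1])
      show "AE \<omega> in M. a * simple_integral \<Lambda> A (G n) \<omega> + b * simple_integral \<Lambda> A (H n) \<omega> = simple_integral \<Lambda> A (?K n) \<omega>" for n
        using simple_integral_linear[OF G(1)[of n] H(1)[of n] A, of a b] by eventually_elim simp
    qed measurable
  qed
  have "AE s in lborel. (\<lambda>n. ?K n s) \<longlonglongrightarrow> a * g s + b * h s"
    using G(2) H(2) by eventually_elim (intro tendsto_intros)
  moreover have "\<exists>U\<in>borel_measurable M. tendsto_in_prob M (\<lambda>n. simple_integral \<Lambda> A (?K n)) U" if A: "A \<in> sets borel" for A
  proof -
    obtain W where W: "W \<in> borel_measurable M" "tendsto_in_prob M (\<lambda>n. simple_integral \<Lambda> A (G n)) W" using GW[OF A] by blast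
    obtain V where V: "V \<in> borel_measurable M" "tendsto_in_prob M (\<lambda>n. simple_integral \<Lambda> A (H n)) V" using HW[OF A] by blast
    have "(\<lambda>\<omega>. a * W \<omega> + b * V \<omega>) \<in> borel_measurable M" using W V by measurable
    then show ?thesis using lin[OF A W(1) V(1) W(2) V(2)] by blast
  qed
  moreover have "tendsto_in_prob M (\<lambda>n. simple_integral \<Lambda> UNIV (?K n)) (\<lambda>\<omega>. a * Y \<omega> + b * Z \<omega>)"
    by (rule lin[OF _ _ _ GY HZ]) auto
  ultimately show ?thesis
    unfolding has_levy_integral_basis using K by (intro conjI exI[of _ ?K]) auto
qed

text \<open>
  Continuity of characteristic functions only gives convergence of the exponentials of \<open>LINT
  s|lborel. \<psi> (u * H n s)\<close> for the approximating simple functions \<open>H n\<close>, which converge merely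
  almost everywhere. The limit could a priori depend on the sequence \<open>H n\<close>. Convergence of the
  simple integrals over every Borel set is exactly what \<open>gliding_hump\<close> needs to exclude this.
\<close>

theorem cf_levy_integral:
  assumes h: "has_levy_integral M L h Y" and int: "integrable lborel (\<lambda>s. \<psi> (u * h s))"
  shows "cf M Y u = exp (LINT s|lborel. \<psi> (u * h s))"
proof -
  obtain H where [measurable]: "h \<in> borel_measurable borel" "Y \<in> borel_measurable M"
    and H: "\<And>n. simple_integrand (H n)" "AE s in lborel. (\<lambda>n. H n s) \<longlonglongrightarrow> h s"
    and HW: "\<And>A. A \<in> sets borel \<Longrightarrow> \<exists>W\<in>borel_measurable M. tendsto_in_prob M (\<lambda>n. simple_integral \<Lambda> A (H n)) W"
    and HY: "tendsto_in_prob M (\<lambda>n. simple_integral \<Lambda> UNIV (H n)) Y"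
    using h unfolding has_levy_integral_basis by blast
  define k where "k n s = \<psi> (u * H n s) - \<psi> (u * h s)" for n s
  have cf_conv: "(\<lambda>n. exp (LINT s:A|lborel. \<psi> (u * H n s))) \<longlonglongrightarrow> cf M W u"
    if A: "A \<in> sets borel" and W: "W \<in> borel_measurable M" "tendsto_in_prob M (\<lambda>n. simple_integral \<Lambda> A (H n)) W" for A W
  proof -
    have "(\<lambda>n. cf M (simple_integral \<Lambda> A (H n)) u) \<longlonglongrightarrow> cf M W u"
      using W(2) unfolding tendsto_in_prob_def by (intro tendsto_cf simple_integral_measurable H A W(1)) auto
    then show ?thesis using cf_simple_integral(2)[OF H(1) A] by simp
  qed
  have intH: "integrable lborel (\<lambda>s. \<psi> (u * H n s))" for n
    using cf_simple_integral(1)[OF H(1), of UNIV] by auto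
  have split: "(LINT s:A|lborel. k n s) = (LINT s:A|lborel. \<psi> (u * H n s)) - (LINT s:A|lborel. \<psi> (u * h s))"
    if "A \<in> sets borel" for A n
    unfolding k_def using that intH int
    by (intro set_integral_diff) (auto simp: set_integrable_def intro!: integrable_mult_indicator)
  have "(\<lambda>n. exp (LINT s|lborel. k n s)) \<longlonglongrightarrow> 1"
  proof (rule gliding_hump)
    show "integrable lborel (k n)" for n unfolding k_def using intH int by simp
    show "AE s in lborel. (\<lambda>n. k n s) \<longlonglongrightarrow> 0"
      using H(2)
    proof eventually_elim
      case (elim s)
      have "isCont \<psi> (u * h s)" using \<psi>_cont by (simp add: continuous_on_eq_continuous_at)
      then have "(\<lambda>n. \<psi> (u * H n s)) \<longlonglongrightarrow> \<psi> (u * h s)"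
        by (rule isCont_tendsto_compose) (intro tendsto_intros elim)
      then show ?case unfolding k_def by (auto intro: tendsto_eq_intros)
    qed
    fix A :: "real set" assume A: "A \<in> sets borel"
    obtain W where W: "W \<in> borel_measurable M" "tendsto_in_prob M (\<lambda>n. simple_integral \<Lambda> A (H n)) W"
      using HW[OF A] by blast
    have "(\<lambda>n. exp (LINT s:A|lborel. k n s)) \<longlonglongrightarrow> cf M W u / exp (LINT s:A|lborel. \<psi> (u * h s))"
      unfolding split[OF A] exp_diff by (intro tendsto_divide cf_conv A W tendsto_const) auto
    then show "convergent (\<lambda>n. exp (LINT s:A|lborel. k n s))" by (rule convergentI)
  qed
  moreover have "(\<lambda>n. exp (LINT s|lborel. k n s)) \<longlonglongrightarrow> cf M Y u / exp (LINT s|lborel. \<psi> (u * h s))"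
    using split[of UNIV] cf_conv[of UNIV Y, OF _ _ HY]
    by (auto simp: set_lebesgue_integral_def exp_diff intro!: tendsto_divide)
  ultimately have "cf M Y u / exp (LINT s|lborel. \<psi> (u * h s)) = 1" by (metis LIMSEQ_unique)
  then show ?thesis by (simp add: field_simps)
qed

end

section \<open>Independence from factorizing characteristic functions\<close>

lemma (in prob_space) cf_minus:
  assumes "Y \<in> borel_measurable M" shows "cf M Y (- b) = cnj (cf M Y b)"
  using assms unfolding cf_eq[OF assms] Bochner_Integration.integral_cnj[symmetric] by (simp add: exp_cnj)

text \<open>
  A signed weight is made into a probability density by an affine change: \<open>D = (2 + V) / (2 + v)\<close> is
  positive because \<open>V\<close> and \<open>v\<close> are bounded by 1. The hypothesis then says that \<open>Y\<close> has the same
  characteristic function under the density \<open>D\<close> as under \<open>M\<close>, and the one-dimensional uniqueness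
  theorem applies.
\<close>

lemma (in prob_space) weighted_cf_uniqueness_real:
  fixes V Y :: "'a \<Rightarrow> real"
  assumes [measurable]: "V \<in> borel_measurable M" "Y \<in> borel_measurable M"
    and V: "\<And>\<omega>. \<bar>V \<omega>\<bar> \<le> 1"
    and eq: "\<And>b. (\<integral>\<omega>. of_real (V \<omega>) * iexp (b * Y \<omega>) \<partial>M) = of_real v * cf M Y b"
    and A[measurable]: "A \<in> sets borel"
  shows "(\<integral>\<omega>. V \<omega> * indicator A (Y \<omega>) \<partial>M) = v * prob (Y -` A \<inter> space M)"
proof -
  have intV: "integrable M V" by (rule integrable_const_bound[where B=1]) (use V in auto)
  have "(\<integral>\<omega>. complex_of_real (V \<omega>) \<partial>M) = of_real v"
    using eq[of 0] by (simp add: cf_eq prob_space)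
  then have v: "(\<integral>\<omega>. V \<omega> \<partial>M) = v" by (metis integral_complex_of_real of_real_eq_iff)
  have "\<bar>v\<bar> \<le> (\<integral>\<omega>. \<bar>V \<omega>\<bar> \<partial>M)" unfolding v[symmetric] by (rule integral_abs_bound)
  also have "\<dots> \<le> 1" using V intV by (intro integral_le_const) auto
  finally have v1: "\<bar>v\<bar> \<le> 1" .
  define D where "D \<omega> = (2 + V \<omega>) / (2 + v)" for \<omega>
  have [measurable]: "D \<in> borel_measurable M" unfolding D_def by measurable
  have Dpos: "D \<omega> \<ge> 0" for \<omega> using V[of \<omega>] v1 unfolding D_def by (intro divide_nonneg_nonneg) auto
  have Dint: "integrable M D" unfolding D_def using intV by simp
  have "(\<integral>\<omega>. D \<omega> \<partial>M) = 1"
    unfolding D_def using intV v v1 by (simp add: prob_space)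
  then have nnD: "(\<integral>\<^sup>+ \<omega>. ennreal (D \<omega>) \<partial>M) = 1"
    using Dint Dpos by (simp add: nn_integral_eq_integral)
  define N where "N = distr (density M D) borel Y"
  have psD: "prob_space (density M D)"
    by (rule prob_spaceI) (simp add: emeasure_density nnD cong: nn_integral_cong)
  then have psN: "prob_space N" unfolding N_def by (rule prob_space.prob_space_distr) simp
  have rN: "real_distribution N"
    using psN by (intro real_distribution.intro real_distribution_axioms.intro) (auto simp: N_def)
  have rY: "real_distribution (distr M borel Y)" by (rule real_distribution_distr) simp
  have ii: "integrable M (\<lambda>\<omega>. of_real (W \<omega>) * iexp (b * Y \<omega>))" if "integrable M W" for W :: "'a \<Rightarrow> real" and b
    by (rule Bochner_Integration.integrable_bound[OF that]) (use that in \<open>auto simp: norm_mult intro!: borel_measurable_times borel_measurable_of_real\<close>)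
  have "char N = cf M Y"
  proof
    fix b
    have "char N b = (\<integral>\<omega>. D \<omega> *\<^sub>R iexp (b * Y \<omega>) \<partial>M)"
      unfolding N_def char_def by (simp add: integral_distr integral_density Dpos)
    also have "\<dots> = (\<integral>\<omega>. (2 * iexp (b * Y \<omega>) + of_real (V \<omega>) * iexp (b * Y \<omega>)) / of_real (2 + v) \<partial>M)"
      by (intro Bochner_Integration.integral_cong refl) (simp add: D_def scaleR_conv_of_real algebra_simps add_divide_distrib)
    also have "\<dots> = (2 * (\<integral>\<omega>. iexp (b * Y \<omega>) \<partial>M) + (\<integral>\<omega>. of_real (V \<omega>) * iexp (b * Y \<omega>) \<partial>M)) / of_real (2 + v)"
      using ii[OF intV, of b] ii[of "\<lambda>_. 2" b]
      by (subst integral_divide_zero, subst Bochner_Integration.integral_add) auto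
    also have "\<dots> = (2 * cf M Y b + of_real v * cf M Y b) / of_real (2 + v)"
      by (simp only: eq) (simp add: cf_eq)
    also have "\<dots> = of_real (2 + v) * cf M Y b / of_real (2 + v)" by (simp add: algebra_simps)
    also have "\<dots> = cf M Y b"
    proof -
      have "complex_of_real (2 + v) \<noteq> 0" using v1 by (subst of_real_eq_0_iff) auto
      then show ?thesis by simp
    qed
    finally show "char N b = cf M Y b" .
  qed
  then have NY: "N = distr M borel Y" by (rule Levy_uniqueness[OF rN rY])
  have "measure N A = (\<integral>\<omega>. D \<omega> * indicator A (Y \<omega>) \<partial>M)"
  proof -
    interpret N: prob_space N by fact
    have "measure N A = (\<integral>x. indicator A x \<partial>N)" by (simp add: N_def)
    also have "\<dots> = (\<integral>\<omega>. D \<omega> * indicator A (Y \<omega>) \<partial>M)"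
      unfolding N_def by (subst integral_distr, simp, simp) (subst integral_density, auto simp: Dpos)
    finally show ?thesis .
  qed
  moreover have "measure N A = prob (Y -` A \<inter> space M)" by (simp add: NY measure_distr)
  moreover have "(\<integral>\<omega>. D \<omega> * indicator A (Y \<omega>) \<partial>M)
      = (2 * prob (Y -` A \<inter> space M) + (\<integral>\<omega>. V \<omega> * indicator A (Y \<omega>) \<partial>M)) / (2 + v)"
  proof -
    have *: "integrable M (\<lambda>\<omega>. V \<omega> * indicator A (Y \<omega>))"
      by (rule Bochner_Integration.integrable_bound[OF intV]) (auto simp: indicator_def)
    have "(\<integral>\<omega>. D \<omega> * indicator A (Y \<omega>) \<partial>M) = (\<integral>\<omega>. (2 * indicator (Y -` A \<inter> space M) \<omega> + V \<omega> * indicator A (Y \<omega>)) / (2 + v) \<partial>M)"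
      by (intro Bochner_Integration.integral_cong refl) (simp add: D_def indicator_def)
    also have "\<dots> = ((\<integral>\<omega>. 2 * indicator (Y -` A \<inter> space M) \<omega> \<partial>M) + (\<integral>\<omega>. V \<omega> * indicator A (Y \<omega>) \<partial>M)) / (2 + v)"
      using * by (subst integral_divide_zero, subst Bochner_Integration.integral_add)
                 (auto intro!: integrable_mult_right integrable_real_indicator simp: emeasure_eq_measure)
    finally show ?thesis by simp
  qed
  ultimately have "(2 + v) * prob (Y -` A \<inter> space M) = 2 * prob (Y -` A \<inter> space M) + (\<integral>\<omega>. V \<omega> * indicator A (Y \<omega>) \<partial>M)"
    using v1 by (simp add: field_simps)
  then show ?thesis by (simp add: algebra_simps)
qed

text \<open>
  Conjugating the hypothesis at \<open>- b\<close> gives the hypothesis for the conjugate weight, which separates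
  the real and imaginary parts of \<open>U\<close>.
\<close>

lemma (in prob_space) weighted_cf_uniqueness:
  fixes U :: "'a \<Rightarrow> complex" and Y :: "'a \<Rightarrow> real"
  assumes [measurable]: "U \<in> borel_measurable M" "Y \<in> borel_measurable M"
    and U: "\<And>\<omega>. norm (U \<omega>) \<le> 1"
    and eq: "\<And>b. (\<integral>\<omega>. U \<omega> * iexp (b * Y \<omega>) \<partial>M) = c * cf M Y b"
    and A[measurable]: "A \<in> sets borel"
  shows "(\<integral>\<omega>. U \<omega> * indicator A (Y \<omega>) \<partial>M) = c * of_real (prob (Y -` A \<inter> space M))"
proof -
  have mc[measurable]: "(\<lambda>\<omega>. cnj (U \<omega>)) \<in> borel_measurable M"
    by (intro measurable_compose[OF _ borel_measurable_continuous_onI[of cnj]] continuous_intros) auto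
  have i: "integrable M (\<lambda>\<omega>. W \<omega> * iexp (b * Y \<omega>))"
    if [measurable]: "W \<in> borel_measurable M" and "\<And>\<omega>. norm (W \<omega>) \<le> 1" for W b
    by (rule integrable_const_bound[where B=1]) (use that in \<open>auto simp: norm_mult\<close>)
  have cnj_eq: "(\<integral>\<omega>. cnj (U \<omega>) * iexp (b * Y \<omega>) \<partial>M) = cnj c * cf M Y b" for b
  proof -
    have "(\<integral>\<omega>. cnj (U \<omega>) * iexp (b * Y \<omega>) \<partial>M) = (\<integral>\<omega>. cnj (U \<omega> * iexp ((- b) * Y \<omega>)) \<partial>M)"
      by (simp add: exp_cnj)
    also have "\<dots> = cnj (c * cf M Y (- b))" unfolding eq[symmetric] by (rule Bochner_Integration.integral_cnj)
    finally show ?thesis by (simp add: cf_minus)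
  qed
  have Re_eq: "(\<integral>\<omega>. of_real (Re (U \<omega>)) * iexp (b * Y \<omega>) \<partial>M) = of_real (Re c) * cf M Y b" for b
  proof -
    have "(\<integral>\<omega>. of_real (Re (U \<omega>)) * iexp (b * Y \<omega>) \<partial>M)
        = (\<integral>\<omega>. (U \<omega> * iexp (b * Y \<omega>) + cnj (U \<omega>) * iexp (b * Y \<omega>)) / 2 \<partial>M)"
    proof (intro Bochner_Integration.integral_cong refl)
      fix \<omega>
      have "complex_of_real (Re (U \<omega>)) = (U \<omega> + cnj (U \<omega>)) / 2" by (simp add: complex_add_cnj)
      then show "of_real (Re (U \<omega>)) * iexp (b * Y \<omega>) = (U \<omega> * iexp (b * Y \<omega>) + cnj (U \<omega>) * iexp (b * Y \<omega>)) / 2"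
        by (simp only: distrib_right times_divide_eq_left)
    qed
    also have "\<dots> = (c * cf M Y b + cnj c * cf M Y b) / 2"
      unfolding eq[symmetric] cnj_eq[symmetric] using i[of U b] i[OF mc, of b] U
      by (subst integral_divide_zero, subst Bochner_Integration.integral_add) auto
    also have "\<dots> = of_real (Re c) * cf M Y b"
      using complex_add_cnj[of c] by (simp add: distrib_right[symmetric])
    finally show ?thesis .
  qed
  have Im_eq: "(\<integral>\<omega>. of_real (Im (U \<omega>)) * iexp (b * Y \<omega>) \<partial>M) = of_real (Im c) * cf M Y b" for b
  proof -
    have *: "complex_of_real (Im z) = (z - cnj z) / (2 * \<i>)" for z
    proof -
      have "z - cnj z = complex_of_real (Im z) * (2 * \<i>)" by (simp add: complex_diff_cnj)
      moreover have "complex_of_real (Im z) = complex_of_real (Im z) * (2 * \<i>) / (2 * \<i>)"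
        by (rule nonzero_mult_div_cancel_right[symmetric]) simp
      ultimately show ?thesis by simp
    qed
    have "(\<integral>\<omega>. of_real (Im (U \<omega>)) * iexp (b * Y \<omega>) \<partial>M)
        = (\<integral>\<omega>. (U \<omega> * iexp (b * Y \<omega>) - cnj (U \<omega>) * iexp (b * Y \<omega>)) / (2 * \<i>) \<partial>M)"
      by (intro Bochner_Integration.integral_cong refl) (simp only: * left_diff_distrib times_divide_eq_left)
    also have "\<dots> = (c * cf M Y b - cnj c * cf M Y b) / (2 * \<i>)"
      unfolding eq[symmetric] cnj_eq[symmetric] using i[of U b] i[OF mc, of b] U
      by (subst integral_divide_zero, subst Bochner_Integration.integral_diff) auto
    also have "\<dots> = of_real (Im c) * cf M Y b"
      by (simp only: * left_diff_distrib times_divide_eq_left)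
    finally show ?thesis .
  qed
  have ReA: "(\<integral>\<omega>. Re (U \<omega>) * indicator A (Y \<omega>) \<partial>M) = Re c * prob (Y -` A \<inter> space M)"
    by (rule weighted_cf_uniqueness_real[OF _ _ _ Re_eq A]) (auto intro: order_trans[OF abs_Re_le_cmod U])
  have ImA: "(\<integral>\<omega>. Im (U \<omega>) * indicator A (Y \<omega>) \<partial>M) = Im c * prob (Y -` A \<inter> space M)"
    by (rule weighted_cf_uniqueness_real[OF _ _ _ Im_eq A]) (auto intro: order_trans[OF abs_Im_le_cmod U])
  have int: "integrable M (\<lambda>\<omega>. U \<omega> * indicator A (Y \<omega>))"
    by (rule integrable_const_bound[where B=1]) (use U in \<open>auto simp: indicator_def\<close>)
  have Re_ind: "Re (z * indicator A y) = Re z * indicator A y" "Im (z * indicator A y) = Im z * indicator A y" for z y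
    by (auto simp: indicator_def)
  show ?thesis
  proof (rule complex_eqI)
    have "Re (\<integral>\<omega>. U \<omega> * indicator A (Y \<omega>) \<partial>M) = (\<integral>\<omega>. Re (U \<omega>) * indicator A (Y \<omega>) \<partial>M)"
      unfolding integral_Re[OF int, symmetric] Re_ind ..
    then show "Re (\<integral>\<omega>. U \<omega> * indicator A (Y \<omega>) \<partial>M) = Re (c * of_real (prob (Y -` A \<inter> space M)))"
      using ReA by simp
    have "Im (\<integral>\<omega>. U \<omega> * indicator A (Y \<omega>) \<partial>M) = (\<integral>\<omega>. Im (U \<omega>) * indicator A (Y \<omega>) \<partial>M)"
      unfolding integral_Im[OF int, symmetric] Re_ind ..
    then show "Im (\<integral>\<omega>. U \<omega> * indicator A (Y \<omega>) \<partial>M) = Im (c * of_real (prob (Y -` A \<inter> space M)))"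
      using ImA by simp
  qed
qed

text \<open>
  The exponential factors are exchanged for indicators one coordinate at a time. When coordinate \<open>j\<close>
  is treated, all other factors form a weight of modulus at most 1, so each exchange is an
  application of the one-dimensional uniqueness theorem with weights.
\<close>

lemma (in prob_space) indep_vars_if_cf_factorizes:
  fixes X :: "nat \<Rightarrow> 'a \<Rightarrow> real"
  assumes X[measurable]: "\<And>k. X k \<in> borel_measurable M"
    and fac: "\<And>n b. cf M (\<lambda>\<omega>. \<Sum>k\<le>n. b k * X k \<omega>) 1 = (\<Prod>k\<le>n. cf M (X k) (b k))"
  shows "indep_vars (\<lambda>_. borel) X UNIV"
proof -
  have main: "(\<integral>\<omega>. (\<Prod>k<j. indicator (A k) (X k \<omega>)) * (\<Prod>k\<in>{j..n}. iexp (b k * X k \<omega>)) \<partial>M)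
      = (\<Prod>k<j. of_real (prob (X k -` A k \<inter> space M))) * (\<Prod>k\<in>{j..n}. cf M (X k) (b k))"
    if A: "\<And>k. A k \<in> sets borel" and "j \<le> Suc n" for A n j b
    using \<open>j \<le> Suc n\<close>
  proof (induction j arbitrary: b)
    case 0
    have "(\<integral>\<omega>. (\<Prod>k\<in>{0..n}. iexp (b k * X k \<omega>)) \<partial>M) = cf M (\<lambda>\<omega>. \<Sum>k\<le>n. b k * X k \<omega>) 1"
      by (subst cf_eq) (auto simp: exp_sum sum_distrib_left atMost_atLeast0)
    then show ?case using fac[of b n] by (simp add: atMost_atLeast0)
  next
    case (Suc j)
    note [measurable] = A
    define U where "U \<omega> = (\<Prod>k<j. indicator (A k) (X k \<omega>)) * (\<Prod>k\<in>{Suc j..n}. iexp (b k * X k \<omega>))" for \<omega>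
    define c where "c = (\<Prod>k<j. complex_of_real (prob (X k -` A k \<inter> space M))) * (\<Prod>k\<in>{Suc j..n}. cf M (X k) (b k))"
    have split: "{j..n} = insert j {Suc j..n}" using Suc.prems by auto
    have eq: "(\<integral>\<omega>. U \<omega> * iexp (t * X j \<omega>) \<partial>M) = c * cf M (X j) t" for t
    proof -
      have upd1: "(\<Prod>k\<in>{Suc j..n}. iexp ((b(j := t)) k * X k \<omega>)) = (\<Prod>k\<in>{Suc j..n}. iexp (b k * X k \<omega>))" for \<omega>
        by (rule prod.cong) auto
      have upd2: "(\<Prod>k\<in>{Suc j..n}. cf M (X k) ((b(j := t)) k)) = (\<Prod>k\<in>{Suc j..n}. cf M (X k) (b k))"
        by (rule prod.cong) auto
      have "(\<integral>\<omega>. (\<Prod>k<j. indicator (A k) (X k \<omega>)) * (\<Prod>k\<in>{j..n}. iexp ((b(j := t)) k * X k \<omega>)) \<partial>M)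
        = (\<Prod>k<j. of_real (prob (X k -` A k \<inter> space M))) * (\<Prod>k\<in>{j..n}. cf M (X k) ((b(j := t)) k))"
        using Suc.prems by (intro Suc.IH) auto
      moreover have "(\<Prod>k\<in>{j..n}. iexp ((b(j := t)) k * X k \<omega>)) = iexp (t * X j \<omega>) * (\<Prod>k\<in>{Suc j..n}. iexp (b k * X k \<omega>))" for \<omega>
        unfolding upd1[symmetric] split by (subst prod.insert) simp_all
      moreover have "(\<Prod>k\<in>{j..n}. cf M (X k) ((b(j := t)) k)) = cf M (X j) t * (\<Prod>k\<in>{Suc j..n}. cf M (X k) (b k))"
        unfolding upd2[symmetric] split by (subst prod.insert) simp_all
      ultimately show ?thesis
        unfolding U_def c_def by (simp only: mult_ac)
    qed
    have Un: "norm (U \<omega>) \<le> 1" for \<omega>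
      unfolding U_def norm_mult prod_norm[symmetric]
      by (intro mult_le_one prod_le_1 prod_nonneg conjI) (auto simp: indicator_def)
    have [measurable]: "U \<in> borel_measurable M" unfolding U_def by measurable
    have "(\<integral>\<omega>. U \<omega> * indicator (A j) (X j \<omega>) \<partial>M) = c * of_real (prob (X j -` A j \<inter> space M))"
      by (rule weighted_cf_uniqueness[OF _ _ Un eq A]) auto
    then show ?case
      by (simp add: U_def c_def mult_ac)
  qed
  show ?thesis
    unfolding indep_vars_def
  proof (intro conjI)
    show "\<forall>i\<in>UNIV. X i \<in> borel_measurable M" by simp
    show "indep_sets (\<lambda>i. sigma_sets (space M) {X i -` A \<inter> space M |A. A \<in> sets borel}) UNIV"
    proof -
      have "indep_sets (\<lambda>i. {X i -` A \<inter> space M |A. A \<in> sets borel}) UNIV"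
      proof (rule indep_setsI)
        fix i show "{X i -` A \<inter> space M |A. A \<in> sets borel} \<subseteq> events" by auto
      next
        fix B and J :: "nat set"
        assume J: "J \<noteq> {}" "J \<subseteq> UNIV" "finite J" and B: "\<forall>j\<in>J. B j \<in> {X j -` A \<inter> space M |A. A \<in> sets borel}"
        then obtain A0 where A0: "\<And>j. j \<in> J \<Longrightarrow> B j = X j -` A0 j \<inter> space M \<and> A0 j \<in> sets borel"
          by (auto simp: Bex_def Ball_def) metis
        define A where "A j = (if j \<in> J then A0 j else UNIV)" for j
        have A: "A j \<in> sets borel" for j using A0 by (auto simp: A_def)
        define n where "n = Max J"
        have Jn: "J \<subseteq> {..<Suc n}" using J by (auto simp: n_def less_Suc_eq_le)
        have "(\<integral>\<omega>. (\<Prod>k<Suc n. indicator (A k) (X k \<omega>)) \<partial>M) = (\<Prod>k<Suc n. complex_of_real (prob (X k -` A k \<inter> space M)))"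
          using main[of A "Suc n" n "\<lambda>_. 0", OF A] by simp
        moreover have "(\<Prod>k<Suc n. indicator (A k) (X k \<omega>)) = complex_of_real (indicator (\<Inter>j\<in>J. B j) \<omega>)" if "\<omega> \<in> space M" for \<omega>
        proof (cases "\<forall>k\<in>J. \<omega> \<in> B k")
          case True
          have "indicator (A k) (X k \<omega>) = (1::complex)" for k
            using True A0 that by (auto simp: A_def indicator_def)
          then show ?thesis using True by simp
        next
          case False
          then obtain k where k: "k \<in> J" "\<omega> \<notin> B k" by auto
          then have "indicator (A k) (X k \<omega>) = (0::complex)" using A0 that by (auto simp: A_def indicator_def)
          moreover have "k \<in> {..<Suc n}" using k Jn by auto
          ultimately have "(\<Prod>k<Suc n. indicator (A k) (X k \<omega>)) = (0::complex)"
            by (intro prod_zero) auto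
          then show ?thesis using k by (auto simp: indicator_def)
        qed
        ultimately have "(\<integral>\<omega>. complex_of_real (indicator (\<Inter>j\<in>J. B j) \<omega>) \<partial>M) = (\<Prod>k<Suc n. complex_of_real (prob (X k -` A k \<inter> space M)))"
          by (simp cong: Bochner_Integration.integral_cong)
        moreover have "(\<Inter>j\<in>J. B j) \<inter> space M = (\<Inter>j\<in>J. B j)" using J A0 by auto
        ultimately have 1: "prob (\<Inter>j\<in>J. B j) = (\<Prod>k<Suc n. prob (X k -` A k \<inter> space M))"
          by (simp flip: of_real_prod of_real_mult)
        also have "\<dots> = (\<Prod>k\<in>J. prob (X k -` A k \<inter> space M))"
          using Jn by (intro prod.mono_neutral_right) (auto simp: A_def prob_space)
        also have "\<dots> = (\<Prod>j\<in>J. prob (B j))" using A0 by (intro prod.cong refl) (auto simp: A_def)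
        finally show "prob (\<Inter>j\<in>J. B j) = (\<Prod>j\<in>J. prob (B j))" .
      qed
      then show ?thesis
      proof (rule indep_sets_sigma)
        fix i :: nat
        show "Int_stable {X i -` A \<inter> space M |A. A \<in> sets borel}"
        proof (rule Int_stableI)
          fix a b assume "a \<in> {X i -` A \<inter> space M |A. A \<in> sets borel}" "b \<in> {X i -` A \<inter> space M |A. A \<in> sets borel}"
          then obtain A A' where "a = X i -` A \<inter> space M" "b = X i -` A' \<inter> space M" "A \<in> sets borel" "A' \<in> sets borel" by auto
          then show "a \<inter> b \<in> {X i -` A \<inter> space M |A. A \<in> sets borel}"
            by (intro CollectI exI[of _ "A \<inter> A'"]) auto
        qed
      qed
    qed
  qed
qed

section \<open>Small moments of symmetrized laws\<close>

text \<open>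
  If \<open>\<bar>z\<bar> > 1\<close>, some dyadic fraction of \<open>z\<close> has modulus between 1 and 2, where \<open>1 - cos\<close> is at least
  \<open>1 - cos 1\<close>. This one term of the series dominates \<open>\<bar>z\<bar> powr q\<close>.
\<close>

lemma powr_le_cosine_sum:
  fixes z q :: real
  assumes q: "q > 0"
  shows "ennreal (\<bar>z\<bar> powr q) \<le> 1 + (\<Sum>j. ennreal (2 powr q / (1 - cos 1) * (2 powr q) ^ j * (1 - cos ((1/2) ^ j * z))))"
proof (cases "\<bar>z\<bar> \<le> 1")
  case True
  then have "\<bar>z\<bar> powr q \<le> 1" using q by (intro powr_le1) auto
  then have "ennreal (\<bar>z\<bar> powr q) \<le> 1 + 0" by simp
  also have "\<dots> \<le> 1 + (\<Sum>j. ennreal (2 powr q / (1 - cos 1) * (2 powr q) ^ j * (1 - cos ((1/2) ^ j * z))))"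
    by (intro add_left_mono) simp
  finally show ?thesis .
next
  case False
  define m where "m = (LEAST m. \<bar>z\<bar> < 2 ^ m)"
  obtain m0 where "\<bar>z\<bar> < 2 ^ m0" using real_arch_pow[of 2 "\<bar>z\<bar>"] by auto
  then have m: "\<bar>z\<bar> < 2 ^ m" unfolding m_def by (rule LeastI)
  then have "m \<noteq> 0" using False by (intro notI) auto
  then obtain j where j: "m = Suc j" by (cases m) auto
  have "\<not> \<bar>z\<bar> < 2 ^ j" using not_less_Least[of j "\<lambda>m. \<bar>z\<bar> < 2 ^ m"] j m_def by auto
  then have j1: "2 ^ j \<le> \<bar>z\<bar>" by simp
  define y where "y = (1/2) ^ j * \<bar>z\<bar>"
  have y: "1 \<le> y" "y \<le> 2" using j1 m by (auto simp: y_def j power_divide field_simps)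
  have "cos y \<le> cos 1" using y pi_gt3 by (intro cos_monotone_0_pi_le) auto
  moreover have "cos ((1/2) ^ j * z) = cos y"
  proof (cases "z \<ge> 0")
    case False
    then have "(1/2) ^ j * z = - y" by (simp add: y_def)
    then show ?thesis by simp
  qed (simp add: y_def)
  ultimately have c: "1 - cos ((1/2) ^ j * z) \<ge> 1 - cos 1" by simp
  have c1: "1 - cos (1::real) > 0"
  proof -
    have "cos (1::real) < cos 0" using pi_gt3 by (intro cos_monotone_0_pi) auto
    then show ?thesis by simp
  qed
  have "\<bar>z\<bar> powr q \<le> (2 ^ Suc j) powr q" using m j q by (intro powr_mono2) auto
  also have "(2 ^ Suc j) powr q = 2 powr q * (2 powr q) ^ j"
  proof -
    have "(2 ^ n) powr q = (2 powr q) ^ n" for n :: nat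
      by (simp add: powr_realpow[symmetric] powr_powr mult.commute)
    then show ?thesis by (metis power_Suc)
  qed
  also have "\<dots> = 2 powr q / (1 - cos 1) * (2 powr q) ^ j * (1 - cos 1)" using c1 by simp
  also have "\<dots> \<le> 2 powr q / (1 - cos 1) * (2 powr q) ^ j * (1 - cos ((1/2) ^ j * z))"
    using c c1 by (intro mult_left_mono) auto
  finally have "ennreal (\<bar>z\<bar> powr q) \<le> (\<Sum>i\<in>{j}. ennreal (2 powr q / (1 - cos 1) * (2 powr q) ^ i * (1 - cos ((1/2) ^ i * z))))"
    by (simp add: ennreal_leI)
  also have "\<dots> \<le> (\<Sum>j. ennreal (2 powr q / (1 - cos 1) * (2 powr q) ^ j * (1 - cos ((1/2) ^ j * z))))"
    by (rule sum_le_suminf) auto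
  also have "\<dots> \<le> 1 + (\<Sum>j. ennreal (2 powr q / (1 - cos 1) * (2 powr q) ^ j * (1 - cos ((1/2) ^ j * z))))"
    by (simp add: add_increasing)
  finally show ?thesis .
qed

text \<open>
  The squared modulus of the characteristic function at \<open>u\<close> is the expectation of \<open>cos (u * (x -
  y))\<close> for independent \<open>x\<close> and \<open>y\<close>. Integrating the preceding series termwise gives a geometric
  series of ratio \<open>2 powr (q - p)\<close>. The bound depends on \<open>C\<close>, \<open>p\<close> and \<open>q\<close> only, and so is uniform
  over all innovations of the process.
\<close>

lemma symmetrized_moment_bound:
  assumes q: "0 < q" "q < p" and C: "C \<ge> 0"
  obtains K where "K \<ge> 0"
    "\<And>\<mu>. real_distribution \<mu> \<Longrightarrow> (\<And>u. \<bar>u\<bar> \<le> 1 \<Longrightarrow> (norm (char \<mu> u))\<^sup>2 \<ge> 1 - C * \<bar>u\<bar> powr p) \<Longrightarrow>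
      (\<integral>\<^sup>+ z. ennreal (\<bar>fst z - snd z\<bar> powr q) \<partial>(\<mu> \<Otimes>\<^sub>M \<mu>)) \<le> ennreal K"
proof -
  define c where "c = 2 powr q / (1 - cos (1::real))"
  have c0: "c \<ge> 0" by (simp add: c_def)
  define a where "a j = c * (2 powr q) ^ j * (C * ((1/2) ^ j) powr p)" for j :: nat
  have a: "a j = c * C * (2 powr (q - p)) ^ j" for j
  proof -
    have "((1/2) ^ j) powr p = (2 powr (- p)) ^ j"
    proof -
      have "((1/2::real) ^ j) = 2 powr (- real j)" unfolding powr_minus by (subst powr_realpow) (auto simp: power_one_over inverse_eq_divide)
      moreover have "(2 powr (- p)) ^ j = (2 powr (- p)) powr real j"
        by (rule powr_realpow[symmetric]) simp
      ultimately show ?thesis by (simp only: powr_powr) (simp add: mult.commute)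
    qed
    moreover have "(2 powr q) ^ j * (2 powr (- p)) ^ j = (2 powr (q - p) :: real) ^ j"
      by (simp add: power_mult_distrib[symmetric] powr_add[symmetric])
    ultimately show ?thesis unfolding a_def by (simp add: mult_ac)
  qed
  have "2 powr (q - p) < (1::real)" using q by (simp add: powr_less_one)
  then have suma: "summable a" unfolding a by (intro summable_mult summable_geometric) auto
  have a0: "a j \<ge> 0" for j using c0 C by (simp add: a_def)
  show ?thesis
  proof (rule that[of "1 + suminf a"])
    show "1 + suminf a \<ge> 0" using suminf_nonneg[OF suma a0] by simp
    fix \<mu> assume \<mu>: "real_distribution \<mu>" and ch: "\<And>u. \<bar>u\<bar> \<le> 1 \<Longrightarrow> (norm (char \<mu> u))\<^sup>2 \<ge> 1 - C * \<bar>u\<bar> powr p"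
    interpret \<mu>: real_distribution \<mu> by fact
    interpret P: pair_prob_space \<mu> \<mu> ..
    have cosint: "integrable (\<mu> \<Otimes>\<^sub>M \<mu>) (\<lambda>z. cos (u * (fst z - snd z)))" for u
      by (rule P.integrable_const_bound[where B=1]) auto
    have cosE: "(\<integral>z. cos (u * (fst z - snd z)) \<partial>(\<mu> \<Otimes>\<^sub>M \<mu>)) = (norm (char \<mu> u))\<^sup>2" for u
    proof -
      have int: "integrable (\<mu> \<Otimes>\<^sub>M \<mu>) (\<lambda>(x, y). iexp (u * x) * cnj (iexp (u * y)))"
        by (rule P.integrable_const_bound[where B=1]) (auto simp: norm_mult exp_cnj)
      have "(\<integral>z. (\<lambda>(x, y). iexp (u * x) * cnj (iexp (u * y))) z \<partial>(\<mu> \<Otimes>\<^sub>M \<mu>)) = (\<integral>x. \<integral>y. iexp (u * x) * cnj (iexp (u * y)) \<partial>\<mu> \<partial>\<mu>)"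
        using P.integral_fst'[OF int] by simp
      also have "\<dots> = char \<mu> u * cnj (char \<mu> u)"
        unfolding char_def by (simp only: integral_mult_right_zero integral_mult_left_zero Bochner_Integration.integral_cnj)
      also have "\<dots> = of_real ((norm (char \<mu> u))\<^sup>2)" by (simp only: complex_norm_square)
      finally have "Re (\<integral>z. (\<lambda>(x, y). iexp (u * x) * cnj (iexp (u * y))) z \<partial>(\<mu> \<Otimes>\<^sub>M \<mu>)) = (norm (char \<mu> u))\<^sup>2" by simp
      moreover have "Re ((\<lambda>(x, y). iexp (u * x) * cnj (iexp (u * y))) z) = cos (u * (fst z - snd z))" for z
        by (simp add: split_beta exp_cnj flip: exp_add) (simp add: Re_exp algebra_simps)
      ultimately show ?thesis using integral_Re[OF int] by simp
    qed
    have step: "(\<integral>\<^sup>+ z. ennreal (c * (2 powr q) ^ j * (1 - cos ((1/2) ^ j * (fst z - snd z)))) \<partial>(\<mu> \<Otimes>\<^sub>M \<mu>)) \<le> ennreal (a j)" for j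
    proof -
      have int: "integrable (\<mu> \<Otimes>\<^sub>M \<mu>) (\<lambda>z. c * (2 powr q) ^ j * (1 - cos ((1/2) ^ j * (fst z - snd z))))"
        using cosint[of "(1/2)^j"] by (intro integrable_mult_right Bochner_Integration.integrable_diff integrable_const) auto
      have "(\<integral>\<^sup>+ z. ennreal (c * (2 powr q) ^ j * (1 - cos ((1/2) ^ j * (fst z - snd z)))) \<partial>(\<mu> \<Otimes>\<^sub>M \<mu>))
         = ennreal (\<integral>z. c * (2 powr q) ^ j * (1 - cos ((1/2) ^ j * (fst z - snd z))) \<partial>(\<mu> \<Otimes>\<^sub>M \<mu>))"
        using c0 by (intro nn_integral_eq_integral int) auto
      also have "(\<integral>z. c * (2 powr q) ^ j * (1 - cos ((1/2) ^ j * (fst z - snd z))) \<partial>(\<mu> \<Otimes>\<^sub>M \<mu>))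
          = c * (2 powr q) ^ j * (1 - (norm (char \<mu> ((1/2)^j)))\<^sup>2)"
        using cosint[of "(1/2)^j"] cosE[of "(1/2)^j"]
        by (subst integral_mult_right_zero, subst Bochner_Integration.integral_diff) (auto simp: P.prob_space)
      also have "\<dots> \<le> a j" unfolding a_def
        using ch[of "(1/2)^j"] c0 by (intro mult_left_mono) (auto simp: power_le_one)
      finally show ?thesis by (simp add: ennreal_leI)
    qed
    have "(\<integral>\<^sup>+ z. ennreal (\<bar>fst z - snd z\<bar> powr q) \<partial>(\<mu> \<Otimes>\<^sub>M \<mu>))
       \<le> (\<integral>\<^sup>+ z. 1 + (\<Sum>j. ennreal (c * (2 powr q) ^ j * (1 - cos ((1/2) ^ j * (fst z - snd z))))) \<partial>(\<mu> \<Otimes>\<^sub>M \<mu>))"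
      unfolding c_def by (intro nn_integral_mono powr_le_cosine_sum q)
    also have "\<dots> = 1 + (\<Sum>j. \<integral>\<^sup>+ z. ennreal (c * (2 powr q) ^ j * (1 - cos ((1/2) ^ j * (fst z - snd z)))) \<partial>(\<mu> \<Otimes>\<^sub>M \<mu>))"
      by (subst nn_integral_add, simp, measurable, subst nn_integral_suminf) (auto simp: P.emeasure_space_1)
    also have "\<dots> \<le> 1 + (\<Sum>j. ennreal (a j))"
      by (intro add_left_mono suminf_le step) auto
    also have "(\<Sum>j. ennreal (a j)) = ennreal (suminf a)" using a0 suma by (rule suminf_ennreal2)
    also have "1 + ennreal (suminf a) = ennreal (1 + suminf a)"
      using suminf_nonneg[OF suma a0] by (simp add: ennreal_plus)
    finally show "(\<integral>\<^sup>+ z. ennreal (\<bar>fst z - snd z\<bar> powr q) \<partial>(\<mu> \<Otimes>\<^sub>M \<mu>)) \<le> ennreal (1 + suminf a)" .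
  qed
qed

section \<open>Innovations of the stable Ornstein-Uhlenbeck process\<close>

lemma stable_levy_exponent:
  assumes M: "prob_space M" and st: "stable_levy_process \<beta> M L" and \<beta>: "\<beta> > 0"
  obtains \<psi> C p where "continuous_on UNIV \<psi>" "\<psi> 0 = (0::complex)"
    "\<And>s t u. s \<le> t \<Longrightarrow> cf M (\<lambda>\<omega>. L t \<omega> - L s \<omega>) u = exp (of_real (t - s) * \<psi> u)"
    "C > 0" "0 < p" "p \<le> 1" "\<And>u. \<bar>u\<bar> \<le> 1 \<Longrightarrow> norm (\<psi> u) \<le> C * \<bar>u\<bar> powr p"
proof -
  interpret prob_space M by fact
  have L: "two_sided_levy_process M L" using st by (simp add: stable_levy_process_def)
  note [measurable] = levy_process_measurable[OF L]
  obtain \<psi> where \<psi>: "continuous_on UNIV \<psi>" "\<psi> 0 = (0::complex)"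
    "\<And>s t u. s \<le> t \<Longrightarrow> cf M (\<lambda>\<omega>. L t \<omega> - L s \<omega>) u = exp (of_real (t - s) * \<psi> u)"
    using levy_exponent_exists[OF L] by blast
  have "AE \<omega> in M. L 0 \<omega> = 0" using L by (simp add: two_sided_levy_process_def)
  then have ae: "AE \<omega> in M. L 1 \<omega> = L 1 \<omega> - L 0 \<omega>" by eventually_elim simp
  have "cf M (L 1) = cf M (\<lambda>\<omega>. L 1 \<omega> - L 0 \<omega>)"
    by (rule cf_cong_AE[OF _ _ ae]) auto
  then have ch: "cf M (L 1) u = exp (\<psi> u)" for u using \<psi>(3)[of 0 1 u] by simp
  have "stable_law \<beta> (distr M borel (L 1))" using st by (simp add: stable_levy_process_def)
  from stable_law_exponent_rec[OF this \<beta> \<psi>(1,2) ch]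
  obtain c d where cd: "c > 1" "\<And>u. \<psi> (c * u) = 2 * \<psi> u - \<i> * of_real (d * u)" by blast
  from stable_exponent_growth[OF \<psi>(1) cd] obtain C p where
    "C > 0" "0 < p" "p \<le> 1" "\<And>u. \<bar>u\<bar> \<le> 1 \<Longrightarrow> norm (\<psi> u) \<le> C * \<bar>u\<bar> powr p" by blast
  with \<psi> that show ?thesis by blast
qed

text \<open>
  Entry 0 is the starting value and not a difference, so that the sequence determines the path after
  time \<open>T\<close>.
\<close>

definition innovation :: "real \<Rightarrow> (real \<Rightarrow> 'a \<Rightarrow> real) \<Rightarrow> real \<Rightarrow> nat \<Rightarrow> 'a \<Rightarrow> real" where
  "innovation a X T k \<omega> = (if k = 0 then X T \<omega> else X (T + real k) \<omega> - a * X (T + real k - 1) \<omega>)"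

text \<open>
  The integrand of the \<open>k\<close>-th innovation when \<open>T = 0\<close>. Its window is the interval \<open>(k - 1, k]\<close>, and
  the whole half-line \<open>(-\<infinity>, 0]\<close> for the starting value. The windows are pairwise disjoint.
\<close>

definition innovation_kernel :: "real \<Rightarrow> nat \<Rightarrow> real \<Rightarrow> real" where
  "innovation_kernel \<kappa> k s = (if (k = 0 \<or> real k - 1 < s) \<and> s \<le> real k then exp (- \<kappa> * (real k - s)) else 0)"

lemma integrable_exp_decay:
  fixes c t :: real
  assumes c: "c > 0"
  shows "integrable lborel (\<lambda>s. if s \<le> t then exp (- c * (t - s)) else 0)"
    and "(LINT s|lborel. (if s \<le> t then exp (- c * (t - s)) else 0)) = 1 / c"
proof -
  have ed: "exponential_density c x = (if x < 0 then 0 else c * exp (- x * c))" for x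
    by (simp add: exponential_density_def)
  have nn: "(\<integral>\<^sup>+ x. ennreal (exponential_density c x) \<partial>lborel) = 1"
    using prob_space.emeasure_space_1[OF prob_space_exponential_density[OF c]]
    by (simp add: emeasure_density)
  have 1: "has_bochner_integral lborel (exponential_density c) 1"
    by (rule has_bochner_integral_nn_integral) (use nn c in \<open>auto simp: exponential_density_def\<close>)
  have 2: "integrable lborel (\<lambda>s. exponential_density c (t + (-1) * s))"
    using 1 by (intro lborel_integrable_real_affine) (auto simp: has_bochner_integral_iff)
  have 3: "(LINT s|lborel. exponential_density c (t + (-1) * s)) = 1"
    using 1 lborel_integral_real_affine[of "-1" "exponential_density c" t] by (simp add: has_bochner_integral_iff)
  have eq: "(if s \<le> t then exp (- c * (t - s)) else 0) = exponential_density c (t + (-1) * s) / c" for s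
    using c by (simp add: ed algebra_simps)
  show "integrable lborel (\<lambda>s. if s \<le> t then exp (- c * (t - s)) else 0)"
    unfolding eq using 2 by simp
  show "(LINT s|lborel. (if s \<le> t then exp (- c * (t - s)) else 0)) = 1 / c"
    unfolding eq using 3 by simp
qed

lemma innovation_kernel_nonneg: "innovation_kernel \<kappa> k s \<ge> 0"
  by (simp add: innovation_kernel_def)

lemma innovation_kernel_le_1: "\<kappa> > 0 \<Longrightarrow> innovation_kernel \<kappa> k s \<le> 1"
  by (simp add: innovation_kernel_def)

lemma innovation_kernel_measurable [measurable]: "innovation_kernel \<kappa> k \<in> borel_measurable borel"
  unfolding innovation_kernel_def[abs_def] by measurable

lemma innovation_kernel_disjoint:
  "innovation_kernel \<kappa> j s \<noteq> 0 \<Longrightarrow> innovation_kernel \<kappa> k s \<noteq> 0 \<Longrightarrow> j = k"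
  by (auto simp: innovation_kernel_def split: if_splits)

locale OU_basis = levy_basis M L \<Lambda> \<psi> for M :: "'a measure" and L \<Lambda> \<psi> +
  fixes X :: "real \<Rightarrow> 'a \<Rightarrow> real" and \<kappa> C p :: real
  assumes \<kappa>: "\<kappa> > 0" and C: "C > 0" and p: "0 < p" "p \<le> 1"
    and growth: "\<And>u. \<bar>u\<bar> \<le> 1 \<Longrightarrow> norm (\<psi> u) \<le> C * \<bar>u\<bar> powr p"
    and OU: "\<And>t. has_levy_integral M L (\<lambda>s. if s \<le> t then exp (- \<kappa> * (t - s)) else 0) (X t)"
begin

abbreviation "innov \<equiv> innovation (exp (- \<kappa>)) X"

lemma X_measurable [measurable]: "X t \<in> borel_measurable M"
  using OU[of t] by (simp add: has_levy_integral_def)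

lemma innov_measurable [measurable]: "innov T k \<in> borel_measurable M"
  unfolding innovation_def[abs_def] by measurable

lemma growth_bounded:
  obtains D where "D > 0" "\<And>u. \<bar>u\<bar> \<le> R \<Longrightarrow> norm (\<psi> u) \<le> D * \<bar>u\<bar> powr p"
proof -
  have "compact (\<psi> ` {-R..R})"
    by (intro compact_continuous_image continuous_on_subset[OF \<psi>_cont]) auto
  then obtain K where K: "\<forall>z\<in>\<psi> ` {-R..R}. norm z \<le> K"
    using compact_imp_bounded[of "\<psi> ` {-R..R}"] unfolding bounded_iff by blast
  show ?thesis
  proof (rule that[of "max C K"])
    show "max C K > 0" using C by simp
    fix u assume u: "\<bar>u\<bar> \<le> R"
    show "norm (\<psi> u) \<le> max C K * \<bar>u\<bar> powr p"
    proof (cases "\<bar>u\<bar> \<le> 1")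
      case True
      have "norm (\<psi> u) \<le> C * \<bar>u\<bar> powr p" by (rule growth[OF True])
      also have "\<dots> \<le> max C K * \<bar>u\<bar> powr p" by (intro mult_right_mono) auto
      finally show ?thesis .
    next
      case False
      have "norm (\<psi> u) \<le> K" using K u by (auto simp: abs_le_iff)
      also have "K \<le> max C K * 1" by simp
      also have "\<dots> \<le> max C K * \<bar>u\<bar> powr p"
        using False p C by (intro mult_left_mono ge_one_powr_ge_zero) auto
      finally show ?thesis .
    qed
  qed
qed

lemma kernel_powr_integral:
  "integrable lborel (\<lambda>s. innovation_kernel \<kappa> k s powr p)"
  "(LINT s|lborel. innovation_kernel \<kappa> k s powr p) \<le> 1 / (\<kappa> * p)"
proof -
  let ?e = "\<lambda>s. if s \<le> real k then exp (- (\<kappa> * p) * (real k - s)) else 0"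
  have kp: "\<kappa> * p > 0" using \<kappa> p by simp
  have le: "innovation_kernel \<kappa> k s powr p \<le> ?e s" for s
    by (auto simp: innovation_kernel_def powr_def mult_ac)
  show *: "integrable lborel (\<lambda>s. innovation_kernel \<kappa> k s powr p)"
    by (rule Bochner_Integration.integrable_bound[OF integrable_exp_decay(1)[OF kp, of "real k"]])
       (use le in \<open>auto simp del: minus_mult_left\<close>)
  have "(LINT s|lborel. innovation_kernel \<kappa> k s powr p) \<le> (LINT s|lborel. ?e s)"
    by (intro integral_mono * integrable_exp_decay(1) kp le)
  then show "(LINT s|lborel. innovation_kernel \<kappa> k s powr p) \<le> 1 / (\<kappa> * p)"
    using integrable_exp_decay(2)[OF kp, of "real k"] by simp
qed

lemma integrable_\<psi>_kernel: "integrable lborel (\<lambda>s. \<psi> (u * innovation_kernel \<kappa> k (s - T)))"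
proof -
  obtain D where D: "D > 0" "\<And>v. \<bar>v\<bar> \<le> \<bar>u\<bar> \<Longrightarrow> norm (\<psi> v) \<le> D * \<bar>v\<bar> powr p"
    using growth_bounded[of "\<bar>u\<bar>"] by blast
  have "integrable lborel (\<lambda>s. \<psi> (u * innovation_kernel \<kappa> k s))"
  proof (rule Bochner_Integration.integrable_bound)
    show "integrable lborel (\<lambda>s. D * \<bar>u\<bar> powr p * innovation_kernel \<kappa> k s powr p)"
      by (intro integrable_mult_right kernel_powr_integral)
    show "AE s in lborel. norm (\<psi> (u * innovation_kernel \<kappa> k s)) \<le> norm (D * \<bar>u\<bar> powr p * innovation_kernel \<kappa> k s powr p)"
    proof (intro AE_I2)
      fix s
      have "\<bar>u * innovation_kernel \<kappa> k s\<bar> = \<bar>u\<bar> * innovation_kernel \<kappa> k s"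
        using innovation_kernel_nonneg[of \<kappa> k s] by (simp add: abs_mult)
      moreover have "\<dots> \<le> \<bar>u\<bar> * 1" by (intro mult_left_mono innovation_kernel_le_1 \<kappa>) auto
      ultimately have "norm (\<psi> (u * innovation_kernel \<kappa> k s)) \<le> D * (\<bar>u\<bar> * innovation_kernel \<kappa> k s) powr p"
        using D(2)[of "u * innovation_kernel \<kappa> k s"] by simp
      then show "norm (\<psi> (u * innovation_kernel \<kappa> k s)) \<le> norm (D * \<bar>u\<bar> powr p * innovation_kernel \<kappa> k s powr p)"
        using D innovation_kernel_nonneg[of \<kappa> k s] by (simp add: powr_mult)
    qed
  qed measurable
  from lborel_integrable_real_affine[OF this, of 1 "-T"] show ?thesis by simp
qed

lemma norm_integral_\<psi>_kernel:
  assumes u: "\<bar>u\<bar> \<le> 1"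
  shows "norm (LINT s|lborel. \<psi> (u * innovation_kernel \<kappa> k s)) \<le> C / (\<kappa> * p) * \<bar>u\<bar> powr p"
proof -
  have "norm (LINT s|lborel. \<psi> (u * innovation_kernel \<kappa> k s)) \<le> (LINT s|lborel. norm (\<psi> (u * innovation_kernel \<kappa> k s)))"
    by (rule integral_norm_bound)
  also have "\<dots> \<le> (LINT s|lborel. C * \<bar>u\<bar> powr p * innovation_kernel \<kappa> k s powr p)"
  proof (rule integral_mono)
    show "integrable lborel (\<lambda>s. norm (\<psi> (u * innovation_kernel \<kappa> k s)))"
      using integrable_\<psi>_kernel[of u k 0] by simp
    show "integrable lborel (\<lambda>s. C * \<bar>u\<bar> powr p * innovation_kernel \<kappa> k s powr p)"
      by (intro integrable_mult_right kernel_powr_integral)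
    fix s
    have e: "\<bar>u * innovation_kernel \<kappa> k s\<bar> = \<bar>u\<bar> * innovation_kernel \<kappa> k s"
      using innovation_kernel_nonneg[of \<kappa> k s] by (simp add: abs_mult)
    moreover have "\<bar>u\<bar> * innovation_kernel \<kappa> k s \<le> 1 * 1"
      using u by (intro mult_mono innovation_kernel_le_1 innovation_kernel_nonneg \<kappa>) auto
    ultimately have "norm (\<psi> (u * innovation_kernel \<kappa> k s)) \<le> C * (\<bar>u\<bar> * innovation_kernel \<kappa> k s) powr p"
      using growth[of "u * innovation_kernel \<kappa> k s"] by simp
    then show "norm (\<psi> (u * innovation_kernel \<kappa> k s)) \<le> C * \<bar>u\<bar> powr p * innovation_kernel \<kappa> k s powr p"
      using innovation_kernel_nonneg[of \<kappa> k s] by (simp add: powr_mult mult.assoc)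
  qed
  also have "\<dots> = C * \<bar>u\<bar> powr p * (LINT s|lborel. innovation_kernel \<kappa> k s powr p)" by simp
  also have "\<dots> \<le> C * \<bar>u\<bar> powr p * (1 / (\<kappa> * p))"
    using C by (intro mult_left_mono kernel_powr_integral) auto
  finally show ?thesis by (simp add: mult_ac)
qed

text \<open>
  The kernel of \<open>X (t - 1)\<close>, multiplied by \<open>exp (- \<kappa>)\<close>, is the kernel of \<open>X t\<close> restricted to the
  past of \<open>t - 1\<close>. The difference lives on one unit interval.
\<close>

lemma innov_levy_integral: "has_levy_integral M L (\<lambda>s. innovation_kernel \<kappa> k (s - T)) (innov T k)"
proof (cases k)
  case 0
  have "(\<lambda>s. innovation_kernel \<kappa> 0 (s - T)) = (\<lambda>s. if s \<le> T then exp (- \<kappa> * (T - s)) else 0)"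
    by (auto simp: innovation_kernel_def)
  moreover have "innov T 0 = X T" by (auto simp: innovation_def)
  ultimately show ?thesis using OU[of T] 0 by simp
next
  case (Suc j)
  let ?t = "T + real k"
  have "has_levy_integral M L
     (\<lambda>s. 1 * (if s \<le> ?t then exp (- \<kappa> * (?t - s)) else 0) + (- exp (- \<kappa>)) * (if s \<le> ?t - 1 then exp (- \<kappa> * (?t - 1 - s)) else 0))
     (\<lambda>\<omega>. 1 * X ?t \<omega> + (- exp (- \<kappa>)) * X (?t - 1) \<omega>)"
    by (rule has_levy_integral_linear[OF OU OU])
  moreover have "(\<lambda>s. 1 * (if s \<le> ?t then exp (- \<kappa> * (?t - s)) else 0) + (- exp (- \<kappa>)) * (if s \<le> ?t - 1 then exp (- \<kappa> * (?t - 1 - s)) else 0))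
     = (\<lambda>s. innovation_kernel \<kappa> k (s - T))"
  proof
    fix s
    have "exp (- \<kappa>) * exp (- \<kappa> * (?t - 1 - s)) = exp (- \<kappa> * (?t - s))"
      by (simp add: algebra_simps flip: exp_add)
    moreover have "?t - s = real k - (s - T)" by simp
    ultimately show "1 * (if s \<le> ?t then exp (- \<kappa> * (?t - s)) else 0) + (- exp (- \<kappa>)) * (if s \<le> ?t - 1 then exp (- \<kappa> * (?t - 1 - s)) else 0)
     = innovation_kernel \<kappa> k (s - T)"
      using Suc unfolding innovation_kernel_def by (auto simp del: of_nat_Suc simp: algebra_simps)
  qed
  moreover have "(\<lambda>\<omega>. 1 * X ?t \<omega> + (- exp (- \<kappa>)) * X (?t - 1) \<omega>) = innov T k"
    using Suc by (auto simp: innovation_def)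
  ultimately show ?thesis by simp
qed

lemma cf_innov: "cf M (innov T k) u = exp (LINT s|lborel. \<psi> (u * innovation_kernel \<kappa> k s))"
proof -
  have "cf M (innov T k) u = exp (LINT s|lborel. \<psi> (u * innovation_kernel \<kappa> k (s - T)))"
    by (rule cf_levy_integral[OF innov_levy_integral integrable_\<psi>_kernel])
  also have "(LINT s|lborel. \<psi> (u * innovation_kernel \<kappa> k (s - T))) = (LINT s|lborel. \<psi> (u * innovation_kernel \<kappa> k s))"
    using lborel_integral_real_affine[of 1 "\<lambda>s. \<psi> (u * innovation_kernel \<kappa> k s)" "-T"] by simp
  finally show ?thesis .
qed

lemma innov_law_shift: "distr M borel (innov T k) = distr M borel (innov 0 k)"
  by (rule Levy_uniqueness) (auto simp: cf_innov intro!: real_distribution_distr)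

lemma cf_innov_lower:
  assumes "\<bar>u\<bar> \<le> 1"
  shows "(norm (cf M (innov T k) u))\<^sup>2 \<ge> 1 - 2 * C / (\<kappa> * p) * \<bar>u\<bar> powr p"
proof -
  define z where "z = (LINT s|lborel. \<psi> (u * innovation_kernel \<kappa> k s))"
  have "\<bar>Re z\<bar> \<le> norm z" by (rule abs_Re_le_cmod)
  also have "\<dots> \<le> C / (\<kappa> * p) * \<bar>u\<bar> powr p" unfolding z_def by (rule norm_integral_\<psi>_kernel[OF assms])
  finally have "Re z \<ge> - (C / (\<kappa> * p) * \<bar>u\<bar> powr p)" by linarith
  moreover have "(norm (exp z))\<^sup>2 = exp (2 * Re z)" by (simp add: power2_eq_square flip: exp_add)
  moreover have "exp (2 * Re z) \<ge> 1 + 2 * Re z" by (rule exp_ge_add_one_self)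
  moreover have "2 * C / (\<kappa> * p) * \<bar>u\<bar> powr p = 2 * (C / (\<kappa> * p) * \<bar>u\<bar> powr p)" by simp
  ultimately show ?thesis unfolding cf_innov z_def[symmetric] by linarith
qed

text \<open>
  At each point at most one of the kernels is nonzero and \<open>\<psi>\<close> vanishes at 0. So \<open>\<psi>\<close> of a linear
  combination of the kernels is a sum, and the joint characteristic function is a product.
\<close>

lemma innov_indep: "indep_vars (\<lambda>_. borel) (innov T) UNIV"
proof (rule indep_vars_if_cf_factorizes)
  fix n and b :: "nat \<Rightarrow> real"
  let ?h = "\<lambda>s. \<Sum>k\<le>n. b k * innovation_kernel \<kappa> k (s - T)"
  have "has_levy_integral M L ?h (\<lambda>\<omega>. \<Sum>k\<le>n. b k * innov T k \<omega>)"
  proof (induction n)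
    case 0
    show ?case using has_levy_integral_linear[OF innov_levy_integral[of 0 T] innov_levy_integral[of 0 T], of "b 0" 0] by simp
  next
    case (Suc n)
    show ?case using has_levy_integral_linear[OF Suc innov_levy_integral[of "Suc n" T], of 1 "b (Suc n)"] by simp
  qed
  moreover have split: "\<psi> (1 * ?h s) = (\<Sum>k\<le>n. \<psi> (b k * innovation_kernel \<kappa> k (s - T)))" for s
  proof (cases "\<exists>j\<le>n. innovation_kernel \<kappa> j (s - T) \<noteq> 0")
    case True
    then obtain j where j: "j \<le> n" "innovation_kernel \<kappa> j (s - T) \<noteq> 0" by blast
    have z: "innovation_kernel \<kappa> k (s - T) = 0" if "k \<noteq> j" for k
      using innovation_kernel_disjoint[OF j(2), of k] that by blast
    have "?h s = b j * innovation_kernel \<kappa> j (s - T)"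
      using j z by (subst sum.remove[of _ j]) (auto intro!: sum.neutral)
    moreover have "(\<Sum>k\<le>n. \<psi> (b k * innovation_kernel \<kappa> k (s - T))) = \<psi> (b j * innovation_kernel \<kappa> j (s - T))"
      using j z by (subst sum.remove[of _ j]) (auto intro!: sum.neutral)
    ultimately show ?thesis by simp
  next
    case False
    then have "innovation_kernel \<kappa> k (s - T) = 0" if "k \<le> n" for k using that by blast
    then show ?thesis by simp
  qed
  have "integrable lborel (\<lambda>s. \<psi> (1 * ?h s))"
    unfolding split by (intro Bochner_Integration.integrable_sum integrable_\<psi>_kernel)
  ultimately have "cf M (\<lambda>\<omega>. \<Sum>k\<le>n. b k * innov T k \<omega>) 1 = exp (LINT s|lborel. \<psi> (1 * ?h s))"
    by (rule cf_levy_integral)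
  also have "(LINT s|lborel. \<psi> (1 * ?h s)) = (\<Sum>k\<le>n. LINT s|lborel. \<psi> (b k * innovation_kernel \<kappa> k (s - T)))"
    unfolding split by (intro Bochner_Integration.integral_sum integrable_\<psi>_kernel)
  also have "exp \<dots> = (\<Prod>k\<le>n. exp (LINT s|lborel. \<psi> (b k * innovation_kernel \<kappa> k (s - T))))"
    by (simp add: exp_sum)
  also have "\<dots> = (\<Prod>k\<le>n. cf M (innov T k) (b k))"
    by (intro prod.cong refl cf_levy_integral[symmetric] innov_levy_integral integrable_\<psi>_kernel)
  finally show "cf M (\<lambda>\<omega>. \<Sum>k\<le>n. b k * innov T k \<omega>) 1 = (\<Prod>k\<le>n. cf M (innov T k) (b k))" .
qed simp

end

definition chain :: "real \<Rightarrow> (nat \<Rightarrow> real) \<Rightarrow> nat \<Rightarrow> real" where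
  "chain a x t = (\<Sum>k\<le>t. a ^ (t - k) * x k)"

lemma chain_innovation: "chain a (\<lambda>k. innovation a X T k \<omega>) t = X (T + real t) \<omega>"
proof (induction t)
  case 0
  show ?case by (simp add: chain_def innovation_def)
next
  case (Suc t)
  have "chain a (\<lambda>k. innovation a X T k \<omega>) (Suc t) = (\<Sum>k\<le>t. a ^ (Suc t - k) * innovation a X T k \<omega>) + innovation a X T (Suc t) \<omega>"
    by (simp add: chain_def)
  also have "(\<Sum>k\<le>t. a ^ (Suc t - k) * innovation a X T k \<omega>) = a * chain a (\<lambda>k. innovation a X T k \<omega>) t"
    unfolding chain_def sum_distrib_left by (intro sum.cong refl) (simp add: Suc_diff_le mult.assoc)
  also have "\<dots> = a * X (T + real t) \<omega>" by (simp add: Suc.IH)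
  also have "innovation a X T (Suc t) \<omega> = X (T + real (Suc t)) \<omega> - a * X (T + real t) \<omega>"
    by (simp add: innovation_def)
  finally show ?case by simp
qed

text \<open>
  The form in which the process enters the normal approximation. After any time \<open>T\<close> it is a linear
  recursion with independent inputs. Their laws do not depend on \<open>T\<close>, which is stationarity. Their
  characteristic functions are close to 1 near 0, which bounds small moments of differences of
  independent copies.
\<close>

theorem stable_OU_chain:
  fixes M :: "'a measure"
  assumes M: "prob_space M" and \<beta>: "\<beta> > 0" and \<kappa>: "\<kappa> > 0" and OU: "stable_OU_process \<beta> \<kappa> M L X"
  obtains \<mu> C p where "\<And>k::nat. real_distribution (\<mu> k)" "C \<ge> 0" "0 < p" "p \<le> 1"
    "\<And>k u. \<bar>u\<bar> \<le> 1 \<Longrightarrow> (norm (char (\<mu> k) u))\<^sup>2 \<ge> 1 - C * \<bar>u\<bar> powr p"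
    "\<And>t. X t \<in> borel_measurable M"
    "\<And>T. distr M (PiM UNIV (\<lambda>_. borel)) (\<lambda>\<omega> k. innovation (exp (- \<kappa>)) X T k \<omega>) = PiM UNIV \<mu>"
proof -
  interpret prob_space M by fact
  have st: "stable_levy_process \<beta> M L" using OU by (simp add: stable_OU_process_def)
  have L: "two_sided_levy_process M L" using st by (simp add: stable_levy_process_def)
  obtain \<psi> C p where \<psi>: "continuous_on UNIV \<psi>" "\<psi> 0 = (0::complex)"
    "\<And>s t u. s \<le> t \<Longrightarrow> cf M (\<lambda>\<omega>. L t \<omega> - L s \<omega>) u = exp (of_real (t - s) * \<psi> u)"
    and C': "C > 0" "0 < p" "p \<le> 1" "\<And>u. \<bar>u\<bar> \<le> 1 \<Longrightarrow> norm (\<psi> u) \<le> C * \<bar>u\<bar> powr p"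
    using stable_levy_exponent[OF M st \<beta>] by blast
  have I: "has_levy_integral M L (\<lambda>s. if s \<le> t then exp (- \<kappa> * (t - s)) else 0) (X t)" for t
    using OU by (simp add: stable_OU_process_def)
  obtain \<Lambda> where \<Lambda>: "levy_random_measure M L \<Lambda>" using I[of 0] unfolding has_levy_integral_def by blast
  interpret OU_basis M L \<Lambda> \<psi> X \<kappa> C p
    by unfold_locales (rule \<Lambda> levy_process_measurable[OF L] \<psi> \<kappa> C' I | assumption)+
  define \<mu> where "\<mu> k = distr M borel (innov 0 k)" for k
  show ?thesis
  proof (rule that[of \<mu> "2 * C / (\<kappa> * p)" p])
    show "real_distribution (\<mu> k)" for k unfolding \<mu>_def by (intro real_distribution_distr) simp
    show "(norm (char (\<mu> k) u))\<^sup>2 \<ge> 1 - 2 * C / (\<kappa> * p) * \<bar>u\<bar> powr p" if "\<bar>u\<bar> \<le> 1" for k u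
      unfolding \<mu>_def by (rule cf_innov_lower[OF that])
    show "distr M (PiM UNIV (\<lambda>_. borel)) (\<lambda>\<omega> k. innovation (exp (- \<kappa>)) X T k \<omega>) = PiM UNIV \<mu>" for T
    proof -
      have "distr M (PiM UNIV (\<lambda>_. borel)) (\<lambda>\<omega>. \<lambda>k\<in>UNIV. innov T k \<omega>) = PiM UNIV (\<lambda>k. distr M borel (innov T k))"
        using innov_indep[of T] by (subst (asm) indep_vars_iff_distr_eq_PiM') auto
      also have "(\<lambda>k. distr M borel (innov T k)) = \<mu>" unfolding \<mu>_def using innov_law_shift[of T] by auto
      finally show ?thesis by simp
    qed
  qed (use C' \<kappa> in auto)
qed

section \<open>The normal distribution function and the Mills ratio\<close>

lemma lower_integral_properties:
  fixes k :: "real \<Rightarrow> real"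
  assumes cont: "continuous_on UNIV k" and int: "integrable lborel k"
  defines "F \<equiv> \<lambda>w. LINT x:{..w}|lborel. k x"
  shows "(F has_real_derivative k w) (at w)" "(F \<longlongrightarrow> 0) at_bot" "(F \<longlongrightarrow> (LINT x|lborel. k x)) at_top"
proof -
  have [measurable]: "k \<in> borel_measurable borel" by (rule borel_measurable_continuous_onI[OF cont])
  have si: "set_integrable lborel A k" if "A \<in> sets borel" for A
    unfolding set_integrable_def by (rule integrable_mult_indicator) (use that int in auto)
  have F_eq: "F x = F c + (LBINT y=c..x. k y)" for x c
  proof (cases "c \<le> x")
    case True
    have "F x = (LINT y:({..c} \<union> {c<..x})|lborel. k y)"
      unfolding F_def using True by (intro arg_cong2[where f="set_lebesgue_integral lborel"]) auto
    also have "\<dots> = F c + (LINT y:{c<..x}|lborel. k y)"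
      unfolding F_def by (intro set_integral_Un si) auto
    also have "(LINT y:{c<..x}|lborel. k y) = (LBINT y=c..x. k y)"
      using True by (simp add: interval_integral_Ioc)
    finally show ?thesis .
  next
    case False
    have "F c = (LINT y:({..x} \<union> {x<..c})|lborel. k y)"
      unfolding F_def using False by (intro arg_cong2[where f="set_lebesgue_integral lborel"]) auto
    also have "\<dots> = F x + (LINT y:{x<..c}|lborel. k y)"
      unfolding F_def by (intro set_integral_Un si) auto
    also have "(LINT y:{x<..c}|lborel. k y) = (LBINT y=x..c. k y)"
      using False by (simp add: interval_integral_Ioc)
    finally show ?thesis using interval_integral_endpoints_reverse[of c x k] by simp
  qed
  have "((\<lambda>x. LBINT y=(w-1)..x. k y) has_vector_derivative k w) (at w within {w - 1..w + 1})"
    by (rule interval_integral_FTC2) (auto intro: continuous_on_subset[OF cont])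
  then have "((\<lambda>x. LBINT y=(w-1)..x. k y) has_real_derivative k w) (at w)"
    by (simp add: has_real_derivative_iff_has_vector_derivative at_within_Icc_at)
  then have "((\<lambda>x. F (w-1) + (LBINT y=(w-1)..x. k y)) has_real_derivative k w) (at w)"
    by (auto intro!: derivative_eq_intros)
  then show "(F has_real_derivative k w) (at w)"
    unfolding F_eq[of _ "w-1", symmetric] .
  have "((\<lambda>t. LINT x|lborel. indicator {..-t} x *\<^sub>R k x) \<longlongrightarrow> integral\<^sup>L lborel (\<lambda>x::real. 0::real)) at_top"
  proof (rule integral_dominated_convergence_at_top[where w="\<lambda>x. norm (k x)"])
    show "integrable lborel (\<lambda>x. norm (k x))" using int by simp
    show "\<forall>\<^sub>F t in at_top. AE x in lborel. norm (indicator {..-t} x *\<^sub>R k x) \<le> norm (k x)"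
      by (intro always_eventually allI AE_I2) (auto simp: indicator_def)
    show "AE x in lborel. ((\<lambda>t. indicator {..-t} x *\<^sub>R k x) \<longlongrightarrow> 0) at_top"
    proof (intro AE_I2 tendsto_eventually)
      fix x
      show "\<forall>\<^sub>F t in at_top. indicator {..-t} x *\<^sub>R k x = 0"
        using eventually_gt_at_top[of "-x"] by eventually_elim (auto simp: indicator_def)
    qed
  qed measurable
  then show "(F \<longlongrightarrow> 0) at_bot"
    unfolding filterlim_at_bot_mirror F_def set_lebesgue_integral_def by simp
  show "(F \<longlongrightarrow> (LINT x|lborel. k x)) at_top"
    unfolding F_def set_lebesgue_integral_def by (rule tendsto_integral_at_top) (auto intro: int)
qed

lemma nonneg_if_deriv_nonneg_at_bot:
  fixes D :: "real \<Rightarrow> real"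
  assumes D: "\<And>x. x \<le> w \<Longrightarrow> (D has_real_derivative D' x) (at x)" "\<And>x. x \<le> w \<Longrightarrow> D' x \<ge> 0"
    and lim: "(D \<longlongrightarrow> 0) at_bot"
  shows "D w \<ge> 0"
proof (rule tendsto_upperbound[OF lim])
  show "\<forall>\<^sub>F v in at_bot. D v \<le> D w"
    using eventually_le_at_bot[of w]
  proof eventually_elim
    case (elim v)
    show ?case
      by (rule DERIV_nonneg_imp_nondecreasing[OF elim]) (use D in blast)
  qed
qed simp

lemma nonneg_if_deriv_nonpos_at_top:
  fixes D :: "real \<Rightarrow> real"
  assumes D: "\<And>x. x \<ge> w \<Longrightarrow> (D has_real_derivative D' x) (at x)" "\<And>x. x \<ge> w \<Longrightarrow> D' x \<le> 0"
    and lim: "(D \<longlongrightarrow> 0) at_top"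
  shows "D w \<ge> 0"
proof (rule tendsto_upperbound[OF lim])
  show "\<forall>\<^sub>F v in at_top. D v \<le> D w"
    using eventually_ge_at_top[of w]
  proof eventually_elim
    case (elim v)
    show ?case
      by (rule DERIV_nonpos_imp_nonincreasing[OF elim]) (use D in blast)
  qed
qed simp

abbreviation \<nu> :: "real \<Rightarrow> real" where "\<nu> \<equiv> std_normal_density"

definition std_normal_cdf :: "real \<Rightarrow> real" where
  "std_normal_cdf w = (LINT x:{..w}|lborel. \<nu> x)"

text \<open>The classical Mills ratio of the upper tail, evaluated at \<open>- w\<close>.\<close>

definition mills_ratio :: "real \<Rightarrow> real" where
  "mills_ratio w = std_normal_cdf w / \<nu> w"

lemma \<nu>_pos: "\<nu> w > 0" by (rule normal_density_pos) simp

lemma \<nu>_minus: "\<nu> (- w) = \<nu> w" by (simp add: std_normal_density_def)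

lemma \<nu>_deriv: "(\<nu> has_real_derivative - w * \<nu> w) (at w)"
proof -
  have "((\<lambda>w. c * exp (- w\<^sup>2 / 2)) has_real_derivative - w * (c * exp (- w\<^sup>2 / 2))) (at w)" for c :: real
    by (auto intro!: derivative_eq_intros)
  then show ?thesis unfolding std_normal_density_def[abs_def] .
qed

lemma \<nu>_cont: "continuous_on UNIV \<nu>"
  by (intro continuous_at_imp_continuous_on ballI DERIV_isCont[OF \<nu>_deriv])

lemma \<nu>_integrable: "integrable lborel \<nu>" "(LINT x|lborel. \<nu> x) = 1"
  by (auto intro: integrable_normal_density integral_normal_density)

lemma \<nu>_0_ge: "\<nu> 0 \<ge> 1 / 3"
proof -
  have "sqrt (2 * pi) \<le> sqrt (3\<^sup>2)" using pi_less_4 by (intro real_sqrt_le_mono) simp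
  then have "sqrt (2 * pi) \<le> 3" by simp
  then show ?thesis by (simp add: std_normal_density_def field_simps)
qed

lemma x_\<nu>_tendsto_at_top: "((\<lambda>w. w * \<nu> w) \<longlongrightarrow> 0) at_top"
proof (rule Lim_null_comparison)
  show "\<forall>\<^sub>F w in at_top. norm (w * \<nu> w) \<le> 2 * inverse w"
    using eventually_gt_at_top[of 0]
  proof eventually_elim
    case (elim w)
    have "w\<^sup>2 / 2 \<le> exp (w\<^sup>2 / 2)" using exp_ge_add_one_self[of "w\<^sup>2 / 2"] by linarith
    then have 1: "exp (- w\<^sup>2 / 2) \<le> 2 / w\<^sup>2" using elim by (simp add: exp_minus field_simps)
    have "1 \<le> sqrt (2 * pi)" using pi_gt3 by (intro real_le_rsqrt) simp
    then have "1 / sqrt (2 * pi) \<le> 1" by simp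
    then have "\<nu> w \<le> 1 * (2 / w\<^sup>2)" unfolding std_normal_density_def using 1
      by (intro mult_mono) auto
    then have "w * \<nu> w \<le> w * (2 / w\<^sup>2)" using elim by (intro mult_left_mono) auto
    also have "\<dots> = 2 * inverse w" using elim by (simp add: power2_eq_square field_simps)
    finally show ?case using elim \<nu>_pos[of w] by (simp add: abs_mult)
  qed
  show "((\<lambda>w::real. 2 * inverse w) \<longlongrightarrow> 0) at_top"
    by (intro tendsto_mult_right_zero tendsto_inverse_0_at_top filterlim_ident)
qed

lemma x_\<nu>_tendsto_at_bot: "((\<lambda>w. w * \<nu> w) \<longlongrightarrow> 0) at_bot"
  unfolding filterlim_at_bot_mirror \<nu>_minus using tendsto_minus[OF x_\<nu>_tendsto_at_top] by simp

lemma \<nu>_tendsto_at_top: "(\<nu> \<longlongrightarrow> 0) at_top"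
proof (rule Lim_null_comparison[OF _ x_\<nu>_tendsto_at_top])
  show "\<forall>\<^sub>F w in at_top. norm (\<nu> w) \<le> w * \<nu> w"
    using eventually_ge_at_top[of 1] by eventually_elim (use \<nu>_pos in \<open>auto simp: less_imp_le\<close>)
qed

lemma \<nu>_tendsto_at_bot: "(\<nu> \<longlongrightarrow> 0) at_bot"
  unfolding filterlim_at_bot_mirror \<nu>_minus by (rule \<nu>_tendsto_at_top)

lemma cdf_deriv: "(std_normal_cdf has_real_derivative \<nu> w) (at w)"
  and cdf_at_bot: "(std_normal_cdf \<longlongrightarrow> 0) at_bot"
  and cdf_at_top: "(std_normal_cdf \<longlongrightarrow> 1) at_top"
  using lower_integral_properties[OF \<nu>_cont \<nu>_integrable(1)] \<nu>_integrable(2)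
  unfolding std_normal_cdf_def[abs_def] by auto

lemma cdf_nonneg: "std_normal_cdf w \<ge> 0"
  by (rule nonneg_if_deriv_nonneg_at_bot[OF cdf_deriv _ cdf_at_bot]) (use \<nu>_pos less_imp_le in auto)

lemma cdf_minus: "std_normal_cdf (- w) = 1 - std_normal_cdf w"
proof -
  define D where "D w = std_normal_cdf (- w) + std_normal_cdf w - 1" for w
  have d: "(D has_real_derivative 0) (at x)" for x
    unfolding D_def[abs_def]
    by (auto intro!: derivative_eq_intros DERIV_chain2[of std_normal_cdf] cdf_deriv simp: \<nu>_minus)
  have lim: "(D \<longlongrightarrow> 0) at_top"
  proof -
    have "((\<lambda>w. std_normal_cdf (- w)) \<longlongrightarrow> 0) at_top"
      using cdf_at_bot unfolding filterlim_at_bot_mirror .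
    from tendsto_diff[OF tendsto_add[OF this cdf_at_top] tendsto_const[of 1]] show ?thesis
      unfolding D_def by simp
  qed
  have "D w \<ge> 0" by (rule nonneg_if_deriv_nonpos_at_top[OF d _ lim]) simp
  moreover have "- D w \<ge> 0"
    by (rule nonneg_if_deriv_nonpos_at_top[where D="\<lambda>w. - D w" and D'="\<lambda>_. 0"])
       (use d lim in \<open>auto intro!: derivative_eq_intros tendsto_eq_intros\<close>)
  ultimately show ?thesis by (simp add: D_def)
qed

lemma cdf_le_1: "std_normal_cdf w \<le> 1"
  using cdf_nonneg[of "- w"] cdf_minus[of w] by simp

lemma cdf_mono: assumes "v \<le> w" shows "std_normal_cdf v \<le> std_normal_cdf w"
  using assms
proof (rule DERIV_nonneg_imp_nondecreasing)
  fix x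
  show "\<exists>y. (std_normal_cdf has_real_derivative y) (at x) \<and> 0 \<le> y"
    using cdf_deriv[of x] \<nu>_pos[of x] by (intro exI[of _ "\<nu> x"]) auto
qed

text \<open>
  This bound and the next are the classical inequalities for the normal tail, in a form that is
  meaningful for both signs of \<open>w\<close>. The second follows by integrating the first from minus infinity,
  and says that \<open>w * mills_ratio w\<close> is increasing.
\<close>

lemma mills_lower: "\<nu> w + w * std_normal_cdf w \<ge> 0"
proof (cases "w < 0")
  case True
  define D where "D x = - \<nu> x / x - std_normal_cdf x" for x
  have "D w \<ge> 0"
  proof (rule nonneg_if_deriv_nonneg_at_bot[where D=D and D'="\<lambda>x. \<nu> x / x\<^sup>2"])
    show "(D has_real_derivative \<nu> x / x\<^sup>2) (at x)" if "x \<le> w" for x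
      unfolding D_def[abs_def] using that True
      by (auto intro!: derivative_eq_intros \<nu>_deriv cdf_deriv simp: power2_eq_square field_simps)
    show "\<nu> x / x\<^sup>2 \<ge> 0" for x using \<nu>_pos[of x] by simp
    have "((\<lambda>x. - \<nu> x / x) \<longlongrightarrow> 0) at_bot"
    proof (rule Lim_null_comparison[OF _ \<nu>_tendsto_at_bot])
      show "\<forall>\<^sub>F x in at_bot. norm (- \<nu> x / x) \<le> \<nu> x"
        using eventually_le_at_bot[of "-1"]
      proof eventually_elim
        case (elim x)
        have "\<nu> x * 1 \<le> \<nu> x * \<bar>x\<bar>" using elim \<nu>_pos[of x] by (intro mult_left_mono) auto
        then have "\<nu> x / \<bar>x\<bar> \<le> \<nu> x" using elim by (subst pos_divide_le_eq) auto
        then show ?case using \<nu>_pos[of x] by (simp add: abs_divide)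
      qed
    qed
    from tendsto_diff[OF this cdf_at_bot] show "(D \<longlongrightarrow> 0) at_bot" unfolding D_def by simp
  qed
  then show ?thesis using True by (simp add: D_def field_simps)
next
  case False
  then have "w * std_normal_cdf w \<ge> 0" using cdf_nonneg by (intro mult_nonneg_nonneg) auto
  then show ?thesis using \<nu>_pos[of w] by simp
qed

lemma mills_upper: "(1 + w\<^sup>2) * std_normal_cdf w + w * \<nu> w \<ge> 0"
proof (rule nonneg_if_deriv_nonneg_at_bot[where D="\<lambda>w. (1 + w\<^sup>2) * std_normal_cdf w + w * \<nu> w"
      and D'="\<lambda>x. 2 * (\<nu> x + x * std_normal_cdf x)"])
  show "((\<lambda>w. (1 + w\<^sup>2) * std_normal_cdf w + w * \<nu> w) has_real_derivative 2 * (\<nu> x + x * std_normal_cdf x)) (at x)" for x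
    by (auto intro!: derivative_eq_intros \<nu>_deriv cdf_deriv simp: power2_eq_square algebra_simps)
  show "2 * (\<nu> x + x * std_normal_cdf x) \<ge> 0" for x using mills_lower[of x] by simp
  have "((\<lambda>w. w\<^sup>2 * std_normal_cdf w) \<longlongrightarrow> 0) at_bot"
  proof (rule Lim_null_comparison)
    show "\<forall>\<^sub>F w in at_bot. norm (w\<^sup>2 * std_normal_cdf w) \<le> - (w * \<nu> w)"
      using eventually_le_at_bot[of 0]
    proof eventually_elim
      case (elim w)
      have "(- w) * (- w * std_normal_cdf w) \<le> (- w) * \<nu> w"
        using mills_lower[of w] elim by (intro mult_left_mono) auto
      then show ?case using cdf_nonneg[of w] by (simp add: power2_eq_square abs_mult mult.assoc)
    qed
    show "((\<lambda>w. - (w * \<nu> w)) \<longlongrightarrow> 0) at_bot" using tendsto_minus[OF x_\<nu>_tendsto_at_bot] by simp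
  qed
  from tendsto_add[OF tendsto_add[OF cdf_at_bot this] x_\<nu>_tendsto_at_bot]
  show "((\<lambda>w. (1 + w\<^sup>2) * std_normal_cdf w + w * \<nu> w) \<longlongrightarrow> 0) at_bot"
    by (simp add: algebra_simps)
qed

lemma mills_ratio_deriv: "(mills_ratio has_real_derivative 1 + w * mills_ratio w) (at w)"
  unfolding mills_ratio_def[abs_def] using \<nu>_pos[of w]
  by (auto intro!: derivative_eq_intros \<nu>_deriv cdf_deriv simp: field_simps)

lemma mills_ratio_nonneg: "mills_ratio w \<ge> 0"
  using cdf_nonneg[of w] \<nu>_pos[of w] by (simp add: mills_ratio_def)

lemma x_mills_ratio_ge: "w * mills_ratio w \<ge> - 1"
  using mills_lower[of w] \<nu>_pos[of w] by (simp add: mills_ratio_def field_simps)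

lemma mills_ratio_le: "w \<le> 0 \<Longrightarrow> mills_ratio w \<le> 3"
proof -
  assume "w \<le> 0"
  then have "mills_ratio w \<le> mills_ratio 0"
  proof (rule DERIV_nonneg_imp_nondecreasing)
    fix x assume "w \<le> x" "x \<le> 0"
    show "\<exists>y. (mills_ratio has_real_derivative y) (at x) \<and> 0 \<le> y"
      using mills_ratio_deriv[of x] x_mills_ratio_ge[of x] by (intro exI[of _ "1 + x * mills_ratio x"]) auto
  qed
  also have "mills_ratio 0 \<le> 1 / \<nu> 0" unfolding mills_ratio_def
    using cdf_le_1[of 0] \<nu>_pos[of 0] by (intro divide_right_mono) auto
  also have "\<dots> \<le> 3" using \<nu>_0_ge \<nu>_pos[of 0] by (simp add: field_simps)
  finally show ?thesis .
qed

lemma x_mills_ratio_deriv: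
  "((\<lambda>w. w * mills_ratio w) has_real_derivative ((1 + w\<^sup>2) * std_normal_cdf w + w * \<nu> w) / \<nu> w) (at w)"
proof -
  have "((\<lambda>w. w * mills_ratio w) has_real_derivative mills_ratio w + w * (1 + w * mills_ratio w)) (at w)"
    by (auto intro!: derivative_eq_intros mills_ratio_deriv)
  moreover have "mills_ratio w + w * (1 + w * mills_ratio w) = ((1 + w\<^sup>2) * std_normal_cdf w + w * \<nu> w) / \<nu> w"
    using \<nu>_pos[of w] by (simp add: mills_ratio_def power2_eq_square field_simps)
  ultimately show ?thesis by simp
qed

lemma x_mills_ratio_mono: "v \<le> w \<Longrightarrow> v * mills_ratio v \<le> w * mills_ratio w"
proof (rule DERIV_nonneg_imp_nondecreasing[where f="\<lambda>w. w * mills_ratio w"])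
  fix x
  show "\<exists>y. ((\<lambda>w. w * mills_ratio w) has_real_derivative y) (at x) \<and> 0 \<le> y"
    using x_mills_ratio_deriv[of x] mills_upper[of x] \<nu>_pos[of x]
    by (intro exI[of _ "((1 + x\<^sup>2) * std_normal_cdf x + x * \<nu> x) / \<nu> x"]) auto
qed

lemma x_mills_ratio_cdf_le:
  assumes "v \<le> - w"
  shows "\<bar>w * mills_ratio w\<bar> * std_normal_cdf v \<le> 1"
proof (cases "w \<le> 0")
  case True
  then have "\<bar>w * mills_ratio w\<bar> \<le> 1"
    using x_mills_ratio_ge[of w] mills_ratio_nonneg[of w] by (simp add: abs_le_iff mult_nonpos_nonneg)
  then show ?thesis using cdf_nonneg[of v] cdf_le_1[of v] by (intro mult_le_one) auto
next
  case False
  have "\<bar>w * mills_ratio w\<bar> * std_normal_cdf v \<le> \<bar>w * mills_ratio w\<bar> * std_normal_cdf (- w)"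
    using assms by (intro mult_left_mono cdf_mono) auto
  also have "\<dots> = (w * mills_ratio (- w)) * std_normal_cdf w"
    using False mills_ratio_nonneg[of w] cdf_nonneg[of w] by (simp add: mills_ratio_def \<nu>_minus abs_mult)
  also have "\<dots> \<le> 1"
  proof (rule mult_le_one[OF _ cdf_nonneg cdf_le_1])
    show "w * mills_ratio (- w) \<le> 1" using x_mills_ratio_ge[of "- w"] by simp
  qed
  finally show ?thesis .
qed

section \<open>Solutions of Stein's equation\<close>

text \<open>
  \<open>g\<close> is the bounded solution of \<open>g' w - w * g w = indicator {..z} w - std_normal_cdf z\<close>, a multiple
  of the Mills ratio at \<open>w\<close> to the left of \<open>z\<close> and at \<open>- w\<close> to the right. Its derivative jumps at
  \<open>z\<close>, so differential information is stated for increments: \<open>w * g w\<close> increases and the indicator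
  decreases, hence the mean slope of \<open>g\<close> over \<open>[a, b]\<close> lies between the two bounds obtained by
  evaluating each term at the appropriate end point.
\<close>

lemma stein_solution_indicator:
  fixes z :: real
  obtains g where "continuous_on UNIV g" "\<And>w. \<bar>w * g w\<bar> \<le> 1" "mono (\<lambda>w. w * g w)"
    "\<And>a b. a \<le> b \<Longrightarrow> (b - a) * (a * g a + indicator {..z} b - std_normal_cdf z) \<le> g b - g a"
    "\<And>a b. a \<le> b \<Longrightarrow> g b - g a \<le> (b - a) * (b * g b + indicator {..z} a - std_normal_cdf z)"
proof -
  define P where "P = std_normal_cdf z"
  have P: "0 \<le> P" "P \<le> 1" by (simp_all add: P_def cdf_nonneg cdf_le_1)
  define gl where "gl w = (1 - P) * mills_ratio w" for w
  define gr where "gr w = P * mills_ratio (- w)" for w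
  define g where "g w = (if w \<le> z then gl w else gr w)" for w
  have "gl z = gr z"
    using cdf_minus[of z] by (simp add: gl_def gr_def mills_ratio_def \<nu>_minus P_def)
  then have g_r: "g w = gr w" if "z \<le> w" for w
    using that by (cases "w = z") (auto simp: g_def)
  have g_l: "g w = gl w" if "w \<le> z" for w using that by (simp add: g_def)
  have gl': "(gl has_real_derivative w * gl w + 1 - P) (at w)" for w
    unfolding gl_def[abs_def]
    by (auto intro!: derivative_eq_intros mills_ratio_deriv simp: algebra_simps)
  have gr': "(gr has_real_derivative w * gr w - P) (at w)" for w
    unfolding gr_def[abs_def]
    by (auto intro!: derivative_eq_intros DERIV_chain2[of mills_ratio] mills_ratio_deriv simp: algebra_simps)
  have mono_l: "v * gl v \<le> w * gl w" if "v \<le> w" for v w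
  proof -
    have "(1 - P) * (v * mills_ratio v) \<le> (1 - P) * (w * mills_ratio w)"
      using P by (intro mult_left_mono x_mills_ratio_mono that) auto
    then show ?thesis by (simp add: gl_def mult_ac)
  qed
  have mono_r: "v * gr v \<le> w * gr w" if "v \<le> w" for v w
  proof -
    have "P * ((- w) * mills_ratio (- w)) \<le> P * ((- v) * mills_ratio (- v))"
      using P that by (intro mult_left_mono x_mills_ratio_mono) auto
    then show ?thesis by (simp add: gr_def mult_ac)
  qed
  have mono: "v * g v \<le> w * g w" if "v \<le> w" for v w
  proof -
    consider "w \<le> z" | "z \<le> v" | "v \<le> z" "z \<le> w" by linarith
    then show ?thesis
    proof cases
      case 3
      have "v * g v \<le> z * g z" using mono_l[of v z] 3 by (simp add: g_l)
      also have "\<dots> \<le> w * g w" using mono_r[of z w] 3 by (simp add: g_r)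
      finally show ?thesis .
    qed (use that mono_l mono_r in \<open>auto simp: g_l g_r\<close>)
  qed
  have bound: "\<bar>w * g w\<bar> \<le> 1" for w
  proof (cases "w \<le> z")
    case True
    have "\<bar>w * mills_ratio w\<bar> * std_normal_cdf (- z) \<le> 1"
      using True by (intro x_mills_ratio_cdf_le) simp
    then show ?thesis using True P by (simp add: g_l gl_def cdf_minus P_def abs_mult mult_ac)
  next
    case False
    have "\<bar>(- w) * mills_ratio (- w)\<bar> * std_normal_cdf z \<le> 1"
      using False by (intro x_mills_ratio_cdf_le) simp
    then show ?thesis using False P by (simp add: g_r gr_def P_def abs_mult mult_ac)
  qed
  have cont: "continuous_on UNIV g"
  proof -
    have "continuous_on ({..z} \<union> {z..}) (\<lambda>w. if w \<le> z then gl w else gr w)"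
    proof (rule continuous_on_If)
      show "continuous_on {..z} gl" "continuous_on {z..} gr"
        by (intro continuous_at_imp_continuous_on ballI DERIV_isCont[OF gl'] DERIV_isCont[OF gr'])+
    qed (use \<open>gl z = gr z\<close> in \<open>auto simp: not_le\<close>)
    moreover have "{..z} \<union> {z..} = UNIV" by auto
    ultimately show ?thesis unfolding g_def[abs_def] by simp
  qed
  have inc_l: "(b - a) * (a * g a + 1 - P) \<le> g b - g a \<and> g b - g a \<le> (b - a) * (b * g b + 1 - P)"
    if "a \<le> b" "b \<le> z" for a b
  proof (cases "a = b")
    case False
    then have "a < b" using that by simp
    then obtain c where c: "a < c" "c < b" "gl b - gl a = (b - a) * (c * gl c + 1 - P)"
      using MVT2[of a b gl "\<lambda>w. w * gl w + 1 - P"] gl' by blast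
    have "a * gl a \<le> c * gl c" "c * gl c \<le> b * gl b" using c by (auto intro: mono_l)
    then have "(b - a) * (a * gl a + 1 - P) \<le> gl b - gl a \<and> gl b - gl a \<le> (b - a) * (b * gl b + 1 - P)"
      unfolding c(3) using \<open>a < b\<close> by (intro conjI mult_left_mono) auto
    then show ?thesis using that by (simp add: g_l)
  qed simp
  have inc_r: "(b - a) * (a * g a - P) \<le> g b - g a \<and> g b - g a \<le> (b - a) * (b * g b - P)"
    if "a \<le> b" "z \<le> a" for a b
  proof (cases "a = b")
    case False
    then have "a < b" using that by simp
    then obtain c where c: "a < c" "c < b" "gr b - gr a = (b - a) * (c * gr c - P)"
      using MVT2[of a b gr "\<lambda>w. w * gr w - P"] gr' by blast
    have "a * gr a \<le> c * gr c" "c * gr c \<le> b * gr b" using c by (auto intro: mono_r)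
    then have "(b - a) * (a * gr a - P) \<le> gr b - gr a \<and> gr b - gr a \<le> (b - a) * (b * gr b - P)"
      unfolding c(3) using \<open>a < b\<close> by (intro conjI mult_left_mono) auto
    then show ?thesis using that by (simp add: g_r)
  qed simp
  have inc: "(b - a) * (a * g a + indicator {..z} b - P) \<le> g b - g a \<and>
      g b - g a \<le> (b - a) * (b * g b + indicator {..z} a - P)" if ab: "a \<le> b" for a b
  proof -
    consider "b \<le> z" | "z < a" | "a \<le> z" "z < b" by linarith
    then show ?thesis
    proof cases
      case 1
      then show ?thesis using inc_l[OF ab] ab by (simp add: indicator_def)
    next
      case 2
      then show ?thesis using inc_r[OF ab] ab by (simp add: indicator_def)
    next
      case 3
      have l: "(z - a) * (a * g a + 1 - P) \<le> g z - g a" "g z - g a \<le> (z - a) * (z * g z + 1 - P)"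
        using inc_l[of a z] 3 by auto
      have r: "(b - z) * (z * g z - P) \<le> g b - g z" "g b - g z \<le> (b - z) * (b * g b - P)"
        using inc_r[of z b] 3 by auto
      have "(b - a) * (a * g a + 0 - P) = (z - a) * (a * g a - P) + (b - z) * (a * g a - P)" by (simp add: algebra_simps)
      also have "\<dots> \<le> (z - a) * (a * g a + 1 - P) + (b - z) * (z * g z - P)"
        using 3 mono[of a z] by (intro add_mono mult_left_mono) auto
      also have "\<dots> \<le> g b - g a" using l r by simp
      finally have low: "(b - a) * (a * g a + 0 - P) \<le> g b - g a" .
      have "g b - g a \<le> (z - a) * (z * g z + 1 - P) + (b - z) * (b * g b - P)" using l r by simp
      also have "\<dots> \<le> (z - a) * (b * g b + 1 - P) + (b - z) * (b * g b + 1 - P)"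
        using 3 mono[of z b] by (intro add_mono mult_left_mono) auto
      also have "\<dots> = (b - a) * (b * g b + 1 - P)" by (simp add: algebra_simps)
      finally show ?thesis using low 3 by (simp add: indicator_def)
    qed
  qed
  show ?thesis
    by (rule that[of g]) (use cont bound mono inc in \<open>auto simp: mono_def P_def\<close>)
qed

text \<open>
  The functions \<open>C * std_normal_cdf \<plusminus> u * \<nu>\<close> have the nonnegative derivatives \<open>(C \<plusminus> r) * \<nu>\<close> and
  vanish at minus infinity. Dividing by \<open>\<nu>\<close> bounds \<open>u\<close> by a multiple of the Mills ratio.
\<close>

lemma stein_equation_bound_left:
  fixes u :: "real \<Rightarrow> real"
  assumes u: "\<And>x. (u has_real_derivative x * u x + r x) (at x)" and r: "\<And>x. \<bar>r x\<bar> \<le> C"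
    and lim: "((\<lambda>x. u x * \<nu> x) \<longlongrightarrow> 0) at_bot" and w: "w \<le> 0"
  shows "\<bar>u w\<bar> \<le> 3 * C" "\<bar>w * u w\<bar> \<le> C"
proof -
  have C: "C \<ge> 0" using r[of 0] by linarith
  have D: "\<sigma> * (u w * \<nu> w) \<le> C * std_normal_cdf w" if \<sigma>: "\<bar>\<sigma>\<bar> = 1" for \<sigma> :: real
  proof -
    have "C * std_normal_cdf w - \<sigma> * (u w * \<nu> w) \<ge> 0"
    proof (rule nonneg_if_deriv_nonneg_at_bot[where D="\<lambda>w. C * std_normal_cdf w - \<sigma> * (u w * \<nu> w)" and D'="\<lambda>x. (C - \<sigma> * r x) * \<nu> x"])
      show "((\<lambda>w. C * std_normal_cdf w - \<sigma> * (u w * \<nu> w)) has_real_derivative (C - \<sigma> * r x) * \<nu> x) (at x)" for x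
        by (auto intro!: derivative_eq_intros u \<nu>_deriv cdf_deriv simp: algebra_simps)
      show "(C - \<sigma> * r x) * \<nu> x \<ge> 0" for x
      proof -
        have "\<sigma> * r x \<le> \<bar>\<sigma>\<bar> * \<bar>r x\<bar>" by (metis abs_ge_self abs_mult)
        then have "\<sigma> * r x \<le> C" using r[of x] \<sigma> by simp
        then show ?thesis using \<nu>_pos[of x] by (intro mult_nonneg_nonneg) auto
      qed
      show "((\<lambda>w. C * std_normal_cdf w - \<sigma> * (u w * \<nu> w)) \<longlongrightarrow> 0) at_bot"
        by (rule tendsto_eq_intros refl lim cdf_at_bot | simp)+
    qed
    then show ?thesis by simp
  qed
  have "\<bar>u w\<bar> * \<nu> w \<le> C * std_normal_cdf w"
    using D[of 1] D[of "-1"] \<nu>_pos[of w] by (simp add: abs_if)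
  then have *: "\<bar>u w\<bar> \<le> C * mills_ratio w"
    using \<nu>_pos[of w] by (simp add: mills_ratio_def field_simps)
  also have "\<dots> \<le> C * 3" using C w by (intro mult_left_mono mills_ratio_le)
  finally show "\<bar>u w\<bar> \<le> 3 * C" by simp
  have "\<bar>w * u w\<bar> \<le> \<bar>w\<bar> * (C * mills_ratio w)"
    unfolding abs_mult using * by (intro mult_left_mono) auto
  also have "\<dots> = C * (- (w * mills_ratio w))" using w by simp
  also have "\<dots> \<le> C * 1" using C x_mills_ratio_ge[of w] by (intro mult_left_mono) auto
  finally show "\<bar>w * u w\<bar> \<le> C" by simp
qed

lemma stein_equation_bound:
  fixes u :: "real \<Rightarrow> real"
  assumes u: "\<And>x. (u has_real_derivative x * u x + r x) (at x)" and r: "\<And>x. \<bar>r x\<bar> \<le> C"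
    and lim: "((\<lambda>x. u x * \<nu> x) \<longlongrightarrow> 0) at_bot" "((\<lambda>x. u x * \<nu> x) \<longlongrightarrow> 0) at_top"
  shows "\<bar>u w\<bar> \<le> 3 * C" "\<bar>w * u w\<bar> \<le> C"
proof -
  have "\<bar>u w\<bar> \<le> 3 * C \<and> \<bar>w * u w\<bar> \<le> C"
  proof (cases "w \<le> 0")
    case True
    then show ?thesis using stein_equation_bound_left[OF u r lim(1)] by blast
  next
    case False
    define v where "v x = - u (- x)" for x
    have v: "(v has_real_derivative x * v x + r (- x)) (at x)" for x
      unfolding v_def[abs_def] by (auto intro!: derivative_eq_intros DERIV_chain2[of u] u)
    have "((\<lambda>x. v x * \<nu> x) \<longlongrightarrow> 0) at_bot"
      unfolding filterlim_at_bot_mirror using tendsto_minus[OF lim(2)] by (simp add: v_def \<nu>_minus)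
    from stein_equation_bound_left[OF v r this, of "- w"] False show ?thesis by (simp add: v_def)
  qed
  then show "\<bar>u w\<bar> \<le> 3 * C" "\<bar>w * u w\<bar> \<le> C" by auto
qed

abbreviation normal_mean :: "(real \<Rightarrow> real) \<Rightarrow> real" where
  "normal_mean h \<equiv> (LINT x|lborel. \<nu> x * h x)"

lemma lipschitz_normal_integrable:
  fixes h :: "real \<Rightarrow> real"
  assumes h: "1-lipschitz_on UNIV h"
  shows "integrable lborel (\<lambda>x. \<nu> x * h x)" "\<bar>h x - normal_mean h\<bar> \<le> \<bar>x\<bar> + 1"
proof -
  have hl: "\<bar>h x - h y\<bar> \<le> \<bar>x - y\<bar>" for x y
    using lipschitz_onD[OF h, of x y] by (simp add: dist_real_def)
  have [measurable]: "h \<in> borel_measurable borel"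
    by (rule borel_measurable_continuous_onI) (rule lipschitz_on_continuous_on[OF h])
  have i1: "integrable lborel (\<lambda>x. \<nu> x * \<bar>x\<bar>)" using integrable_std_normal_moment_abs[of 1] by simp
  have i2: "integrable lborel (\<lambda>y. \<nu> y * (\<bar>x\<bar> + \<bar>y\<bar>))" for x
    using i1 \<nu>_integrable(1) by (simp add: ring_distribs)
  have i3: "integrable lborel (\<lambda>y. \<nu> y * (h x - h y))" for x
  proof (rule Bochner_Integration.integrable_bound[OF i2[of x]])
    show "AE y in lborel. norm (\<nu> y * (h x - h y)) \<le> norm (\<nu> y * (\<bar>x\<bar> + \<bar>y\<bar>))"
    proof (intro AE_I2)
      fix y
      have "\<bar>h x - h y\<bar> \<le> \<bar>x\<bar> + \<bar>y\<bar>" using hl[of x y] by linarith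
      then show "norm (\<nu> y * (h x - h y)) \<le> norm (\<nu> y * (\<bar>x\<bar> + \<bar>y\<bar>))"
        using \<nu>_pos[of y] by (simp add: abs_mult)
    qed
  qed measurable
  have "integrable lborel (\<lambda>y. \<nu> y * h 0 - \<nu> y * (h 0 - h y))"
    using i3[of 0] \<nu>_integrable(1) by (intro Bochner_Integration.integrable_diff) auto
  then show int: "integrable lborel (\<lambda>x. \<nu> x * h x)" by (simp add: algebra_simps)
  have m1: "(LINT x|lborel. \<nu> x * \<bar>x\<bar>) \<le> 1"
  proof -
    have "(LINT x|lborel. \<nu> x * \<bar>x\<bar>) = sqrt (2 / pi)"
      using integral_std_normal_moment_abs_odd[of 0] by simp
    also have "\<dots> \<le> 1" using pi_gt3 by (simp add: real_sqrt_le_1_iff field_simps)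
    finally show ?thesis .
  qed
  have "h x - normal_mean h = (LINT y|lborel. \<nu> y * h x) - normal_mean h"
    using \<nu>_integrable by simp
  also have "\<dots> = (LINT y|lborel. \<nu> y * h x - \<nu> y * h y)"
    using int \<nu>_integrable(1) by (intro Bochner_Integration.integral_diff[symmetric]) auto
  also have "\<bar>\<dots>\<bar> \<le> (LINT y|lborel. \<bar>\<nu> y * h x - \<nu> y * h y\<bar>)" by (rule integral_abs_bound)
  also have "\<dots> \<le> (LINT y|lborel. \<nu> y * (\<bar>x\<bar> + \<bar>y\<bar>))"
  proof (rule integral_mono)
    show "integrable lborel (\<lambda>y. \<bar>\<nu> y * h x - \<nu> y * h y\<bar>)" using i3[of x] by (simp add: right_diff_distrib)
    fix y
    have "\<bar>h x - h y\<bar> \<le> \<bar>x\<bar> + \<bar>y\<bar>" using hl[of x y] by linarith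
    then have "\<nu> y * \<bar>h x - h y\<bar> \<le> \<nu> y * (\<bar>x\<bar> + \<bar>y\<bar>)" using \<nu>_pos[of y] by (intro mult_left_mono) auto
    moreover have "\<bar>\<nu> y * h x - \<nu> y * h y\<bar> = \<nu> y * \<bar>h x - h y\<bar>"
      using \<nu>_pos[of y] by (simp add: abs_mult flip: right_diff_distrib)
    ultimately show "\<bar>\<nu> y * h x - \<nu> y * h y\<bar> \<le> \<nu> y * (\<bar>x\<bar> + \<bar>y\<bar>)" by simp
  qed (rule i2)
  also have "\<dots> = \<bar>x\<bar> + (LINT y|lborel. \<nu> y * \<bar>y\<bar>)"
    using i1 \<nu>_integrable by (simp add: ring_distribs)
  finally show "\<bar>h x - normal_mean h\<bar> \<le> \<bar>x\<bar> + 1" using m1 by linarith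
qed

text \<open>
  The solution is \<open>g = F / \<nu>\<close>, with \<open>F\<close> the integral of \<open>\<nu> * (h - m)\<close> up to the given point. As \<open>F\<close>
  also vanishes at plus infinity, \<open>g\<close> is bounded. Differentiating the Stein equation shows that \<open>u =
  g'\<close> solves an equation of the same kind, \<open>u' = x u + (g + h')\<close>, whose inhomogeneous term is
  bounded by \<open>4 + 1\<close>. So the preceding lemma bounds \<open>u\<close> and \<open>x u\<close>, and with them \<open>u'\<close>.
\<close>

lemma stein_solution_smooth:
  fixes h h' :: "real \<Rightarrow> real"
  assumes h: "\<And>x. (h has_real_derivative h' x) (at x)" and h'_le: "\<And>x. \<bar>h' x\<bar> \<le> 1"
  obtains g u where "\<And>x. (g has_real_derivative u x) (at x)" "\<And>x. u x - x * g x = h x - normal_mean h"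
    "\<And>x. \<bar>u x\<bar> \<le> 15" "\<And>x y. \<bar>u x - u y\<bar> \<le> 10 * \<bar>x - y\<bar>"
proof -
  have lip: "1-lipschitz_on UNIV h"
  proof (rule lipschitz_onI)
    fix x y
    show "dist (h x) (h y) \<le> 1 * dist x y"
      unfolding dist_real_def real_norm_def[symmetric]
      by (rule field_differentiable_bound[of UNIV h h' 1]) (use h h'_le in auto)
  qed simp
  define m where "m = normal_mean h"
  define k where "k x = \<nu> x * (h x - m)" for x
  have k_le: "\<bar>k x\<bar> \<le> (\<bar>x\<bar> + 1) * \<nu> x" for x
  proof -
    have "\<nu> x * \<bar>h x - m\<bar> \<le> \<nu> x * (\<bar>x\<bar> + 1)"
      unfolding m_def using \<nu>_pos[of x] by (intro mult_left_mono lipschitz_normal_integrable[OF lip]) auto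
    then show ?thesis using \<nu>_pos[of x] by (simp add: k_def abs_mult mult.commute)
  qed
  have hcont: "continuous_on UNIV h" by (rule lipschitz_on_continuous_on[OF lip])
  have kcont: "continuous_on UNIV k" unfolding k_def by (intro continuous_intros \<nu>_cont hcont)
  have kint: "integrable lborel k" "(LINT x|lborel. k x) = 0"
    unfolding k_def right_diff_distrib using lipschitz_normal_integrable(1)[OF lip] \<nu>_integrable by (simp_all add: m_def)
  define F where "F w = (LINT x:{..w}|lborel. k x)" for w
  have F: "(F has_real_derivative k w) (at w)" "(F \<longlongrightarrow> 0) at_bot" "(F \<longlongrightarrow> 0) at_top" for w
    using lower_integral_properties[OF kcont kint(1)] kint(2) unfolding F_def[abs_def] by auto
  have F_left: "\<bar>F w\<bar> \<le> \<nu> w + std_normal_cdf w" if "w \<le> 0" for w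
  proof -
    have "\<sigma> * F w \<le> \<nu> w + std_normal_cdf w" if \<sigma>: "\<bar>\<sigma>\<bar> = 1" for \<sigma> :: real
    proof -
      have "\<nu> w + std_normal_cdf w - \<sigma> * F w \<ge> 0"
      proof (rule nonneg_if_deriv_nonneg_at_bot[where D="\<lambda>w. \<nu> w + std_normal_cdf w - \<sigma> * F w" and D'="\<lambda>x. (- x + 1) * \<nu> x - \<sigma> * k x"])
        show "((\<lambda>w. \<nu> w + std_normal_cdf w - \<sigma> * F w) has_real_derivative (- x + 1) * \<nu> x - \<sigma> * k x) (at x)" for x
          by (auto intro!: derivative_eq_intros \<nu>_deriv cdf_deriv F simp: algebra_simps)
        show "(- x + 1) * \<nu> x - \<sigma> * k x \<ge> 0" if "x \<le> w" for x
        proof -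
          have "\<sigma> * k x \<le> \<bar>\<sigma>\<bar> * \<bar>k x\<bar>" by (metis abs_ge_self abs_mult)
          then show ?thesis using k_le[of x] \<sigma> that \<open>w \<le> 0\<close> by simp
        qed
        show "((\<lambda>w. \<nu> w + std_normal_cdf w - \<sigma> * F w) \<longlongrightarrow> 0) at_bot"
          by (rule tendsto_eq_intros refl F \<nu>_tendsto_at_bot cdf_at_bot | simp)+
      qed
      then show ?thesis by simp
    qed
    from this[of 1] this[of "-1"] show ?thesis by (simp add: abs_if)
  qed
  have F_right: "\<bar>F w\<bar> \<le> \<nu> w + std_normal_cdf (- w)" if "w \<ge> 0" for w
  proof -
    have "\<sigma> * F w \<le> \<nu> w + (1 - std_normal_cdf w)" if \<sigma>: "\<bar>\<sigma>\<bar> = 1" for \<sigma> :: real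
    proof -
      have "\<nu> w + (1 - std_normal_cdf w) - \<sigma> * F w \<ge> 0"
      proof (rule nonneg_if_deriv_nonpos_at_top[where D="\<lambda>w. \<nu> w + (1 - std_normal_cdf w) - \<sigma> * F w" and D'="\<lambda>x. - (x + 1) * \<nu> x - \<sigma> * k x"])
        show "((\<lambda>w. \<nu> w + (1 - std_normal_cdf w) - \<sigma> * F w) has_real_derivative - (x + 1) * \<nu> x - \<sigma> * k x) (at x)" for x
          by (auto intro!: derivative_eq_intros \<nu>_deriv cdf_deriv F simp: algebra_simps)
        show "- (x + 1) * \<nu> x - \<sigma> * k x \<le> 0" if "x \<ge> w" for x
        proof -
          have "- (\<sigma> * k x) \<le> \<bar>\<sigma>\<bar> * \<bar>k x\<bar>" by (metis abs_ge_minus_self abs_mult)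
          then have "- (\<sigma> * k x) \<le> (x + 1) * \<nu> x" using k_le[of x] \<sigma> that \<open>w \<ge> 0\<close> by simp
          then show ?thesis unfolding mult_minus_left by linarith
        qed
        show "((\<lambda>w. \<nu> w + (1 - std_normal_cdf w) - \<sigma> * F w) \<longlongrightarrow> 0) at_top"
          by (rule tendsto_eq_intros refl F \<nu>_tendsto_at_top cdf_at_top | simp)+
      qed
      then show ?thesis by simp
    qed
    from this[of 1] this[of "-1"] show ?thesis by (simp add: abs_if cdf_minus)
  qed
  define g where "g w = F w / \<nu> w" for w
  have g_le: "\<bar>g w\<bar> \<le> 4" for w
  proof (cases "w \<le> 0")
    case True
    have "\<bar>g w\<bar> = \<bar>F w\<bar> / \<nu> w" using \<nu>_pos[of w] by (simp add: g_def)
    also have "\<dots> \<le> (\<nu> w + std_normal_cdf w) / \<nu> w"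
      using F_left[OF True] \<nu>_pos[of w] by (intro divide_right_mono) auto
    also have "\<dots> = 1 + mills_ratio w" using \<nu>_pos[of w] by (simp add: mills_ratio_def field_simps)
    finally show ?thesis using mills_ratio_le[OF True] by simp
  next
    case False
    have "\<bar>g w\<bar> = \<bar>F w\<bar> / \<nu> w" using \<nu>_pos[of w] by (simp add: g_def)
    also have "\<dots> \<le> (\<nu> w + std_normal_cdf (- w)) / \<nu> w"
      using F_right[of w] False \<nu>_pos[of w] by (intro divide_right_mono) auto
    also have "\<dots> = 1 + mills_ratio (- w)" using \<nu>_pos[of w] by (simp add: mills_ratio_def \<nu>_minus field_simps)
    finally show ?thesis using mills_ratio_le[of "- w"] False by simp
  qed
  define u where "u w = w * g w + (h w - m)" for w
  have g': "(g has_real_derivative u w) (at w)" for w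
    unfolding g_def[abs_def] u_def using \<nu>_pos[of w]
    by (auto intro!: derivative_eq_intros F \<nu>_deriv simp: k_def g_def field_simps)
  define r where "r w = g w + h' w" for w
  have u': "(u has_real_derivative w * u w + r w) (at w)" for w
    unfolding u_def[abs_def] by (auto intro!: derivative_eq_intros g' h simp: r_def u_def)
  have r_le: "\<bar>r w\<bar> \<le> 5" for w using g_le[of w] h'_le[of w] by (simp add: r_def)
  have u_lin: "\<bar>u x * \<nu> x\<bar> \<le> 5 * \<bar>x * \<nu> x\<bar> + \<nu> x" for x
  proof -
    have "\<bar>u x\<bar> \<le> \<bar>x\<bar> * \<bar>g x\<bar> + \<bar>h x - m\<bar>" unfolding u_def abs_mult[symmetric] by (rule abs_triangle_ineq)
    also have "\<dots> \<le> \<bar>x\<bar> * 4 + (\<bar>x\<bar> + 1)"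
      unfolding m_def by (intro add_mono mult_left_mono g_le lipschitz_normal_integrable[OF lip]) auto
    finally have "\<bar>u x\<bar> * \<nu> x \<le> (5 * \<bar>x\<bar> + 1) * \<nu> x" using \<nu>_pos[of x] by (intro mult_right_mono) auto
    then show ?thesis using \<nu>_pos[of x] by (simp add: abs_mult algebra_simps)
  qed
  have lim: "((\<lambda>x. u x * \<nu> x) \<longlongrightarrow> 0) at_bot" "((\<lambda>x. u x * \<nu> x) \<longlongrightarrow> 0) at_top"
  proof -
    have b: "((\<lambda>x. 5 * \<bar>x * \<nu> x\<bar> + \<nu> x) \<longlongrightarrow> 0) at_bot" "((\<lambda>x. 5 * \<bar>x * \<nu> x\<bar> + \<nu> x) \<longlongrightarrow> 0) at_top"
      by (rule tendsto_eq_intros refl x_\<nu>_tendsto_at_bot x_\<nu>_tendsto_at_top \<nu>_tendsto_at_bot \<nu>_tendsto_at_top | simp)+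
    show "((\<lambda>x. u x * \<nu> x) \<longlongrightarrow> 0) at_bot"
      by (rule Lim_null_comparison[OF _ b(1)]) (auto intro!: always_eventually u_lin)
    show "((\<lambda>x. u x * \<nu> x) \<longlongrightarrow> 0) at_top"
      by (rule Lim_null_comparison[OF _ b(2)]) (auto intro!: always_eventually u_lin)
  qed
  have u_le: "\<bar>u x\<bar> \<le> 3 * 5" "\<bar>x * u x\<bar> \<le> 5" for x
    using stein_equation_bound[OF u' r_le lim] by auto
  have u'_le: "\<bar>w * u w + r w\<bar> \<le> 10" for w using u_le(2)[of w] r_le[of w] by linarith
  have "\<bar>u x - u y\<bar> \<le> 10 * \<bar>x - y\<bar>" for x y
    unfolding real_norm_def[symmetric]
    by (rule field_differentiable_bound[of UNIV u "\<lambda>w. w * u w + r w" 10])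
       (use u' u'_le in \<open>auto intro: has_field_derivative_at_within\<close>)
  with g' u_le(1) show ?thesis
    by (intro that[of g u]) (auto simp: u_def m_def)
qed

text \<open>
  Averaging a Lipschitz function over \<open>[x, x + e]\<close> makes it differentiable without increasing the
  Lipschitz constant, and moves it by at most \<open>e\<close>. The bounds on the solution do not depend on \<open>e\<close>.
\<close>

lemma stein_solution_lipschitz:
  fixes h :: "real \<Rightarrow> real"
  assumes h: "1-lipschitz_on UNIV h" and e: "e > 0"
  obtains g u where "\<And>x. (g has_real_derivative u x) (at x)"
    "\<And>x. \<bar>(u x - x * g x) - (h x - normal_mean h)\<bar> \<le> 2 * e"
    "\<And>x. \<bar>u x\<bar> \<le> 15" "\<And>x y. \<bar>u x - u y\<bar> \<le> 10 * \<bar>x - y\<bar>"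
proof -
  have hl: "\<bar>h x - h y\<bar> \<le> \<bar>x - y\<bar>" for x y
    using lipschitz_onD[OF h, of x y] by (simp add: dist_real_def)
  have cont: "continuous_on UNIV h" by (rule lipschitz_on_continuous_on[OF h])
  define H where "H x = (LBINT y=0..x. h y)" for x :: real
  have H: "(H has_real_derivative h x) (at x)" for x
  proof -
    have "(at x within {min 0 (x - 1)..max 0 (x + 1)}) = at x"
      by (intro at_within_interior) auto
    moreover have "((\<lambda>u. LBINT y=0..u. h y) has_vector_derivative h x) (at x within {min 0 (x - 1)..max 0 (x + 1)})"
      using interval_integral_FTC2[of "min 0 (x - 1)" 0 "max 0 (x + 1)" h x] continuous_on_subset[OF cont]
      by (simp add: zero_ereal_def)
    ultimately show ?thesis
      by (simp add: H_def[abs_def] has_real_derivative_iff_has_vector_derivative)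
  qed
  define k where "k x = (H (x + e) - H x) / e" for x
  have k': "(k has_real_derivative (h (x + e) - h x) / e) (at x)" for x
    unfolding k_def[abs_def] using e
    by (auto intro!: derivative_eq_intros DERIV_chain2[of H] H)
  have k'_le: "\<bar>(h (x + e) - h x) / e\<bar> \<le> 1" for x
    using hl[of "x + e" x] e by (simp add: abs_divide divide_le_eq)
  have near: "\<bar>k x - h x\<bar> \<le> e" for x
  proof -
    obtain c where c: "x < c" "c < x + e" "H (x + e) - H x = (x + e - x) * h c"
      using MVT2[of x "x + e" H h] H e by auto
    then have "k x = h c" using e by (simp add: k_def)
    then show ?thesis using hl[of c x] c by simp
  qed
  obtain g u where gu: "\<And>x. (g has_real_derivative u x) (at x)" "\<And>x. u x - x * g x = k x - normal_mean k"
    "\<And>x. \<bar>u x\<bar> \<le> 15" "\<And>x y. \<bar>u x - u y\<bar> \<le> 10 * \<bar>x - y\<bar>"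
    using stein_solution_smooth[OF k' k'_le] by blast
  have kcont: "continuous_on UNIV k" by (intro continuous_at_imp_continuous_on ballI DERIV_isCont[OF k'])
  have lk: "1-lipschitz_on UNIV k"
  proof (rule lipschitz_onI)
    fix x y
    show "dist (k x) (k y) \<le> 1 * dist x y"
      unfolding dist_real_def real_norm_def[symmetric]
      by (rule field_differentiable_bound[of UNIV k "\<lambda>x. (h (x + e) - h x) / e" 1]) (use k' k'_le in auto)
  qed simp
  have "\<bar>normal_mean k - normal_mean h\<bar> \<le> e"
  proof -
    have i: "integrable lborel (\<lambda>x. \<nu> x * (k x - h x))"
      unfolding right_diff_distrib
      by (intro Bochner_Integration.integrable_diff lipschitz_normal_integrable[OF lk] lipschitz_normal_integrable[OF h])
    have "normal_mean k - normal_mean h = (LINT x|lborel. \<nu> x * (k x - h x))"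
      unfolding right_diff_distrib
      by (intro Bochner_Integration.integral_diff[symmetric] lipschitz_normal_integrable[OF lk] lipschitz_normal_integrable[OF h])
    also have "\<bar>\<dots>\<bar> \<le> (LINT x|lborel. \<bar>\<nu> x * (k x - h x)\<bar>)" by (rule integral_abs_bound)
    also have "\<dots> \<le> (LINT x|lborel. \<nu> x * e)"
    proof (rule integral_mono)
      show "integrable lborel (\<lambda>x. \<bar>\<nu> x * (k x - h x)\<bar>)" using i by simp
      show "integrable lborel (\<lambda>x. \<nu> x * e)" using \<nu>_integrable by simp
      show "\<bar>\<nu> x * (k x - h x)\<bar> \<le> \<nu> x * e" for x
        using near[of x] \<nu>_pos[of x] by (simp add: abs_mult)
    qed
    also have "\<dots> = e" using \<nu>_integrable by simp
    finally show ?thesis .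
  qed
  then have "\<bar>(u x - x * g x) - (h x - normal_mean h)\<bar> \<le> 2 * e" for x
    using near[of x] unfolding gu(2) by linarith
  with gu show ?thesis by (intro that[of g u]) auto
qed

section \<open>Resampling independent inputs\<close>

text \<open>
  The bound holds at every point and not only almost everywhere, so that it survives composition
  with the coordinate changes below under any of the measures involved.
\<close>

definition bounded_measurable :: "'a measure \<Rightarrow> ('a \<Rightarrow> real) \<Rightarrow> bool" where
  "bounded_measurable M f \<longleftrightarrow> f \<in> borel_measurable M \<and> (\<exists>B. \<forall>x. \<bar>f x\<bar> \<le> B)"

named_theorems bm_intros

lemma bounded_measurableI: "f \<in> borel_measurable M \<Longrightarrow> (\<And>x. \<bar>f x\<bar> \<le> B) \<Longrightarrow> bounded_measurable M f"
  by (auto simp: bounded_measurable_def)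

lemma bounded_measurable_measurable: "bounded_measurable M f \<Longrightarrow> f \<in> borel_measurable M"
  by (simp add: bounded_measurable_def)

lemma (in prob_space) bounded_measurable_integrable: "bounded_measurable M f \<Longrightarrow> integrable M f"
  unfolding bounded_measurable_def by (elim conjE exE, rule integrable_const_bound) auto

lemma bounded_measurable_const [bm_intros]: "bounded_measurable M (\<lambda>_. c)"
  by (rule bounded_measurableI[where B="\<bar>c\<bar>"]) auto

lemma bounded_measurable_add [bm_intros]:
  assumes "bounded_measurable M f" "bounded_measurable M g"
  shows "bounded_measurable M (\<lambda>x. f x + g x)"
proof -
  obtain B C where "\<And>x. \<bar>f x\<bar> \<le> B" "\<And>x. \<bar>g x\<bar> \<le> C" using assms by (auto simp: bounded_measurable_def)
  then have "\<bar>f x + g x\<bar> \<le> B + C" for x by (meson abs_triangle_ineq add_mono order_trans)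
  then show ?thesis using assms by (auto simp: bounded_measurable_def)
qed

lemma bounded_measurable_mult [bm_intros]:
  assumes "bounded_measurable M f" "bounded_measurable M g"
  shows "bounded_measurable M (\<lambda>x. f x * g x)"
proof -
  obtain B C where "\<And>x. \<bar>f x\<bar> \<le> B" "\<And>x. \<bar>g x\<bar> \<le> C" using assms by (auto simp: bounded_measurable_def)
  then have "\<bar>f x * g x\<bar> \<le> B * C" for x unfolding abs_mult by (meson abs_ge_zero mult_mono order_trans)
  then show ?thesis using assms by (auto simp: bounded_measurable_def)
qed

lemma bounded_measurable_minus [bm_intros]: "bounded_measurable M f \<Longrightarrow> bounded_measurable M (\<lambda>x. - f x)"
  by (auto simp: bounded_measurable_def)

lemma bounded_measurable_diff [bm_intros]:
  "bounded_measurable M f \<Longrightarrow> bounded_measurable M g \<Longrightarrow> bounded_measurable M (\<lambda>x. f x - g x)"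
  using bounded_measurable_add[OF _ bounded_measurable_minus, of M f g] by simp

lemma bounded_measurable_abs [bm_intros]: "bounded_measurable M f \<Longrightarrow> bounded_measurable M (\<lambda>x. \<bar>f x\<bar>)"
  by (auto simp: bounded_measurable_def)

lemma bounded_measurable_divide [bm_intros]: "bounded_measurable M f \<Longrightarrow> bounded_measurable M (\<lambda>x. f x / c)"
  using bounded_measurable_mult[OF _ bounded_measurable_const, of M f "inverse c"] by (simp add: divide_inverse)

lemma bounded_measurable_power [bm_intros]: "bounded_measurable M f \<Longrightarrow> bounded_measurable M (\<lambda>x. f x ^ n)"
  by (induction n) (auto intro: bm_intros)

lemma bounded_measurable_sum [bm_intros]:
  "(\<And>i. i \<in> I \<Longrightarrow> bounded_measurable M (f i)) \<Longrightarrow> bounded_measurable M (\<lambda>x. \<Sum>i\<in>I. f i x)"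
  by (induction I rule: infinite_finite_induct) (auto intro: bm_intros)

lemma bounded_measurable_compose:
  "bounded_measurable N f \<Longrightarrow> T \<in> measurable M N \<Longrightarrow> bounded_measurable M (\<lambda>x. f (T x))"
  by (auto simp: bounded_measurable_def intro: measurable_compose)

abbreviation seq_borel :: "(nat \<Rightarrow> real) measure" where
  "seq_borel \<equiv> PiM UNIV (\<lambda>_. borel)"

text \<open>
  Under the doubled law the entries of \<open>\<omega>\<close> at even and at odd positions are two independent copies
  of one sequence of inputs. The maps below pass from the first copy to the second: \<open>mix k\<close> has
  replaced the first \<open>k\<close> inputs and \<open>resample k\<close> only the \<open>k\<close>-th. Exchanging the two members of a
  pair leaves the law invariant; \<open>swap_pairs P\<close> does so for all pairs \<open>i\<close> with \<open>P i\<close>. The covariance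
  identity and the Efron-Stein inequality come from such exchanges.
\<close>

definition even_part :: "(nat \<Rightarrow> real) \<Rightarrow> nat \<Rightarrow> real" where "even_part \<omega> i = \<omega> (2 * i)"
definition odd_part :: "(nat \<Rightarrow> real) \<Rightarrow> nat \<Rightarrow> real" where "odd_part \<omega> i = \<omega> (2 * i + 1)"
definition mix :: "nat \<Rightarrow> (nat \<Rightarrow> real) \<Rightarrow> nat \<Rightarrow> real" where
  "mix k \<omega> i = (if i < k then \<omega> (2 * i + 1) else \<omega> (2 * i))"
definition resample :: "nat \<Rightarrow> (nat \<Rightarrow> real) \<Rightarrow> nat \<Rightarrow> real" where
  "resample k \<omega> i = (if i = k then \<omega> (2 * i + 1) else \<omega> (2 * i))"
definition doubled :: "(nat \<Rightarrow> real measure) \<Rightarrow> nat \<Rightarrow> real measure" where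
  "doubled \<mu> j = \<mu> (j div 2)"
definition swap_pairs :: "(nat \<Rightarrow> bool) \<Rightarrow> nat \<Rightarrow> nat" where
  "swap_pairs P j = (if P (j div 2) then (if even j then j + 1 else j - 1) else j)"

definition depends_below :: "nat \<Rightarrow> ((nat \<Rightarrow> real) \<Rightarrow> real) \<Rightarrow> bool" where
  "depends_below n F \<longleftrightarrow> (\<forall>x y. (\<forall>i<n. x i = y i) \<longrightarrow> F x = F y)"

lemma seq_map_measurable:
  assumes "\<And>i. (\<lambda>\<omega>. T \<omega> i) \<in> borel_measurable seq_borel"
  shows "T \<in> measurable seq_borel seq_borel"
  by (rule measurable_abs_UNIV[where f="\<lambda>i \<omega>. T \<omega> i", OF assms])

lemma coordinate_measurable [measurable]: "(\<lambda>\<omega>. \<omega> i) \<in> borel_measurable seq_borel"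
  by (rule measurable_component_singleton) simp

lemma parts_measurable [measurable]:
  "even_part \<in> measurable seq_borel seq_borel" "odd_part \<in> measurable seq_borel seq_borel"
  "mix k \<in> measurable seq_borel seq_borel" "resample k \<in> measurable seq_borel seq_borel"
  by (rule seq_map_measurable; unfold even_part_def odd_part_def mix_def resample_def; simp)+

lemma swap_pairs_div2 [simp]: "swap_pairs P j div 2 = j div 2"
  by (auto simp: swap_pairs_def elim!: oddE)

lemma swap_pairs_swap_pairs [simp]: "swap_pairs P (swap_pairs P j) = j"
  unfolding swap_pairs_def[of P "swap_pairs P j"] swap_pairs_div2
  by (auto simp: swap_pairs_def)

lemma inj_swap_pairs: "inj (swap_pairs P)"
  by (rule inj_on_inverseI[of _ "swap_pairs P"]) simp

lemma swap_pairs_even: "swap_pairs P (2 * i) = (if P i then 2 * i + 1 else 2 * i)"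
  by (simp add: swap_pairs_def)

lemma swap_pairs_odd: "swap_pairs P (Suc (2 * i)) = (if P i then 2 * i else Suc (2 * i))"
  by (simp add: swap_pairs_def)

lemma swap_single:
  "even_part (\<lambda>j. \<omega> (swap_pairs ((=) k) j)) = resample k \<omega>"
  "resample k (\<lambda>j. \<omega> (swap_pairs ((=) k) j)) = even_part \<omega>"
  "mix k (\<lambda>j. \<omega> (swap_pairs ((=) k) j)) = mix (Suc k) \<omega>"
  "mix (Suc k) (\<lambda>j. \<omega> (swap_pairs ((=) k) j)) = mix k \<omega>"
  by (auto simp: fun_eq_iff even_part_def resample_def mix_def swap_pairs_even swap_pairs_odd)

lemma swap_initial:
  "even_part (\<lambda>j. \<omega> (swap_pairs (\<lambda>i. i < k) j)) = mix k \<omega>"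
  "resample k (\<lambda>j. \<omega> (swap_pairs (\<lambda>i. i < k) j)) = mix (Suc k) \<omega>"
  by (auto simp: fun_eq_iff even_part_def resample_def mix_def swap_pairs_even swap_pairs_odd)

lemma mix_0: "mix 0 = even_part"
  by (auto simp: fun_eq_iff mix_def even_part_def)

locale product_law =
  fixes \<mu> :: "nat \<Rightarrow> real measure"
  assumes \<mu>: "\<And>i. real_distribution (\<mu> i)"
begin

abbreviation "Q \<equiv> PiM UNIV \<mu>"
abbreviation "Q2 \<equiv> PiM UNIV (doubled \<mu>)"

lemma doubled_law: "product_law (doubled \<mu>)"
  by (rule product_law.intro) (simp add: doubled_def \<mu>)

lemma prob_\<mu>: "prob_space (\<mu> i)"
  using \<mu>[of i] by (simp add: real_distribution_def)

lemma sets_\<mu> [measurable_cong]: "sets (\<mu> i) = sets borel"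
  using \<mu>[of i] by (simp add: real_distribution_def real_distribution_axioms_def)

lemma prob_Q: "prob_space Q"
  by (rule prob_space_PiM) (rule prob_\<mu>)

lemma sets_Q [measurable_cong]: "sets Q = sets seq_borel"
  by (rule sets_PiM_cong) (auto simp: sets_\<mu>)

lemma measurable_Q: "borel_measurable Q = borel_measurable seq_borel"
  by (rule measurable_cong_sets[OF sets_Q refl])

lemma bounded_measurable_Q: "bounded_measurable Q = bounded_measurable seq_borel"
  by (simp add: bounded_measurable_def[abs_def] measurable_Q)

lemma integral_reindex:
  fixes F :: "(nat \<Rightarrow> real) \<Rightarrow> real"
  assumes F: "F \<in> borel_measurable seq_borel" and f: "inj f" "\<And>i. \<mu>' i = \<mu> (f i)"
  shows "(\<integral>\<omega>. F (\<lambda>i. \<omega> (f i)) \<partial>Q) = (\<integral>x. F x \<partial>(PiM UNIV \<mu>'))"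
proof -
  have \<mu>': "\<mu>' = (\<lambda>i. \<mu> (f i))" using f by auto
  have d: "distr Q (PiM UNIV \<mu>') (\<lambda>\<omega> i. \<omega> (f i)) = PiM UNIV \<mu>'"
    using distr_PiM_reindex[of UNIV \<mu> f UNIV] prob_\<mu> f unfolding \<mu>' restrict_UNIV by simp
  have s: "sets (PiM UNIV \<mu>') = sets seq_borel"
    by (rule sets_PiM_cong) (auto simp: sets_\<mu> \<mu>')
  have T: "(\<lambda>\<omega> i. \<omega> (f i)) \<in> measurable Q (PiM UNIV \<mu>')"
    unfolding measurable_cong_sets[OF sets_Q s] by (rule seq_map_measurable) simp
  have F': "F \<in> borel_measurable (PiM UNIV \<mu>')"
    using F unfolding measurable_cong_sets[OF s refl] .
  show "(\<integral>\<omega>. F (\<lambda>i. \<omega> (f i)) \<partial>Q) = (\<integral>x. F x \<partial>(PiM UNIV \<mu>'))"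
    using integral_distr[OF T F'] unfolding d by simp
qed

lemma integral_even:
  fixes F :: "(nat \<Rightarrow> real) \<Rightarrow> real"
  assumes F: "F \<in> borel_measurable seq_borel"
  shows "(\<integral>\<omega>. F (even_part \<omega>) \<partial>Q2) = (\<integral>x. F x \<partial>Q)" "(\<integral>\<omega>. F (odd_part \<omega>) \<partial>Q2) = (\<integral>x. F x \<partial>Q)"
proof -
  interpret d: product_law "doubled \<mu>" by (rule doubled_law)
  show "(\<integral>\<omega>. F (even_part \<omega>) \<partial>Q2) = (\<integral>x. F x \<partial>Q)"
    using d.integral_reindex[OF F, of "\<lambda>i. 2 * i" \<mu>] by (simp add: even_part_def[abs_def] doubled_def inj_def)
  show "(\<integral>\<omega>. F (odd_part \<omega>) \<partial>Q2) = (\<integral>x. F x \<partial>Q)"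
    using d.integral_reindex[OF F, of "\<lambda>i. Suc (2 * i)" \<mu>] by (simp add: odd_part_def[abs_def] doubled_def inj_def)
qed

lemma integral_swap:
  fixes F :: "(nat \<Rightarrow> real) \<Rightarrow> real"
  assumes F: "F \<in> borel_measurable seq_borel"
  shows "(\<integral>\<omega>. F (\<lambda>j. \<omega> (swap_pairs P j)) \<partial>Q2) = (\<integral>\<omega>. F \<omega> \<partial>Q2)"
proof -
  interpret d: product_law "doubled \<mu>" by (rule doubled_law)
  show ?thesis
    using d.integral_reindex[OF F inj_swap_pairs, of "doubled \<mu>" P] by (simp add: doubled_def)
qed

lemma component_law: "distr Q borel (\<lambda>\<omega>. \<omega> i) = \<mu> i"
proof -
  have "distr Q borel (\<lambda>\<omega>. \<omega> i) = distr Q (\<mu> i) (\<lambda>\<omega>. \<omega> i)"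
    by (rule distr_cong) (auto simp: sets_\<mu>)
  then show ?thesis using distr_PiM_component[of UNIV \<mu> i] prob_\<mu> by simp
qed

lemma coordinates_indep: "prob_space.indep_vars Q (\<lambda>_. borel) (\<lambda>i \<omega>. \<omega> i) UNIV"
proof -
  interpret prob_space Q by (rule prob_Q)
  have [measurable]: "(\<lambda>\<omega>. \<omega> i) \<in> borel_measurable Q" for i
    unfolding measurable_Q by simp
  have "distr Q seq_borel (\<lambda>\<omega>. \<omega>) = distr Q Q (\<lambda>\<omega>. \<omega>)" by (rule distr_cong) (auto simp: sets_Q)
  then have "distr Q seq_borel (\<lambda>\<omega>. \<omega>) = Q" by (simp add: distr_id2)
  then show ?thesis
    by (subst indep_vars_iff_distr_eq_PiM') (auto simp: restrict_UNIV component_law)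
qed

lemma pair_law:
  assumes "i \<noteq> j"
  shows "distr Q (borel \<Otimes>\<^sub>M borel) (\<lambda>\<omega>. (\<omega> i, \<omega> j)) = \<mu> i \<Otimes>\<^sub>M \<mu> j"
proof -
  interpret prob_space Q by (rule prob_Q)
  have "indep_var (PiM {i} (\<lambda>_. borel)) (\<lambda>\<omega>. restrict \<omega> {i}) (PiM {j} (\<lambda>_. borel)) (\<lambda>\<omega>. restrict \<omega> {j})"
    using indep_var_restrict[OF coordinates_indep, of "{i}" "{j}"] assms by simp
  then have "indep_var borel ((\<lambda>r. r i) \<circ> (\<lambda>\<omega>. restrict \<omega> {i})) borel ((\<lambda>r. r j) \<circ> (\<lambda>\<omega>. restrict \<omega> {j}))"
    by (rule indep_var_compose) (auto intro: measurable_component_singleton)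
  then have "indep_var borel (\<lambda>\<omega>. \<omega> i) borel (\<lambda>\<omega>. \<omega> j)" by (simp add: o_def)
  then show ?thesis by (simp add: indep_var_distribution_eq component_law)
qed

lemma integral_even_times_odd:
  assumes F: "bounded_measurable seq_borel F" and G: "bounded_measurable seq_borel G"
  shows "(\<integral>\<omega>. F (even_part \<omega>) * G (odd_part \<omega>) \<partial>Q2) = (\<integral>x. F x \<partial>Q) * (\<integral>x. G x \<partial>Q)"
proof -
  interpret d: product_law "doubled \<mu>" by (rule doubled_law)
  interpret prob_space Q2 by (rule d.prob_Q)
  note [measurable] = bounded_measurable_measurable[OF F] bounded_measurable_measurable[OF G]
  let ?E = "{j::nat. even j}" and ?O = "{j::nat. odd j}"
  define TE where "TE r i = r (2 * i)" for r :: "nat \<Rightarrow> real" and i :: nat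
  define TO where "TO r i = r (2 * i + 1)" for r :: "nat \<Rightarrow> real" and i :: nat
  have TE: "TE \<in> measurable (PiM ?E (\<lambda>_. borel)) seq_borel"
    using measurable_abs_UNIV[of "\<lambda>i r. TE r i" "PiM ?E (\<lambda>_. borel)" "\<lambda>_. borel"]
    by (simp add: TE_def[abs_def] measurable_component_singleton)
  have TO: "TO \<in> measurable (PiM ?O (\<lambda>_. borel)) seq_borel"
    using measurable_abs_UNIV[of "\<lambda>i r. TO r i" "PiM ?O (\<lambda>_. borel)" "\<lambda>_. borel"]
    by (simp add: TO_def[abs_def] measurable_component_singleton)
  have iv: "indep_var (PiM ?E (\<lambda>_. borel)) (\<lambda>\<omega>. restrict \<omega> ?E) (PiM ?O (\<lambda>_. borel)) (\<lambda>\<omega>. restrict \<omega> ?O)"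
    using indep_var_restrict[OF d.coordinates_indep, of ?E ?O] by (simp add: disjoint_iff)
  have mE: "(\<lambda>r. F (TE r)) \<in> borel_measurable (PiM ?E (\<lambda>_. borel))"
    by (rule measurable_compose[OF TE bounded_measurable_measurable[OF F]])
  have mO: "(\<lambda>r. G (TO r)) \<in> borel_measurable (PiM ?O (\<lambda>_. borel))"
    by (rule measurable_compose[OF TO bounded_measurable_measurable[OF G]])
  note indep_var_compose[OF iv mE mO]
  moreover have "(\<lambda>r. F (TE r)) \<circ> (\<lambda>\<omega>. restrict \<omega> ?E) = (\<lambda>\<omega>. F (even_part \<omega>))"
    by (auto simp: o_def TE_def[abs_def] even_part_def[abs_def])
  moreover have "(\<lambda>r. G (TO r)) \<circ> (\<lambda>\<omega>. restrict \<omega> ?O) = (\<lambda>\<omega>. G (odd_part \<omega>))"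
    by (auto simp: o_def TO_def[abs_def] odd_part_def[abs_def])
  ultimately have "indep_var borel (\<lambda>\<omega>. F (even_part \<omega>)) borel (\<lambda>\<omega>. G (odd_part \<omega>))" by simp
  moreover have "integrable Q2 (\<lambda>\<omega>. F (even_part \<omega>))" "integrable Q2 (\<lambda>\<omega>. G (odd_part \<omega>))"
    by (rule bounded_measurable_integrable, unfold d.bounded_measurable_Q,
        rule bounded_measurable_compose[OF F parts_measurable(1)] bounded_measurable_compose[OF G parts_measurable(2)])+
  ultimately have "(\<integral>\<omega>. F (even_part \<omega>) * G (odd_part \<omega>) \<partial>Q2) = (\<integral>\<omega>. F (even_part \<omega>) \<partial>Q2) * (\<integral>\<omega>. G (odd_part \<omega>) \<partial>Q2)"
    by (rule indep_var_lebesgue_integral)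
  then show ?thesis by (simp add: integral_even)
qed

lemma bm_parts [bm_intros]:
  assumes "bounded_measurable seq_borel F"
  shows "bounded_measurable seq_borel (\<lambda>\<omega>. F (even_part \<omega>))" "bounded_measurable seq_borel (\<lambda>\<omega>. F (odd_part \<omega>))"
    "bounded_measurable seq_borel (\<lambda>\<omega>. F (mix k \<omega>))" "bounded_measurable seq_borel (\<lambda>\<omega>. F (resample k \<omega>))"
  by (intro bounded_measurable_compose[OF assms] parts_measurable)+

lemma Q2_integrable: "bounded_measurable seq_borel F \<Longrightarrow> integrable Q2 F"
proof -
  interpret d: product_law "doubled \<mu>" by (rule doubled_law)
  assume "bounded_measurable seq_borel F"
  then show ?thesis
    by (intro prob_space.bounded_measurable_integrable[OF d.prob_Q]) (simp add: d.bounded_measurable_Q)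
qed

text \<open>
  The covariance is the expectation of \<open>G x * (F x - F y)\<close> for an independent copy \<open>y\<close>. The
  difference is telescoped by replacing the inputs one at a time. Exchanging the \<open>k\<close>-th pair changes
  the sign of the \<open>k\<close>-th increment of \<open>F\<close>, so each term can be averaged with its exchanged version,
  which turns \<open>G\<close> into an increment of \<open>G\<close>.
\<close>

lemma covariance_identity:
  assumes F: "bounded_measurable seq_borel F" and G: "bounded_measurable seq_borel G" and n: "depends_below n F"
  shows "(\<integral>x. G x * F x \<partial>Q) - (\<integral>x. G x \<partial>Q) * (\<integral>x. F x \<partial>Q)
    = (\<Sum>k<n. \<integral>\<omega>. (G (even_part \<omega>) - G (resample k \<omega>)) * ((F (mix k \<omega>) - F (mix (Suc k) \<omega>)) / 2) \<partial>Q2)"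
proof -
  note [bm_intros] = F G
  have step: "(\<integral>\<omega>. G (even_part \<omega>) * (F (mix k \<omega>) - F (mix (Suc k) \<omega>)) \<partial>Q2)
      = (\<integral>\<omega>. (G (even_part \<omega>) - G (resample k \<omega>)) * ((F (mix k \<omega>) - F (mix (Suc k) \<omega>)) / 2) \<partial>Q2)" for k
  proof -
    let ?f = "\<lambda>\<omega>. G (even_part \<omega>) * (F (mix k \<omega>) - F (mix (Suc k) \<omega>))"
    let ?f' = "\<lambda>\<omega>. G (resample k \<omega>) * (F (mix (Suc k) \<omega>) - F (mix k \<omega>))"
    have b: "bounded_measurable seq_borel ?f" "bounded_measurable seq_borel ?f'" by (intro bm_intros)+
    have "(\<integral>\<omega>. ?f \<omega> \<partial>Q2) = (\<integral>\<omega>. ?f (\<lambda>j. \<omega> (swap_pairs ((=) k) j)) \<partial>Q2)"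
      by (rule integral_swap[OF bounded_measurable_measurable[OF b(1)], symmetric])
    also have "\<dots> = (\<integral>\<omega>. ?f' \<omega> \<partial>Q2)" by (simp add: swap_single)
    finally have "(\<integral>\<omega>. ?f \<omega> \<partial>Q2) = ((\<integral>\<omega>. ?f \<omega> \<partial>Q2) + (\<integral>\<omega>. ?f' \<omega> \<partial>Q2)) / 2" by simp
    also have "\<dots> = (\<integral>\<omega>. (?f \<omega> + ?f' \<omega>) / 2 \<partial>Q2)"
      using b by (simp add: Q2_integrable)
    also have "\<dots> = (\<integral>\<omega>. (G (even_part \<omega>) - G (resample k \<omega>)) * ((F (mix k \<omega>) - F (mix (Suc k) \<omega>)) / 2) \<partial>Q2)"
      by (intro Bochner_Integration.integral_cong refl) (simp add: algebra_simps)
    finally show ?thesis .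
  qed
  have odd: "F (mix n \<omega>) = F (odd_part \<omega>)" for \<omega>
    using n unfolding depends_below_def by (auto simp: mix_def odd_part_def)
  have bGF: "bounded_measurable seq_borel (\<lambda>x. G x * F x)" by (intro bm_intros)
  have "(\<integral>x. G x * F x \<partial>Q) - (\<integral>x. G x \<partial>Q) * (\<integral>x. F x \<partial>Q)
      = (\<integral>\<omega>. G (even_part \<omega>) * F (even_part \<omega>) \<partial>Q2) - (\<integral>\<omega>. G (even_part \<omega>) * F (odd_part \<omega>) \<partial>Q2)"
    using integral_even(1)[OF bounded_measurable_measurable[OF bGF]] integral_even_times_odd[OF G F] by simp
  also have "\<dots> = (\<integral>\<omega>. G (even_part \<omega>) * F (even_part \<omega>) - G (even_part \<omega>) * F (odd_part \<omega>) \<partial>Q2)"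
    by (intro Bochner_Integration.integral_diff[symmetric] Q2_integrable bm_intros)
  also have "\<dots> = (\<integral>\<omega>. (\<Sum>k<n. G (even_part \<omega>) * (F (mix k \<omega>) - F (mix (Suc k) \<omega>))) \<partial>Q2)"
  proof (intro Bochner_Integration.integral_cong refl)
    fix \<omega>
    have "(\<Sum>k<n. F (mix k \<omega>) - F (mix (Suc k) \<omega>)) = F (mix 0 \<omega>) - F (mix n \<omega>)"
      by (rule sum_lessThan_telescope')
    then show "G (even_part \<omega>) * F (even_part \<omega>) - G (even_part \<omega>) * F (odd_part \<omega>) = (\<Sum>k<n. G (even_part \<omega>) * (F (mix k \<omega>) - F (mix (Suc k) \<omega>)))"
      by (simp only: sum_distrib_left[symmetric] right_diff_distrib[symmetric]) (simp add: mix_0 odd)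
  qed
  also have "\<dots> = (\<Sum>k<n. \<integral>\<omega>. G (even_part \<omega>) * (F (mix k \<omega>) - F (mix (Suc k) \<omega>)) \<partial>Q2)"
    by (intro Bochner_Integration.integral_sum Q2_integrable bm_intros)
  also have "\<dots> = (\<Sum>k<n. \<integral>\<omega>. (G (even_part \<omega>) - G (resample k \<omega>)) * ((F (mix k \<omega>) - F (mix (Suc k) \<omega>)) / 2) \<partial>Q2)"
    by (intro sum.cong refl step)
  finally show ?thesis .
qed

text \<open>
  The covariance identity for \<open>G = F\<close>. Exchanging the first \<open>k\<close> pairs shows that the two increments
  in the \<open>k\<close>-th term have the same law.
\<close>

theorem Efron_Stein:
  assumes F: "bounded_measurable seq_borel F" and n: "depends_below n F"
  shows "(\<integral>x. (F x - (\<integral>y. F y \<partial>Q))\<^sup>2 \<partial>Q) \<le> (\<Sum>k<n. \<integral>\<omega>. (F (even_part \<omega>) - F (resample k \<omega>))\<^sup>2 \<partial>Q2) / 2"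
proof -
  note [bm_intros] = F
  interpret prob_space Q by (rule prob_Q)
  have iF: "integrable Q F" "integrable Q (\<lambda>x. F x * F x)"
    by (intro bounded_measurable_integrable; unfold bounded_measurable_Q; intro bm_intros)+
  have "(\<integral>x. (F x - (\<integral>y. F y \<partial>Q))\<^sup>2 \<partial>Q) = (\<integral>x. F x * F x \<partial>Q) - (\<integral>x. F x \<partial>Q) * (\<integral>x. F x \<partial>Q)"
    using variance_eq[OF iF(1)] iF(2) by (simp add: power2_eq_square)
  also have "\<dots> = (\<Sum>k<n. \<integral>\<omega>. (F (even_part \<omega>) - F (resample k \<omega>)) * ((F (mix k \<omega>) - F (mix (Suc k) \<omega>)) / 2) \<partial>Q2)"
    by (rule covariance_identity[OF F F n])
  also have "\<dots> \<le> (\<Sum>k<n. (\<integral>\<omega>. (F (even_part \<omega>) - F (resample k \<omega>))\<^sup>2 \<partial>Q2) / 2)"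
  proof (rule sum_mono)
    fix k
    let ?d = "\<lambda>\<omega>. F (even_part \<omega>) - F (resample k \<omega>)" and ?e = "\<lambda>\<omega>. F (mix k \<omega>) - F (mix (Suc k) \<omega>)"
    have b: "bounded_measurable seq_borel (\<lambda>\<omega>. (?d \<omega>)\<^sup>2)" by (intro bm_intros)
    have same: "(\<integral>\<omega>. (?e \<omega>)\<^sup>2 \<partial>Q2) = (\<integral>\<omega>. (?d \<omega>)\<^sup>2 \<partial>Q2)"
      using integral_swap[OF bounded_measurable_measurable[OF b], of "\<lambda>i. i < k"] by (simp add: swap_initial)
    have "(\<integral>\<omega>. ?d \<omega> * (?e \<omega> / 2) \<partial>Q2) \<le> (\<integral>\<omega>. ((?d \<omega>)\<^sup>2 + (?e \<omega>)\<^sup>2) / 4 \<partial>Q2)"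
    proof (rule integral_mono)
      show "integrable Q2 (\<lambda>\<omega>. ?d \<omega> * (?e \<omega> / 2))" "integrable Q2 (\<lambda>\<omega>. ((?d \<omega>)\<^sup>2 + (?e \<omega>)\<^sup>2) / 4)"
        by (intro Q2_integrable bm_intros)+
      fix \<omega>
      show "?d \<omega> * (?e \<omega> / 2) \<le> ((?d \<omega>)\<^sup>2 + (?e \<omega>)\<^sup>2) / 4"
      proof -
        have "2 * (?d \<omega> * ?e \<omega>) \<le> (?d \<omega>)\<^sup>2 + (?e \<omega>)\<^sup>2"
          using sum_squares_bound[of "?d \<omega>" "?e \<omega>"] by (simp only: mult.assoc)
        moreover have "?d \<omega> * (?e \<omega> / 2) = (2 * (?d \<omega> * ?e \<omega>)) / 4" by simp
        ultimately show ?thesis by (simp only: divide_right_mono)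
      qed
    qed
    also have "\<dots> = ((\<integral>\<omega>. (?d \<omega>)\<^sup>2 \<partial>Q2) + (\<integral>\<omega>. (?e \<omega>)\<^sup>2 \<partial>Q2)) / 4"
      by (subst Bochner_Integration.integral_add[symmetric]) (auto intro!: Q2_integrable bm_intros)
    finally show "(\<integral>\<omega>. ?d \<omega> * (?e \<omega> / 2) \<partial>Q2) \<le> (\<integral>\<omega>. (?d \<omega>)\<^sup>2 \<partial>Q2) / 2"
      unfolding same by simp
  qed
  finally show ?thesis by (simp add: sum_divide_distrib)
qed

end

section \<open>Normal approximation of a functional of independent inputs\<close>

lemma (in prob_space) expectation_abs_le_sqrt:
  assumes "bounded_measurable M f"
  shows "expectation (\<lambda>x. \<bar>f x\<bar>) \<le> sqrt (expectation (\<lambda>x. (f x)\<^sup>2))"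
proof -
  have i: "integrable M (\<lambda>x. \<bar>f x\<bar>)" "integrable M (\<lambda>x. \<bar>f x\<bar>\<^sup>2)"
    by (intro bounded_measurable_integrable bm_intros assms)+
  have "0 \<le> variance (\<lambda>x. \<bar>f x\<bar>)" by (rule variance_positive)
  also have "\<dots> = expectation (\<lambda>x. \<bar>f x\<bar>\<^sup>2) - (expectation (\<lambda>x. \<bar>f x\<bar>))\<^sup>2"
    by (rule variance_eq[OF i])
  finally show ?thesis by (intro real_le_rsqrt) simp
qed

locale normalized_functional = product_law +
  fixes W :: "(nat \<Rightarrow> real) \<Rightarrow> real" and n :: nat
  assumes W_bm: "bounded_measurable seq_borel W" and W_dep: "depends_below n W"
    and W_mean: "(\<integral>x. W x \<partial>Q) = 0" and W_var: "(\<integral>x. (W x)\<^sup>2 \<partial>Q) = 1"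
begin

text \<open>
  The covariance identity writes \<open>E (W * g W)\<close> as the expectation of the sum of \<open>\<D> k\<close> times the
  change of \<open>g W\<close> when input \<open>k\<close> is resampled. To first order that change is \<open>g' W * \<Delta> k\<close>, so \<open>E (W
  * g W)\<close> is close to \<open>E (\<A> * g' W)\<close>. For a normal variable the factor would be 1, the mean of \<open>\<A>\<close>;
  the fluctuation of \<open>\<A>\<close> measures the distance to the normal law, and \<open>\<B>\<close> measures the error of the
  linearization.
\<close>

definition \<D> :: "nat \<Rightarrow> (nat \<Rightarrow> real) \<Rightarrow> real" where
  "\<D> k \<omega> = (W (mix k \<omega>) - W (mix (Suc k) \<omega>)) / 2"

definition \<Delta> :: "nat \<Rightarrow> (nat \<Rightarrow> real) \<Rightarrow> real" where
  "\<Delta> k \<omega> = W (even_part \<omega>) - W (resample k \<omega>)"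

definition \<A> :: "(nat \<Rightarrow> real) \<Rightarrow> real" where "\<A> \<omega> = (\<Sum>k<n. \<D> k \<omega> * \<Delta> k \<omega>)"
definition \<B> :: "(nat \<Rightarrow> real) \<Rightarrow> real" where "\<B> \<omega> = (\<Sum>k<n. \<bar>\<D> k \<omega>\<bar> * \<Delta> k \<omega>)"

lemmas W_bm' [bm_intros] = W_bm bm_parts[OF W_bm]

lemma D_bm [bm_intros]: "bounded_measurable seq_borel (\<D> k)"
  unfolding \<D>_def[abs_def] by (intro bm_intros)

lemma Delta_bm [bm_intros]: "bounded_measurable seq_borel (\<Delta> k)"
  unfolding \<Delta>_def[abs_def] by (intro bm_intros)

lemma A_bm [bm_intros]: "bounded_measurable seq_borel \<A>"
  unfolding \<A>_def[abs_def] by (intro bm_intros)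

lemma B_bm [bm_intros]: "bounded_measurable seq_borel \<B>"
  unfolding \<B>_def[abs_def] by (intro bm_intros)

lemma prob_Q2: "prob_space Q2"
  by (rule product_law.prob_Q[OF doubled_law])

lemma W_compose_bm:
  assumes g: "g \<in> borel_measurable borel" and b: "\<And>K. \<exists>C. \<forall>w. \<bar>w\<bar> \<le> K \<longrightarrow> \<bar>g w\<bar> \<le> C"
  shows "bounded_measurable seq_borel (\<lambda>x. g (W x))"
proof -
  obtain K where K: "\<And>x. \<bar>W x\<bar> \<le> K" using W_bm by (auto simp: bounded_measurable_def)
  obtain C where "\<And>w. \<bar>w\<bar> \<le> K \<Longrightarrow> \<bar>g w\<bar> \<le> C" using b[of K] by blast
  with K have "\<And>x. \<bar>g (W x)\<bar> \<le> C" by blast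
  then show ?thesis
    using measurable_compose[OF bounded_measurable_measurable[OF W_bm] g] by (auto simp: bounded_measurable_def)
qed

lemma continuous_compose_bm:
  assumes g: "continuous_on UNIV (g :: real \<Rightarrow> real)"
  shows "bounded_measurable seq_borel (\<lambda>x. g (W x))"
proof (rule W_compose_bm)
  show "g \<in> borel_measurable borel" by (rule borel_measurable_continuous_onI[OF g])
  fix K
  have "compact (g ` {-K..K})"
    by (intro compact_continuous_image continuous_on_subset[OF g]) auto
  then obtain C where "\<forall>z\<in>g ` {-K..K}. norm z \<le> C"
    using compact_imp_bounded[of "g ` {-K..K}"] unfolding bounded_iff by blast
  then show "\<exists>C. \<forall>w. \<bar>w\<bar> \<le> K \<longrightarrow> \<bar>g w\<bar> \<le> C" by (intro exI[of _ C]) (auto simp: abs_le_iff)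
qed

lemma stein_identity:
  assumes g: "bounded_measurable seq_borel (\<lambda>x. g (W x))"
  shows "(\<integral>x. W x * g (W x) \<partial>Q)
    = (\<integral>\<omega>. (\<Sum>k<n. \<D> k \<omega> * (g (W (even_part \<omega>)) - g (W (resample k \<omega>)))) \<partial>Q2)"
proof -
  have "(\<integral>x. W x * g (W x) \<partial>Q) = (\<Sum>k<n. \<integral>\<omega>. (g (W (even_part \<omega>)) - g (W (resample k \<omega>))) * \<D> k \<omega> \<partial>Q2)"
    using covariance_identity[OF W_bm g W_dep] by (simp add: W_mean \<D>_def mult.commute)
  also have "\<dots> = (\<integral>\<omega>. (\<Sum>k<n. (g (W (even_part \<omega>)) - g (W (resample k \<omega>))) * \<D> k \<omega>) \<partial>Q2)"
    by (intro Bochner_Integration.integral_sum[symmetric] Q2_integrable bm_intros bm_parts[OF g])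
  finally show ?thesis by (simp add: mult.commute)
qed

lemma A_mean: "(\<integral>\<omega>. \<A> \<omega> \<partial>Q2) = 1"
  using stein_identity[of "\<lambda>w. w"] W_bm W_var by (simp add: \<A>_def \<Delta>_def power2_eq_square)

lemma D_Delta_swap:
  "\<D> k (\<lambda>j. \<omega> (swap_pairs ((=) k) j)) = - \<D> k \<omega>"
  "\<Delta> k (\<lambda>j. \<omega> (swap_pairs ((=) k) j)) = - \<Delta> k \<omega>"
  by (simp_all add: \<D>_def \<Delta>_def swap_single field_simps)

text \<open>
  Exchanging the \<open>k\<close>-th pair changes the signs of \<open>\<D> k\<close> and \<open>\<Delta> k\<close> and interchanges \<open>W\<close> with its
  resampled version.
\<close>

lemma antisymmetry:
  assumes g: "bounded_measurable seq_borel (\<lambda>x. g (W x))"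
  shows "(\<integral>\<omega>. \<bar>\<D> k \<omega>\<bar> * \<Delta> k \<omega> * g (W (resample k \<omega>)) \<partial>Q2) = - (\<integral>\<omega>. \<bar>\<D> k \<omega>\<bar> * \<Delta> k \<omega> * g (W (even_part \<omega>)) \<partial>Q2)"
proof -
  have b: "bounded_measurable seq_borel (\<lambda>\<omega>. \<bar>\<D> k \<omega>\<bar> * \<Delta> k \<omega> * g (W (even_part \<omega>)))"
    by (intro bm_intros bm_parts[OF g])
  have "(\<integral>\<omega>. \<bar>\<D> k \<omega>\<bar> * \<Delta> k \<omega> * g (W (even_part \<omega>)) \<partial>Q2)
      = (\<integral>\<omega>. - (\<bar>\<D> k \<omega>\<bar> * \<Delta> k \<omega> * g (W (resample k \<omega>))) \<partial>Q2)"
    unfolding integral_swap[OF bounded_measurable_measurable[OF b], of "(=) k", symmetric]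
    by (intro Bochner_Integration.integral_cong refl) (simp add: D_Delta_swap swap_single)
  then show ?thesis by simp
qed

text \<open>
  By antisymmetry the two terms of each difference have opposite integrals. So each difference
  counts as twice its first term, and summation over \<open>k\<close> leaves \<open>\<B>\<close>. The bound uses the size of \<open>g\<close>
  and not its increments, so it covers discontinuous functions.
\<close>

lemma antisymmetric_sum_le:
  assumes g: "bounded_measurable seq_borel (\<lambda>x. g (W x))" and g1: "\<And>w. \<bar>g w\<bar> \<le> 1"
  shows "\<bar>\<integral>\<omega>. (\<Sum>k<n. \<bar>\<D> k \<omega>\<bar> * \<Delta> k \<omega> * (g (W (even_part \<omega>)) - g (W (resample k \<omega>)))) \<partial>Q2\<bar>
    \<le> 2 * (\<integral>\<omega>. \<bar>\<B> \<omega>\<bar> \<partial>Q2)"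
proof -
  have "(\<integral>\<omega>. (\<Sum>k<n. \<bar>\<D> k \<omega>\<bar> * \<Delta> k \<omega> * (g (W (even_part \<omega>)) - g (W (resample k \<omega>)))) \<partial>Q2)
     = (\<Sum>k<n. \<integral>\<omega>. \<bar>\<D> k \<omega>\<bar> * \<Delta> k \<omega> * g (W (even_part \<omega>)) - \<bar>\<D> k \<omega>\<bar> * \<Delta> k \<omega> * g (W (resample k \<omega>)) \<partial>Q2)"
    unfolding right_diff_distrib
    by (intro Bochner_Integration.integral_sum Q2_integrable bm_intros bm_parts[OF g])
  also have "\<dots> = (\<Sum>k<n. 2 * (\<integral>\<omega>. \<bar>\<D> k \<omega>\<bar> * \<Delta> k \<omega> * g (W (even_part \<omega>)) \<partial>Q2))"
  proof (intro sum.cong refl)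
    fix k
    have "(\<integral>\<omega>. \<bar>\<D> k \<omega>\<bar> * \<Delta> k \<omega> * g (W (even_part \<omega>)) - \<bar>\<D> k \<omega>\<bar> * \<Delta> k \<omega> * g (W (resample k \<omega>)) \<partial>Q2)
      = (\<integral>\<omega>. \<bar>\<D> k \<omega>\<bar> * \<Delta> k \<omega> * g (W (even_part \<omega>)) \<partial>Q2) - (\<integral>\<omega>. \<bar>\<D> k \<omega>\<bar> * \<Delta> k \<omega> * g (W (resample k \<omega>)) \<partial>Q2)"
      by (intro Bochner_Integration.integral_diff Q2_integrable bm_intros bm_parts[OF g])
    then show "(\<integral>\<omega>. \<bar>\<D> k \<omega>\<bar> * \<Delta> k \<omega> * g (W (even_part \<omega>)) - \<bar>\<D> k \<omega>\<bar> * \<Delta> k \<omega> * g (W (resample k \<omega>)) \<partial>Q2)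
      = 2 * (\<integral>\<omega>. \<bar>\<D> k \<omega>\<bar> * \<Delta> k \<omega> * g (W (even_part \<omega>)) \<partial>Q2)"
      unfolding antisymmetry[OF g] by simp
  qed
  also have "\<dots> = 2 * (\<Sum>k<n. \<integral>\<omega>. \<bar>\<D> k \<omega>\<bar> * \<Delta> k \<omega> * g (W (even_part \<omega>)) \<partial>Q2)"
    by (rule sum_distrib_left[symmetric])
  also have "(\<Sum>k<n. \<integral>\<omega>. \<bar>\<D> k \<omega>\<bar> * \<Delta> k \<omega> * g (W (even_part \<omega>)) \<partial>Q2) = (\<integral>\<omega>. \<B> \<omega> * g (W (even_part \<omega>)) \<partial>Q2)"
    unfolding \<B>_def sum_distrib_right
    by (intro Bochner_Integration.integral_sum[symmetric] Q2_integrable bm_intros bm_parts[OF g])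
  finally have eq: "(\<integral>\<omega>. (\<Sum>k<n. \<bar>\<D> k \<omega>\<bar> * \<Delta> k \<omega> * (g (W (even_part \<omega>)) - g (W (resample k \<omega>)))) \<partial>Q2)
     = 2 * (\<integral>\<omega>. \<B> \<omega> * g (W (even_part \<omega>)) \<partial>Q2)" .
  have "\<bar>\<integral>\<omega>. \<B> \<omega> * g (W (even_part \<omega>)) \<partial>Q2\<bar> \<le> (\<integral>\<omega>. \<bar>\<B> \<omega> * g (W (even_part \<omega>))\<bar> \<partial>Q2)"
    by (rule integral_abs_bound)
  also have "\<dots> \<le> (\<integral>\<omega>. \<bar>\<B> \<omega>\<bar> \<partial>Q2)"
  proof (rule integral_mono)
    show "integrable Q2 (\<lambda>\<omega>. \<bar>\<B> \<omega> * g (W (even_part \<omega>))\<bar>)" "integrable Q2 (\<lambda>\<omega>. \<bar>\<B> \<omega>\<bar>)"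
      by (intro Q2_integrable bm_intros bm_parts[OF g])+
    show "\<bar>\<B> \<omega> * g (W (even_part \<omega>))\<bar> \<le> \<bar>\<B> \<omega>\<bar>" for \<omega>
      unfolding abs_mult by (rule mult_left_le) (use g1 in auto)
  qed
  finally show ?thesis unfolding eq by simp
qed

lemma B_mean: "(\<integral>\<omega>. \<B> \<omega> \<partial>Q2) = 0"
proof -
  have "(\<integral>\<omega>. \<B> \<omega> \<partial>Q2) = (\<Sum>k<n. \<integral>\<omega>. \<bar>\<D> k \<omega>\<bar> * \<Delta> k \<omega> \<partial>Q2)"
    unfolding \<B>_def by (intro Bochner_Integration.integral_sum Q2_integrable bm_intros)
  also have "\<dots> = 0"
    using antisymmetry[of "\<lambda>_. 1"] by (intro sum.neutral) (simp add: bounded_measurable_const)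
  finally show ?thesis .
qed

text \<open>
  \<open>d\<close> stands for the derivative of \<open>g\<close>, in the weak sense that the error of the linearization is
  controlled. The solution that belongs to an indicator is not differentiable at the jump.
\<close>

lemma stein_discrepancy:
  assumes g: "bounded_measurable seq_borel (\<lambda>x. g (W x))" and d: "bounded_measurable seq_borel (\<lambda>x. d (W x))"
    and d_le: "\<And>w. \<bar>d w\<bar> \<le> K"
    and R: "bounded_measurable seq_borel R"
    and rem: "\<And>\<omega>. (\<Sum>k<n. \<bar>\<D> k \<omega>\<bar> * \<bar>g (W (even_part \<omega>)) - g (W (resample k \<omega>)) - d (W (even_part \<omega>)) * \<Delta> k \<omega>\<bar>) \<le> R \<omega>"
  shows "\<bar>\<integral>x. d (W x) - W x * g (W x) \<partial>Q\<bar> \<le> K * sqrt (\<integral>\<omega>. (\<A> \<omega> - 1)\<^sup>2 \<partial>Q2) + (\<integral>\<omega>. R \<omega> \<partial>Q2)"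
proof -
  interpret Q: prob_space Q by (rule prob_Q)
  interpret Q2: prob_space Q2 by (rule prob_Q2)
  have K: "K \<ge> 0" using d_le[of 0] by linarith
  let ?dev = "\<lambda>\<omega>. d (W (even_part \<omega>))"
  let ?rem = "\<lambda>\<omega>. \<Sum>k<n. \<D> k \<omega> * (g (W (even_part \<omega>)) - g (W (resample k \<omega>)) - ?dev \<omega> * \<Delta> k \<omega>)"
  note [bm_intros] = g bm_parts[OF g] bm_parts[OF d] R d
  have "(\<integral>x. d (W x) - W x * g (W x) \<partial>Q) = (\<integral>x. d (W x) \<partial>Q) - (\<integral>x. W x * g (W x) \<partial>Q)"
    by (intro Bochner_Integration.integral_diff Q.bounded_measurable_integrable; unfold bounded_measurable_Q; intro bm_intros)
  also have "(\<integral>x. d (W x) \<partial>Q) = (\<integral>\<omega>. ?dev \<omega> \<partial>Q2)"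
    by (rule integral_even(1)[symmetric]) (rule bounded_measurable_measurable[OF d])
  also have "(\<integral>\<omega>. ?dev \<omega> \<partial>Q2) - (\<integral>x. W x * g (W x) \<partial>Q)
      = (\<integral>\<omega>. ?dev \<omega> - (\<Sum>k<n. \<D> k \<omega> * (g (W (even_part \<omega>)) - g (W (resample k \<omega>)))) \<partial>Q2)"
    unfolding stein_identity[OF g]
    by (intro Bochner_Integration.integral_diff[symmetric] Q2_integrable bm_intros)
  finally have eq: "(\<integral>x. d (W x) - W x * g (W x) \<partial>Q)
      = (\<integral>\<omega>. ?dev \<omega> - (\<Sum>k<n. \<D> k \<omega> * (g (W (even_part \<omega>)) - g (W (resample k \<omega>)))) \<partial>Q2)" .
  have "\<bar>\<integral>x. d (W x) - W x * g (W x) \<partial>Q\<bar>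
      \<le> (\<integral>\<omega>. \<bar>?dev \<omega> - (\<Sum>k<n. \<D> k \<omega> * (g (W (even_part \<omega>)) - g (W (resample k \<omega>))))\<bar> \<partial>Q2)"
    unfolding eq by (rule integral_abs_bound)
  also have "\<dots> \<le> (\<integral>\<omega>. K * \<bar>\<A> \<omega> - 1\<bar> + R \<omega> \<partial>Q2)"
  proof (rule integral_mono)
    show "integrable Q2 (\<lambda>\<omega>. \<bar>?dev \<omega> - (\<Sum>k<n. \<D> k \<omega> * (g (W (even_part \<omega>)) - g (W (resample k \<omega>))))\<bar>)"
      "integrable Q2 (\<lambda>\<omega>. K * \<bar>\<A> \<omega> - 1\<bar> + R \<omega>)"
      by (intro Q2_integrable bm_intros)+
    fix \<omega>
    have "(\<Sum>k<n. \<D> k \<omega> * (g (W (even_part \<omega>)) - g (W (resample k \<omega>)))) = ?rem \<omega> + ?dev \<omega> * \<A> \<omega>"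
      unfolding \<A>_def sum_distrib_left sum.distrib[symmetric] by (intro sum.cong refl) (simp add: algebra_simps)
    then have e: "?dev \<omega> - (\<Sum>k<n. \<D> k \<omega> * (g (W (even_part \<omega>)) - g (W (resample k \<omega>)))) = - (?dev \<omega> * (\<A> \<omega> - 1)) - ?rem \<omega>"
      by (simp add: algebra_simps)
    have 1: "\<bar>?dev \<omega> * (\<A> \<omega> - 1)\<bar> \<le> K * \<bar>\<A> \<omega> - 1\<bar>"
      unfolding abs_mult by (intro mult_right_mono d_le) auto
    have "\<bar>?rem \<omega>\<bar> \<le> (\<Sum>k<n. \<bar>\<D> k \<omega> * (g (W (even_part \<omega>)) - g (W (resample k \<omega>)) - ?dev \<omega> * \<Delta> k \<omega>)\<bar>)"
      by (rule sum_abs)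
    also have "\<dots> \<le> R \<omega>" unfolding abs_mult by (rule rem)
    finally have 2: "\<bar>?rem \<omega>\<bar> \<le> R \<omega>" .
    have "\<bar>- x - y\<bar> \<le> \<bar>x\<bar> + \<bar>y\<bar>" for x y :: real by linarith
    then show "\<bar>?dev \<omega> - (\<Sum>k<n. \<D> k \<omega> * (g (W (even_part \<omega>)) - g (W (resample k \<omega>))))\<bar> \<le> K * \<bar>\<A> \<omega> - 1\<bar> + R \<omega>"
      unfolding e by (rule order_trans[OF _ add_mono[OF 1 2]])
  qed
  also have "\<dots> = K * (\<integral>\<omega>. \<bar>\<A> \<omega> - 1\<bar> \<partial>Q2) + (\<integral>\<omega>. R \<omega> \<partial>Q2)"
  proof -
    have "integrable Q2 (\<lambda>\<omega>. \<bar>\<A> \<omega> - 1\<bar>)" "integrable Q2 R" by (intro Q2_integrable bm_intros)+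
    then show ?thesis by simp
  qed
  also have "\<dots> \<le> K * sqrt (\<integral>\<omega>. (\<A> \<omega> - 1)\<^sup>2 \<partial>Q2) + (\<integral>\<omega>. R \<omega> \<partial>Q2)"
    by (intro add_right_mono mult_left_mono K Q2.expectation_abs_le_sqrt)
       (unfold product_law.bounded_measurable_Q[OF doubled_law], intro bm_intros)
  finally show ?thesis .
qed

text \<open>
  The sandwich for the solution \<open>g\<close> bounds the error of the linearization by \<open>\<Delta> k\<close> times the
  increment of \<open>p - c\<close>, where \<open>p w = w * g w\<close> increases, the indicator \<open>c\<close> decreases, and both are
  bounded by 1. So the error is a difference of two antisymmetric sums, which \<open>\<B>\<close> controls.
  Antisymmetry thus makes up for the fact that the increments of an indicator are not small.
\<close>

theorem kolmogorov_bound: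
  "\<bar>(\<integral>x. indicator {..z} (W x) \<partial>Q) - std_normal_cdf z\<bar>
    \<le> 2 * sqrt (\<integral>\<omega>. (\<A> \<omega> - 1)\<^sup>2 \<partial>Q2) + 4 * sqrt (\<integral>\<omega>. (\<B> \<omega>)\<^sup>2 \<partial>Q2)"
proof -
  interpret Q: prob_space Q by (rule prob_Q)
  interpret Q2: prob_space Q2 by (rule prob_Q2)
  obtain g where gcont: "continuous_on UNIV g" and g1: "\<And>w. \<bar>w * g w\<bar> \<le> 1" and gmono: "mono (\<lambda>w. w * g w)"
    and lo: "\<And>a b. a \<le> b \<Longrightarrow> (b - a) * (a * g a + indicator {..z} b - std_normal_cdf z) \<le> g b - g a"
    and up: "\<And>a b. a \<le> b \<Longrightarrow> g b - g a \<le> (b - a) * (b * g b + indicator {..z} a - std_normal_cdf z)"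
    using stein_solution_indicator[of z] by blast
  define p where "p w = w * g w" for w
  define c where "c w = (indicator {..z} w :: real)" for w
  define P where "P = std_normal_cdf z"
  define d where "d w = p w + c w - P" for w
  have P: "0 \<le> P" "P \<le> 1" by (simp_all add: P_def cdf_nonneg cdf_le_1)
  have c1: "\<bar>c w\<bar> \<le> 1" for w by (simp add: c_def indicator_def)
  have gb: "bounded_measurable seq_borel (\<lambda>x. g (W x))" by (rule continuous_compose_bm[OF gcont])
  have pb: "bounded_measurable seq_borel (\<lambda>x. p (W x))" unfolding p_def by (intro bm_intros gb)
  have cb: "bounded_measurable seq_borel (\<lambda>x. c (W x))"
    by (rule W_compose_bm) (use c1 in \<open>auto simp: c_def[abs_def]\<close>)
  have db: "bounded_measurable seq_borel (\<lambda>x. d (W x))" unfolding d_def by (intro bm_intros pb cb)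
  have d_le: "\<bar>d w\<bar> \<le> 2" for w
    using g1[of w] P by (auto simp: d_def p_def c_def indicator_def)
  let ?T = "\<lambda>f \<omega>. \<Sum>k<n. \<bar>\<D> k \<omega>\<bar> * \<Delta> k \<omega> * (f (W (even_part \<omega>)) - f (W (resample k \<omega>)))"
  have key: "\<bar>g w - g w' - d w * (w - w')\<bar> \<le> (w - w') * (p w - p w') - (w - w') * (c w - c w')" for w w'
  proof -
    have pm: "p x \<le> p y" if "x \<le> y" for x y using gmono that by (auto simp: p_def mono_def)
    have cm: "c y \<le> c x" if "x \<le> y" for x y using that by (auto simp: c_def indicator_def)
    show ?thesis
    proof (cases "w' \<le> w")
      case True
      have 1: "(w - w') * (p w' + c w - P) \<le> g w - g w'" "g w - g w' \<le> (w - w') * (p w + c w' - P)"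
        using lo[OF True] up[OF True] by (simp_all add: p_def c_def P_def)
      have "(w - w') * (p w - p w') \<ge> 0" "(w - w') * (c w' - c w) \<ge> 0"
        using True pm[OF True] cm[OF True] by (auto intro!: mult_nonneg_nonneg)
      with 1 show ?thesis unfolding d_def by (simp add: abs_le_iff algebra_simps)
    next
      case False
      then have le: "w \<le> w'" by simp
      have 1: "(w' - w) * (p w + c w' - P) \<le> g w' - g w" "g w' - g w \<le> (w' - w) * (p w' + c w - P)"
        using lo[OF le] up[OF le] by (simp_all add: p_def c_def P_def)
      have "(w' - w) * (p w' - p w) \<ge> 0" "(w' - w) * (c w - c w') \<ge> 0"
        using le pm[OF le] cm[OF le] by (auto intro!: mult_nonneg_nonneg)
      with 1 show ?thesis unfolding d_def by (simp add: abs_le_iff algebra_simps)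
    qed
  qed
  have Tb: "bounded_measurable seq_borel (?T p)" "bounded_measurable seq_borel (?T c)"
    by (intro bm_intros bm_parts[OF pb] bm_parts[OF cb])+
  have "\<bar>\<integral>x. d (W x) - W x * g (W x) \<partial>Q\<bar>
      \<le> 2 * sqrt (\<integral>\<omega>. (\<A> \<omega> - 1)\<^sup>2 \<partial>Q2) + (\<integral>\<omega>. ?T p \<omega> - ?T c \<omega> \<partial>Q2)"
  proof (rule stein_discrepancy[OF gb db d_le])
    show "bounded_measurable seq_borel (\<lambda>\<omega>. ?T p \<omega> - ?T c \<omega>)" by (intro bounded_measurable_diff Tb)
    fix \<omega>
    show "(\<Sum>k<n. \<bar>\<D> k \<omega>\<bar> * \<bar>g (W (even_part \<omega>)) - g (W (resample k \<omega>)) - d (W (even_part \<omega>)) * \<Delta> k \<omega>\<bar>) \<le> ?T p \<omega> - ?T c \<omega>"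
      unfolding sum_subtractf[symmetric]
    proof (rule sum_mono)
      fix k
      have "\<bar>\<D> k \<omega>\<bar> * \<bar>g (W (even_part \<omega>)) - g (W (resample k \<omega>)) - d (W (even_part \<omega>)) * \<Delta> k \<omega>\<bar>
         \<le> \<bar>\<D> k \<omega>\<bar> * (\<Delta> k \<omega> * (p (W (even_part \<omega>)) - p (W (resample k \<omega>))) - \<Delta> k \<omega> * (c (W (even_part \<omega>)) - c (W (resample k \<omega>))))"
        unfolding \<Delta>_def by (intro mult_left_mono key) auto
      then show "\<bar>\<D> k \<omega>\<bar> * \<bar>g (W (even_part \<omega>)) - g (W (resample k \<omega>)) - d (W (even_part \<omega>)) * \<Delta> k \<omega>\<bar>
         \<le> \<bar>\<D> k \<omega>\<bar> * \<Delta> k \<omega> * (p (W (even_part \<omega>)) - p (W (resample k \<omega>)))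
           - \<bar>\<D> k \<omega>\<bar> * \<Delta> k \<omega> * (c (W (even_part \<omega>)) - c (W (resample k \<omega>)))"
        by (simp only: right_diff_distrib mult.assoc)
    qed
  qed
  moreover have "(\<integral>\<omega>. ?T p \<omega> - ?T c \<omega> \<partial>Q2) = (\<integral>\<omega>. ?T p \<omega> \<partial>Q2) - (\<integral>\<omega>. ?T c \<omega> \<partial>Q2)"
    by (intro Bochner_Integration.integral_diff Q2_integrable Tb)
  moreover have "\<bar>\<integral>\<omega>. ?T p \<omega> \<partial>Q2\<bar> \<le> 2 * (\<integral>\<omega>. \<bar>\<B> \<omega>\<bar> \<partial>Q2)"
    by (rule antisymmetric_sum_le[OF pb]) (simp add: p_def g1)
  moreover have "\<bar>\<integral>\<omega>. ?T c \<omega> \<partial>Q2\<bar> \<le> 2 * (\<integral>\<omega>. \<bar>\<B> \<omega>\<bar> \<partial>Q2)"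
    by (rule antisymmetric_sum_le[OF cb c1])
  moreover have "(\<integral>\<omega>. \<bar>\<B> \<omega>\<bar> \<partial>Q2) \<le> sqrt (\<integral>\<omega>. (\<B> \<omega>)\<^sup>2 \<partial>Q2)"
    by (rule Q2.expectation_abs_le_sqrt)
       (unfold product_law.bounded_measurable_Q[OF doubled_law], intro bm_intros)
  ultimately have main: "\<bar>\<integral>x. d (W x) - W x * g (W x) \<partial>Q\<bar> \<le> 2 * sqrt (\<integral>\<omega>. (\<A> \<omega> - 1)\<^sup>2 \<partial>Q2) + 4 * sqrt (\<integral>\<omega>. (\<B> \<omega>)\<^sup>2 \<partial>Q2)"
    by linarith
  have "(\<integral>x. d (W x) - W x * g (W x) \<partial>Q) = (\<integral>x. c (W x) - P \<partial>Q)"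
    by (simp add: d_def p_def)
  also have "\<dots> = (\<integral>x. c (W x) \<partial>Q) - P"
  proof -
    have "integrable Q (\<lambda>x. c (W x))"
      by (rule Q.bounded_measurable_integrable) (unfold bounded_measurable_Q, rule cb)
    then show ?thesis by (simp add: Q.prob_space)
  qed
  finally show ?thesis using main by (simp add: c_def P_def)
qed

text \<open>
  Here the derivative \<open>u\<close> of the solution is Lipschitz, and the error of the linearization is of
  second order in \<open>\<Delta> k\<close>. The smoothing parameter \<open>e\<close> does not enter the constants and tends to 0.
\<close>

theorem wasserstein_bound:
  assumes h: "1-lipschitz_on UNIV h"
  shows "\<bar>(\<integral>x. h (W x) \<partial>Q) - normal_mean h\<bar>
    \<le> 15 * sqrt (\<integral>\<omega>. (\<A> \<omega> - 1)\<^sup>2 \<partial>Q2) + 5 * (\<integral>\<omega>. (\<Sum>k<n. 2 * \<bar>\<D> k \<omega>\<bar> * (\<Delta> k \<omega>)\<^sup>2) \<partial>Q2)"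
proof (rule field_le_epsilon)
  fix e :: real assume e: "e > 0"
  interpret Q: prob_space Q by (rule prob_Q)
  obtain g u where g': "\<And>x. (g has_real_derivative u x) (at x)"
    and near: "\<And>x. \<bar>(u x - x * g x) - (h x - normal_mean h)\<bar> \<le> 2 * (e / 2)"
    and u_le: "\<And>x. \<bar>u x\<bar> \<le> 15" and u_lip: "\<And>x y. \<bar>u x - u y\<bar> \<le> 10 * \<bar>x - y\<bar>"
    \<comment> \<open>Smoothing by \<open>e/2\<close> costs at most \<open>e\<close>: once for \<open>h\<close> and once for its mean.\<close>
    using stein_solution_lipschitz[OF h, of "e/2"] e by auto
  have gcont: "continuous_on UNIV g" by (intro continuous_at_imp_continuous_on ballI DERIV_isCont[OF g'])
  have "10-lipschitz_on UNIV u" by (rule lipschitz_onI) (use u_lip in \<open>auto simp: dist_real_def\<close>)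
  then have ucont: "continuous_on UNIV u" by (rule lipschitz_on_continuous_on)
  have hcont: "continuous_on UNIV h" by (rule lipschitz_on_continuous_on[OF h])
  note b = continuous_compose_bm[OF gcont] continuous_compose_bm[OF ucont] continuous_compose_bm[OF hcont]
  have taylor: "\<bar>g w - g w' - u w * (w - w')\<bar> \<le> 10 * (w - w')\<^sup>2" for w w'
  proof -
    have mvt: "\<exists>x. min a b \<le> x \<and> x \<le> max a b \<and> g b - g a = (b - a) * u x" for a b
    proof (cases a b rule: linorder_cases)
      case less
      then obtain x where "a < x" "x < b" "g b - g a = (b - a) * u x" using MVT2[of a b g u] g' by blast
      then show ?thesis by (intro exI[of _ x]) auto
    next
      case greater
      then obtain x where "b < x" "x < a" "g a - g b = (a - b) * u x" using MVT2[of b a g u] g' by blast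
      then show ?thesis by (intro exI[of _ x]) (auto simp: algebra_simps)
    qed auto
    obtain x where x: "min w' w \<le> x" "x \<le> max w' w" "g w - g w' = (w - w') * u x" using mvt by blast
    have "\<bar>x - w\<bar> \<le> \<bar>w - w'\<bar>" using x by auto
    then have "\<bar>u x - u w\<bar> \<le> 10 * \<bar>w - w'\<bar>"
      by (intro order_trans[OF u_lip] mult_left_mono) auto
    then have "\<bar>w - w'\<bar> * \<bar>u x - u w\<bar> \<le> \<bar>w - w'\<bar> * (10 * \<bar>w - w'\<bar>)" by (intro mult_left_mono) auto
    moreover have "g w - g w' - u w * (w - w') = (w - w') * (u x - u w)" using x by (simp add: algebra_simps)
    moreover have "\<bar>w - w'\<bar> * \<bar>w - w'\<bar> = (w - w')\<^sup>2" by (simp add: power2_eq_square flip: abs_mult)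
    ultimately show ?thesis by (simp add: abs_mult)
  qed
  define R where "R \<omega> = (\<Sum>k<n. 5 * (2 * \<bar>\<D> k \<omega>\<bar> * (\<Delta> k \<omega>)\<^sup>2))" for \<omega>
  have Rb: "bounded_measurable seq_borel R" unfolding R_def[abs_def] by (intro bm_intros)
  have main: "\<bar>\<integral>x. u (W x) - W x * g (W x) \<partial>Q\<bar> \<le> 15 * sqrt (\<integral>\<omega>. (\<A> \<omega> - 1)\<^sup>2 \<partial>Q2) + (\<integral>\<omega>. R \<omega> \<partial>Q2)"
  proof (rule stein_discrepancy[OF b(1,2) u_le Rb])
    fix \<omega>
    show "(\<Sum>k<n. \<bar>\<D> k \<omega>\<bar> * \<bar>g (W (even_part \<omega>)) - g (W (resample k \<omega>)) - u (W (even_part \<omega>)) * \<Delta> k \<omega>\<bar>) \<le> R \<omega>"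
      unfolding R_def
    proof (rule sum_mono)
      fix k
      have "\<bar>\<D> k \<omega>\<bar> * \<bar>g (W (even_part \<omega>)) - g (W (resample k \<omega>)) - u (W (even_part \<omega>)) * \<Delta> k \<omega>\<bar>
         \<le> \<bar>\<D> k \<omega>\<bar> * (10 * (\<Delta> k \<omega>)\<^sup>2)"
        unfolding \<Delta>_def by (intro mult_left_mono taylor) auto
      then show "\<bar>\<D> k \<omega>\<bar> * \<bar>g (W (even_part \<omega>)) - g (W (resample k \<omega>)) - u (W (even_part \<omega>)) * \<Delta> k \<omega>\<bar>
         \<le> 5 * (2 * \<bar>\<D> k \<omega>\<bar> * (\<Delta> k \<omega>)\<^sup>2)" by simp
    qed
  qed
  have i: "integrable Q (\<lambda>x. u (W x) - W x * g (W x))" "integrable Q (\<lambda>x. h (W x))"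
    by (intro Q.bounded_measurable_integrable; unfold bounded_measurable_Q; intro bm_intros b)+
  have "\<bar>(\<integral>x. h (W x) \<partial>Q) - normal_mean h - (\<integral>x. u (W x) - W x * g (W x) \<partial>Q)\<bar> \<le> e"
  proof -
    have eq: "(\<integral>x. h (W x) \<partial>Q) - normal_mean h - (\<integral>x. u (W x) - W x * g (W x) \<partial>Q)
      = (\<integral>x. h (W x) - normal_mean h - (u (W x) - W x * g (W x)) \<partial>Q)"
      using i by (simp add: Q.prob_space)
    have "\<bar>(\<integral>x. h (W x) \<partial>Q) - normal_mean h - (\<integral>x. u (W x) - W x * g (W x) \<partial>Q)\<bar>
        \<le> (\<integral>x. \<bar>h (W x) - normal_mean h - (u (W x) - W x * g (W x))\<bar> \<partial>Q)"
      unfolding eq by (rule integral_abs_bound)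
    also have "\<dots> \<le> e"
    proof (rule Q.integral_le_const)
      show "integrable Q (\<lambda>x. \<bar>h (W x) - normal_mean h - (u (W x) - W x * g (W x))\<bar>)" using i by simp
      show "AE x in Q. \<bar>h (W x) - normal_mean h - (u (W x) - W x * g (W x))\<bar> \<le> e"
      proof (intro AE_I2)
        fix x
        show "\<bar>h (W x) - normal_mean h - (u (W x) - W x * g (W x))\<bar> \<le> e"
          using near[of "W x"] by linarith
      qed
    qed
    finally show ?thesis .
  qed
  moreover have "(\<integral>\<omega>. R \<omega> \<partial>Q2) = 5 * (\<integral>\<omega>. (\<Sum>k<n. 2 * \<bar>\<D> k \<omega>\<bar> * (\<Delta> k \<omega>)\<^sup>2) \<partial>Q2)"
    unfolding R_def sum_distrib_left[symmetric] by simp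
  ultimately show "\<bar>(\<integral>x. h (W x) \<partial>Q) - normal_mean h\<bar>
    \<le> 15 * sqrt (\<integral>\<omega>. (\<A> \<omega> - 1)\<^sup>2 \<partial>Q2) + 5 * (\<integral>\<omega>. (\<Sum>k<n. 2 * \<bar>\<D> k \<omega>\<bar> * (\<Delta> k \<omega>)\<^sup>2) \<partial>Q2) + e"
    using main by linarith
qed

end

section \<open>Additive functionals of a contracting chain\<close>

definition nat_dist :: "nat \<Rightarrow> nat \<Rightarrow> nat" where
  "nat_dist i k = (if i \<le> k then k - i else i - k)"

lemma truncated_geometric_sum_le:
  fixes q :: real
  assumes q: "0 \<le> q" "q < 1" and T: "finite T"
  shows "(\<Sum>t\<in>T. if k \<le> t then q ^ (t - k) else 0) \<le> 1 / (1 - q)"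
proof -
  have "(\<Sum>t\<in>T. if k \<le> t then q ^ (t - k) else 0) = (\<Sum>t\<in>{t\<in>T. k \<le> t}. q ^ (t - k))"
    using T by (simp add: sum.inter_filter)
  also have "\<dots> = (\<Sum>i\<in>(\<lambda>t. t - k) ` {t\<in>T. k \<le> t}. q ^ i)"
    by (subst sum.reindex) (auto simp: inj_on_def)
  also have "\<dots> \<le> (\<Sum>i. q ^ i)"
    using q T by (intro sum_le_suminf summable_geometric) auto
  also have "\<dots> = 1 / (1 - q)" using q by (intro suminf_geometric) auto
  finally show ?thesis .
qed

lemma two_sided_geometric_sum_le:
  fixes q :: real
  assumes q: "0 \<le> q" "q < 1" and T: "finite T"
  shows "(\<Sum>k\<in>T. q ^ nat_dist i k) \<le> 2 / (1 - q)"
proof -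
  have "(\<Sum>k\<in>T. q ^ nat_dist i k) \<le> (\<Sum>k\<in>T. (if i \<le> k then q ^ (k - i) else 0) + (if k \<le> i then q ^ (i - k) else 0))"
    using q by (intro sum_mono) (auto simp: nat_dist_def)
  also have "\<dots> = (\<Sum>k\<in>T. if i \<le> k then q ^ (k - i) else 0) + (\<Sum>k\<in>T. if k \<le> i then q ^ (i - k) else 0)"
    by (rule sum.distrib)
  also have "(\<Sum>k\<in>T. if k \<le> i then q ^ (i - k) else 0) \<le> 1 / (1 - q)"
  proof -
    have "(\<Sum>k\<in>T. if k \<le> i then q ^ (i - k) else 0) = (\<Sum>k\<in>{k\<in>T. k \<le> i}. q ^ (i - k))"
      using T by (simp add: sum.inter_filter)
    also have "\<dots> = (\<Sum>j\<in>(\<lambda>k. i - k) ` {k\<in>T. k \<le> i}. q ^ j)"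
      by (subst sum.reindex) (auto simp: inj_on_def)
    also have "\<dots> \<le> (\<Sum>j. q ^ j)"
      using q T by (intro sum_le_suminf summable_geometric) auto
    also have "\<dots> = 1 / (1 - q)" using q by (intro suminf_geometric) auto
    finally show ?thesis .
  qed
  finally show ?thesis using truncated_geometric_sum_le[OF q T, of i] by simp
qed

lemma chain_update:
  "chain a (x(k := y)) t = chain a x t + (if k \<le> t then a ^ (t - k) * (y - x k) else 0)"
proof (cases "k \<le> t")
  case True
  have "chain a (x(k := y)) t = a ^ (t - k) * y + (\<Sum>i\<in>{..t} - {k}. a ^ (t - i) * x i)"
    unfolding chain_def using True by (subst sum.remove[of _ k]) (auto intro!: sum.cong)
  moreover have "chain a x t = a ^ (t - k) * x k + (\<Sum>i\<in>{..t} - {k}. a ^ (t - i) * x i)"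
    unfolding chain_def using True by (subst sum.remove[of _ k]) auto
  ultimately show ?thesis using True by (simp add: algebra_simps)
next
  case False
  then show ?thesis unfolding chain_def by (auto intro!: sum.cong)
qed

lemma chain_measurable [measurable]: "(\<lambda>x. chain a x t) \<in> borel_measurable seq_borel"
  unfolding chain_def by measurable

lemma chain_depends: "(\<And>i. i \<le> t \<Longrightarrow> x i = y i) \<Longrightarrow> chain a x t = chain a y t"
  unfolding chain_def by (intro sum.cong) auto

lemma le_geometric_mean: "q \<le> c * u\<^sup>2 \<Longrightarrow> q \<le> c * v\<^sup>2 \<Longrightarrow> 0 \<le> u \<Longrightarrow> 0 \<le> v \<Longrightarrow> 0 \<le> c \<Longrightarrow> q \<le> c * (u * v)" for q c u v :: real
proof (cases "u \<le> v")
  case True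
  assume "q \<le> c * u\<^sup>2" "0 \<le> u" "0 \<le> c"
  then have "c * u\<^sup>2 \<le> c * (u * v)" using True by (auto simp: power2_eq_square intro!: mult_left_mono)
  with \<open>q \<le> c * u\<^sup>2\<close> show ?thesis by linarith
next
  case False
  assume "q \<le> c * v\<^sup>2" "0 \<le> v" "0 \<le> c"
  then have "c * v\<^sup>2 \<le> c * (u * v)" using False by (auto simp: power2_eq_square intro!: mult_left_mono mult_right_mono)
  with \<open>q \<le> c * v\<^sup>2\<close> show ?thesis by linarith
qed

lemma weighted_Cauchy_Schwarz:
  fixes w v :: "nat \<Rightarrow> real"
  assumes "\<And>k. w k \<ge> 0"
  shows "(\<Sum>k\<in>I. w k * v k)\<^sup>2 \<le> (\<Sum>k\<in>I. w k) * (\<Sum>k\<in>I. w k * (v k)\<^sup>2)"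
proof -
  have "(\<Sum>k\<in>I. sqrt (w k) * (sqrt (w k) * v k))\<^sup>2 \<le> (\<Sum>k\<in>I. (sqrt (w k))\<^sup>2) * (\<Sum>k\<in>I. (sqrt (w k) * v k)\<^sup>2)"
    by (rule Cauchy_Schwarz_ineq_sum)
  then show ?thesis using assms by (simp add: power_mult_distrib mult.assoc[symmetric])
qed

lemma cube_sum_pow8_le: "(x + y + z) ^ 8 \<le> 3 ^ 8 * (x ^ 8 + y ^ 8 + z ^ 8)" if "0 \<le> x" "0 \<le> y" "0 \<le> z" for x y z :: real
proof -
  define M where "M = max x (max y z)"
  have "x + y + z \<le> 3 * M" by (simp add: M_def)
  then have "(x + y + z) ^ 8 \<le> (3 * M) ^ 8" using that by (intro power_mono) auto
  also have "\<dots> = 3 ^ 8 * M ^ 8" by (simp add: power_mult_distrib)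
  also have "M ^ 8 \<le> x ^ 8 + y ^ 8 + z ^ 8" by (auto simp: M_def max_def)
  finally show ?thesis by simp
qed

text \<open>
  Distances are measured by \<open>s\<close>-th powers: a moment of small order of a distance is a moment of high
  order of such a power. The exponent in the Hoelder condition on \<open>f\<close> is \<open>2 * s\<close>, so the effect on
  \<open>F\<close> of changing one input is a square of such a power; when two inputs are changed, one factor is
  attributed to each. The rate at which the chain forgets is \<open>r\<close>, and \<open>G\<close> is a common bound for
  first and mixed second differences of \<open>F\<close>.
\<close>

locale contraction =
  fixes a s H :: real and f :: "real \<Rightarrow> real" and n :: nat
  assumes a: "0 < a" "a < 1" and s: "0 < s" and H: "0 \<le> H"
    and hoelder: "\<And>u v. \<bar>f u - f v\<bar> \<le> H * (\<bar>u - v\<bar> powr s)\<^sup>2"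
begin

definition r :: real where "r = a powr s"
definition m :: "real \<Rightarrow> real \<Rightarrow> real" where "m x y = \<bar>x - y\<bar> powr s"
definition G :: real where "G = 2 * H / (1 - r\<^sup>2)"
definition F :: "(nat \<Rightarrow> real) \<Rightarrow> real" where "F x = (\<Sum>t=1..n. f (chain a x t))"

lemma r: "0 < r" "r < 1"
  using a s powr_less_mono2[of s a 1] by (auto simp: r_def)

lemma r2: "0 \<le> r\<^sup>2" "r\<^sup>2 < 1"
  using r by (auto simp: power_less_one_iff)

lemma G_nonneg: "G \<ge> 0" using H r2 by (simp add: G_def)

lemma m_nonneg [simp]: "m x y \<ge> 0" by (simp add: m_def)

lemma chain_step: "\<bar>f (chain a x t) - f (chain a (x(k := y)) t)\<bar> \<le> (if k \<le> t then H * (r ^ (t - k) * m (x k) y)\<^sup>2 else 0)"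
proof (cases "k \<le> t")
  case True
  have "(a ^ (t - k)) powr s = r ^ (t - k)"
    using a by (simp add: r_def powr_realpow[symmetric] powr_powr mult.commute)
  then have "\<bar>chain a x t - chain a (x(k := y)) t\<bar> powr s = r ^ (t - k) * m (x k) y"
    using a True by (simp add: chain_update abs_mult powr_mult m_def abs_minus_commute)
  then show ?thesis using hoelder[of "chain a x t" "chain a (x(k := y)) t"] True by simp
qed (simp add: chain_update)

lemma F_step: "\<bar>F x - F (x(k := y))\<bar> \<le> G * (m (x k) y)\<^sup>2"
proof -
  have "\<bar>F x - F (x(k := y))\<bar> \<le> (\<Sum>t=1..n. \<bar>f (chain a x t) - f (chain a (x(k := y)) t)\<bar>)"
    unfolding F_def sum_subtractf[symmetric] by (rule sum_abs)
  also have "\<dots> \<le> (\<Sum>t=1..n. H * (m (x k) y)\<^sup>2 * (if k \<le> t then (r\<^sup>2) ^ (t - k) else 0))"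
    by (intro sum_mono order_trans[OF chain_step])
       (auto simp: power_mult_distrib power_mult[symmetric] mult_ac)
  also have "\<dots> = H * (m (x k) y)\<^sup>2 * (\<Sum>t=1..n. if k \<le> t then (r\<^sup>2) ^ (t - k) else 0)"
    by (rule sum_distrib_left[symmetric])
  also have "\<dots> \<le> H * (m (x k) y)\<^sup>2 * (1 / (1 - r\<^sup>2))"
    using H by (intro mult_left_mono truncated_geometric_sum_le r2) auto
  also have "\<dots> \<le> 2 * (H * (m (x k) y)\<^sup>2 * (1 / (1 - r\<^sup>2)))"
  proof -
    have "0 \<le> H * (m (x k) y)\<^sup>2 * (1 / (1 - r\<^sup>2))" using H r2 by (intro mult_nonneg_nonneg) auto
    then show ?thesis by linarith
  qed
  also have "\<dots> = G * (m (x k) y)\<^sup>2" by (simp add: G_def)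
  finally show ?thesis .
qed

text \<open>
  Each summand of the mixed difference is at most twice the effect of either change alone. The
  geometric mean of the two bounds contains one factor for each changed input. Its rate \<open>r ^ ((t -
  k) + (t - i))\<close> splits into \<open>r ^ nat_dist i k\<close> and a factor that is summable over \<open>t\<close>.
\<close>

lemma F_mixed_step:
  assumes ki: "k \<noteq> i"
  shows "\<bar>(F x - F (x(k := y))) - (F (x(i := z)) - F (x(i := z, k := y)))\<bar> \<le> G * r ^ nat_dist i k * (m (x k) y * m (x i) z)"
proof -
  let ?q = "\<lambda>t. \<bar>(f (chain a x t) - f (chain a (x(k := y)) t)) - (f (chain a (x(i := z)) t) - f (chain a (x(i := z, k := y)) t))\<bar>"
  define M where "M = max k i"
  have q: "?q t \<le> 2 * H * r ^ nat_dist i k * (m (x k) y * m (x i) z) * (if M \<le> t then (r\<^sup>2) ^ (t - M) else 0)" for t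
  proof -
    have 1: "?q t \<le> (if k \<le> t then 2 * H * (r ^ (t - k) * m (x k) y)\<^sup>2 else 0)"
      using chain_step[of x t k y] chain_step[of "x(i := z)" t k y] ki by (auto split: if_splits)
    have c: "x(i := z, k := y) = x(k := y, i := z)" using ki by (rule fun_upd_twist[symmetric])
    have "?q t = \<bar>(f (chain a x t) - f (chain a (x(i := z)) t)) - (f (chain a (x(k := y)) t) - f (chain a (x(k := y, i := z)) t))\<bar>"
      unfolding c by simp
    then have 2: "?q t \<le> (if i \<le> t then 2 * H * (r ^ (t - i) * m (x i) z)\<^sup>2 else 0)"
      using chain_step[of x t i z] chain_step[of "x(k := y)" t i z] ki by (auto split: if_splits)
    show ?thesis
    proof (cases "M \<le> t")
      case True
      then have t: "k \<le> t" "i \<le> t" by (auto simp: M_def)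
      have "?q t \<le> 2 * H * ((r ^ (t - k) * m (x k) y) * (r ^ (t - i) * m (x i) z))"
        using 1 2 t r H by (intro le_geometric_mean) auto
      also have "\<dots> = 2 * H * (r ^ ((t - k) + (t - i))) * (m (x k) y * m (x i) z)"
        by (simp add: power_add mult_ac)
      also have "(t - k) + (t - i) = nat_dist i k + 2 * (t - M)"
        using t by (auto simp: nat_dist_def M_def max_def)
      also have "2 * H * r ^ (nat_dist i k + 2 * (t - M)) * (m (x k) y * m (x i) z) = 2 * H * r ^ nat_dist i k * (m (x k) y * m (x i) z) * (r\<^sup>2) ^ (t - M)"
      proof -
        have "r ^ (d + 2 * e) = r ^ d * (r\<^sup>2) ^ e" for d e by (simp add: power_add power_mult)
        then show ?thesis by (simp only: mult_ac)
      qed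
      finally show ?thesis unfolding if_P[OF True] .
    next
      case False
      then show ?thesis using 1 2 by (auto simp: M_def split: if_splits)
    qed
  qed
  have "\<bar>(F x - F (x(k := y))) - (F (x(i := z)) - F (x(i := z, k := y)))\<bar> \<le> (\<Sum>t=1..n. ?q t)"
    unfolding F_def sum_subtractf[symmetric] by (rule sum_abs)
  also have "\<dots> \<le> (\<Sum>t=1..n. 2 * H * r ^ nat_dist i k * (m (x k) y * m (x i) z) * (if M \<le> t then (r\<^sup>2) ^ (t - M) else 0))"
    by (rule sum_mono) (rule q)
  also have "\<dots> = 2 * H * r ^ nat_dist i k * (m (x k) y * m (x i) z) * (\<Sum>t=1..n. if M \<le> t then (r\<^sup>2) ^ (t - M) else 0)"
    by (rule sum_distrib_left[symmetric])
  also have "\<dots> \<le> 2 * H * r ^ nat_dist i k * (m (x k) y * m (x i) z) * (1 / (1 - r\<^sup>2))"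
    using H r by (intro mult_left_mono truncated_geometric_sum_le r2) auto
  finally show ?thesis by (simp add: G_def mult_ac)
qed

text \<open>
  A selection takes one member of each pair, the second one for the indices with \<open>p i\<close>. The
  sequences \<open>even_part\<close> and \<open>mix k\<close> are selections, and \<open>resample k\<close> is one with entry \<open>k\<close>
  exchanged. The gain is the increment of \<open>F\<close> when entry \<open>k\<close> is exchanged; up to constants \<open>\<D> k\<close> and
  \<open>\<Delta> k\<close> are gains. The spread is a common bound for the distances that occur when coordinate \<open>j\<close> of
  the doubled sequence is changed.
\<close>

definition pair_gap :: "(nat \<Rightarrow> real) \<Rightarrow> nat \<Rightarrow> real" where
  "pair_gap \<omega> k = m (\<omega> (2 * k)) (\<omega> (2 * k + 1))"

definition spread :: "nat \<Rightarrow> (nat \<Rightarrow> real) \<Rightarrow> (nat \<Rightarrow> real) \<Rightarrow> nat \<Rightarrow> real" where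
  "spread j \<omega> \<omega>' k = pair_gap \<omega> k + pair_gap \<omega>' k + m (\<omega> j) (\<omega>' j)"

lemma pair_gap_nonneg [simp]: "pair_gap \<omega> k \<ge> 0" by (simp add: pair_gap_def)

lemma spread_bounds: "0 \<le> spread j \<omega> \<omega>' k" "pair_gap \<omega> k \<le> spread j \<omega> \<omega>' k" "pair_gap \<omega>' k \<le> spread j \<omega> \<omega>' k"
   "m (\<omega> j) (\<omega>' j) \<le> spread j \<omega> \<omega>' k"
  by (simp_all add: spread_def)

definition selection :: "(nat \<Rightarrow> bool) \<Rightarrow> (nat \<Rightarrow> real) \<Rightarrow> nat \<Rightarrow> real" where
  "selection p \<omega> i = (if p i then \<omega> (2 * i + 1) else \<omega> (2 * i))"

definition gain :: "(nat \<Rightarrow> bool) \<Rightarrow> nat \<Rightarrow> (nat \<Rightarrow> real) \<Rightarrow> real" where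
  "gain p k \<omega> = F (selection p \<omega>) - F ((selection p \<omega>)(k := \<omega> (2 * k + 1)))"

lemma gain_le:
  assumes "\<not> p k"
  shows "\<bar>gain p k \<omega>\<bar> \<le> G * (pair_gap \<omega> k)\<^sup>2"
  using F_step[of "selection p \<omega>" k "\<omega> (2 * k + 1)"] assms
  by (simp add: gain_def pair_gap_def selection_def)

lemma selection_update:
  "selection p (fun_upd \<omega> j w) = (if p (j div 2) = odd j then (selection p \<omega>)(j div 2 := w) else selection p \<omega>)"
proof
  fix i
  show "selection p (fun_upd \<omega> j w) i = (if p (j div 2) = odd j then (selection p \<omega>)(j div 2 := w) else selection p \<omega>) i"
    by (cases "even j") (auto simp: selection_def elim!: evenE oddE)
qed

text \<open>
  If coordinate \<open>j\<close> belongs to pair \<open>k\<close>, the change is one step of \<open>F\<close>, and the claim contains no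
  decay. If it belongs to another pair that is visible in the selection, the change is a mixed
  second difference.
\<close>

lemma gain_perturb:
  fixes j :: nat
  assumes p: "\<not> p k"
  defines "i \<equiv> j div 2"
  shows "\<bar>gain p k \<omega> - gain p k (fun_upd \<omega> j w)\<bar> \<le> G * r ^ nat_dist i k * (spread j \<omega> (fun_upd \<omega> j w) k)\<^sup>2"
proof (cases "k = i")
  case True
  let ?V = "spread j \<omega> (fun_upd \<omega> j w) k"
  let ?b = "selection p \<omega>"
  have "\<bar>gain p k \<omega> - gain p k (fun_upd \<omega> j w)\<bar> \<le> G * (m (\<omega> j) w)\<^sup>2"
  proof (cases "even j")
    case True
    then have j: "j = 2 * k" using \<open>k = i\<close> by (auto simp: i_def)
    have "selection p (fun_upd \<omega> j w) = ?b(k := w)" using p j by (simp add: selection_update)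
    then have "gain p k \<omega> - gain p k (fun_upd \<omega> j w) = F ?b - F (?b(k := w))"
      unfolding gain_def using j by simp
    moreover have "?b k = \<omega> j" using p j by (simp add: selection_def)
    ultimately show ?thesis using F_step[of ?b k w] by simp
  next
    case False
    then have j: "j = 2 * k + 1" using \<open>k = i\<close> by (auto simp: i_def elim!: oddE)
    have "selection p (fun_upd \<omega> j w) = ?b" using p j by (simp add: selection_update)
    then have "gain p k \<omega> - gain p k (fun_upd \<omega> j w) = - (F (?b(k := \<omega> j)) - F ((?b(k := \<omega> j))(k := w)))"
      unfolding gain_def using j by simp
    then show ?thesis using F_step[of "?b(k := \<omega> j)" k w] by simp
  qed
  also have "\<dots> \<le> G * ?V\<^sup>2"
    using G_nonneg spread_bounds(4)[where j=j and \<omega>=\<omega> and \<omega>'="fun_upd \<omega> j w" and k=k] by (intro mult_left_mono power_mono) auto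
  also have "\<dots> = G * r ^ nat_dist i k * ?V\<^sup>2" using True by (simp add: nat_dist_def)
  finally show ?thesis .
next
  case False
  let ?V = "spread j \<omega> (fun_upd \<omega> j w) k"
  let ?b = "selection p \<omega>"
  have y: "(fun_upd \<omega> j w) (2 * k + 1) = \<omega> (2 * k + 1)" using False by (auto simp: i_def)
  have nn: "0 \<le> G * r ^ nat_dist i k" using G_nonneg r by simp
  have "\<bar>gain p k \<omega> - gain p k (fun_upd \<omega> j w)\<bar> \<le> G * r ^ nat_dist i k * (pair_gap \<omega> k * m (\<omega> j) w)"
  proof (cases "p i = odd j")
    case True
    have "selection p (fun_upd \<omega> j w) = ?b(i := w)" using True by (simp add: selection_update i_def)
    then have "gain p k \<omega> - gain p k (fun_upd \<omega> j w)
        = (F ?b - F (?b(k := \<omega> (2 * k + 1)))) - (F (?b(i := w)) - F (?b(i := w, k := \<omega> (2 * k + 1))))"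
      unfolding gain_def y by simp
    moreover have "?b k = \<omega> (2 * k)" using p by (simp add: selection_def)
    moreover have "?b i = \<omega> j" using True by (cases "even j") (auto simp: selection_def i_def elim!: evenE oddE)
    ultimately show ?thesis using F_mixed_step[OF False, of ?b "\<omega> (2 * k + 1)" w] by (simp add: pair_gap_def)
  next
    case False
    then have "selection p (fun_upd \<omega> j w) = ?b" by (simp add: selection_update i_def)
    then have "gain p k (fun_upd \<omega> j w) = gain p k \<omega>" unfolding gain_def y by simp
    then show ?thesis using nn by simp
  qed
  also have "\<dots> \<le> G * r ^ nat_dist i k * (?V * ?V)"
    using spread_bounds[where j=j and \<omega>=\<omega> and \<omega>'="fun_upd \<omega> j w" and k=k] by (intro mult_left_mono mult_mono nn) auto
  finally show ?thesis by (simp add: power2_eq_square)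
qed

text \<open>
  The function \<open>\<phi>\<close> is the identity in the application to \<open>\<A>\<close> and the absolute value in that to \<open>\<B>\<close>.
\<close>

lemma gain_product_perturb:
  assumes "\<not> p k" "\<not> p' k"
    and D: "\<And>x y. \<bar>\<phi> x - \<phi> y\<bar> \<le> \<bar>x - y\<bar>" "\<And>x. \<bar>\<phi> x\<bar> \<le> \<bar>x\<bar>"
  shows "\<bar>\<phi> (gain p k \<omega>) * gain p' k \<omega> - \<phi> (gain p k (fun_upd \<omega> j w)) * gain p' k (fun_upd \<omega> j w)\<bar>
    \<le> 2 * G\<^sup>2 * r ^ nat_dist (j div 2) k * (spread j \<omega> (fun_upd \<omega> j w) k) ^ 4"
proof -
  let ?\<omega>' = "fun_upd \<omega> j w" and ?V = "spread j \<omega> (fun_upd \<omega> j w) k" and ?R = "r ^ nat_dist (j div 2) k"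
  have nn: "0 \<le> G * ?R" using G_nonneg r by simp
  have 1: "\<bar>\<phi> (gain p k \<omega>) - \<phi> (gain p k ?\<omega>')\<bar> \<le> G * ?R * ?V\<^sup>2"
    by (rule order_trans[OF D(1) gain_perturb[of p k, OF assms(1)]])
  have 2: "\<bar>gain p' k \<omega>\<bar> \<le> G * ?V\<^sup>2"
    using gain_le[of p' k \<omega>] assms(2) G_nonneg spread_bounds[where j=j and \<omega>=\<omega> and \<omega>'="?\<omega>'" and k=k]
    by (intro order_trans[OF gain_le] mult_left_mono power_mono) auto
  have 3: "\<bar>\<phi> (gain p k ?\<omega>')\<bar> \<le> G * ?V\<^sup>2"
    using assms(1) G_nonneg spread_bounds[where j=j and \<omega>=\<omega> and \<omega>'="?\<omega>'" and k=k]
    by (intro order_trans[OF D(2)] order_trans[OF gain_le] mult_left_mono power_mono) auto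
  have 4: "\<bar>gain p' k \<omega> - gain p' k ?\<omega>'\<bar> \<le> G * ?R * ?V\<^sup>2"
    by (rule gain_perturb[of p' k, OF assms(2)])
  have "\<phi> (gain p k \<omega>) * gain p' k \<omega> - \<phi> (gain p k ?\<omega>') * gain p' k ?\<omega>'
     = (\<phi> (gain p k \<omega>) - \<phi> (gain p k ?\<omega>')) * gain p' k \<omega> + \<phi> (gain p k ?\<omega>') * (gain p' k \<omega> - gain p' k ?\<omega>')"
    by (simp add: algebra_simps)
  then have "\<bar>\<phi> (gain p k \<omega>) * gain p' k \<omega> - \<phi> (gain p k ?\<omega>') * gain p' k ?\<omega>'\<bar>
     \<le> \<bar>\<phi> (gain p k \<omega>) - \<phi> (gain p k ?\<omega>')\<bar> * \<bar>gain p' k \<omega>\<bar> + \<bar>\<phi> (gain p k ?\<omega>')\<bar> * \<bar>gain p' k \<omega> - gain p' k ?\<omega>'\<bar>"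
    by (metis abs_mult abs_triangle_ineq)
  also have "\<dots> \<le> (G * ?R * ?V\<^sup>2) * (G * ?V\<^sup>2) + (G * ?V\<^sup>2) * (G * ?R * ?V\<^sup>2)"
    using nn G_nonneg by (intro add_mono mult_mono 1 2 3 4) auto
  also have "\<dots> = 2 * G\<^sup>2 * ?R * ?V ^ 4" by (simp add: power2_eq_square power4_eq_xxxx)
  finally show ?thesis .
qed

text \<open>
  The Cauchy-Schwarz inequality is used with the geometric weights, whose total is bounded. This
  keeps the bound for one coordinate independent of the number \<open>N\<close> of summands.
\<close>

lemma gain_sum_perturb:
  fixes N :: nat
  assumes p: "\<And>k. \<not> p k k" "\<And>k. \<not> p' k k"
    and D: "\<And>x y. \<bar>\<phi> x - \<phi> y\<bar> \<le> \<bar>x - y\<bar>" "\<And>x. \<bar>\<phi> x\<bar> \<le> \<bar>x\<bar>"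
  defines "S \<equiv> \<lambda>\<omega>. \<Sum>k<N. \<phi> (gain (p k) k \<omega>) * gain (p' k) k \<omega>"
  shows "(S \<omega> - S (fun_upd \<omega> j w))\<^sup>2 \<le> 8 * G ^ 4 / (1 - r) *
     (\<Sum>k<N. r ^ nat_dist (j div 2) k * (3 ^ 8 * (pair_gap \<omega> k ^ 8 + pair_gap (fun_upd \<omega> j w) k ^ 8 + m (\<omega> j) w ^ 8)))"
proof -
  let ?\<omega>' = "fun_upd \<omega> j w"
  let ?V = "\<lambda>k. spread j \<omega> ?\<omega>' k" and ?R = "\<lambda>k. r ^ nat_dist (j div 2) k"
  have "\<bar>S \<omega> - S ?\<omega>'\<bar> \<le> (\<Sum>k<N. \<bar>\<phi> (gain (p k) k \<omega>) * gain (p' k) k \<omega> - \<phi> (gain (p k) k ?\<omega>') * gain (p' k) k ?\<omega>'\<bar>)"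
    unfolding S_def sum_subtractf[symmetric] by (rule sum_abs)
  also have "\<dots> \<le> (\<Sum>k<N. 2 * G\<^sup>2 * ?R k * ?V k ^ 4)"
    by (intro sum_mono gain_product_perturb p D)
  also have "\<dots> = 2 * G\<^sup>2 * (\<Sum>k<N. ?R k * ?V k ^ 4)" by (simp add: sum_distrib_left mult.assoc)
  finally have "\<bar>S \<omega> - S ?\<omega>'\<bar>\<^sup>2 \<le> (2 * G\<^sup>2 * (\<Sum>k<N. ?R k * ?V k ^ 4))\<^sup>2" by (intro power_mono) auto
  also have "\<dots> = 4 * G ^ 4 * (\<Sum>k<N. ?R k * ?V k ^ 4)\<^sup>2" by (simp add: power_mult_distrib power_mult[symmetric])
  also have "\<dots> \<le> 4 * G ^ 4 * ((\<Sum>k<N. ?R k) * (\<Sum>k<N. ?R k * (?V k ^ 4)\<^sup>2))"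
    using r G_nonneg by (intro mult_left_mono weighted_Cauchy_Schwarz) auto
  also have "\<dots> \<le> 4 * G ^ 4 * (2 / (1 - r) * (\<Sum>k<N. ?R k * (3 ^ 8 * (pair_gap \<omega> k ^ 8 + pair_gap ?\<omega>' k ^ 8 + m (\<omega> j) w ^ 8))))"
  proof (intro mult_left_mono mult_mono)
    show "(\<Sum>k<N. ?R k) \<le> 2 / (1 - r)" using r by (intro two_sided_geometric_sum_le) auto
    show "(\<Sum>k<N. ?R k * (?V k ^ 4)\<^sup>2) \<le> (\<Sum>k<N. ?R k * (3 ^ 8 * (pair_gap \<omega> k ^ 8 + pair_gap ?\<omega>' k ^ 8 + m (\<omega> j) w ^ 8)))"
    proof (intro sum_mono mult_left_mono)
      fix k
      have "(?V k ^ 4)\<^sup>2 = ?V k ^ 8" by (simp flip: power_mult)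
      also have "\<dots> \<le> 3 ^ 8 * (pair_gap \<omega> k ^ 8 + pair_gap ?\<omega>' k ^ 8 + m (\<omega> j) (?\<omega>' j) ^ 8)"
        unfolding spread_def by (rule cube_sum_pow8_le) auto
      finally show "(?V k ^ 4)\<^sup>2 \<le> 3 ^ 8 * (pair_gap \<omega> k ^ 8 + pair_gap ?\<omega>' k ^ 8 + m (\<omega> j) w ^ 8)" by simp
    qed (use r in auto)
  qed (use r G_nonneg in \<open>auto intro!: sum_nonneg\<close>)
  also have "\<dots> = 8 * G ^ 4 / (1 - r) * (\<Sum>k<N. ?R k * (3 ^ 8 * (pair_gap \<omega> k ^ 8 + pair_gap ?\<omega>' k ^ 8 + m (\<omega> j) w ^ 8)))"
    by simp
  finally show ?thesis by simp
qed

end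

section \<open>Variance bounds from eighth moments\<close>

text \<open>
  Eighth powers are needed because the Efron-Stein inequality is applied to sums of products of two
  gains: each gain is quadratic in the \<open>s\<close>-th powers of distances, and the increments are squared.
\<close>

locale moment_law = product_law +
  fixes s K :: real
  assumes s_pos: "0 < s" and K_nonneg: "0 \<le> K"
    and moment: "\<And>i. (\<integral>\<^sup>+ z. ennreal (\<bar>fst z - snd z\<bar> powr (8 * s)) \<partial>(\<mu> i \<Otimes>\<^sub>M \<mu> i)) \<le> ennreal K"
begin

lemma doubled_moment_law: "moment_law (doubled \<mu>) s K"
  using doubled_law s_pos K_nonneg moment by (simp add: moment_law_def moment_law_axioms_def doubled_def)

lemma pair_moment:
  assumes ij: "i \<noteq> j" "\<mu> i = \<mu> j"
  shows "integrable Q (\<lambda>\<omega>. (\<bar>\<omega> i - \<omega> j\<bar> powr s) ^ 8)" "(\<integral>\<omega>. (\<bar>\<omega> i - \<omega> j\<bar> powr s) ^ 8 \<partial>Q) \<le> K"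
proof -
  have pw: "(x powr s) ^ 8 = x powr (8 * s)" if "x \<ge> 0" for x :: real
  proof (cases "x = 0")
    case False
    then have "(x powr s) ^ 8 = (x powr s) powr real 8" using that by (subst powr_realpow) auto
    then show ?thesis by (simp add: powr_powr mult.commute)
  qed (use s_pos in auto)
  have meas: "(\<lambda>\<omega>. (\<bar>\<omega> i - \<omega> j\<bar> powr s) ^ 8) \<in> borel_measurable Q"
    unfolding measurable_Q by measurable
  have T: "(\<lambda>\<omega>. (\<omega> i, \<omega> j)) \<in> measurable Q (borel \<Otimes>\<^sub>M borel)"
    unfolding measurable_cong_sets[OF sets_Q refl] by measurable
  have "(\<integral>\<^sup>+ \<omega>. ennreal ((\<bar>\<omega> i - \<omega> j\<bar> powr s) ^ 8) \<partial>Q) = (\<integral>\<^sup>+ \<omega>. (\<lambda>z. ennreal (\<bar>fst z - snd z\<bar> powr (8 * s))) (\<omega> i, \<omega> j) \<partial>Q)"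
    by (simp add: pw)
  also have "\<dots> = (\<integral>\<^sup>+ z. ennreal (\<bar>fst z - snd z\<bar> powr (8 * s)) \<partial>(distr Q (borel \<Otimes>\<^sub>M borel) (\<lambda>\<omega>. (\<omega> i, \<omega> j))))"
    by (rule nn_integral_distr[OF T, symmetric]) measurable
  also have "\<dots> \<le> ennreal K" unfolding pair_law[OF ij(1)] using moment[of i] ij(2) by simp
  finally have le: "(\<integral>\<^sup>+ \<omega>. ennreal ((\<bar>\<omega> i - \<omega> j\<bar> powr s) ^ 8) \<partial>Q) \<le> ennreal K" .
  show int: "integrable Q (\<lambda>\<omega>. (\<bar>\<omega> i - \<omega> j\<bar> powr s) ^ 8)"
    by (rule integrableI_nonneg[OF meas]) (use le in \<open>auto intro: le_less_trans\<close>)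
  have "ennreal (\<integral>\<omega>. (\<bar>\<omega> i - \<omega> j\<bar> powr s) ^ 8 \<partial>Q) = (\<integral>\<^sup>+ \<omega>. ennreal ((\<bar>\<omega> i - \<omega> j\<bar> powr s) ^ 8) \<partial>Q)"
    by (rule nn_integral_eq_integral[OF int, symmetric]) auto
  with le have "ennreal (\<integral>\<omega>. (\<bar>\<omega> i - \<omega> j\<bar> powr s) ^ 8 \<partial>Q) \<le> ennreal K" by (simp only:)
  then show "(\<integral>\<omega>. (\<bar>\<omega> i - \<omega> j\<bar> powr s) ^ 8 \<partial>Q) \<le> K"
    using K_nonneg by (simp only: ennreal_le_iff)
qed

end

locale chain_law = moment_law \<mu> s K + contraction a s H f n for \<mu> s K a H f n +
  fixes Bf c \<sigma> :: real
  assumes f_meas: "f \<in> borel_measurable borel" and f_bdd: "\<And>u. \<bar>f u\<bar> \<le> Bf"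
    and \<sigma>: "\<sigma> > 0"
    and mean: "(\<integral>x. F x \<partial>Q) = c" and var: "(\<integral>x. (F x - c)\<^sup>2 \<partial>Q) = \<sigma>\<^sup>2"
begin

lemma F_bm: "bounded_measurable seq_borel F"
proof -
  have "bounded_measurable seq_borel (\<lambda>x. f (chain a x t))" for t
    by (rule bounded_measurableI[OF measurable_compose[OF chain_measurable f_meas] f_bdd])
  then show ?thesis unfolding F_def[abs_def] by (intro bounded_measurable_sum) auto
qed

lemma F_depends: "depends_below (Suc n) F"
  unfolding depends_below_def F_def
  by (intro allI impI sum.cong refl arg_cong[where f=f] chain_depends) auto

definition W :: "(nat \<Rightarrow> real) \<Rightarrow> real" where "W x = (F x - c) / \<sigma>"

\<comment> \<open>There are \<open>Suc n\<close> inputs because the starting value is one of them.\<close>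
sublocale normalized_functional \<mu> W "Suc n"
proof (unfold_locales)
  show "bounded_measurable seq_borel W" unfolding W_def[abs_def] by (intro bm_intros F_bm)
  show "depends_below (Suc n) W" using F_depends by (simp add: depends_below_def W_def)
  interpret Q: prob_space Q by (rule prob_Q)
  have "integrable Q F" by (rule Q.bounded_measurable_integrable) (simp add: bounded_measurable_Q F_bm)
  then show "(\<integral>x. W x \<partial>Q) = 0" unfolding W_def using mean by (simp add: Q.prob_space)
  show "(\<integral>x. (W x)\<^sup>2 \<partial>Q) = 1" unfolding W_def using var \<sigma> by (simp add: power_divide)
qed

lemma selection_parts:
  "even_part \<omega> = selection (\<lambda>_. False) \<omega>"
  "resample k \<omega> = (selection (\<lambda>_. False) \<omega>)(k := \<omega> (2 * k + 1))"
  "mix k \<omega> = selection (\<lambda>i. i < k) \<omega>"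
  "mix (Suc k) \<omega> = (selection (\<lambda>i. i < k) \<omega>)(k := \<omega> (2 * k + 1))"
  by (auto simp: fun_eq_iff even_part_def resample_def mix_def selection_def)

lemma D_gain: "\<D> k \<omega> = gain (\<lambda>i. i < k) k \<omega> / (2 * \<sigma>)"
  unfolding \<D>_def W_def gain_def selection_parts(4)[of k] selection_parts(3)[of k]
  by (simp add: diff_divide_distrib[symmetric] mult.commute)

lemma Delta_gain: "\<Delta> k \<omega> = gain (\<lambda>_. False) k \<omega> / \<sigma>"
  unfolding \<Delta>_def W_def gain_def selection_parts by (simp add: diff_divide_distrib[symmetric])

lemma A_gain: "\<A> \<omega> = (\<Sum>k<Suc n. gain (\<lambda>i. i < k) k \<omega> * gain (\<lambda>_. False) k \<omega>) / (2 * \<sigma>\<^sup>2)"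
  unfolding \<A>_def D_gain Delta_gain sum_divide_distrib by (intro sum.cong refl) (simp add: power2_eq_square)

lemma B_gain: "\<B> \<omega> = (\<Sum>k<Suc n. \<bar>gain (\<lambda>i. i < k) k \<omega>\<bar> * gain (\<lambda>_. False) k \<omega>) / (2 * \<sigma>\<^sup>2)"
  unfolding \<B>_def D_gain Delta_gain sum_divide_distrib using \<sigma>
  by (intro sum.cong refl) (simp add: power2_eq_square abs_divide)

lemma gain_depends:
  assumes "\<And>i. i < 2 * Suc n \<Longrightarrow> \<omega> i = \<omega>' i" "k < Suc n"
  shows "gain p k \<omega> = gain p k \<omega>'"
proof -
  have "F (selection p \<omega>) = F (selection p \<omega>')"
    using F_depends assms unfolding depends_below_def selection_def by auto
  moreover have "F ((selection p \<omega>)(k := \<omega> (2 * k + 1))) = F ((selection p \<omega>')(k := \<omega>' (2 * k + 1)))"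
  proof -
    have "((selection p \<omega>)(k := \<omega> (2 * k + 1))) i = ((selection p \<omega>')(k := \<omega>' (2 * k + 1))) i" if "i < Suc n" for i
      using that assms by (auto simp: selection_def)
    then show ?thesis using F_depends unfolding depends_below_def by blast
  qed
  ultimately show ?thesis by (simp add: gain_def)
qed

lemma gain_sum_depends:
  "depends_below (2 * Suc n) (\<lambda>\<omega>. (\<Sum>k<Suc n. \<phi> (gain (p k) k \<omega>) * gain (p' k) k \<omega>) / d)"
  unfolding depends_below_def
proof (intro allI impI)
  fix x y :: "nat \<Rightarrow> real" assume xy: "\<forall>i<2 * Suc n. x i = y i"
  have "gain p k x = gain p k y" if "k < Suc n" for p k
    using that xy by (intro gain_depends) auto
  then show "(\<Sum>k<Suc n. \<phi> (gain (p k) k x) * gain (p' k) k x) / d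
    = (\<Sum>k<Suc n. \<phi> (gain (p k) k y) * gain (p' k) k y) / d"
    by (intro arg_cong[where f="\<lambda>x. x / d"] sum.cong refl) auto
qed

lemma A_depends: "depends_below (2 * Suc n) \<A>"
  using gain_sum_depends[of "\<lambda>x. x"] by (simp only: A_gain[abs_def])

lemma B_depends: "depends_below (2 * Suc n) \<B>"
  using gain_sum_depends[of abs] by (simp only: B_gain[abs_def])

text \<open>
  \<open>\<A>\<close> and \<open>\<B>\<close> are already functions of a doubled sequence. Resampling their arguments requires a
  second doubling, in which every input occurs in four independent copies.
\<close>

abbreviation "Q4 \<equiv> PiM UNIV (doubled (doubled \<mu>))"

definition var_const :: real where "var_const = 8 * G ^ 4 / (1 - r) * (2 / (1 - r)) * (3 ^ 9 * K)"

text \<open>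
  Every distance in the hypothesis compares two different copies of one input, so its eighth power
  has expectation at most \<open>K\<close>. The sum of the geometric weights does not depend on the number of
  inputs.
\<close>

lemma gain_sum_resample:
  assumes T: "bounded_measurable seq_borel T"
    and T_le: "\<And>\<omega> w. (T \<omega> - T (fun_upd \<omega> j w))\<^sup>2 \<le> 8 * G ^ 4 / (1 - r) *
     (\<Sum>k<Suc n. r ^ nat_dist (j div 2) k * (3 ^ 8 * (pair_gap \<omega> k ^ 8 + pair_gap (fun_upd \<omega> j w) k ^ 8 + m (\<omega> j) w ^ 8)))"
  shows "(\<integral>\<eta>. (T (even_part \<eta>) - T (resample j \<eta>))\<^sup>2 \<partial>Q4) \<le> var_const"
proof -
  interpret d: moment_law "doubled \<mu>" s K by (rule doubled_moment_law)
  interpret dd: moment_law "doubled (doubled \<mu>)" s K by (rule d.doubled_moment_law)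
  interpret Q4: prob_space Q4 by (rule dd.prob_Q)
  have res: "resample j \<eta> = fun_upd (even_part \<eta>) j (\<eta> (2 * j + 1))" for \<eta> :: "nat \<Rightarrow> real"
    by (auto simp: fun_eq_iff resample_def even_part_def)
  define Z1 where "Z1 k \<eta> = pair_gap (even_part \<eta>) k ^ 8" for k and \<eta> :: "nat \<Rightarrow> real"
  define Z2 where "Z2 k \<eta> = pair_gap (resample j \<eta>) k ^ 8" for k and \<eta> :: "nat \<Rightarrow> real"
  define Z3 where "Z3 \<eta> = m (\<eta> (2 * j)) (\<eta> (2 * j + 1)) ^ 8" for \<eta> :: "nat \<Rightarrow> real"
  have mom: "integrable Q4 (\<lambda>\<eta>. m (\<eta> i) (\<eta> i') ^ 8) \<and> (\<integral>\<eta>. m (\<eta> i) (\<eta> i') ^ 8 \<partial>Q4) \<le> K"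
    \<comment> \<open>The four copies of input \<open>k\<close> are the coordinates \<open>4 * k, \<dots>, 4 * k + 3\<close>.\<close>
    if "i \<noteq> i'" "i div 4 = i' div 4" for i i'
  proof -
    have "doubled (doubled \<mu>) i = doubled (doubled \<mu>) i'"
      using that(2) by (simp add: doubled_def div_mult2_eq[symmetric])
    from dd.pair_moment[OF that(1) this] show ?thesis by (simp add: m_def)
  qed
  have Z1: "integrable Q4 (Z1 k)" "(\<integral>\<eta>. Z1 k \<eta> \<partial>Q4) \<le> K" for k
    using mom[of "2 * (2 * k)" "2 * (2 * k + 1)"] by (simp_all add: Z1_def[abs_def] pair_gap_def even_part_def)
  have Z2: "integrable Q4 (Z2 k)" "(\<integral>\<eta>. Z2 k \<eta> \<partial>Q4) \<le> K" for k
  proof -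
    define i1 where "i1 = (if 2 * k = j then 2 * (2 * k) + 1 else 2 * (2 * k))"
    define i2 where "i2 = (if 2 * k + 1 = j then 2 * (2 * k + 1) + 1 else 2 * (2 * k + 1))"
    have "i1 div 4 = k" by (rule div_nat_eqI) (auto simp: i1_def)
    moreover have "i2 div 4 = k" by (rule div_nat_eqI) (auto simp: i2_def)
    ultimately have "i1 \<noteq> i2" "i1 div 4 = i2 div 4" by (auto simp: i1_def i2_def)
    moreover have "Z2 k = (\<lambda>\<eta>. m (\<eta> i1) (\<eta> i2) ^ 8)"
      by (auto simp: Z2_def[abs_def] pair_gap_def resample_def i1_def i2_def)
    ultimately show "integrable Q4 (Z2 k)" "(\<integral>\<eta>. Z2 k \<eta> \<partial>Q4) \<le> K" using mom by auto
  qed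
  have Z3: "integrable Q4 Z3" "(\<integral>\<eta>. Z3 \<eta> \<partial>Q4) \<le> K"
    using mom[of "2 * j" "2 * j + 1"] by (auto simp: Z3_def[abs_def])
  define c0 where "c0 = 8 * G ^ 4 / (1 - r)"
  have c0: "c0 \<ge> 0" using r G_nonneg by (simp add: c0_def)
  have "(\<integral>\<eta>. (T (even_part \<eta>) - T (resample j \<eta>))\<^sup>2 \<partial>Q4)
     \<le> (\<integral>\<eta>. c0 * (\<Sum>k<Suc n. r ^ nat_dist (j div 2) k * (3 ^ 8 * (Z1 k \<eta> + Z2 k \<eta> + Z3 \<eta>))) \<partial>Q4)"
  proof (rule integral_mono)
    show "integrable Q4 (\<lambda>\<eta>. (T (even_part \<eta>) - T (resample j \<eta>))\<^sup>2)"
      by (intro Q4.bounded_measurable_integrable; unfold dd.bounded_measurable_Q; intro bm_intros T)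
    show "integrable Q4 (\<lambda>\<eta>. c0 * (\<Sum>k<Suc n. r ^ nat_dist (j div 2) k * (3 ^ 8 * (Z1 k \<eta> + Z2 k \<eta> + Z3 \<eta>))))"
      by (intro integrable_mult_right Bochner_Integration.integrable_sum Bochner_Integration.integrable_add Z1 Z2 Z3)
    fix \<eta>
    show "(T (even_part \<eta>) - T (resample j \<eta>))\<^sup>2 \<le> c0 * (\<Sum>k<Suc n. r ^ nat_dist (j div 2) k * (3 ^ 8 * (Z1 k \<eta> + Z2 k \<eta> + Z3 \<eta>)))"
      using T_le[of "even_part \<eta>" "\<eta> (2 * j + 1)"] unfolding res Z1_def Z2_def Z3_def c0_def
      by (simp only: even_part_def)
  qed
  also have "\<dots> = c0 * (\<Sum>k<Suc n. r ^ nat_dist (j div 2) k * (3 ^ 8 * ((\<integral>\<eta>. Z1 k \<eta> \<partial>Q4) + (\<integral>\<eta>. Z2 k \<eta> \<partial>Q4) + (\<integral>\<eta>. Z3 \<eta> \<partial>Q4))))"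
  proof -
    have i: "integrable Q4 (\<lambda>\<eta>. r ^ nat_dist (j div 2) k * (3 ^ 8 * (Z1 k \<eta> + Z2 k \<eta> + Z3 \<eta>)))" for k
      by (intro integrable_mult_right Bochner_Integration.integrable_add Z1 Z2 Z3)
    have e: "(\<integral>\<eta>. r ^ nat_dist (j div 2) k * (3 ^ 8 * (Z1 k \<eta> + Z2 k \<eta> + Z3 \<eta>)) \<partial>Q4)
       = r ^ nat_dist (j div 2) k * (3 ^ 8 * ((\<integral>\<eta>. Z1 k \<eta> \<partial>Q4) + (\<integral>\<eta>. Z2 k \<eta> \<partial>Q4) + (\<integral>\<eta>. Z3 \<eta> \<partial>Q4)))" for k
      using Z1 Z2 Z3 by simp
    show ?thesis
      by (subst integral_mult_right_zero, subst Bochner_Integration.integral_sum) (simp_all only: i e)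
  qed
  also have "\<dots> \<le> c0 * (\<Sum>k<Suc n. r ^ nat_dist (j div 2) k * (3 ^ 8 * (K + K + K)))"
    using r by (intro mult_left_mono sum_mono add_mono Z1 Z2 Z3 c0) auto
  also have "\<dots> = c0 * ((\<Sum>k<Suc n. r ^ nat_dist (j div 2) k) * (3 ^ 9 * K))"
  proof -
    have "3 ^ 8 * (K + K + K) = 3 ^ 9 * K" by simp
    then show ?thesis by (simp only: sum_distrib_right)
  qed
  also have "\<dots> \<le> c0 * (2 / (1 - r) * (3 ^ 9 * K))"
    using r K_nonneg c0 by (intro mult_left_mono mult_right_mono two_sided_geometric_sum_le) auto
  finally show ?thesis by (simp add: var_const_def c0_def)
qed

text \<open>
  The doubled sequence has \<open>2 * Suc n\<close> relevant coordinates, and the factor 2 cancels against the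
  factor \<open>1/2\<close> of the Efron-Stein inequality.
\<close>

lemma variance_le_if_resampling_le:
  assumes T: "bounded_measurable seq_borel T" and dep: "depends_below (2 * Suc n) T"
    and res: "\<And>j. (\<integral>\<eta>. (T (even_part \<eta>) - T (resample j \<eta>))\<^sup>2 \<partial>Q4) \<le> V"
  shows "(\<integral>\<omega>. (T \<omega> - (\<integral>\<omega>. T \<omega> \<partial>Q2))\<^sup>2 \<partial>Q2) \<le> real (Suc n) * V"
proof -
  interpret d: product_law "doubled \<mu>" by (rule doubled_law)
  have "(\<integral>\<omega>. (T \<omega> - (\<integral>\<omega>. T \<omega> \<partial>Q2))\<^sup>2 \<partial>Q2) \<le> (\<Sum>j<2 * Suc n. \<integral>\<eta>. (T (even_part \<eta>) - T (resample j \<eta>))\<^sup>2 \<partial>Q4) / 2"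
    by (rule d.Efron_Stein[OF T dep])
  also have "\<dots> \<le> (\<Sum>j<2 * Suc n. V) / 2" by (intro divide_right_mono sum_mono res) simp
  also have "\<dots> = real (Suc n) * V" by (simp add: field_simps)
  finally show ?thesis .
qed

lemma A_variance: "(\<integral>\<omega>. (\<A> \<omega> - 1)\<^sup>2 \<partial>Q2) \<le> real (Suc n) * var_const / \<sigma> ^ 4"
  and B_variance: "(\<integral>\<omega>. (\<B> \<omega>)\<^sup>2 \<partial>Q2) \<le> real (Suc n) * var_const / \<sigma> ^ 4"
proof -
  have vc: "var_const \<ge> 0" using r G_nonneg K_nonneg by (simp add: var_const_def)
  have s4: "(2 * \<sigma>\<^sup>2)\<^sup>2 = 4 * \<sigma> ^ 4" by (simp add: power_mult_distrib flip: power_mult)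
  have res: "(\<integral>\<eta>. (T (even_part \<eta>) - T (resample j \<eta>))\<^sup>2 \<partial>Q4) \<le> var_const / \<sigma> ^ 4"
    if eq: "\<And>\<omega>. T \<omega> = S \<omega> / (2 * \<sigma>\<^sup>2)" and Tb: "bounded_measurable seq_borel T"
      and le: "\<And>\<omega> w. (S \<omega> - S (fun_upd \<omega> j w))\<^sup>2 \<le> 8 * G ^ 4 / (1 - r) *
     (\<Sum>k<Suc n. r ^ nat_dist (j div 2) k * (3 ^ 8 * (pair_gap \<omega> k ^ 8 + pair_gap (fun_upd \<omega> j w) k ^ 8 + m (\<omega> j) w ^ 8)))"
    for T S :: "(nat \<Rightarrow> real) \<Rightarrow> real" and j
  proof -
    have S: "S = (\<lambda>\<omega>. (2 * \<sigma>\<^sup>2) * T \<omega>)" using eq \<sigma> by auto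
    have Sb: "bounded_measurable seq_borel S" unfolding S by (intro bm_intros Tb)
    have "(\<integral>\<eta>. (S (even_part \<eta>) - S (resample j \<eta>))\<^sup>2 \<partial>Q4) \<le> var_const"
      by (rule gain_sum_resample[OF Sb le])
    moreover have "(\<integral>\<eta>. (T (even_part \<eta>) - T (resample j \<eta>))\<^sup>2 \<partial>Q4) = (\<integral>\<eta>. (S (even_part \<eta>) - S (resample j \<eta>))\<^sup>2 \<partial>Q4) / (4 * \<sigma> ^ 4)"
    proof -
      have "(T (even_part \<eta>) - T (resample j \<eta>))\<^sup>2 = (S (even_part \<eta>) - S (resample j \<eta>))\<^sup>2 / (4 * \<sigma> ^ 4)" for \<eta>
        unfolding eq diff_divide_distrib[symmetric] power_divide s4 ..
      then show ?thesis by simp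
    qed
    ultimately have "(\<integral>\<eta>. (T (even_part \<eta>) - T (resample j \<eta>))\<^sup>2 \<partial>Q4) \<le> var_const / (4 * \<sigma> ^ 4)"
      using \<sigma> by (simp add: divide_right_mono)
    also have "\<dots> \<le> var_const / \<sigma> ^ 4" using vc \<sigma> by (intro divide_left_mono) auto
    finally show ?thesis .
  qed
  have "(\<integral>\<eta>. (\<A> (even_part \<eta>) - \<A> (resample j \<eta>))\<^sup>2 \<partial>Q4) \<le> var_const / \<sigma> ^ 4" for j
    by (rule res[OF A_gain A_bm], rule gain_sum_perturb[where \<phi>="\<lambda>x. x"]) auto
  from variance_le_if_resampling_le[OF A_bm A_depends this]
  show "(\<integral>\<omega>. (\<A> \<omega> - 1)\<^sup>2 \<partial>Q2) \<le> real (Suc n) * var_const / \<sigma> ^ 4" by (simp add: A_mean)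
  have "(\<integral>\<eta>. (\<B> (even_part \<eta>) - \<B> (resample j \<eta>))\<^sup>2 \<partial>Q4) \<le> var_const / \<sigma> ^ 4" for j
    by (rule res[OF B_gain B_bm], rule gain_sum_perturb[where \<phi>=abs]) (auto intro: abs_triangle_ineq3)
  from variance_le_if_resampling_le[OF B_bm B_depends this]
  show "(\<integral>\<omega>. (\<B> \<omega>)\<^sup>2 \<partial>Q2) \<le> real (Suc n) * var_const / \<sigma> ^ 4" by (simp add: B_mean)
qed

lemma third_moment: "(\<integral>\<omega>. (\<Sum>k<Suc n. 2 * \<bar>\<D> k \<omega>\<bar> * (\<Delta> k \<omega>)\<^sup>2) \<partial>Q2) \<le> real (Suc n) * (G ^ 3 * (1 + K)) / \<sigma> ^ 3"
proof -
  interpret d: moment_law "doubled \<mu>" s K by (rule doubled_moment_law)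
  interpret Q2: prob_space Q2 by (rule prob_Q2)
  have gap: "integrable Q2 (\<lambda>\<omega>. pair_gap \<omega> k ^ 8)" "(\<integral>\<omega>. pair_gap \<omega> k ^ 8 \<partial>Q2) \<le> K" for k
    using d.pair_moment[of "2 * k" "2 * k + 1"] by (simp_all add: pair_gap_def m_def doubled_def)
  have le: "2 * \<bar>\<D> k \<omega>\<bar> * (\<Delta> k \<omega>)\<^sup>2 \<le> G ^ 3 / \<sigma> ^ 3 * (1 + pair_gap \<omega> k ^ 8)" for k \<omega>
  proof -
    let ?g = "pair_gap \<omega> k"
    have 1: "\<bar>gain (\<lambda>i. i < k) k \<omega>\<bar> \<le> G * ?g\<^sup>2" "\<bar>gain (\<lambda>_. False) k \<omega>\<bar> \<le> G * ?g\<^sup>2"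
      by (rule gain_le; simp)+
    have "2 * \<bar>\<D> k \<omega>\<bar> * (\<Delta> k \<omega>)\<^sup>2 = \<bar>gain (\<lambda>i. i < k) k \<omega>\<bar> * \<bar>gain (\<lambda>_. False) k \<omega>\<bar>\<^sup>2 / \<sigma> ^ 3"
      unfolding D_gain Delta_gain using \<sigma> by (simp add: abs_divide power_divide power2_eq_square power3_eq_cube)
    also have "\<dots> \<le> (G * ?g\<^sup>2) * (G * ?g\<^sup>2)\<^sup>2 / \<sigma> ^ 3"
      using 1 \<sigma> G_nonneg by (intro divide_right_mono mult_mono power_mono) auto
    also have "\<dots> = G ^ 3 / \<sigma> ^ 3 * ?g ^ 6"
      by (simp add: power_mult_distrib power_mult[symmetric] power_add[symmetric] power3_eq_cube power2_eq_square eval_nat_numeral mult_ac)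
    also have "\<dots> \<le> G ^ 3 / \<sigma> ^ 3 * (1 + ?g ^ 8)"
    proof (intro mult_left_mono)
      show "?g ^ 6 \<le> 1 + ?g ^ 8"
      proof (cases "?g \<le> 1")
        case True
        then have "?g ^ 6 \<le> 1" by (intro power_le_one) auto
        then show ?thesis by (simp add: add_increasing2)
      next
        case False
        then have "?g ^ 6 \<le> ?g ^ 8" by (intro power_increasing) auto
        then show ?thesis by simp
      qed
    qed (use G_nonneg \<sigma> in auto)
    finally show ?thesis .
  qed
  have "(\<integral>\<omega>. (\<Sum>k<Suc n. 2 * \<bar>\<D> k \<omega>\<bar> * (\<Delta> k \<omega>)\<^sup>2) \<partial>Q2) \<le> (\<integral>\<omega>. (\<Sum>k<Suc n. G ^ 3 / \<sigma> ^ 3 * (1 + pair_gap \<omega> k ^ 8)) \<partial>Q2)"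
  proof (rule integral_mono)
    show "integrable Q2 (\<lambda>\<omega>. \<Sum>k<Suc n. 2 * \<bar>\<D> k \<omega>\<bar> * (\<Delta> k \<omega>)\<^sup>2)" by (intro Q2_integrable bm_intros)
    show "integrable Q2 (\<lambda>\<omega>. \<Sum>k<Suc n. G ^ 3 / \<sigma> ^ 3 * (1 + pair_gap \<omega> k ^ 8))"
      by (intro Bochner_Integration.integrable_sum integrable_mult_right Bochner_Integration.integrable_add gap integrable_const) simp
    show "(\<Sum>k<Suc n. 2 * \<bar>\<D> k \<omega>\<bar> * (\<Delta> k \<omega>)\<^sup>2) \<le> (\<Sum>k<Suc n. G ^ 3 / \<sigma> ^ 3 * (1 + pair_gap \<omega> k ^ 8))" for \<omega>
      by (rule sum_mono) (rule le)
  qed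
  also have "\<dots> = (\<Sum>k<Suc n. G ^ 3 / \<sigma> ^ 3 * (1 + (\<integral>\<omega>. pair_gap \<omega> k ^ 8 \<partial>Q2)))"
  proof -
    have i: "integrable Q2 (\<lambda>\<omega>. G ^ 3 / \<sigma> ^ 3 * (1 + pair_gap \<omega> k ^ 8))" for k
      by (intro integrable_mult_right Bochner_Integration.integrable_add gap integrable_const) simp
    have "(\<integral>\<omega>. G ^ 3 / \<sigma> ^ 3 * (1 + pair_gap \<omega> k ^ 8) \<partial>Q2) = G ^ 3 / \<sigma> ^ 3 * (1 + (\<integral>\<omega>. pair_gap \<omega> k ^ 8 \<partial>Q2))" for k
      using gap(1)[of k] by (simp add: Q2.prob_space)
    then show ?thesis by (subst Bochner_Integration.integral_sum) (simp_all only: i)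
  qed
  also have "\<dots> \<le> (\<Sum>k<Suc n. G ^ 3 / \<sigma> ^ 3 * (1 + K))"
    using G_nonneg \<sigma> by (intro sum_mono mult_left_mono add_left_mono gap) auto
  also have "\<dots> = real (Suc n) * (G ^ 3 * (1 + K)) / \<sigma> ^ 3" by simp
  finally show ?thesis .
qed

end

section \<open>Linear growth of the variance\<close>

text \<open>
  A positive infinite sum is an honest one, as the sum of a family that is not summable is 0 by
  convention. Almost the whole sum is captured by the indices up to some \<open>m\<close>, so each row \<open>s\<close> at
  distance at least \<open>m\<close> from both ends contributes at least three quarters of it. The other \<open>2 * m\<close>
  rows contribute at least \<open>- B\<close> each, which is negligible for large \<open>n\<close>.
\<close>

lemma averaged_double_sum_lower_bound:
  fixes \<gamma> :: "int \<Rightarrow> real"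
  assumes v: "infsum \<gamma> UNIV > 0"
  obtains n0 where "\<And>n. n \<ge> n0 \<Longrightarrow> n \<ge> 1 \<Longrightarrow>
    (\<Sum>s=1..n. \<Sum>t=1..n. \<gamma> (int t - int s)) \<ge> infsum \<gamma> UNIV / 2 * real n"
proof -
  define v where "v = infsum \<gamma> UNIV"
  have v0: "v > 0" using v by (simp add: v_def)
  have sum: "\<gamma> summable_on UNIV" using v infsum_not_exists by fastforce
  have abs: "(\<lambda>j. \<bar>\<gamma> j\<bar>) summable_on UNIV"
    using sum summable_on_iff_abs_summable_on_real by auto
  define B where "B = infsum (\<lambda>j. \<bar>\<gamma> j\<bar>) UNIV"
  have B0: "B \<ge> 0" unfolding B_def by (intro infsum_nonneg) auto
  have fin_le: "\<bar>sum \<gamma> J\<bar> \<le> B" if "finite J" for J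
  proof -
    have "\<bar>sum \<gamma> J\<bar> \<le> (\<Sum>j\<in>J. \<bar>\<gamma> j\<bar>)" by (rule sum_abs)
    also have "\<dots> \<le> B" unfolding B_def using that by (intro finite_sum_le_infsum abs) auto
    finally show ?thesis .
  qed
  have "(sum \<gamma> \<longlongrightarrow> v) (finite_subsets_at_top UNIV)"
    using has_sum_infsum[OF sum] by (simp add: has_sum_def v_def)
  then have "\<forall>\<^sub>F J in finite_subsets_at_top UNIV. 3 / 4 * v < sum \<gamma> J"
    by (rule order_tendstoD(1)) (use v0 in simp)
  then obtain J0 where J0: "finite J0" "\<And>J. finite J \<Longrightarrow> J0 \<subseteq> J \<Longrightarrow> 3 / 4 * v < sum \<gamma> J"
    unfolding eventually_finite_subsets_at_top by auto
  obtain m :: nat where m: "J0 \<subseteq> {- int m..int m}"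
  proof -
    define m where "m = nat (Max (insert 0 (abs ` J0)))"
    have "\<bar>j\<bar> \<le> int m" if "j \<in> J0" for j
    proof -
      have "\<bar>j\<bar> \<le> Max (insert 0 (abs ` J0))" using J0(1) that by (intro Max_ge) auto
      then show ?thesis using abs_ge_zero[of j] unfolding m_def by linarith
    qed
    then show ?thesis by (intro that[of m]) (auto simp: abs_le_iff, fastforce)
  qed
  have inner: "(\<Sum>t=1..n. \<gamma> (int t - int s)) = sum \<gamma> {1 - int s..int n - int s}" for n s
  proof -
    have "(\<Sum>t=1..n. \<gamma> (int t - int s)) = sum \<gamma> ((\<lambda>t. int t - int s) ` {1..n})"
      by (subst sum.reindex) (auto simp: inj_on_def)
    also have "(\<lambda>t. int t - int s) ` {1..n} = {1 - int s..int n - int s}"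
    proof (intro set_eqI iffI)
      fix x assume "x \<in> {1 - int s..int n - int s}"
      then have "x = int (nat (x + int s)) - int s" "nat (x + int s) \<in> {1..n}" by auto
      then show "x \<in> (\<lambda>t. int t - int s) ` {1..n}" by blast
    qed auto
    finally show ?thesis .
  qed
  define n0 where "n0 = 2 * m + nat \<lceil>8 * real m * (v + B) / v\<rceil>"
  show ?thesis
  proof (rule that[of n0])
    fix n :: nat assume n: "n \<ge> n0" "n \<ge> 1"
    then have n2: "2 * m \<le> n" by (simp add: n0_def)
    have "8 * real m * (v + B) / v \<le> real n"
    proof -
      have "8 * real m * (v + B) / v \<le> real (nat \<lceil>8 * real m * (v + B) / v\<rceil>)" by linarith
      also have "\<dots> \<le> real n" using n unfolding n0_def by linarith
      finally show ?thesis .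
    qed
    then have big: "8 * real m * (v + B) \<le> real n * v" using v0 by (simp add: field_simps)
    define I where "I = {m + 1..n - m}"
    have good: "3 / 4 * v \<le> (\<Sum>t=1..n. \<gamma> (int t - int s))" if "s \<in> I" for s
    proof -
      have "{- int m..int m} \<subseteq> {1 - int s..int n - int s}" using that n2 by (auto simp: I_def)
      then have "J0 \<subseteq> {1 - int s..int n - int s}" using m by blast
      then show ?thesis unfolding inner using J0(2)[of "{1 - int s..int n - int s}"] by simp
    qed
    have bad: "- B \<le> (\<Sum>t=1..n. \<gamma> (int t - int s))" for s
      unfolding inner using fin_le[of "{1 - int s..int n - int s}"] by (simp add: abs_le_iff)
    have I: "I \<subseteq> {1..n}" by (auto simp: I_def)
    have cI: "real (card I) = real n - 2 * real m" using n2 by (simp add: I_def of_nat_diff)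
    have cO: "real (card ({1..n} - I)) = 2 * real m"
    proof -
      have "card ({1..n} - I) = card {1..n} - card I" using I by (intro card_Diff_subset) (auto simp: I_def)
      then show ?thesis using n2 by (simp add: I_def of_nat_diff)
    qed
    have "v / 2 * real n \<le> (real n - 2 * real m) * (3 / 4 * v) + 2 * real m * (- B)"
    proof -
      have e: "(real n - 2 * real m) * (3 / 4 * v) + 2 * real m * (- B) = 3 / 4 * (real n * v) - 3 / 2 * (real m * v) - 2 * (real m * B)"
        by (simp add: field_simps)
      have e2: "8 * (real m * v) + 8 * (real m * B) \<le> real n * v" using big by (simp add: algebra_simps)
      have "real m * v \<ge> 0" "real m * B \<ge> 0" using v0 B0 by auto
      then show ?thesis unfolding e using e2 by (simp add: mult.commute)
    qed
    also have "\<dots> = (\<Sum>s\<in>I. 3 / 4 * v) + (\<Sum>s\<in>{1..n} - I. - B)" by (simp only: sum_constant cI cO)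
    also have "\<dots> \<le> (\<Sum>s\<in>I. \<Sum>t=1..n. \<gamma> (int t - int s)) + (\<Sum>s\<in>{1..n} - I. \<Sum>t=1..n. \<gamma> (int t - int s))"
      by (intro add_mono sum_mono good bad)
    also have "\<dots> = (\<Sum>s=1..n. \<Sum>t=1..n. \<gamma> (int t - int s))"
      by (subst add.commute, rule sum.subset_diff[symmetric]) (use I in auto)
    finally show "infsum \<gamma> UNIV / 2 * real n \<le> (\<Sum>s=1..n. \<Sum>t=1..n. \<gamma> (int t - int s))" by (simp add: v_def)
  qed
qed

section \<open>Rates for the chain\<close>

text \<open>
  A bounded Lipschitz function satisfies a Hoelder condition of every order up to 1: at distances
  below 1 by the Lipschitz condition, at larger ones by boundedness.
\<close>

lemma C2_bounded_hoelder:
  assumes f: "C2_bounded f" and e: "0 < e" "e \<le> 1"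
  obtains H Bf where "0 \<le> H" "\<And>u v. \<bar>f u - f v\<bar> \<le> H * \<bar>u - v\<bar> powr e" "\<And>u. \<bar>f u\<bar> \<le> Bf" "continuous_on UNIV f"
proof -
  obtain f' where f': "\<And>x. (f has_real_derivative f' x) (at x)" and b: "bounded (range f)" "bounded (range f')"
    using f unfolding C2_bounded_def by blast
  obtain Bf where Bf: "\<And>u. \<bar>f u\<bar> \<le> Bf" using b(1) unfolding bounded_iff by auto
  obtain Lf where Lf: "\<And>u. \<bar>f' u\<bar> \<le> Lf" using b(2) unfolding bounded_iff by auto
  define H where "H = max (2 * Bf) Lf"
  have H0: "H \<ge> 0" using Bf[of 0] by (simp add: H_def)
  have "\<bar>f u - f v\<bar> \<le> H * \<bar>u - v\<bar> powr e" for u v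
  proof (cases "\<bar>u - v\<bar> \<le> 1")
    case True
    have "\<bar>f u - f v\<bar> \<le> Lf * \<bar>u - v\<bar>"
      unfolding real_norm_def[symmetric]
      by (rule field_differentiable_bound[of UNIV f f' Lf]) (use f' Lf in auto)
    also have "\<dots> \<le> H * \<bar>u - v\<bar>" by (intro mult_right_mono) (auto simp: H_def)
    also have "\<bar>u - v\<bar> \<le> \<bar>u - v\<bar> powr e"
    proof (cases "u = v")
      case False
      have "\<bar>u - v\<bar> powr 1 \<le> \<bar>u - v\<bar> powr e" using True e False by (intro powr_mono') auto
      then show ?thesis using False by simp
    qed simp
    finally show ?thesis using H0 by (simp add: mult_left_mono)
  next
    case False
    have "\<bar>f u - f v\<bar> \<le> \<bar>f u\<bar> + \<bar>f v\<bar>" by (rule abs_triangle_ineq4)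
    also have "\<dots> \<le> 2 * Bf" using Bf[of u] Bf[of v] by simp
    also have "\<dots> \<le> H * 1" by (simp add: H_def)
    also have "\<dots> \<le> H * \<bar>u - v\<bar> powr e" using False e H0 by (intro mult_left_mono ge_one_powr_ge_zero) auto
    finally show ?thesis .
  qed
  moreover have "continuous_on UNIV f" by (intro continuous_at_imp_continuous_on ballI DERIV_isCont[OF f'])
  ultimately show ?thesis using H0 Bf that by blast
qed

context chain_law begin

lemma variance_sqrt_le: "(\<integral>\<omega>. (T \<omega>)\<^sup>2 \<partial>Q2) \<le> real (Suc n) * var_const / \<sigma> ^ 4 \<Longrightarrow>
   sqrt (\<integral>\<omega>. (T \<omega>)\<^sup>2 \<partial>Q2) \<le> sqrt (real (Suc n) * var_const) / \<sigma>\<^sup>2"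
proof -
  assume "(\<integral>\<omega>. (T \<omega>)\<^sup>2 \<partial>Q2) \<le> real (Suc n) * var_const / \<sigma> ^ 4"
  then have "sqrt (\<integral>\<omega>. (T \<omega>)\<^sup>2 \<partial>Q2) \<le> sqrt (real (Suc n) * var_const / \<sigma> ^ 4)" by (rule real_sqrt_le_mono)
  also have "\<dots> = sqrt (real (Suc n) * var_const) / \<sigma>\<^sup>2"
  proof -
    have "sqrt (\<sigma> ^ 4) = \<sigma>\<^sup>2"
      by (rule real_sqrt_unique) (simp_all flip: power_mult)
    then show ?thesis by (simp add: real_sqrt_divide)
  qed
  finally show ?thesis .
qed

lemma kolmogorov_rate:
  "\<bar>(\<integral>x. indicator {..z} (W x) \<partial>Q) - std_normal_cdf z\<bar> \<le> 6 * (sqrt (real (Suc n) * var_const) / \<sigma>\<^sup>2)"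
  using kolmogorov_bound[of z] variance_sqrt_le[OF A_variance] variance_sqrt_le[OF B_variance] by linarith

lemma wasserstein_rate:
  assumes "1-lipschitz_on UNIV h"
  shows "\<bar>(\<integral>x. h (W x) \<partial>Q) - normal_mean h\<bar>
    \<le> 15 * (sqrt (real (Suc n) * var_const) / \<sigma>\<^sup>2) + 5 * (real (Suc n) * (G ^ 3 * (1 + K)) / \<sigma> ^ 3)"
  using wasserstein_bound[OF assms] variance_sqrt_le[OF A_variance] third_moment by linarith

lemma var_const_nonneg: "var_const \<ge> 0"
  using r G_nonneg K_nonneg by (simp add: var_const_def)

text \<open>
  The variance of \<open>F\<close> is at least of order \<open>n\<close>. So the standard deviations of \<open>\<A>\<close> and \<open>\<B>\<close> and the
  sum of third moments are all of order \<open>n powr (- 1 / 2)\<close>.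
\<close>

lemma rate_bounds:
  assumes n: "n \<ge> 1" and v: "v > 0" "v * real n \<le> \<sigma>\<^sup>2"
  shows "sqrt (real (Suc n) * var_const) / \<sigma>\<^sup>2 \<le> sqrt (2 * var_const) / v * real n powr (- 1 / 2)"
    "real (Suc n) * (G ^ 3 * (1 + K)) / \<sigma> ^ 3 \<le> 2 * (G ^ 3 * (1 + K)) / (sqrt v) ^ 3 * real n powr (- 1 / 2)"
proof -
  have pw: "real n powr (- 1 / 2) = 1 / sqrt (real n)"
  proof -
    have "(- 1 / 2 :: real) = - (1 / 2)" by simp
    then have "real n powr (- 1 / 2) = inverse (real n powr (1 / 2))" by (simp only: powr_minus)
    also have "real n powr (1 / 2) = sqrt (real n)" by (rule powr_half_sqrt) simp
    finally show ?thesis by (simp add: inverse_eq_divide)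
  qed
  have "sqrt (real (Suc n) * var_const) \<le> sqrt ((2 * var_const) * real n)"
  proof (rule real_sqrt_le_mono)
    have "real (Suc n) * var_const \<le> (2 * real n) * var_const"
      using n var_const_nonneg by (intro mult_right_mono) auto
    then show "real (Suc n) * var_const \<le> (2 * var_const) * real n" by (simp only: mult_ac)
  qed
  also have "\<dots> = sqrt (2 * var_const) * sqrt (real n)" by (rule real_sqrt_mult)
  finally have "sqrt (real (Suc n) * var_const) / \<sigma>\<^sup>2 \<le> sqrt (2 * var_const) * sqrt (real n) / (v * real n)"
    using v n \<sigma> var_const_nonneg by (intro frac_le) auto
  also have "\<dots> = sqrt (2 * var_const) / v * real n powr (- 1 / 2)"
  proof -
    define q where "q = sqrt (real n)"
    have q: "q > 0" "real n = q * q" using n by (simp_all add: q_def)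
    show ?thesis unfolding pw q_def[symmetric] unfolding q(2) using q(1) v by (simp add: field_simps)
  qed
  finally show "sqrt (real (Suc n) * var_const) / \<sigma>\<^sup>2 \<le> sqrt (2 * var_const) / v * real n powr (- 1 / 2)" .
  have g: "0 \<le> G ^ 3 * (1 + K)" using G_nonneg K_nonneg by simp
  have "sqrt (v * real n) \<le> \<sigma>" using v \<sigma> by (intro real_le_lsqrt) auto
  then have s: "(sqrt v * sqrt (real n)) ^ 3 \<le> \<sigma> ^ 3" using v by (intro power_mono) (auto simp: real_sqrt_mult)
  have "real (Suc n) * (G ^ 3 * (1 + K)) \<le> (2 * (G ^ 3 * (1 + K))) * real n"
  proof -
    have "real (Suc n) * (G ^ 3 * (1 + K)) \<le> (2 * real n) * (G ^ 3 * (1 + K))" using n g by (intro mult_right_mono) auto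
    then show ?thesis by (simp add: mult_ac)
  qed
  then have "real (Suc n) * (G ^ 3 * (1 + K)) / \<sigma> ^ 3 \<le> (2 * (G ^ 3 * (1 + K))) * real n / (sqrt v * sqrt (real n)) ^ 3"
    using s v n g by (intro frac_le) auto
  also have "\<dots> = 2 * (G ^ 3 * (1 + K)) / (sqrt v) ^ 3 * real n powr (- 1 / 2)"
  proof -
    have "sqrt (real n) ^ 3 = real n * sqrt (real n)" by (simp add: power3_eq_cube)
    then show ?thesis unfolding pw using n v by (simp add: power_mult_distrib field_simps)
  qed
  finally show "real (Suc n) * (G ^ 3 * (1 + K)) / \<sigma> ^ 3 \<le> 2 * (G ^ 3 * (1 + K)) / (sqrt v) ^ 3 * real n powr (- 1 / 2)" .
qed

text \<open>
  Both laws have first absolute moment at most 1 and are compared through the value \<open>h 0\<close>. This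
  serves the finitely many \<open>n\<close> for which the variance of the sum is not yet known to be of order
  \<open>n\<close>.
\<close>

lemma wasserstein_trivial:
  assumes h: "1-lipschitz_on UNIV h"
  shows "\<bar>(\<integral>x. h (W x) \<partial>Q) - normal_mean h\<bar> \<le> 2"
proof -
  interpret Q: prob_space Q by (rule prob_Q)
  have hcont: "continuous_on UNIV h" by (rule lipschitz_on_continuous_on[OF h])
  have i: "integrable Q (\<lambda>x. h (W x))" "integrable Q (\<lambda>x. \<bar>W x\<bar>)"
    by (intro Q.bounded_measurable_integrable; unfold bounded_measurable_Q; intro bm_intros continuous_compose_bm[OF hcont])+
  have "\<bar>(\<integral>x. h (W x) \<partial>Q) - h 0\<bar> = \<bar>\<integral>x. h (W x) - h 0 \<partial>Q\<bar>" using i by (simp add: Q.prob_space)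
  also have "\<dots> \<le> (\<integral>x. \<bar>h (W x) - h 0\<bar> \<partial>Q)" by (rule integral_abs_bound)
  also have "\<dots> \<le> (\<integral>x. \<bar>W x\<bar> \<partial>Q)"
  proof (rule integral_mono)
    show "\<bar>h (W x) - h 0\<bar> \<le> \<bar>W x\<bar>" for x using lipschitz_onD[OF h, of "W x" 0] by (simp add: dist_real_def)
  qed (use i in auto)
  also have "\<dots> \<le> sqrt (\<integral>x. (W x)\<^sup>2 \<partial>Q)"
    by (rule Q.expectation_abs_le_sqrt) (simp add: bounded_measurable_Q W_bm)
  also have "\<dots> = 1" by (simp add: W_var)
  finally have "\<bar>(\<integral>x. h (W x) \<partial>Q) - h 0\<bar> \<le> 1" .
  moreover have "\<bar>h 0 - normal_mean h\<bar> \<le> 1" using lipschitz_normal_integrable(2)[OF h, of 0] by simp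
  ultimately show ?thesis by linarith
qed

end

section \<open>The stationary process\<close>

lemma (in prob_space) integral_indicator_atMost:
  assumes "Y \<in> borel_measurable M"
  shows "(\<integral>\<omega>. indicator {..z} (Y \<omega>) \<partial>M) = prob {\<omega> \<in> space M. Y \<omega> \<le> (z::real)}"
proof -
  have "(\<integral>\<omega>. indicator {..z} (Y \<omega>) \<partial>M) = (\<integral>\<omega>. indicator {\<omega> \<in> space M. Y \<omega> \<le> z} \<omega> \<partial>M)"
    by (intro Bochner_Integration.integral_cong refl) (auto simp: indicator_def)
  also have "\<dots> = prob ({\<omega> \<in> space M. Y \<omega> \<le> z} \<inter> space M)" by (rule Bochner_Integration.integral_indicator)
  also have "{\<omega> \<in> space M. Y \<omega> \<le> z} \<inter> space M = {\<omega> \<in> space M. Y \<omega> \<le> z}" by auto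
  finally show ?thesis .
qed

text \<open>
  Stationarity of the process is expressed by the law of the inputs, which is the same for every
  starting time \<open>T\<close>.
\<close>

locale stationary_chain = prob_space M + product_law \<mu>
  for M :: "'a measure" and \<mu> :: "nat \<Rightarrow> real measure" +
  fixes X :: "real \<Rightarrow> 'a \<Rightarrow> real" and a :: real and f :: "real \<Rightarrow> real"
  assumes X_measurable [measurable]: "\<And>t. X t \<in> borel_measurable M"
    and law: "\<And>T. distr M seq_borel (\<lambda>\<omega> k. innovation a X T k \<omega>) = Q"
    and f_measurable [measurable]: "f \<in> borel_measurable borel" and f_bounded: "\<exists>B. \<forall>u. \<bar>f u\<bar> \<le> B"
begin

lemma innovation_measurable: "(\<lambda>\<omega> k. innovation a X T k \<omega>) \<in> measurable M seq_borel"
  by (rule measurable_abs_UNIV) (unfold innovation_def, measurable)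

lemma transfer:
  assumes "\<Phi> \<in> borel_measurable seq_borel"
  shows "(\<integral>\<omega>. \<Phi> (\<lambda>k. innovation a X T k \<omega>) \<partial>M) = (\<integral>x. (\<Phi> x :: real) \<partial>Q)"
  using integral_distr[OF innovation_measurable assms, of T] law[of T] by simp

definition f_mean :: real where "f_mean = (\<integral>x. f (chain a x 0) \<partial>Q)"
definition autocov :: "nat \<Rightarrow> real" where "autocov j = (\<integral>x. (f (chain a x 0) - f_mean) * (f (chain a x j) - f_mean) \<partial>Q)"

lemma f_bm: "bounded_measurable M (\<lambda>\<omega>. f (X t \<omega>))"
  using f_bounded by (auto simp: bounded_measurable_def)

lemma mean_f: "(\<integral>\<omega>. f (X T \<omega>) \<partial>M) = f_mean"
proof -
  have "(\<lambda>x. f (chain a x 0)) \<in> borel_measurable seq_borel" by measurable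
  from transfer[OF this, of T] show ?thesis by (simp add: f_mean_def chain_innovation)
qed

lemma covar_f:
  assumes "v = u + real j"
  shows "covar M (\<lambda>\<omega>. f (X u \<omega>)) (\<lambda>\<omega>. f (X v \<omega>)) = autocov j" "covar M (\<lambda>\<omega>. f (X v \<omega>)) (\<lambda>\<omega>. f (X u \<omega>)) = autocov j"
proof -
  have "(\<lambda>x. (f (chain a x 0) - f_mean) * (f (chain a x j) - f_mean)) \<in> borel_measurable seq_borel" by measurable
  from transfer[OF this, of u] show 1: "covar M (\<lambda>\<omega>. f (X u \<omega>)) (\<lambda>\<omega>. f (X v \<omega>)) = autocov j"
    by (simp add: covar_def mean_f autocov_def chain_innovation assms)
  then show "covar M (\<lambda>\<omega>. f (X v \<omega>)) (\<lambda>\<omega>. f (X u \<omega>)) = autocov j"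
    by (simp add: covar_def mult.commute)
qed

lemma covar_stationary:
  "covar M (\<lambda>\<omega>. f (X (real s) \<omega>)) (\<lambda>\<omega>. f (X (real t) \<omega>)) = covar M (\<lambda>\<omega>. f (X 0 \<omega>)) (\<lambda>\<omega>. f (X (of_int (int t - int s)) \<omega>))"
proof (cases "s \<le> t")
  case True
  have "real t = real s + real (t - s)" "of_int (int t - int s) = 0 + real (t - s)" using True by (simp_all add: of_nat_diff)
  then show ?thesis using covar_f(1) by metis
next
  case False
  have "real s = real t + real (s - t)" "0 = of_int (int t - int s) + real (s - t)" using False by (simp_all add: of_nat_diff)
  then show ?thesis using covar_f(2) by metis
qed

lemma second_moment_sum:
  "(\<integral>\<omega>. (\<Sum>t=1..n. f (X (real t) \<omega>) - f_mean)\<^sup>2 \<partial>M)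
    = (\<Sum>s=1..n. \<Sum>t=1..n. covar M (\<lambda>\<omega>. f (X 0 \<omega>)) (\<lambda>\<omega>. f (X (of_int (int t - int s)) \<omega>)))"
proof -
  let ?c = "\<lambda>s t \<omega>. (f (X (real s) \<omega>) - f_mean) * (f (X (real t) \<omega>) - f_mean)"
  have b: "bounded_measurable M (?c s t)" for s t :: nat by (intro bm_intros f_bm)
  have "(\<integral>\<omega>. (\<Sum>t=1..n. f (X (real t) \<omega>) - f_mean)\<^sup>2 \<partial>M) = (\<integral>\<omega>. (\<Sum>s=1..n. \<Sum>t=1..n. ?c s t \<omega>) \<partial>M)"
    by (simp only: power2_eq_square sum_product)
  also have "\<dots> = (\<Sum>s=1..n. \<Sum>t=1..n. \<integral>\<omega>. ?c s t \<omega> \<partial>M)"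
  proof -
    have "(\<integral>\<omega>. (\<Sum>s=1..n. \<Sum>t=1..n. ?c s t \<omega>) \<partial>M) = (\<Sum>s=1..n. \<integral>\<omega>. (\<Sum>t=1..n. ?c s t \<omega>) \<partial>M)"
      by (intro Bochner_Integration.integral_sum bounded_measurable_integrable bounded_measurable_sum b)
    also have "\<dots> = (\<Sum>s=1..n. \<Sum>t=1..n. \<integral>\<omega>. ?c s t \<omega> \<partial>M)"
      by (intro sum.cong refl Bochner_Integration.integral_sum bounded_measurable_integrable b)
    finally show ?thesis .
  qed
  also have "\<dots> = (\<Sum>s=1..n. \<Sum>t=1..n. covar M (\<lambda>\<omega>. f (X (real s) \<omega>)) (\<lambda>\<omega>. f (X (real t) \<omega>)))"
    by (simp only: covar_def mean_f)
  finally show ?thesis unfolding covar_stationary .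
qed

lemma centred_sum_mean: "(\<integral>\<omega>. (\<Sum>t=1..n. f (X (real t) \<omega>) - f_mean) \<partial>M) = 0"
proof -
  have i: "integrable M (\<lambda>\<omega>. f (X (real t) \<omega>))" for t :: nat by (rule bounded_measurable_integrable[OF f_bm])
  have "(\<integral>\<omega>. (\<Sum>t=1..n. f (X (real t) \<omega>) - f_mean) \<partial>M) = (\<Sum>t=1..n. (\<integral>\<omega>. f (X (real t) \<omega>) - f_mean \<partial>M))"
    by (intro Bochner_Integration.integral_sum Bochner_Integration.integrable_diff i integrable_const)
  also have "\<dots> = 0" using i by (intro sum.neutral) (simp add: mean_f prob_space)
  finally show ?thesis .
qed

lemma partial_sum_eq: "partial_sum M X f n \<omega> = (\<Sum>t=1..n. f (X (real t) \<omega>) - f_mean) / sqrt (real n)"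
  by (simp only: partial_sum_def mean_f)

lemma partial_sum_measurable [measurable]: "partial_sum M X f n \<in> borel_measurable M"
  unfolding partial_sum_def[abs_def] by measurable

lemma partial_sum_sd_square:
  assumes n: "n \<ge> 1"
  shows "(partial_sum_sd M X f n)\<^sup>2 * real n = (\<integral>\<omega>. (\<Sum>t=1..n. f (X (real t) \<omega>) - f_mean)\<^sup>2 \<partial>M)"
proof -
  have z: "(\<integral>\<omega>. partial_sum M X f n \<omega> \<partial>M) = 0"
    using centred_sum_mean[of n] by (simp only: partial_sum_eq integral_divide_zero div_0)
  have "(partial_sum_sd M X f n)\<^sup>2 = variance (partial_sum M X f n)"
    unfolding partial_sum_sd_def by (rule real_sqrt_pow2) (rule variance_positive)
  also have "\<dots> = (\<integral>\<omega>. (partial_sum M X f n \<omega>)\<^sup>2 \<partial>M)" by (simp add: z)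
  also have "\<dots> = (\<integral>\<omega>. (\<Sum>t=1..n. f (X (real t) \<omega>) - f_mean)\<^sup>2 / real n \<partial>M)"
    by (simp add: partial_sum_eq power_divide)
  finally show ?thesis using n by simp
qed

end

theorem corollary1p6:
  fixes M :: "'a measure" and N :: "'b measure"
    and L X :: "real \<Rightarrow> 'a \<Rightarrow> real" and Z :: "'b \<Rightarrow> real"
    and f :: "real \<Rightarrow> real" and \<beta> \<kappa> :: real
  assumes "prob_space M" and "prob_space N"
    and "0 < \<beta>" and "\<beta> < 2" and "0 < \<kappa>"
    and "stable_OU_process \<beta> \<kappa> M L X"
    and "C2_bounded f"
    and "long_run_variance M X f > 0"
    and "distributed N lborel Z std_normal_density"
  shows "\<exists>C>0. \<forall>n\<ge>1. partial_sum_sd M X f n > 0 \<longrightarrow>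
    wasserstein_dist M (\<lambda>\<omega>. partial_sum M X f n \<omega> / partial_sum_sd M X f n) N Z
        \<le> ennreal (C * real n powr (- 1 / 2)) \<and>
    kolmogorov_dist M (\<lambda>\<omega>. partial_sum M X f n \<omega> / partial_sum_sd M X f n) N Z
        \<le> C * real n powr (- 1 / 2)"
proof -
  interpret prob_space M by fact
  interpret N: prob_space N by fact
  define a where "a = exp (- \<kappa>)"
  have a: "0 < a" "a < 1" using \<open>0 < \<kappa>\<close> by (auto simp: a_def)
  obtain \<mu> C0 p where \<mu>: "\<And>k::nat. real_distribution (\<mu> k)" and C0: "C0 \<ge> 0" and p: "0 < p" "p \<le> 1"
    and ch: "\<And>k u. \<bar>u\<bar> \<le> 1 \<Longrightarrow> (norm (char (\<mu> k) u))\<^sup>2 \<ge> 1 - C0 * \<bar>u\<bar> powr p"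
    and Xm: "\<And>t. X t \<in> borel_measurable M"
    and law: "\<And>T. distr M seq_borel (\<lambda>\<omega> k. innovation a X T k \<omega>) = PiM UNIV \<mu>"
    by (rule stable_OU_chain[OF assms(1,3,5,6), folded a_def]) (rule that)
  \<comment> \<open>Eight times \<open>s\<close> has to stay below \<open>p\<close>, for the moments of the innovations, and the Hoelder
      exponent \<open>2 * s\<close> must not exceed 1.\<close>
  define s where "s = p / 16"
  have s: "0 < s" "0 < 8 * s" "8 * s < p" "0 < 2 * s" "2 * s \<le> 1" using p by (auto simp: s_def)
  obtain K where K0: "K \<ge> 0" and Kb: "\<And>\<mu>. real_distribution \<mu> \<Longrightarrow>
      (\<And>u. \<bar>u\<bar> \<le> 1 \<Longrightarrow> (norm (char \<mu> u))\<^sup>2 \<ge> 1 - C0 * \<bar>u\<bar> powr p) \<Longrightarrow>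
      (\<integral>\<^sup>+ z. ennreal (\<bar>fst z - snd z\<bar> powr (8 * s)) \<partial>(\<mu> \<Otimes>\<^sub>M \<mu>)) \<le> ennreal K"
  proof (rule symmetrized_moment_bound[OF s(2,3) C0])
    fix K' assume "K' \<ge> 0" and "\<And>\<mu>. real_distribution \<mu> \<Longrightarrow>
      (\<And>u. \<bar>u\<bar> \<le> 1 \<Longrightarrow> (norm (char \<mu> u))\<^sup>2 \<ge> 1 - C0 * \<bar>u\<bar> powr p) \<Longrightarrow>
      (\<integral>\<^sup>+ z. ennreal (\<bar>fst z - snd z\<bar> powr (8 * s)) \<partial>(\<mu> \<Otimes>\<^sub>M \<mu>)) \<le> ennreal K'"
    then show thesis by (rule that)
  qed
  have K: "K \<ge> 0" "(\<integral>\<^sup>+ z. ennreal (\<bar>fst z - snd z\<bar> powr (8 * s)) \<partial>(\<mu> k \<Otimes>\<^sub>M \<mu> k)) \<le> ennreal K" for k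
    by (rule K0, rule Kb[OF \<mu> ch])
  obtain H Bf where H: "0 \<le> H" "\<And>u v. \<bar>f u - f v\<bar> \<le> H * \<bar>u - v\<bar> powr (2 * s)" and Bf: "\<And>u. \<bar>f u\<bar> \<le> Bf"
    and fc: "continuous_on UNIV f"
    using C2_bounded_hoelder[OF \<open>C2_bounded f\<close> s(4,5)] by metis
  have fm: "f \<in> borel_measurable borel" by (rule borel_measurable_continuous_onI[OF fc])
  have hoelder: "\<bar>f u - f v\<bar> \<le> H * (\<bar>u - v\<bar> powr s)\<^sup>2" for u v
  proof -
    have "(\<bar>u - v\<bar> powr s)\<^sup>2 = \<bar>u - v\<bar> powr (2 * s)"
      by (simp add: power2_eq_square flip: powr_add)
    then show ?thesis using H(2) by simp
  qed
  interpret S: stationary_chain M \<mu> X a f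
  proof (intro stationary_chain.intro stationary_chain_axioms.intro product_law.intro)
    show "prob_space M" by fact
    show "\<exists>B. \<forall>u. \<bar>f u\<bar> \<le> B" using Bf by blast
  qed (rule \<mu> Xm law fm)+
  define lrv where "lrv = long_run_variance M X f"
  have lrv: "lrv > 0" using assms(8) by (simp add: lrv_def)
  define \<gamma> where "\<gamma> j = covar M (\<lambda>\<omega>. f (X 0 \<omega>)) (\<lambda>\<omega>. f (X (of_int j) \<omega>))" for j
  have lrv_\<gamma>: "infsum \<gamma> UNIV = lrv" by (simp add: lrv_def long_run_variance_def \<gamma>_def[abs_def])
  obtain n0 where n0: "\<And>n. n \<ge> n0 \<Longrightarrow> n \<ge> 1 \<Longrightarrow> (\<Sum>s=1..n. \<Sum>t=1..n. \<gamma> (int t - int s)) \<ge> lrv / 2 * real n"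
    using averaged_double_sum_lower_bound[of \<gamma>] lrv unfolding lrv_\<gamma> by metis
  define G0 where "G0 = 2 * H / (1 - (a powr s)\<^sup>2)"
  define VC where "VC = 8 * G0 ^ 4 / (1 - a powr s) * (2 / (1 - a powr s)) * (3 ^ 9 * K)"
  define v0 where "v0 = lrv / 2"
  have v0: "v0 > 0" using lrv by (simp add: v0_def)
  have con: "contraction a s H f"
    using a s(1) H(1) hoelder by (rule contraction.intro)
  have G0: "G0 \<ge> 0" using contraction.G_nonneg[OF con] contraction.G_def[OF con] contraction.r_def[OF con] by (simp add: G0_def)
  have r01: "a powr s < 1" using contraction.r(2)[OF con] contraction.r_def[OF con] by simp
  have VC: "VC \<ge> 0" using G0 r01 K(1) by (simp add: VC_def)
  define c1 where "c1 = sqrt (2 * VC) / v0"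
  define c2 where "c2 = 2 * (G0 ^ 3 * (1 + K)) / (sqrt v0) ^ 3"
  have c12: "c1 \<ge> 0" "c2 \<ge> 0" using VC v0 G0 K(1) by (simp_all add: c1_def c2_def)
  \<comment> \<open>The third summand accounts for \<open>n\<close> up to \<open>n0\<close>, where the distances are at most 2; the last one
      makes \<open>C\<close> positive.\<close>
  define C where "C = 15 * c1 + 5 * c2 + 2 * sqrt (real n0) + 1"
  have C: "C > 0" unfolding C_def using c12 by (intro add_nonneg_pos add_nonneg_nonneg) auto
  have normal: "(\<integral>x. h (Z x) \<partial>N) = normal_mean h" if "h \<in> borel_measurable borel" for h
    using distributed_integral[OF assms(9), of h] that \<nu>_pos less_imp_le by simp
  have Zm: "Z \<in> borel_measurable N" using distributed_measurable[OF assms(9)] by simp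
  have cdf: "measure N {\<omega> \<in> space N. Z \<omega> \<le> z} = std_normal_cdf z" for z
  proof -
    have "measure N {\<omega> \<in> space N. Z \<omega> \<le> z} = (\<integral>\<omega>. indicator {..z} (Z \<omega>) \<partial>N)"
      by (rule N.integral_indicator_atMost[OF Zm, symmetric])
    also have "\<dots> = normal_mean (indicator {..z})" by (rule normal) simp
    also have "\<dots> = std_normal_cdf z"
      by (simp add: std_normal_cdf_def set_lebesgue_integral_def mult.commute)
    finally show ?thesis .
  qed
  have main: "wasserstein_dist M (\<lambda>\<omega>. partial_sum M X f n \<omega> / partial_sum_sd M X f n) N Z \<le> ennreal (C * real n powr (- 1 / 2)) \<and>
      kolmogorov_dist M (\<lambda>\<omega>. partial_sum M X f n \<omega> / partial_sum_sd M X f n) N Z \<le> C * real n powr (- 1 / 2)"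
    if n: "n \<ge> 1" and sd: "partial_sum_sd M X f n > 0" for n
  proof -
    define sd where "sd = partial_sum_sd M X f n"
    \<comment> \<open>The standard deviation of the sum without the normalizing factor.\<close>
    define \<sigma> where "\<sigma> = sd * sqrt (real n)"
    define c where "c = real n * S.f_mean"
    have sd0: "sd > 0" using sd by (simp add: sd_def)
    have \<sigma>: "\<sigma> > 0" using sd0 n by (simp add: \<sigma>_def)
    have \<sigma>2: "\<sigma>\<^sup>2 = (\<integral>\<omega>. (\<Sum>t=1..n. f (X (real t) \<omega>) - S.f_mean)\<^sup>2 \<partial>M)"
      using S.partial_sum_sd_square[OF n] by (simp add: \<sigma>_def sd_def power_mult_distrib)
    have F_innov: "(\<Sum>t=1..n. f (chain a (\<lambda>k. innovation a X 0 k \<omega>) t)) - c = (\<Sum>t=1..n. f (X (real t) \<omega>) - S.f_mean)" for \<omega>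
      using chain_innovation[of a X 0 \<omega>] by (simp add: sum_subtractf c_def)
    have Fm: "(\<lambda>x. \<Sum>t=1..n. f (chain a x t)) \<in> borel_measurable seq_borel" using fm by measurable
    have Fmean: "(\<integral>x. (\<Sum>t=1..n. f (chain a x t)) \<partial>S.Q) = c"
    proof -
      have "(\<integral>x. (\<Sum>t=1..n. f (chain a x t)) \<partial>S.Q) = (\<integral>\<omega>. (\<Sum>t=1..n. f (X (real t) \<omega>) - S.f_mean) + c \<partial>M)"
        unfolding S.transfer[OF Fm, of 0, symmetric]
        by (intro Bochner_Integration.integral_cong refl) (use F_innov in \<open>simp add: algebra_simps\<close>)
      also have "\<dots> = (\<integral>\<omega>. (\<Sum>t=1..n. f (X (real t) \<omega>) - S.f_mean) \<partial>M) + c"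
      proof -
        have "integrable M (\<lambda>\<omega>. \<Sum>t=1..n. f (X (real t) \<omega>) - S.f_mean)"
          by (intro bounded_measurable_integrable bm_intros S.f_bm)
        then show ?thesis by (simp add: prob_space)
      qed
      finally show ?thesis by (simp only: S.centred_sum_mean add_0)
    qed
    have Fvar: "(\<integral>x. ((\<Sum>t=1..n. f (chain a x t)) - c)\<^sup>2 \<partial>S.Q) = \<sigma>\<^sup>2"
    proof -
      have m: "(\<lambda>x. ((\<Sum>t=1..n. f (chain a x t)) - c)\<^sup>2) \<in> borel_measurable seq_borel" using Fm by measurable
      show ?thesis unfolding \<sigma>2 S.transfer[OF m, of 0, symmetric] F_innov ..
    qed
    have cl: "chain_law \<mu> s K a H f n Bf c \<sigma>"
    proof (intro chain_law.intro chain_law_axioms.intro moment_law.intro moment_law_axioms.intro product_law.intro con)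
      show "(\<integral>x. contraction.F a f n x \<partial>PiM UNIV \<mu>) = c"
        unfolding contraction.F_def[OF con] by (rule Fmean)
      show "(\<integral>x. (contraction.F a f n x - c)\<^sup>2 \<partial>PiM UNIV \<mu>) = \<sigma>\<^sup>2"
        unfolding contraction.F_def[OF con] by (rule Fvar)
    qed (rule \<mu> s K fm Bf \<sigma>)+
    interpret CL: chain_law \<mu> s K a H f n Bf c \<sigma> by (rule cl)
    have Wm: "CL.W \<in> borel_measurable seq_borel" by (rule bounded_measurable_measurable[OF CL.W_bm])
    have W_innov: "CL.W (\<lambda>k. innovation a X 0 k \<omega>) = partial_sum M X f n \<omega> / sd" for \<omega>
      unfolding CL.W_def CL.F_def F_innov S.partial_sum_eq by (simp add: \<sigma>_def mult.commute)
    have W_transfer: "(\<integral>\<omega>. h (partial_sum M X f n \<omega> / sd) \<partial>M) = (\<integral>x. h (CL.W x) \<partial>S.Q)"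
      if "h \<in> borel_measurable borel" for h :: "real \<Rightarrow> real"
      using S.transfer[OF measurable_compose[OF Wm that], of 0] by (simp add: W_innov)
    have small: "1 \<le> sqrt (real n0) * real n powr (- 1 / 2)" if "n \<le> n0"
    proof -
      have "sqrt (real n) * real n powr (- 1 / 2) = 1"
      proof -
        have "sqrt (real n) = real n powr (1 / 2)" by (rule powr_half_sqrt[symmetric]) simp
        then show ?thesis using n by (simp flip: powr_add)
      qed
      moreover have "sqrt (real n) * real n powr (- 1 / 2) \<le> sqrt (real n0) * real n powr (- 1 / 2)"
        using that by (intro mult_right_mono) auto
      ultimately show ?thesis by simp
    qed
    let ?q = "real n powr (- 1 / 2)"
    have q0: "?q \<ge> 0" by simp
    have parts: "15 * (c1 * ?q) \<ge> 0" "5 * (c2 * ?q) \<ge> 0" "2 * (sqrt (real n0) * ?q) \<ge> 0" using c12 by simp_all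
    have Cq: "C * ?q = 15 * (c1 * ?q) + 5 * (c2 * ?q) + 2 * (sqrt (real n0) * ?q) + ?q"
      by (simp add: C_def algebra_simps)
    have G_eq: "CL.G = G0" by (simp add: CL.G_def CL.r_def G0_def)
    have V_eq: "CL.var_const = VC" unfolding CL.var_const_def G_eq by (simp add: CL.r_def VC_def)
    have rates: "sqrt (real (Suc n) * VC) / \<sigma>\<^sup>2 \<le> c1 * ?q" "real (Suc n) * (G0 ^ 3 * (1 + K)) / \<sigma> ^ 3 \<le> c2 * ?q" if "n \<ge> n0"
    proof -
      have "v0 * real n \<le> \<sigma>\<^sup>2"
        unfolding \<sigma>2 S.second_moment_sum using n0[OF that n] by (simp add: v0_def \<gamma>_def)
      from CL.rate_bounds[OF n v0 this]
      show "sqrt (real (Suc n) * VC) / \<sigma>\<^sup>2 \<le> c1 * ?q" "real (Suc n) * (G0 ^ 3 * (1 + K)) / \<sigma> ^ 3 \<le> c2 * ?q"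
        unfolding G_eq V_eq c1_def c2_def by auto
    qed
    have W: "\<bar>(\<integral>\<omega>. h (partial_sum M X f n \<omega> / sd) \<partial>M) - (\<integral>\<omega>. h (Z \<omega>) \<partial>N)\<bar> \<le> C * ?q" if h: "1-lipschitz_on UNIV h" for h
    proof -
      have hm: "h \<in> borel_measurable borel"
        by (rule borel_measurable_continuous_onI) (rule lipschitz_on_continuous_on[OF h])
      have "\<bar>(\<integral>x. h (CL.W x) \<partial>S.Q) - normal_mean h\<bar> \<le> C * ?q"
      proof (cases "n \<ge> n0")
        case True
        show ?thesis
          using CL.wasserstein_rate[OF h] rates[OF True] parts q0 unfolding G_eq V_eq Cq by linarith
      next
        case False
        then have "n \<le> n0" by simp
        from small[OF this] show ?thesis
          using CL.wasserstein_trivial[OF h] parts q0 unfolding Cq by linarith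
      qed
      then show ?thesis unfolding W_transfer[OF hm] normal[OF hm] .
    qed
    have Kd: "\<bar>prob {\<omega> \<in> space M. partial_sum M X f n \<omega> / sd \<le> z} - measure N {\<omega> \<in> space N. Z \<omega> \<le> z}\<bar> \<le> C * ?q" for z
    proof -
      have Ym: "(\<lambda>\<omega>. partial_sum M X f n \<omega> / sd) \<in> borel_measurable M" by measurable
      have "prob {\<omega> \<in> space M. partial_sum M X f n \<omega> / sd \<le> z} = (\<integral>\<omega>. indicator {..z} (partial_sum M X f n \<omega> / sd) \<partial>M)"
        by (rule integral_indicator_atMost[OF Ym, symmetric])
      also have "\<dots> = (\<integral>x. indicator {..z} (CL.W x) \<partial>S.Q)" by (rule W_transfer) simp
      finally have eq: "prob {\<omega> \<in> space M. partial_sum M X f n \<omega> / sd \<le> z} = (\<integral>x. indicator {..z} (CL.W x) \<partial>S.Q)" .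
      show ?thesis
      proof (cases "n \<ge> n0")
        case True
        show ?thesis
          using CL.kolmogorov_rate[of z] rates[OF True] parts q0 unfolding eq cdf V_eq Cq by linarith
      next
        case False
        then have "n \<le> n0" by simp
        have "0 \<le> prob {\<omega> \<in> space M. partial_sum M X f n \<omega> / sd \<le> z}" "prob {\<omega> \<in> space M. partial_sum M X f n \<omega> / sd \<le> z} \<le> 1"
          "0 \<le> measure N {\<omega> \<in> space N. Z \<omega> \<le> z}" "measure N {\<omega> \<in> space N. Z \<omega> \<le> z} \<le> 1" by auto
        then show ?thesis using small[OF \<open>n \<le> n0\<close>] parts q0 unfolding Cq by linarith
      qed
    qed
    show ?thesis
      unfolding wasserstein_dist_def kolmogorov_dist_def sd_def[symmetric]
    proof (intro conjI SUP_least cSUP_least)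
      fix h assume "h \<in> {h :: real \<Rightarrow> real. 1-lipschitz_on UNIV h}"
      then show "ennreal \<bar>(\<integral>\<omega>. h (partial_sum M X f n \<omega> / sd) \<partial>M) - (\<integral>\<omega>. h (Z \<omega>) \<partial>N)\<bar> \<le> ennreal (C * ?q)"
        using W by (intro ennreal_leI) auto
    qed (use Kd in auto)
  qed
  then show ?thesis using C by blast
qed

end
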